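(* Over $\mathbb C$, a stable semiabelic pair $(P,\Theta)$ with a fixed $T$-action, with cell complex $\Delta=\widetilde\Delta/X$, naturally defines a moment map $\mathrm{Mom}:P(\mathbb C)\to|\Delta|$: the formula $$\widetilde{\mathrm{Mom}}:\widetilde P\to|\widetilde\Delta|,\qquad p\mapsto \frac{\sum_x|\xi_x(p)|^2\,x}{\sum_x|\xi_x(p)|^2}$$ defines an $X$-equivariant map, which descends to $\mathrm{Mom}:P(\mathbb C)=\widetilde P/X\to|\widetilde\Delta|/X=|\Delta|$. The fiber of $\mathrm{Mom}$ over a point in the interior of a $k$-dimensional cell is isomorphic to $(S^1)^k=U(1)^k$.
   Context: A variety is a connected reduced (not necessarily irreducible) separated scheme of finite type. A semiabelian variety is an extension $1\to T'\to G\to A\to0$ of an abelian variety by a torus. A stable semiabelic variety is a variety $P$ with an action of a semiabelian variety $G$ with $\dim P=\dim G$, such that $P$ is seminormal, there are finitely many orbits, and every stabilizer is connected, reduced and contained in $T'$. A stable semiabelic pair $(P,\Theta)$ is a projective stable semiabelic variety with an effective ample Cartier divisor $\Theta$ containing no $G$-orbit; $L=\mathcal O_P(\Theta)$. Cell complexes. Let $X\simeq\mathbb Z^g$, let $X\to X'$ be a surjection of lattices with kernel $X_1$. Let $\widetilde\Delta'$ be a locally finite complex of polytopes with a map to $X'_{\mathbb R}$ identifying each cell with a polytope with vertices in $X'$ (faces of cells are cells, intersections of two cells are unions of cells), with an $X'$-action compatible with translations, finitely many cells modulo $X'$, and connected quotient. $\widetilde\Delta$ is a disjoint union of copies of the pullback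 of $\widetilde\Delta'$ under $X_{\mathbb R}\to X'_{\mathbb R}$ (cells are the pullbacks of cells; $\rho:|\widetilde\Delta|\to X_{\mathbb R}$ is the projection, injective on cells), with an $X$-action compatible with translation, extending the $X'$-action on $\widetilde\Delta'$, with connected quotient $\Delta=\widetilde\Delta/X$, $|\Delta|=|\widetilde\Delta|/X$. Fixed $T$-action. Let $T=\mathrm{Hom}(X,\mathbb C^* )=(\mathbb C^* )^g$. A fixed $T$-action is a presentation $G(\mathbb C)=T/Y_1$ (surjective holomorphic homomorphism $T\to G(\mathbb C)$ with discrete kernel $\simeq Y_1$) such that $T'\to G$ lifts to an injection $T'\to T$, dual to $X\to X'$ ($X'$ = characters of $T'$), together with an analytic $X$-covering $\widetilde P\to P(\mathbb C)$, $P(\mathbb C)=\widetilde P/X$, on which $T$ acts and on which the pullback $\widetilde L$ of $L$ is $T$-linearized, the actions of $a\in T$ and $x\in X$ on $\widetilde L$ commuting up to the factor $x(a)$. The $T$-orbit closures $Z\subset\widetilde P$ correspond bijectively, $X$-equivariantly and preserving inclusions, to the cells $\delta_Z$ of $\widetilde\Delta$, the $T$-weights of sections of $\widetilde L|_Z$ being exactly the points of $X\cap\rho(\delta_Z)$. The equation $\theta$ of $\Theta$ pulls back to a section $\widetilde\theta=\sum_x\xi_x$ of $\widetilde L$, an everywhere convergent sum of $T$-eigensections over integral points $x\in\rho^{-1}(X)\subset|\widetilde\Delta|$. At a point $p$ the values $\xi_x(p)$ lie in the one-dimensional fiber $\widetilde L_p$, so the ratios $|\xi_x(p)|^2/|\xi_{x'}(p)|^2$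 are meaningful; at least one $\xi_x(p)$ is nonzero. For $p$ in the open orbit of $Z$ only $x\in\delta_Z$ contribute, and the weighted average is taken in the convex cell $\delta_Z$. *)

theory Defs
  imports "HOL-Analysis.Analysis" "HOL-Algebra.Group"
begin

section \<open>Spaces with functions\<close>

text \<open>
  Reduced schemes of finite type over the complex numbers, and reduced complex spaces, are
  represented in the style of Serre: a set of closed points with a topology and a sheaf of
  complex-valued functions. The elements of \<open>funs X U\<close> are total functions of which only the
  values on \<open>U\<close> matter.
\<close>

record 'a cspace =
  spc :: "'a topology"
  funs :: "'a set \<Rightarrow> ('a \<Rightarrow> complex) set"

abbreviation pts :: "'a cspace \<Rightarrow> 'a set" where
  "pts X \<equiv> topspace (spc X)"

definition function_sheaf :: "'a cspace \<Rightarrow> bool" where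
  "function_sheaf X \<longleftrightarrow>
     (\<forall>U. \<forall>h\<in>funs X U. openin (spc X) U) \<and>
     (\<forall>U h h'. h \<in> funs X U \<and> (\<forall>x\<in>U. h' x = h x) \<longrightarrow> h' \<in> funs X U) \<and>
     (\<forall>U V h. h \<in> funs X U \<and> openin (spc X) V \<and> V \<subseteq> U \<longrightarrow> h \<in> funs X V) \<and>
     (\<forall>U h. openin (spc X) U \<and> (\<forall>x\<in>U. \<exists>V. x \<in> V \<and> V \<subseteq> U \<and> h \<in> funs X V) \<longrightarrow> h \<in> funs X U)"

definition cmorphism :: "'a cspace \<Rightarrow> 'b cspace \<Rightarrow> ('a \<Rightarrow> 'b) \<Rightarrow> bool" where
  "cmorphism X Y f \<longleftrightarrow> continuous_map (spc X) (spc Y) f \<and>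
     (\<forall>V. \<forall>h\<in>funs Y V. h \<circ> f \<in> funs X {x \<in> pts X. f x \<in> V})"

definition cisomorphism :: "'a cspace \<Rightarrow> 'b cspace \<Rightarrow> ('a \<Rightarrow> 'b) \<Rightarrow> bool" where
  "cisomorphism X Y f \<longleftrightarrow> cmorphism X Y f \<and>
     (\<exists>g. cmorphism Y X g \<and> (\<forall>x\<in>pts X. g (f x) = x) \<and> (\<forall>y\<in>pts Y. f (g y) = y))"

text \<open>Induced structure on a subset: for a closed subset this is the reduced closed subspace.\<close>

definition csubspace :: "'a cspace \<Rightarrow> 'a set \<Rightarrow> 'a cspace" where
  "csubspace X S = \<lparr>spc = subtopology (spc X) S,
     funs = (\<lambda>W. {h. openin (subtopology (spc X) S) W \<and>
       (\<forall>x\<in>W. \<exists>U. \<exists>g\<in>funs X U. x \<in> U \<and> (\<forall>y\<in>U \<inter> W. h y = g y))})\<rparr>"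

definition closed_immersion :: "'a cspace \<Rightarrow> 'b cspace \<Rightarrow> ('a \<Rightarrow> 'b) \<Rightarrow> bool" where
  "closed_immersion X Y f \<longleftrightarrow> closedin (spc Y) (f ` pts X) \<and>
     cisomorphism X (csubspace Y (f ` pts X)) f"


section \<open>Complex varieties\<close>

text \<open>
  The structure generated by a family \<open>\<D>\<close> of pairs (chart domain, function): nonvanishing loci are a
  basis of open sets, and regular functions are locally fractions.
\<close>

definition alg_space :: "('a set \<times> ('a \<Rightarrow> complex)) set \<Rightarrow> 'a cspace" where
  "alg_space \<D> = (let \<tau> = topology_generated_by {{x \<in> D. f x \<noteq> 0} |D f. (D, f) \<in> \<D>} in
     \<lparr>spc = \<tau>,
      funs = (\<lambda>W. {h. openin \<tau> W \<and>
        (\<forall>x\<in>W. \<exists>D a b. (D, a) \<in> \<D> \<and> (D, b) \<in> \<D> \<and> x \<in> D \<and> b x \<noteq> 0 \<and>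
           (\<forall>y\<in>W \<inter> D. b y \<noteq> 0 \<longrightarrow> h y = a y / b y))})\<rparr>)"

text \<open>Polynomial functions in the coordinates \<open>z 0, \<dots>, z (n - 1)\<close>.\<close>

inductive_set cpoly :: "nat \<Rightarrow> ((nat \<Rightarrow> complex) \<Rightarrow> complex) set" for n :: nat where
  const: "(\<lambda>z. c) \<in> cpoly n"
| coord: "i < n \<Longrightarrow> (\<lambda>z. z i) \<in> cpoly n"
| add: "f \<in> cpoly n \<Longrightarrow> g \<in> cpoly n \<Longrightarrow> (\<lambda>z. f z + g z) \<in> cpoly n"
| mult: "f \<in> cpoly n \<Longrightarrow> g \<in> cpoly n \<Longrightarrow> (\<lambda>z. f z * g z) \<in> cpoly n"

definition zero_locus :: "nat \<Rightarrow> ((nat \<Rightarrow> complex) \<Rightarrow> complex) set \<Rightarrow> (nat \<Rightarrow> complex) set" where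
  "zero_locus n E = {z. (\<forall>i\<ge>n. z i = 0) \<and> (\<forall>f\<in>E. f z = 0)}"

definition affine_alg :: "nat \<Rightarrow> (nat \<Rightarrow> complex) set \<Rightarrow> (nat \<Rightarrow> complex) cspace" where
  "affine_alg n V = alg_space {(V, f) |f. f \<in> cpoly n}"

definition alg_prod :: "'a cspace \<Rightarrow> 'b cspace \<Rightarrow> ('a \<times> 'b) cspace" where
  "alg_prod X Y = alg_space {(U \<times> V, \<lambda>(x, y). \<Sum>k<m. f k x * g k y) |U V (m::nat) f g.
     openin (spc X) U \<and> openin (spc Y) V \<and> (\<forall>k<m. f k \<in> funs X U \<and> g k \<in> funs Y V)}"

text \<open>Reduced separated schemes of finite type.\<close>

definition algebraic_space :: "'a cspace \<Rightarrow> bool" where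
  "algebraic_space X \<longleftrightarrow> function_sheaf X \<and>
     (\<exists>\<U>. finite \<U> \<and> \<Union>\<U> = pts X \<and>
       (\<forall>U\<in>\<U>. openin (spc X) U \<and>
         (\<exists>n E f. E \<subseteq> cpoly n \<and> cisomorphism (csubspace X U) (affine_alg n (zero_locus n E)) f))) \<and>
     closedin (spc (alg_prod X X)) ((\<lambda>x. (x, x)) ` pts X)"

definition variety :: "'a cspace \<Rightarrow> bool" where
  "variety X \<longleftrightarrow> algebraic_space X \<and> pts X \<noteq> {} \<and> connected_space (spc X)"

text \<open>
  Test objects range over the point type \<open>nat \<Rightarrow> complex\<close>; for cardinality reasons every algebraic
  space is isomorphic to one with points of this type.
\<close>

definition complete_space :: "'a cspace \<Rightarrow> bool" where
  "complete_space X \<longleftrightarrow> (\<forall>Z :: (nat \<Rightarrow> complex) cspace. algebraic_space Z \<longrightarrow>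
     closed_map (spc (alg_prod X Z)) (spc Z) snd)"

definition proper_morphism :: "'a cspace \<Rightarrow> 'b cspace \<Rightarrow> ('a \<Rightarrow> 'b) \<Rightarrow> bool" where
  "proper_morphism X Y f \<longleftrightarrow> cmorphism X Y f \<and>
     (\<forall>Z :: (nat \<Rightarrow> complex) cspace. algebraic_space Z \<longrightarrow>
        closed_map (spc (alg_prod X Z)) (spc (alg_prod Y Z)) (map_prod f id))"

text \<open>
  A proper bijective morphism is finite, and in characteristic 0 a morphism that is bijective on
  closed points is bijective on all scheme points with isomorphic residue fields.
\<close>

definition seminormal :: "'a cspace \<Rightarrow> bool" where
  "seminormal X \<longleftrightarrow> (\<forall>(Q :: (nat \<Rightarrow> complex) cspace) f.
     algebraic_space Q \<and> proper_morphism Q X f \<and> bij_betw f (pts Q) (pts X) \<longrightarrow>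
     cisomorphism Q X f)"

definition irreducible_closed :: "'a topology \<Rightarrow> 'a set \<Rightarrow> bool" where
  "irreducible_closed \<tau> S \<longleftrightarrow> closedin \<tau> S \<and> S \<noteq> {} \<and>
     (\<forall>A B. closedin \<tau> A \<and> closedin \<tau> B \<and> S \<subseteq> A \<union> B \<longrightarrow> S \<subseteq> A \<or> S \<subseteq> B)"

definition dimension :: "'a cspace \<Rightarrow> enat" where
  "dimension X = Sup {enat n |n. \<exists>Z :: nat \<Rightarrow> 'a set.
     (\<forall>i\<le>n. irreducible_closed (spc X) (Z i)) \<and> (\<forall>i<n. Z i \<subset> Z (Suc i))}"

text \<open>A point of projective space is a punctured line; the charts are \<open>x\<^sub>i \<noteq> 0\<close>.\<close>

definition proj_point :: "(nat \<Rightarrow> complex) \<Rightarrow> (nat \<Rightarrow> complex) set" where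
  "proj_point v = {\<lambda>k. c * v k |c. c \<noteq> 0}"

definition proj_space :: "nat \<Rightarrow> (nat \<Rightarrow> complex) set cspace" where
  "proj_space N = alg_space
     {({proj_point v |v. (\<forall>k>N. v k = 0) \<and> v i \<noteq> 0}, \<lambda>l. f (THE v. v \<in> l \<and> v i = 1)) |i f.
       i \<le> N \<and> f \<in> cpoly (Suc N)}"

definition projective :: "'a cspace \<Rightarrow> bool" where
  "projective X \<longleftrightarrow> (\<exists>N f. closed_immersion X (proj_space N) f)"


section \<open>Complex analytic structure\<close>

definition polydisc :: "nat \<Rightarrow> (nat \<Rightarrow> complex) \<Rightarrow> real \<Rightarrow> (nat \<Rightarrow> complex) set" where
  "polydisc n c r = {z. (\<forall>k<n. dist (z k) (c k) < r) \<and> (\<forall>k\<ge>n. z k = 0)}"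

definition holomorphic_polydisc ::
    "nat \<Rightarrow> (nat \<Rightarrow> complex) \<Rightarrow> real \<Rightarrow> ((nat \<Rightarrow> complex) \<Rightarrow> complex) \<Rightarrow> bool" where
  "holomorphic_polydisc n c r F \<longleftrightarrow> continuous_on (polydisc n c r) F \<and>
     (\<forall>z\<in>polydisc n c r. \<forall>k<n. (\<lambda>t. F (z(k := t))) holomorphic_on ball (c k) r)"

text \<open>
  The analytic structure generated by a family of (domain, function): the coarsest topology making
  the domains open and the functions continuous; holomorphic functions are locally
  \<open>F(f\<^sub>1, \<dots>, f\<^sub>n)\<close> with \<open>F\<close> holomorphic.
\<close>

definition an_space :: "('a set \<times> ('a \<Rightarrow> complex)) set \<Rightarrow> 'a cspace" where
  "an_space \<D> =
    (let \<tau> = topology_generated_by {{x \<in> D. f x \<in> S} |D f S. (D, f) \<in> \<D> \<and> open S} in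
     \<lparr>spc = \<tau>,
      funs = (\<lambda>W. {h. openin \<tau> W \<and>
        (\<forall>x\<in>W. \<exists>(n::nat) f r F N. 0 < r \<and> openin \<tau> N \<and> x \<in> N \<and> N \<subseteq> W \<and>
           (\<forall>k<n. \<exists>D. (D, f k) \<in> \<D> \<and> N \<subseteq> D) \<and>
           (let val = (\<lambda>y k. if k < n then f k y else 0) in
              holomorphic_polydisc n (val x) r F \<and>
              (\<forall>y\<in>N. val y \<in> polydisc n (val x) r \<and> h y = F (val y))))})\<rparr>)"

definition analytification :: "'a cspace \<Rightarrow> 'a cspace" where
  "analytification X = an_space {(U, f). f \<in> funs X U}"

text \<open>Product of complex spaces.\<close>

definition an_prod :: "'a cspace \<Rightarrow> 'b cspace \<Rightarrow> ('a \<times> 'b) cspace" where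
  "an_prod X Y = an_space
     ({(U \<times> V, f \<circ> fst) |U V f. f \<in> funs X U \<and> openin (spc Y) V} \<union>
      {(U \<times> V, g \<circ> snd) |U V g. openin (spc X) U \<and> g \<in> funs Y V})"


section \<open>Lattices, tori and semiabelian varieties\<close>

text \<open>
  A lattice \<open>X\<close> of arbitrary rank is realized inside a Euclidean space, with
  \<open>X\<^sub>\<real> = span X\<close>; the rank may be smaller than the dimension of the type, in particular 0.
\<close>

definition lattice_in :: "'e::euclidean_space set \<Rightarrow> bool" where
  "lattice_in X \<longleftrightarrow> (\<exists>B. independent B \<and> X = {\<Sum>b\<in>B. of_int (n b) *\<^sub>R b |n :: 'e \<Rightarrow> int. True})"

definition torus_pts :: "'e::euclidean_space set \<Rightarrow> ('e \<Rightarrow> complex) set" where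
  "torus_pts X = {a \<in> extensional X. (\<forall>x\<in>X. a x \<noteq> 0) \<and> (\<forall>x\<in>X. \<forall>y\<in>X. a (x + y) = a x * a y)}"

definition torus_group :: "'e::euclidean_space set \<Rightarrow> ('e \<Rightarrow> complex) monoid" where
  "torus_group X = \<lparr>carrier = torus_pts X, mult = (\<lambda>a b. restrict (\<lambda>x. a x * b x) X),
     one = restrict (\<lambda>_. 1) X\<rparr>"

text \<open>Algebraic structure of \<open>Hom(X, \<complex>\<^sup>*)\<close>, with coordinate ring the Laurent polynomials \<open>\<complex>[X]\<close>.\<close>

definition torus :: "'e::euclidean_space set \<Rightarrow> ('e \<Rightarrow> complex) cspace" where
  "torus X = alg_space {(torus_pts X, \<lambda>a. \<Sum>x\<in>S. c x * a x) |S c. finite S \<and> S \<subseteq> X}"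

definition algebraic_group :: "'a cspace \<Rightarrow> 'a monoid \<Rightarrow> bool" where
  "algebraic_group G \<G> \<longleftrightarrow> variety G \<and> group \<G> \<and> carrier \<G> = pts G \<and>
     cmorphism (alg_prod G G) G (\<lambda>(a, b). a \<otimes>\<^bsub>\<G>\<^esub> b) \<and> cmorphism G G (\<lambda>a. inv\<^bsub>\<G>\<^esub> a)"

definition abelian_variety :: "'a cspace \<Rightarrow> 'a monoid \<Rightarrow> bool" where
  "abelian_variety A \<A> \<longleftrightarrow> algebraic_group A \<A> \<and> complete_space A"

text \<open>
  An extension \<open>1 \<rightarrow> T' \<rightarrow> G \<rightarrow> A \<rightarrow> 0\<close> with \<open>T' = Hom(X', \<complex>\<^sup>*)\<close>. In characteristic 0 exactness as
  algebraic groups can be tested on closed points.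
\<close>

locale semiabelian_variety =
  fixes G :: "'g cspace" and \<G> :: "'g monoid"
    and X' :: "'f::euclidean_space set" and \<iota> :: "('f \<Rightarrow> complex) \<Rightarrow> 'g"
  assumes G: "algebraic_group G \<G>"
    and X': "lattice_in X'"
    and \<iota>_hom: "\<iota> \<in> hom (torus_group X') \<G>"
    and \<iota>_immersion: "closed_immersion (torus X') G \<iota>"
    and quotient: "\<exists>(A :: (nat \<Rightarrow> complex) cspace) \<A> q. abelian_variety A \<A> \<and>
      q \<in> hom \<G> \<A> \<and> cmorphism G A q \<and> q ` pts G = pts A \<and>
      {g \<in> pts G. q g = \<one>\<^bsub>\<A>\<^esub>} = \<iota> ` torus_pts X'"


section \<open>Stable semiabelic varieties and pairs\<close>

text \<open>
  Stabilizers are automatically reduced in characteristic 0; here they are represented by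
  their sets of closed points.
\<close>

locale stable_semiabelic_variety = semiabelian_variety G \<G> X' \<iota>
  for G :: "'g cspace" and \<G> and X' :: "'f::euclidean_space set" and \<iota> +
  fixes P :: "'p cspace" and act :: "'g \<Rightarrow> 'p \<Rightarrow> 'p"
  assumes P: "variety P"
    and act_morphism: "cmorphism (alg_prod G P) P (\<lambda>(g, p). act g p)"
    and act_one: "p \<in> pts P \<Longrightarrow> act \<one>\<^bsub>\<G>\<^esub> p = p"
    and act_mult: "\<lbrakk>g \<in> pts G; h \<in> pts G; p \<in> pts P\<rbrakk> \<Longrightarrow> act (g \<otimes>\<^bsub>\<G>\<^esub> h) p = act g (act h p)"
    and dim_eq: "dimension P = dimension G"
    and seminormal: "seminormal P"
    and finite_orbits: "finite {(\<lambda>g. act g p) ` pts G |p. p \<in> pts P}"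
    and stabilizer_connected: "p \<in> pts P \<Longrightarrow> connectedin (spc G) {g \<in> pts G. act g p = p}"
    and stabilizer_toric: "p \<in> pts P \<Longrightarrow> {g \<in> pts G. act g p = p} \<subseteq> \<iota> ` torus_pts X'"

text \<open>
  A Cartier divisor is given by its local equations \<open>(U, f)\<close>. The fiber at \<open>p\<close> of \<open>\<O>(m\<Theta>)\<close> consists of
  compatible families of coordinates, indexed by the local equations whose domain contains \<open>p\<close>:
  a rational section \<open>h\<close> has coordinate \<open>h f\<^sup>m\<close> at the index \<open>(U, f)\<close>.
\<close>

type_synonym 'p divisor = "('p set \<times> ('p \<Rightarrow> complex)) set"
type_synonym 'p fibre_vec = "('p set \<times> ('p \<Rightarrow> complex)) \<Rightarrow> complex"

definition effective_cartier :: "'p cspace \<Rightarrow> 'p divisor \<Rightarrow> bool" where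
  "effective_cartier P \<Theta> \<longleftrightarrow>
     (\<Union>i\<in>\<Theta>. fst i) = pts P \<and>
     (\<forall>(U, f)\<in>\<Theta>. f \<in> funs P U \<and>
        (\<forall>V h. V \<subseteq> U \<and> h \<in> funs P V \<and> (\<forall>p\<in>V. f p * h p = 0) \<longrightarrow> (\<forall>p\<in>V. h p = 0))) \<and>
     (\<forall>(U, f)\<in>\<Theta>. \<forall>(V, g)\<in>\<Theta>. \<exists>u\<in>funs P (U \<inter> V). \<forall>p\<in>U \<inter> V. u p \<noteq> 0 \<and> f p = u p * g p)"

definition divisor_support :: "'p divisor \<Rightarrow> 'p set" where
  "divisor_support \<Theta> = {p. \<exists>(U, f)\<in>\<Theta>. p \<in> U \<and> f p = 0}"

definition bundle_fibre :: "'p cspace \<Rightarrow> 'p divisor \<Rightarrow> nat \<Rightarrow> 'p \<Rightarrow> 'p fibre_vec set" where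
  "bundle_fibre P \<Theta> m p = {v. (\<forall>i. i \<notin> \<Theta> \<or> p \<notin> fst i \<longrightarrow> v i = 0) \<and>
     (\<forall>i\<in>\<Theta>. \<forall>j\<in>\<Theta>. p \<in> fst i \<inter> fst j \<longrightarrow>
       (\<forall>u\<in>funs P (fst i \<inter> fst j). (\<forall>q\<in>fst i \<inter> fst j. snd i q = u q * snd j q) \<longrightarrow>
          v i = u p ^ m * v j))}"

definition bundle_section :: "'p cspace \<Rightarrow> 'p divisor \<Rightarrow> nat \<Rightarrow> ('p \<Rightarrow> 'p fibre_vec) \<Rightarrow> bool" where
  "bundle_section P \<Theta> m s \<longleftrightarrow> (\<forall>p\<in>pts P. s p \<in> bundle_fibre P \<Theta> m p) \<and>
     (\<forall>i\<in>\<Theta>. (\<lambda>p. s p i) \<in> funs P (fst i))"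

text \<open>Some positive power of \<open>\<O>(\<Theta>)\<close> has sections defining a closed immersion into projective space.\<close>

definition ample_divisor :: "'p cspace \<Rightarrow> 'p divisor \<Rightarrow> bool" where
  "ample_divisor P \<Theta> \<longleftrightarrow> (\<exists>m>0. \<exists>N s f. (\<forall>k\<le>N. bundle_section P \<Theta> m (s k)) \<and>
     closed_immersion P (proj_space N) f \<and>
     (\<forall>i\<in>\<Theta>. \<forall>p\<in>fst i. f p = proj_point (\<lambda>k. if k \<le> N then s k p i else 0)))"

locale stable_semiabelic_pair = stable_semiabelic_variety G \<G> X' \<iota> P act
  for G :: "'g cspace" and \<G> and X' :: "'f::euclidean_space set" and \<iota> and P :: "'p cspace" and act +
  fixes \<Theta> :: "'p divisor"
  assumes projective: "projective P"
    and cartier: "effective_cartier P \<Theta>"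
    and ample: "ample_divisor P \<Theta>"
    and no_orbit: "p \<in> pts P \<Longrightarrow> \<not> (\<lambda>g. act g p) ` pts G \<subseteq> divisor_support \<Theta>"


section \<open>Cell complexes\<close>

text \<open>
  A complex over \<open>X'\<^sub>\<real>\<close> is given by its closed cells \<open>C\<close>, sets of points of an abstract type, and the
  map \<open>\<rho>\<close>, injective on cells.
\<close>

definition is_face :: "('c \<Rightarrow> 'f::euclidean_space) \<Rightarrow> 'c set \<Rightarrow> 'c set \<Rightarrow> bool" where
  "is_face \<rho> F \<delta> \<longleftrightarrow> F \<noteq> {} \<and> F \<subseteq> \<delta> \<and> \<rho> ` F face_of \<rho> ` \<delta>"

definition cell_topology :: "('c \<Rightarrow> 'f::euclidean_space) \<Rightarrow> 'c set set \<Rightarrow> 'c topology" where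
  "cell_topology \<rho> C = topology (\<lambda>W. W \<subseteq> \<Union>C \<and>
     (\<forall>\<delta>\<in>C. openin (top_of_set (\<rho> ` \<delta>)) (\<rho> ` (W \<inter> \<delta>))))"

definition lattice_orbit :: "'f set \<Rightarrow> ('f \<Rightarrow> 'c \<Rightarrow> 'c) \<Rightarrow> 'c \<Rightarrow> 'c set" where
  "lattice_orbit X \<alpha> q = (\<lambda>x. \<alpha> x q) ` X"

definition quotient_topology :: "'f set \<Rightarrow> ('f \<Rightarrow> 'c \<Rightarrow> 'c) \<Rightarrow> 'c topology \<Rightarrow> 'c set topology" where
  "quotient_topology X \<alpha> \<tau> =
     topology (\<lambda>W. W \<subseteq> lattice_orbit X \<alpha> ` topspace \<tau> \<and> openin \<tau> (\<Union>W))"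

definition lattice_action ::
    "'f::euclidean_space set \<Rightarrow> ('c \<Rightarrow> 'f) \<Rightarrow> 'c set set \<Rightarrow> ('f \<Rightarrow> 'c \<Rightarrow> 'c) \<Rightarrow> bool" where
  "lattice_action X \<rho> C \<alpha> \<longleftrightarrow>
     (\<forall>q\<in>\<Union>C. \<alpha> 0 q = q) \<and>
     (\<forall>x\<in>X. \<forall>y\<in>X. \<forall>q\<in>\<Union>C. \<alpha> (x + y) q = \<alpha> x (\<alpha> y q)) \<and>
     (\<forall>x\<in>X. \<forall>\<delta>\<in>C. \<alpha> x ` \<delta> \<in> C) \<and>
     (\<forall>x\<in>X. \<forall>q\<in>\<Union>C. \<rho> (\<alpha> x q) = \<rho> q + x) \<and>
     connected_space (quotient_topology X \<alpha> (cell_topology \<rho> C))"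

text \<open>
  Two cells intersect in a union of common faces; so the relative interiors of the cells
  partition the complex. As cells are compact, local finiteness is point finiteness.
\<close>

locale polytope_complex =
  fixes X' :: "'f::euclidean_space set" and \<rho>' :: "'c \<Rightarrow> 'f"
    and C' :: "'c set set" and \<alpha>' :: "'f \<Rightarrow> 'c \<Rightarrow> 'c"
  assumes cell_inj: "\<delta> \<in> C' \<Longrightarrow> inj_on \<rho>' \<delta>"
    and cell_polytope: "\<delta> \<in> C' \<Longrightarrow> \<exists>V. finite V \<and> V \<noteq> {} \<and> V \<subseteq> X' \<and> \<rho>' ` \<delta> = convex hull V"
    and face_cell: "\<lbrakk>\<delta> \<in> C'; is_face \<rho>' F \<delta>\<rbrakk> \<Longrightarrow> F \<in> C'"
    and cell_inter: "\<lbrakk>\<delta> \<in> C'; \<epsilon> \<in> C'; q \<in> \<delta> \<inter> \<epsilon>\<rbrakk> \<Longrightarrow>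
      \<exists>F. q \<in> F \<and> is_face \<rho>' F \<delta> \<and> is_face \<rho>' F \<epsilon>"
    and locally_finite: "finite {\<delta> \<in> C'. q \<in> \<delta>}"
    and action': "lattice_action X' \<rho>' C' \<alpha>'"
    and finite_cells: "finite ((\<lambda>\<delta>. (\<lambda>x. \<alpha>' x ` \<delta>) ` X') ` C')"

text \<open>
  Copies, indexed by \<open>I\<close>, of the pullback along \<open>r : X\<^sub>\<real> \<rightarrow> X'\<^sub>\<real>\<close>. A point is a triple of a point of
  \<open>X\<^sub>\<real>\<close>, a point of the complex over \<open>X'\<^sub>\<real>\<close>, and the index of the copy; so \<open>\<rho>\<close> becomes \<open>fst\<close>.
\<close>

definition pullback_cell ::
    "'e::euclidean_space set \<Rightarrow> ('e \<Rightarrow> 'f) \<Rightarrow> ('c \<Rightarrow> 'f) \<Rightarrow> 'c set \<Rightarrow> 'i \<Rightarrow> ('e \<times> 'c \<times> 'i) set" where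
  "pullback_cell X r \<rho>' \<delta>' i = {(v, q, j). v \<in> span X \<and> q \<in> \<delta>' \<and> r v = \<rho>' q \<and> j = i}"

definition pullback_cells ::
    "'e::euclidean_space set \<Rightarrow> ('e \<Rightarrow> 'f) \<Rightarrow> ('c \<Rightarrow> 'f) \<Rightarrow> 'c set set \<Rightarrow> 'i set \<Rightarrow>
     ('e \<times> 'c \<times> 'i) set set" where
  "pullback_cells X r \<rho>' C' I = {pullback_cell X r \<rho>' \<delta>' i |\<delta>' i. \<delta>' \<in> C' \<and> i \<in> I}"

locale semiabelic_complex = polytope_complex X' \<rho>' C' \<alpha>'
  for X' :: "'f::euclidean_space set" and \<rho>' :: "'c \<Rightarrow> 'f" and C' and \<alpha>' +
  fixes X :: "'e::euclidean_space set" and r :: "'e \<Rightarrow> 'f"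
    and I :: "'i set" and \<alpha> :: "'e \<Rightarrow> 'e \<times> 'c \<times> 'i \<Rightarrow> 'e \<times> 'c \<times> 'i"
  assumes X: "lattice_in X"
    and r_linear: "linear r"
    and r_image: "r ` X = X'"
    and action: "lattice_action X fst (pullback_cells X r \<rho>' C' I) \<alpha>"
    and action_extends: "\<lbrakk>x \<in> X; w \<in> \<Union>(pullback_cells X r \<rho>' C' I)\<rbrakk> \<Longrightarrow>
      fst (snd (\<alpha> x w)) = \<alpha>' (r x) (fst (snd w))"


section \<open>Fixed torus actions\<close>

definition orbit_closure :: "'e::euclidean_space set \<Rightarrow> 'b cspace \<Rightarrow> (('e \<Rightarrow> complex) \<Rightarrow> 'b \<Rightarrow> 'b) \<Rightarrow>
    'b \<Rightarrow> 'b set" where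
  "orbit_closure X Pt ta z = spc Pt closure_of ((\<lambda>a. ta a z) ` torus_pts X)"

text \<open>
  The pullback of \<open>L = \<O>(\<Theta>)\<close> to \<open>Pt\<close> has fiber \<open>bundle_fibre P \<Theta> 1 (\<pi> z)\<close> at \<open>z\<close>; in particular a deck
  transformation acts on it as the identity \<open>L\<^bsub>\<pi> z\<^esub> = L\<^bsub>\<pi> (dk x z)\<^esub>\<close>. The linear map
  \<open>lin a z\<close> goes from the fiber at \<open>z\<close> to the fiber at \<open>ta a z\<close>. A section \<open>s\<close> over a torus-invariant
  closed set \<open>Z\<close> has weight \<open>x\<close> if \<open>s (a z) = x(a) (a (s z))\<close>.
\<close>

definition eigensection where
  "eigensection X P \<Theta> Pt \<pi> ta lin Z x s \<longleftrightarrow>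
     (\<forall>z\<in>Z. s z \<in> bundle_fibre P \<Theta> 1 (\<pi> z)) \<and>
     (\<forall>i\<in>\<Theta>. (\<lambda>z. s z i) \<in> funs (csubspace Pt Z) {z \<in> Z. \<pi> z \<in> fst i}) \<and>
     (\<forall>a\<in>torus_pts X. \<forall>z\<in>Z. s (ta a z) = (\<lambda>i. a x * lin a z (s z) i))"

text \<open>
  In \<open>lin_commute\<close>, the action of \<open>x\<close> after that of \<open>a\<close> is \<open>x(a)\<close> times the action of \<open>a\<close> after that
  of \<open>x\<close>. With the above convention for weights, translation of sections by \<open>x\<close> then adds \<open>x\<close> to the
  weight. Linearity of \<open>lin a z\<close> is part of \<open>lin_holomorphic\<close>.
\<close>

locale fixed_torus_action =
    stable_semiabelic_pair G \<G> X' \<iota> P act \<Theta> +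
    semiabelic_complex X' \<rho>' C' \<alpha>' X r I \<alpha>
  for G :: "'g cspace" and \<G> and X' :: "'f::euclidean_space set" and \<iota>
    and P :: "'p cspace" and act and \<Theta>
    and \<rho>' :: "'c \<Rightarrow> 'f" and C' and \<alpha>'
    and X :: "'e::euclidean_space set" and r
    and I :: "'i set" and \<alpha> +
  fixes \<phi> :: "('e \<Rightarrow> complex) \<Rightarrow> 'g"
    and Pt :: "'b cspace" and \<pi> :: "'b \<Rightarrow> 'p" and dk :: "'e \<Rightarrow> 'b \<Rightarrow> 'b"
    and ta :: "('e \<Rightarrow> complex) \<Rightarrow> 'b \<Rightarrow> 'b"
    and lin :: "('e \<Rightarrow> complex) \<Rightarrow> 'b \<Rightarrow> 'p fibre_vec \<Rightarrow> 'p fibre_vec"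
    and cell :: "'b set \<Rightarrow> ('e \<times> 'c \<times> 'i) set"
  assumes \<phi>_hom: "\<phi> \<in> hom (torus_group X) \<G>"
    and \<phi>_holomorphic: "cmorphism (analytification (torus X)) (analytification G) \<phi>"
    and \<phi>_surj: "\<phi> ` torus_pts X = pts G"
    and \<phi>_kernel:
      "subtopology (spc (analytification (torus X))) {a \<in> torus_pts X. \<phi> a = \<one>\<^bsub>\<G>\<^esub>} =
       discrete_topology {a \<in> torus_pts X. \<phi> a = \<one>\<^bsub>\<G>\<^esub>}"
    and \<phi>_lift: "t \<in> torus_pts X' \<Longrightarrow> \<phi> (restrict (\<lambda>x. t (r x)) X) = \<iota> t"

    and Pt: "function_sheaf Pt"
    and \<pi>_holomorphic: "cmorphism Pt (analytification P) \<pi>"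
    and dk_holomorphic: "x \<in> X \<Longrightarrow> cmorphism Pt Pt (dk x)"
    and dk_zero: "z \<in> pts Pt \<Longrightarrow> dk 0 z = z"
    and dk_add: "\<lbrakk>x \<in> X; y \<in> X; z \<in> pts Pt\<rbrakk> \<Longrightarrow> dk (x + y) z = dk x (dk y z)"
    and \<pi>_quotient: "\<lbrakk>z \<in> pts Pt; w \<in> pts Pt\<rbrakk> \<Longrightarrow> \<pi> z = \<pi> w \<longleftrightarrow> (\<exists>x\<in>X. w = dk x z)"
    and evenly_covered: "p \<in> pts P \<Longrightarrow>
      \<exists>U V. openin (spc (analytification P)) U \<and> p \<in> U \<and> openin (spc Pt) V \<and>
        {z \<in> pts Pt. \<pi> z \<in> U} = (\<Union>x\<in>X. dk x ` V) \<and>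
        (\<forall>x\<in>X. \<forall>y\<in>X. x \<noteq> y \<longrightarrow> dk x ` V \<inter> dk y ` V = {}) \<and>
        cisomorphism (csubspace Pt V) (csubspace (analytification P) U) \<pi>"

    and ta_holomorphic:
      "cmorphism (an_prod (analytification (torus X)) Pt) Pt (\<lambda>(a, z). ta a z)"
    and ta_one: "z \<in> pts Pt \<Longrightarrow> ta \<one>\<^bsub>torus_group X\<^esub> z = z"
    and ta_mult: "\<lbrakk>a \<in> torus_pts X; b \<in> torus_pts X; z \<in> pts Pt\<rbrakk> \<Longrightarrow>
      ta (a \<otimes>\<^bsub>torus_group X\<^esub> b) z = ta a (ta b z)"
    and ta_lifts: "\<lbrakk>a \<in> torus_pts X; z \<in> pts Pt\<rbrakk> \<Longrightarrow> \<pi> (ta a z) = act (\<phi> a) (\<pi> z)"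
    and ta_dk: "\<lbrakk>a \<in> torus_pts X; x \<in> X; z \<in> pts Pt\<rbrakk> \<Longrightarrow> ta a (dk x z) = dk x (ta a z)"

    and lin_fibre: "\<lbrakk>a \<in> torus_pts X; z \<in> pts Pt; v \<in> bundle_fibre P \<Theta> 1 (\<pi> z)\<rbrakk> \<Longrightarrow>
      lin a z v \<in> bundle_fibre P \<Theta> 1 (\<pi> (ta a z))"
    and lin_one: "\<lbrakk>z \<in> pts Pt; v \<in> bundle_fibre P \<Theta> 1 (\<pi> z)\<rbrakk> \<Longrightarrow>
      lin \<one>\<^bsub>torus_group X\<^esub> z v = v"
    and lin_mult: "\<lbrakk>a \<in> torus_pts X; b \<in> torus_pts X; z \<in> pts Pt; v \<in> bundle_fibre P \<Theta> 1 (\<pi> z)\<rbrakk> \<Longrightarrow>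
      lin (a \<otimes>\<^bsub>torus_group X\<^esub> b) z v = lin a (ta b z) (lin b z v)"
    and lin_holomorphic: "\<lbrakk>i \<in> \<Theta>; j \<in> \<Theta>\<rbrakk> \<Longrightarrow>
      \<exists>m\<in>funs (an_prod (analytification (torus X)) Pt)
           {(a, z). a \<in> torus_pts X \<and> z \<in> pts Pt \<and> \<pi> z \<in> fst i \<and> \<pi> (ta a z) \<in> fst j}.
        \<forall>a\<in>torus_pts X. \<forall>z\<in>pts Pt. \<pi> z \<in> fst i \<and> \<pi> (ta a z) \<in> fst j \<longrightarrow>
          (\<forall>v\<in>bundle_fibre P \<Theta> 1 (\<pi> z). lin a z v j = m (a, z) * v i)"
    and lin_commute:
      "\<lbrakk>a \<in> torus_pts X; x \<in> X; z \<in> pts Pt; v \<in> bundle_fibre P \<Theta> 1 (\<pi> z)\<rbrakk> \<Longrightarrow>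
       lin a z v = (\<lambda>i. a x * lin a (dk x z) v i)"

    and cell_bij:
      "bij_betw cell (orbit_closure X Pt ta ` pts Pt) (pullback_cells X r \<rho>' C' I)"
    and cell_mono:
      "\<lbrakk>Z \<in> orbit_closure X Pt ta ` pts Pt; W \<in> orbit_closure X Pt ta ` pts Pt\<rbrakk> \<Longrightarrow>
       cell Z \<subseteq> cell W \<longleftrightarrow> Z \<subseteq> W"
    and cell_equivariant:
      "\<lbrakk>Z \<in> orbit_closure X Pt ta ` pts Pt; x \<in> X\<rbrakk> \<Longrightarrow> cell (dk x ` Z) = \<alpha> x ` cell Z"
    and cell_weights:
      "Z \<in> orbit_closure X Pt ta ` pts Pt \<Longrightarrow>
       {x \<in> X. \<exists>s. eigensection X P \<Theta> Pt \<pi> ta lin Z x s \<and> (\<exists>z\<in>Z. s z \<noteq> (\<lambda>_. 0))} =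
       X \<inter> fst ` cell Z"

text \<open>
  The canonical section of \<open>\<O>(\<Theta>)\<close> has coordinate \<open>f\<close> at the index \<open>(U, f)\<close>. Its pullback is expanded
  into eigensections \<open>\<xi> w\<close> indexed by the integral points \<open>w\<close> of the complex.
\<close>

definition integral_points :: "'e set \<Rightarrow> ('e \<times> 'd) set set \<Rightarrow> ('e \<times> 'd) set" where
  "integral_points X C = {w \<in> \<Union>C. fst w \<in> X}"

locale theta_expansion =
    fixed_torus_action G \<G> X' \<iota> P act \<Theta> \<rho>' C' \<alpha>' X r I \<alpha> \<phi> Pt \<pi> dk ta lin cell
  for G :: "'g cspace" and \<G> and X' :: "'f::euclidean_space set" and \<iota>
    and P :: "'p cspace" and act and \<Theta>
    and \<rho>' :: "'c \<Rightarrow> 'f" and C' and \<alpha>'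
    and X :: "'e::euclidean_space set" and r
    and I :: "'i set" and \<alpha>
    and \<phi> and Pt :: "'b cspace" and \<pi> and dk and ta and lin and cell +
  fixes \<xi> :: "'e \<times> 'c \<times> 'i \<Rightarrow> 'b \<Rightarrow> 'p fibre_vec"
  assumes \<xi>_eigensection: "w \<in> integral_points X (pullback_cells X r \<rho>' C' I) \<Longrightarrow>
      eigensection X P \<Theta> Pt \<pi> ta lin (pts Pt) (fst w) (\<xi> w)"
    and \<xi>_sum: "\<lbrakk>z \<in> pts Pt; i \<in> \<Theta>; \<pi> z \<in> fst i\<rbrakk> \<Longrightarrow>
      ((\<lambda>w. \<xi> w z i) has_sum snd i (\<pi> z)) (integral_points X (pullback_cells X r \<rho>' C' I))"
    and \<xi>_support: "\<lbrakk>w \<in> integral_points X (pullback_cells X r \<rho>' C' I); z \<in> pts Pt;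
        \<xi> w z \<noteq> (\<lambda>_. 0)\<rbrakk> \<Longrightarrow> w \<in> cell (orbit_closure X Pt ta z)"

definition is_weighted_average ::
    "'w set \<Rightarrow> ('w \<Rightarrow> real) \<Rightarrow> ('w \<Rightarrow> 'e::euclidean_space) \<Rightarrow> 'e \<Rightarrow> bool" where
  "is_weighted_average E c v y \<longleftrightarrow> c summable_on E \<and> infsum c E \<noteq> 0 \<and>
     (\<lambda>w. c w *\<^sub>R v w) summable_on E \<and> y = infsum (\<lambda>w. c w *\<^sub>R v w) E /\<^sub>R infsum c E"

end

theory Submission
  imports Defs "HOL-Complex_Analysis.Complex_Analysis"
begin

text \<open>
  An element of \<open>T\<close> of modulus \<open>exp (\<nu> \<bullet> x)\<close> multiplies the weights \<open>\<bar>\<xi> w z\<bar>\<^sup>2\<close> by \<open>exp (2 \<nu> \<bullet> fst w)\<close>, up to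
  a factor that does not depend on \<open>w\<close>. So on a torus orbit, prescribing the weighted average is the
  critical equation of a convex function of \<open>\<nu>\<close>, which is strictly convex and proper along the cell
  because the supporting points \<open>w\<close> span it; the moduli are determined, and what remains is a compact
  torus modulo the stabilizer.

  The support spans the cell because \<open>\<theta>\<close> vanishes on no orbit: it meets every face, and it is
  invariant under the stabilizer of the cell in \<open>X\<close>, which spans the unbounded directions as
  closed orbits have compact image in \<open>P\<close>. The stabilizer of a point in \<open>T\<close> is the annihilator of
  the directions of the cell. One inclusion compares weights of sections and uses connected
  stabilizers; for the other, a one-parameter subgroup that is constant on the cell sweeps out an
  algebraic curve in \<open>P\<close>, on which the quotients of sections of \<open>\<O>(m\<Theta>)\<close> by \<open>\<theta>\<^sup>m\<close> have no poles.

  The equivariance of \<open>\<xi>\<close>, hence of the moment map, is the uniqueness of Fourier coefficients.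
\<close>

subsection \<open>Lattices\<close>

text \<open>Cells are attached to orbit closures, not to orbits, so it must be proved that an orbit
  closure contains only one dense orbit. This shapes the deduction: only after the annihilator of a
  cell is known to fix its orbit is a piece of the orbit of bounded modulus the image of a compact
  set, hence closed in the Hausdorff covering; and only then are deck transformations that preserve
  a cell realized by torus elements.

  Two topologies are in play: connected stabilizers and closed immersions are Zariski notions,
  limits and compactness analytic ones. Since \<open>T \<rightarrow> G\<close> is merely
  holomorphic, the curve swept out in \<open>P\<close> is algebraic only because a one-parameter
  subgroup trivial on the directions of a cell comes from \<open>T'\<close>. The covering carries no
  algebraic structure, so limits are taken in \<open>P\<close> and lifted through an evenly covered
  set.

  The fibre in \<open>P\<close> is computed upstairs: a deck transformation fixing a point of the
  complex is trivial, so the fibre over an interior point maps injectively to \<open>P\<close>, and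
  a continuous bijection from a compact product of circles to a Hausdorff space is a
  homeomorphism.\<close>

lemma dual_vectors:
  fixes B :: "'e::euclidean_space set"
  assumes "independent B"
  obtains d where "\<And>b b'. b \<in> B \<Longrightarrow> b' \<in> B \<Longrightarrow> d b \<bullet> b' = (if b = b' then 1 else 0)"
    and "\<And>b. b \<in> B \<Longrightarrow> d b \<in> span B"
proof -
  have "\<exists>v\<in>span B. \<forall>b'\<in>B. v \<bullet> b' = (if b = b' then 1 else 0)" if "b \<in> B" for b
  proof -
    obtain g :: "'e \<Rightarrow> real" where g: "linear g" "\<forall>x\<in>B. g x = (if b = x then 1 else 0)"
      using linear_independent_extend[OF assms, of "\<lambda>x. if b = x then 1 else (0::real)"] by auto
    \<comment> \<open>The adjoint of a functional, evaluated at 1, is the vector that represents it.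
      Its projection to \<open>span B\<close> has the same inner products with
      \<open>B\<close>.\<close>
    define v where "v = adjoint g 1"
    have v: "v \<bullet> x = g x" for x
      using adjoint_works[OF g(1), of x 1] by (simp add: v_def inner_commute)
    obtain y z where yz: "y \<in> span B" "v = y + z" "\<And>w. w \<in> span B \<Longrightarrow> orthogonal z w"
      using orthogonal_subspace_decomp_exists[of B v] by metis
    have "y \<bullet> b' = v \<bullet> b'" if "b' \<in> B" for b'
      using yz(3)[OF span_base[OF that]] yz(2) by (simp add: orthogonal_def inner_left_distrib)
    with yz(1) v g(2) show ?thesis by (intro bexI[of _ y]) auto
  qed
  then show thesis using that by metis
qed

lemma lattice_in_0: "lattice_in X \<Longrightarrow> 0 \<in> X"
  unfolding lattice_in_def by (auto intro!: exI[of _ "\<lambda>_. 0"])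

lemma lattice_in_add: "lattice_in X \<Longrightarrow> x \<in> X \<Longrightarrow> y \<in> X \<Longrightarrow> x + y \<in> X"
  unfolding lattice_in_def
proof clarsimp
  fix B and n m :: "'a \<Rightarrow> int"
  show "\<exists>k. (\<Sum>b\<in>B. real_of_int (n b) *\<^sub>R b) + (\<Sum>b\<in>B. real_of_int (m b) *\<^sub>R b) = (\<Sum>b\<in>B. real_of_int (k b) *\<^sub>R b)"
    by (rule exI[of _ "\<lambda>b. n b + m b"]) (simp add: scaleR_add_left sum.distrib)
qed

lemma lattice_in_minus: "lattice_in X \<Longrightarrow> x \<in> X \<Longrightarrow> - x \<in> X"
  unfolding lattice_in_def
proof clarsimp
  fix B and n :: "'a \<Rightarrow> int"
  show "\<exists>k. - (\<Sum>b\<in>B. real_of_int (n b) *\<^sub>R b) = (\<Sum>b\<in>B. real_of_int (k b) *\<^sub>R b)"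
    by (rule exI[of _ "\<lambda>b. - n b"]) (simp add: sum_negf)
qed

lemma lattice_in_diff: "lattice_in X \<Longrightarrow> x \<in> X \<Longrightarrow> y \<in> X \<Longrightarrow> x - y \<in> X"
  using lattice_in_add[of X x "- y"] lattice_in_minus[of X y] by simp

lemma subgroup_scale_int:
  fixes H :: "'e::real_vector set"
  assumes "0 \<in> H" "\<And>x y. x \<in> H \<Longrightarrow> y \<in> H \<Longrightarrow> x + y \<in> H" "\<And>x. x \<in> H \<Longrightarrow> - x \<in> H" "x \<in> H"
  shows "of_int n *\<^sub>R x \<in> H"
proof -
  have nat: "of_nat m *\<^sub>R x \<in> H" for m :: nat
    by (induction m) (use assms in \<open>auto simp: algebra_simps\<close>)
  show ?thesis
  proof (cases "n \<ge> 0")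
    case True
    then show ?thesis using nat[of "nat n"] by simp
  next
    case False
    then have "of_int n *\<^sub>R x = - (of_nat (nat (- n)) *\<^sub>R x)" by simp
    then show ?thesis using assms(3) nat by metis
  qed
qed

lemma lattice_in_scale: "lattice_in X \<Longrightarrow> x \<in> X \<Longrightarrow> of_int n *\<^sub>R x \<in> X"
  by (rule subgroup_scale_int) (auto intro: lattice_in_0 lattice_in_add lattice_in_minus)

lemma lattice_in_sum:
  "lattice_in X \<Longrightarrow> (\<And>i. i \<in> A \<Longrightarrow> f i \<in> X) \<Longrightarrow> sum f A \<in> X"
  by (induction A rule: infinite_finite_induct) (auto intro: lattice_in_0 lattice_in_add)

text \<open>Pairing with the dual vectors reads off the integer coordinates, and Cauchy-Schwarz
  bounds them on \<open>S\<close>; only finitely many coefficient vectors remain.\<close>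

lemma finite_lattice_bounded:
  fixes X :: "'e::euclidean_space set"
  assumes "lattice_in X" "bounded S"
  shows "finite (X \<inter> S)"
proof -
  obtain B where B: "independent B" "X = {\<Sum>b\<in>B. of_int (n b) *\<^sub>R b |n :: 'e \<Rightarrow> int. True}"
    using assms(1) unfolding lattice_in_def by blast
  have fB: "finite B" using B(1) independent_imp_finite by blast
  obtain d where d: "\<And>b b'. b \<in> B \<Longrightarrow> b' \<in> B \<Longrightarrow> d b \<bullet> b' = (if b = b' then 1 else 0)"
    using dual_vectors[OF B(1)] by metis
  obtain M where M: "\<And>x. x \<in> S \<Longrightarrow> norm x \<le> M" using assms(2) bounded_iff by blast
  define R where "R = \<lceil>\<Sum>b\<in>B. norm (d b) * M\<rceil>"
  have "X \<inter> S \<subseteq> (\<lambda>n. \<Sum>b\<in>B. of_int (n b) *\<^sub>R b) ` (B \<rightarrow>\<^sub>E {- R..R})"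
  proof
    fix x assume x: "x \<in> X \<inter> S"
    then obtain n :: "'e \<Rightarrow> int" where n: "x = (\<Sum>b\<in>B. of_int (n b) *\<^sub>R b)" using B(2) by auto
    have M0: "M \<ge> 0" using M x norm_ge_zero[of x] by (meson IntD2 order_trans)
    have "\<bar>n b\<bar> \<le> R" if b: "b \<in> B" for b
    proof -
      have "d b \<bullet> x = (\<Sum>b'\<in>B. of_int (n b') * (if b = b' then 1 else 0))"
        unfolding n inner_sum_right by (intro sum.cong) (use d b in auto)
      also have "\<dots> = of_int (n b)" using fB b by (simp add: if_distrib cong: if_cong)
      finally have "\<bar>of_int (n b)\<bar> = \<bar>d b \<bullet> x\<bar>" by simp
      also have "\<dots> \<le> norm (d b) * norm x" by (rule Cauchy_Schwarz_ineq2)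
      also have "\<dots> \<le> norm (d b) * M" using M x by (intro mult_left_mono) auto
      also have "\<dots> \<le> (\<Sum>b\<in>B. norm (d b) * M)"
        using b fB M0 by (intro member_le_sum) auto
      finally have "real_of_int \<bar>n b\<bar> \<le> (\<Sum>b\<in>B. norm (d b) * M)" by simp
      then show ?thesis unfolding R_def by linarith
    qed
    then have "restrict n B \<in> B \<rightarrow>\<^sub>E {- R..R}" by (fastforce simp: abs_le_iff)
    moreover have "x = (\<Sum>b\<in>B. of_int (restrict n B b) *\<^sub>R b)" unfolding n by (intro sum.cong) auto
    ultimately show "x \<in> (\<lambda>n. \<Sum>b\<in>B. of_int (n b) *\<^sub>R b) ` (B \<rightarrow>\<^sub>E {- R..R})" by blast
  qed
  moreover have "finite (B \<rightarrow>\<^sub>E {- R..R})" using fB by (intro finite_PiE) auto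
  ultimately show ?thesis using finite_surj by blast
qed

text \<open>A \<int>-basis \<open>b\<close> of \<open>X\<close> whose first \<open>k\<close> members
  are a basis of \<open>X \<inter> D\<close>, with dual coordinates \<open>d\<close>. Integrality of
  \<open>d i\<close> on \<open>X\<close> distinguishes it from a mere maximal independent family: it
  supplies the integer exponents by which characters are written in the coordinates
  \<open>a (b i)\<close>.\<close>

definition adapted_basis ::
    "'e::euclidean_space set \<Rightarrow> 'e set \<Rightarrow> nat \<Rightarrow> nat \<Rightarrow> (nat \<Rightarrow> 'e) \<Rightarrow> (nat \<Rightarrow> 'e) \<Rightarrow> bool" where
  "adapted_basis X D n k b d \<longleftrightarrow> k \<le> n \<and> (\<forall>i<n. b i \<in> X) \<and>
     (\<forall>i<n. \<forall>j<n. d i \<bullet> b j = (if i = j then 1 else 0)) \<and>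
     (\<forall>x\<in>X. \<forall>i<n. d i \<bullet> x \<in> \<int>) \<and>
     (\<forall>x\<in>span X. x = (\<Sum>i<n. (d i \<bullet> x) *\<^sub>R b i)) \<and>
     (\<forall>x\<in>span X. x \<in> D \<longleftrightarrow> (\<forall>i\<in>{k..<n}. d i \<bullet> x = 0)) \<and> dim D = k"

text \<open>Extends a \<int>-basis \<open>U\<close> of the lattice points of \<open>span U\<close>
  by one direction. Among the lattice points of the larger span, \<open>c\<close> has the least
  positive height \<open>d a \<bullet> c\<close> over \<open>span U\<close>; every other height is
  then an integer multiple of it.\<close>

lemma flag_step:
  fixes X :: "'e::euclidean_space set"
  assumes X: "lattice_in X" and a: "a \<in> X" and notin: "a \<notin> span U"
    and U: "U \<subseteq> X" "finite U" "independent U"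
    and int: "\<And>x. x \<in> X \<inter> span U \<Longrightarrow> \<exists>n :: 'e \<Rightarrow> int. x = (\<Sum>u\<in>U. of_int (n u) *\<^sub>R u)"
  shows "\<exists>c. c \<in> X \<and> c \<notin> span U \<and> span (insert c U) = span (insert a U) \<and>
    (\<forall>x \<in> X \<inter> span (insert c U). \<exists>n :: 'e \<Rightarrow> int. x = (\<Sum>u\<in>insert c U. of_int (n u) *\<^sub>R u))"
proof -
  have ind: "independent (insert a U)" using notin U(3) by (simp add: independent_insertI)
  have aU: "a \<notin> U" using notin span_base by blast
  obtain d where d: "\<And>b b'. b \<in> insert a U \<Longrightarrow> b' \<in> insert a U \<Longrightarrow> d b \<bullet> b' = (if b = b' then 1 else 0)"
    using dual_vectors[OF ind] by metis
  have dU: "d a \<bullet> x = 0" if "x \<in> span U" for x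
    using that
  proof (induction rule: span_induct_alt)
    case (step c x y)
    then show ?case using d[of a x] aU by (auto simp: inner_right_distrib)
  qed simp
  have rep: "\<exists>t. x = (d a \<bullet> x) *\<^sub>R a + (\<Sum>u\<in>U. t u *\<^sub>R u)" if "x \<in> span (insert a U)" for x
  proof -
    obtain k where k: "x - k *\<^sub>R a \<in> span U" using \<open>x \<in> span (insert a U)\<close> span_breakdown_eq by blast
    then obtain t where t: "x - k *\<^sub>R a = (\<Sum>u\<in>U. t u *\<^sub>R u)" using span_finite[OF U(2)] by auto
    have "d a \<bullet> (x - k *\<^sub>R a) = 0" using dU k by blast
    then have "d a \<bullet> x = k" using d[of a a] by (simp add: inner_diff_right)
    then show ?thesis using t by (metis add.commute diff_add_cancel)
  qed
  define Y where "Y = X \<inter> span (insert a U)"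
  \<comment> \<open>A box on the generators: a lattice point of height in \<open>(0, 1]\<close> is
    moved into it by subtracting an integer combination of \<open>U\<close>, which does not change
    the height. So finitely many heights compete for the minimum.\<close>
  define K where "K = (\<lambda>(s,t). s *\<^sub>R a + (\<Sum>u\<in>U. t u *\<^sub>R u)) ` ({0..1::real} \<times> (U \<rightarrow>\<^sub>E {0..1::real}))"
  have K: "bounded K"
  proof -
    have "norm x \<le> norm a + (\<Sum>u\<in>U. norm u)" if "x \<in> K" for x
    proof -
      obtain s t where st: "s \<in> {0..1}" "t \<in> U \<rightarrow>\<^sub>E {0..1::real}" "x = s *\<^sub>R a + (\<Sum>u\<in>U. t u *\<^sub>R u)"
        using \<open>x \<in> K\<close> K_def by auto
      have "norm x \<le> norm (s *\<^sub>R a) + norm (\<Sum>u\<in>U. t u *\<^sub>R u)" using st(3) norm_triangle_ineq by blast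
      also have "norm (s *\<^sub>R a) \<le> norm a" using st(1) by (auto intro: mult_left_le_one_le)
      also have "norm (\<Sum>u\<in>U. t u *\<^sub>R u) \<le> (\<Sum>u\<in>U. norm u)"
        by (rule sum_norm_le) (use st(2) in \<open>force intro: mult_left_le_one_le\<close>)
      finally show ?thesis by simp
    qed
    then show ?thesis using bounded_iff by blast
  qed
  define Q where "Q = {y \<in> X \<inter> K. d a \<bullet> y > 0}"
  have red: "\<exists>z\<in>Q. d a \<bullet> z = d a \<bullet> y" if y: "y \<in> Y" "0 < d a \<bullet> y" "d a \<bullet> y \<le> 1" for y
  proof -
    obtain t where t: "y = (d a \<bullet> y) *\<^sub>R a + (\<Sum>u\<in>U. t u *\<^sub>R u)" using rep y(1) Y_def by blast
    define w where "w = (\<Sum>u\<in>U. of_int \<lfloor>t u\<rfloor> *\<^sub>R u)"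
    have wX: "w \<in> X" unfolding w_def using U(1) by (intro lattice_in_sum[OF X] lattice_in_scale[OF X]) auto
    have wU: "w \<in> span U" unfolding w_def by (intro span_sum span_scale span_base)
    have da: "d a \<bullet> (y - w) = d a \<bullet> y" using dU[OF wU] by (simp add: inner_diff_right)
    have "y - w = (d a \<bullet> y) *\<^sub>R a + (\<Sum>u\<in>U. restrict (\<lambda>u. frac (t u)) U u *\<^sub>R u)"
    proof -
      have "y - w = (d a \<bullet> y) *\<^sub>R a + ((\<Sum>u\<in>U. t u *\<^sub>R u) - w)" using t by (metis add_diff_eq)
      also have "(\<Sum>u\<in>U. t u *\<^sub>R u) - w = (\<Sum>u\<in>U. restrict (\<lambda>u. frac (t u)) U u *\<^sub>R u)"
        unfolding w_def sum_subtractf[symmetric]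
        by (intro sum.cong) (auto simp: frac_def scaleR_diff_left)
      finally show ?thesis .
    qed
    moreover have "restrict (\<lambda>u. frac (t u)) U \<in> U \<rightarrow>\<^sub>E {0..1}"
      by (auto simp: frac_ge_0 less_imp_le[OF frac_lt_1])
    ultimately have "y - w \<in> K" unfolding K_def using y(2,3) by (intro image_eqI[where x="(d a \<bullet> y, restrict (\<lambda>u. frac (t u)) U)"]) auto
    moreover have "y - w \<in> X" using lattice_in_diff[OF X] wX y(1) Y_def by blast
    ultimately show ?thesis using da y(2) unfolding Q_def by (intro bexI[of _ "y - w"]) auto
  qed
  have aY: "a \<in> Y" unfolding Y_def using a by (simp add: span_base)
  have finQ: "finite Q" by (rule finite_subset[OF _ finite_lattice_bounded[OF X K]]) (auto simp: Q_def)
  have "Q \<noteq> {}" using red[OF aY] d[of a a] by auto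
  then obtain c where c: "c \<in> Q" "\<And>y. y \<in> Q \<Longrightarrow> d a \<bullet> c \<le> d a \<bullet> y"
    using finQ arg_min_if_finite[of Q "\<lambda>y. d a \<bullet> y"] by (metis linorder_not_le)
  have cX: "c \<in> X" and c0: "d a \<bullet> c > 0" and cK: "c \<in> K" using c(1) Q_def by auto
  have cs: "c \<in> span (insert a U)"
    using cK unfolding K_def by (auto intro!: span_add span_scale span_sum intro: span_base)
  have c1: "d a \<bullet> c \<le> 1" using red[OF aY] d[of a a] c(2) by force
  have cU: "c \<notin> span U" using dU c0 by force
  have sp: "span (insert c U) = span (insert a U)"
  proof (rule antisym)
    show "span (insert c U) \<subseteq> span (insert a U)"
      using cs by (intro span_minimal) (auto intro: span_base)
    obtain t where t: "c = (d a \<bullet> c) *\<^sub>R a + (\<Sum>u\<in>U. t u *\<^sub>R u)" using rep cs by blast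
    have "(\<Sum>u\<in>U. t u *\<^sub>R u) \<in> span (insert c U)" by (auto intro!: span_scale span_sum intro: span_base)
    moreover have "(d a \<bullet> c) *\<^sub>R a = c - (\<Sum>u\<in>U. t u *\<^sub>R u)" using t by (metis add_diff_cancel_right')
    ultimately have "(d a \<bullet> c) *\<^sub>R a \<in> span (insert c U)" by (simp add: span_diff span_base)
    then have "a \<in> span (insert c U)" using c0 span_scale[of "(d a \<bullet> c) *\<^sub>R a" _ "1 / (d a \<bullet> c)"] by simp
    then show "span (insert a U) \<subseteq> span (insert c U)"
      by (intro span_minimal) (auto intro: span_base)
  qed
  have "\<exists>n :: 'e \<Rightarrow> int. x = (\<Sum>u\<in>insert c U. of_int (n u) *\<^sub>R u)" if x: "x \<in> X \<inter> span (insert c U)" for x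
  proof -
    \<comment> \<open>Division with remainder: the remainder \<open>y\<close> has height in
      \<open>[0, d a \<bullet> c)\<close>, hence height 0 by minimality of \<open>c\<close>, and the
      hypothesis on \<open>U\<close> applies to it.\<close>
    define m where "m = \<lfloor>(d a \<bullet> x) / (d a \<bullet> c)\<rfloor>"
    define y where "y = x - of_int m *\<^sub>R c"
    have yY: "y \<in> Y" unfolding y_def Y_def using x sp cs
      by (auto intro!: lattice_in_diff[OF X] lattice_in_scale[OF X] cX span_diff span_scale)
    have dy: "d a \<bullet> y = d a \<bullet> x - of_int m * (d a \<bullet> c)" by (simp add: y_def inner_diff_right)
    have ge: "0 \<le> d a \<bullet> y" and lt: "d a \<bullet> y < d a \<bullet> c"
    proof -
      have "of_int m \<le> (d a \<bullet> x) / (d a \<bullet> c)" "(d a \<bullet> x) / (d a \<bullet> c) < of_int m + 1"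
        unfolding m_def by linarith+
      then have "of_int m * (d a \<bullet> c) \<le> d a \<bullet> x" "d a \<bullet> x < (of_int m + 1) * (d a \<bullet> c)"
        using c0 by (simp_all add: pos_le_divide_eq pos_divide_less_eq)
      then show "0 \<le> d a \<bullet> y" "d a \<bullet> y < d a \<bullet> c" using dy by (simp_all add: algebra_simps)
    qed
    have "\<not> 0 < d a \<bullet> y"
    proof
      assume "0 < d a \<bullet> y"
      then obtain z where "z \<in> Q" "d a \<bullet> z = d a \<bullet> y" using red[OF yY] lt c1 by force
      then show False using c(2) lt by force
    qed
    then have "d a \<bullet> y = 0" using ge by linarith
    moreover obtain t where "y = (d a \<bullet> y) *\<^sub>R a + (\<Sum>u\<in>U. t u *\<^sub>R u)" using rep yY Y_def by blast
    ultimately have "y = (\<Sum>u\<in>U. t u *\<^sub>R u)" by simp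
    then have "y \<in> span U" by (auto intro!: span_scale span_sum intro: span_base)
    then obtain n :: "'e \<Rightarrow> int" where n: "y = (\<Sum>u\<in>U. of_int (n u) *\<^sub>R u)" using int yY Y_def by blast
    have cnU: "c \<notin> U" using cU span_base by blast
    have "x = of_int m *\<^sub>R c + (\<Sum>u\<in>U. of_int (n u) *\<^sub>R u)" using n y_def by (metis add.commute diff_add_cancel)
    also have "\<dots> = (\<Sum>u\<in>insert c U. of_int ((n(c := m)) u) *\<^sub>R u)"
      using cnU U(2) by (auto intro!: sum.cong)
    finally show ?thesis by blast
  qed
  then show ?thesis using cX cU sp by blast
qed

lemma lattice_in_scale_nat: "lattice_in X \<Longrightarrow> x \<in> X \<Longrightarrow> of_nat m *\<^sub>R x \<in> X"
  using lattice_in_scale[of X x "int m"] by simp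

lemma flag_extend:
  fixes X :: "'e::euclidean_space set"
  assumes X: "lattice_in X" and C: "finite C" "C \<subseteq> X"
    and U: "U \<subseteq> X" "finite U" "independent U"
      "\<And>x. x \<in> X \<inter> span U \<Longrightarrow> \<exists>n :: 'e \<Rightarrow> int. x = (\<Sum>u\<in>U. of_int (n u) *\<^sub>R u)"
  shows "\<exists>W. U \<subseteq> W \<and> W \<subseteq> X \<and> finite W \<and> independent W \<and> span W = span (U \<union> C) \<and>
    (\<forall>x \<in> X \<inter> span W. \<exists>n :: 'e \<Rightarrow> int. x = (\<Sum>u\<in>W. of_int (n u) *\<^sub>R u))"
  using C
proof (induction C rule: finite_induct)
  case empty
  then show ?case using U by auto
next
  case (insert a C)
  then obtain W where W: "U \<subseteq> W" "W \<subseteq> X" "finite W" "independent W" "span W = span (U \<union> C)"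
    "\<And>x. x \<in> X \<inter> span W \<Longrightarrow> \<exists>n :: 'e \<Rightarrow> int. x = (\<Sum>u\<in>W. of_int (n u) *\<^sub>R u)" by auto
  have sp: "span (U \<union> insert a C) = span (insert a W)"
    using W(5) by (simp add: span_insert)
  show ?case
  proof (cases "a \<in> span W")
    case True
    then have "span W = span (U \<union> insert a C)" using sp by (simp add: span_redundant)
    then show ?thesis using W by (intro exI[of _ W]) simp
  next
    case False
    obtain c where c: "c \<in> X" "c \<notin> span W" "span (insert c W) = span (insert a W)"
      "\<forall>x \<in> X \<inter> span (insert c W). \<exists>n :: 'e \<Rightarrow> int. x = (\<Sum>u\<in>insert c W. of_int (n u) *\<^sub>R u)"
      using flag_step[OF X _ False W(2-4) W(6)] insert.prems by auto
    have "independent (insert c W)" using c(2) W(4) by (simp add: independent_insertI)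
    then show ?thesis using W c sp by (intro exI[of _ "insert c W"]) auto
  qed
qed

text \<open>The basis is built along the flag from \<open>D\<close> to \<open>span X\<close>: a
  lattice basis of \<open>X \<inter> D\<close> comes first and is then extended to \<open>X\<close>.
  Rationality of \<open>D\<close>, expressed by \<open>D = span (X \<inter> D)\<close>, makes the
  first stage exhaust \<open>D\<close>.\<close>

lemma adapted_basis_exists:
  fixes X :: "'e::euclidean_space set"
  assumes X: "lattice_in X" and D: "D = span (X \<inter> D)"
  obtains n b d where "adapted_basis X D n (dim D) b d" "\<And>i. i < n \<Longrightarrow> d i \<in> span X"
proof -
  obtain C1 where C1: "C1 \<subseteq> X \<inter> D" "independent C1" "X \<inter> D \<subseteq> span C1"
    using maximal_independent_subset by blast
  obtain C2 where C2: "C2 \<subseteq> X" "independent C2" "X \<subseteq> span C2"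
    using maximal_independent_subset by blast
  have fin: "finite C1" "finite C2" using C1 C2 independent_imp_finite by auto
  have spC1: "span C1 = D"
    by (metis C1(1,3) D antisym span_minimal span_mono subspace_span)
  have spC2: "span C2 = span X"
    by (metis C2(1,3) antisym span_minimal span_mono subspace_span)
  obtain U where U: "U \<subseteq> X" "finite U" "independent U" "span U = span C1"
    "\<And>x. x \<in> X \<inter> span U \<Longrightarrow> \<exists>n :: 'e \<Rightarrow> int. x = (\<Sum>u\<in>U. of_int (n u) *\<^sub>R u)"
  proof -
    have "\<exists>W. {} \<subseteq> W \<and> W \<subseteq> X \<and> finite W \<and> independent W \<and> span W = span ({} \<union> C1) \<and>
      (\<forall>x \<in> X \<inter> span W. \<exists>n :: 'e \<Rightarrow> int. x = (\<Sum>u\<in>W. of_int (n u) *\<^sub>R u))"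
      by (rule flag_extend[OF X fin(1)]) (use C1(1) in \<open>auto simp: independent_empty\<close>)
    then show ?thesis using that by auto
  qed
  obtain W where W: "U \<subseteq> W" "W \<subseteq> X" "finite W" "independent W" "span W = span (U \<union> C2)"
    "\<And>x. x \<in> X \<inter> span W \<Longrightarrow> \<exists>n :: 'e \<Rightarrow> int. x = (\<Sum>u\<in>W. of_int (n u) *\<^sub>R u)"
    using flag_extend[OF X fin(2) C2(1) U(1-3) U(5)] by auto
  have spW: "span W = span X"
  proof (rule antisym)
    show "span W \<subseteq> span X" using W(2) span_mono by blast
    show "span X \<subseteq> span W" using spC2 W(5) by (metis span_mono sup.cobounded2)
  qed
  define k where "k = card U"
  define n where "n = card W"
  obtain f where f: "bij_betw f {..<k} U" using U(2) k_def ex_bij_betw_nat_finite atLeast0LessThan by metis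
  have kn: "k \<le> n" unfolding k_def n_def using W(1,3) card_mono by blast
  have "card (W - U) = card {k..<n}" using W(1,3) U(2) by (simp add: k_def n_def card_Diff_subset)
  then obtain g where g: "bij_betw g {k..<n} (W - U)"
    using W(3) finite_same_card_bij[of "{k..<n}" "W - U"] by auto
  define b where "b i = (if i < k then f i else g i)" for i
  have bU: "bij_betw b {..<k} U" using f by (subst bij_betw_cong[of _ _ f]) (auto simp: b_def)
  have bWU: "bij_betw b {k..<n} (W - U)" using g by (subst bij_betw_cong[of _ _ g]) (auto simp: b_def)
  have un: "{..<k} \<union> {k..<n} = {..<n}" using kn by auto
  have bW: "bij_betw b {..<n} W"
    using bij_betw_combine[OF bU bWU] W(1) un by (metis Diff_disjoint Diff_partition)
  obtain dd where dd: "\<And>b b'. b \<in> W \<Longrightarrow> b' \<in> W \<Longrightarrow> dd b \<bullet> b' = (if b = b' then 1 else 0)"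
     "\<And>b. b \<in> W \<Longrightarrow> dd b \<in> span W"
    using dual_vectors[OF W(4)] by metis
  define d where "d i = dd (b i)" for i
  have bi: "b i \<in> W" if "i < n" for i using bW that by (auto simp: bij_betw_def)
  have dij: "d i \<bullet> b j = (if i = j then 1 else 0)" if "i < n" "j < n" for i j
    using dd(1)[OF bi[OF that(1)] bi[OF that(2)]] bW that unfolding d_def bij_betw_def inj_on_def by auto
  have sumW: "(\<Sum>u\<in>W. h u) = (\<Sum>i<n. h (b i))" for h :: "'e \<Rightarrow> 'e"
    using sum.reindex_bij_betw[OF bW, of h] by simp
  have rep: "\<exists>t. x = (\<Sum>i<n. t i *\<^sub>R b i)" if "x \<in> span X" for x
  proof -
    have "x \<in> span W" using that spW by simp
    then obtain t where "x = (\<Sum>u\<in>W. t u *\<^sub>R u)" unfolding span_finite[OF W(3)] by auto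
    then show ?thesis using sumW[of "\<lambda>u. t u *\<^sub>R u"] by auto
  qed
  have dsum: "d i \<bullet> (\<Sum>j<n. t j *\<^sub>R b j) = t i" if "i < n" for i t
  proof -
    have "d i \<bullet> (\<Sum>j<n. t j *\<^sub>R b j) = (\<Sum>j<n. t j * (if i = j then 1 else 0))"
      unfolding inner_sum_right by (intro sum.cong) (use dij that in auto)
    then show ?thesis using that by (simp add: if_distrib cong: if_cong)
  qed
  have rep': "x = (\<Sum>i<n. (d i \<bullet> x) *\<^sub>R b i)" if x: "x \<in> span X" for x
  proof -
    obtain t where t: "x = (\<Sum>i<n. t i *\<^sub>R b i)" using rep x by blast
    then show ?thesis using dsum[of _ t] by (metis (no_types, lifting) lessThan_iff sum.cong)
  qed
  have int: "d i \<bullet> x \<in> \<int>" if x: "x \<in> X" "i < n" for x i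
  proof -
    obtain m :: "'e \<Rightarrow> int" where "x = (\<Sum>u\<in>W. of_int (m u) *\<^sub>R u)"
      using W(6) x(1) spW span_base by blast
    then have "x = (\<Sum>j<n. of_int (m (b j)) *\<^sub>R b j)" using sumW[of "\<lambda>u. of_int (m u) *\<^sub>R u"] by auto
    then show ?thesis using dsum[OF x(2), of "\<lambda>j. of_int (m (b j))"] by simp
  qed
  have inD: "x \<in> D \<longleftrightarrow> (\<forall>i\<in>{k..<n}. d i \<bullet> x = 0)" if x: "x \<in> span X" for x
  proof
    assume "x \<in> D"
    then obtain t where "x = (\<Sum>u\<in>U. t u *\<^sub>R u)" using span_finite[OF U(2)] U(4) spC1 by auto
    then have x': "x = (\<Sum>j<k. t (b j) *\<^sub>R b j)"
      using sum.reindex_bij_betw[OF bU, of "\<lambda>u. t u *\<^sub>R u"] by simp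
    show "\<forall>i\<in>{k..<n}. d i \<bullet> x = 0"
      unfolding x' inner_sum_right using dij kn by (auto intro!: sum.neutral)
  next
    assume *: "\<forall>i\<in>{k..<n}. d i \<bullet> x = 0"
    have "x = (\<Sum>i<n. (d i \<bullet> x) *\<^sub>R b i)" using rep' x by blast
    also have "\<dots> \<in> span U"
    proof (rule span_sum)
      fix i assume "i \<in> {..<n}"
      show "(d i \<bullet> x) *\<^sub>R b i \<in> span U"
      proof (cases "i < k")
        case True
        then have "b i \<in> U" using bU by (auto simp: bij_betw_def)
        then show ?thesis by (simp add: span_base span_scale)
      qed (use * \<open>i \<in> {..<n}\<close> span_zero in auto)
    qed
    finally show "x \<in> D" using U(4) spC1 by simp
  qed
  have "dim D = k" using U(3,4) spC1 k_def by (metis dim_span_eq_card_independent)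
  then have "adapted_basis X D n (dim D) b d"
    unfolding adapted_basis_def using kn bi W(2) dij int rep' inD by auto
  moreover have "d i \<in> span X" if "i < n" for i using dd(2) bi that spW d_def by auto
  ultimately show thesis using that by blast
qed

section \<open>Additive maps on a lattice and subgroups of a lattice\<close>

lemma additive_scale_int:
  fixes \<beta> :: "'e::real_vector \<Rightarrow> 'v::real_vector"
  assumes H: "0 \<in> H" "\<And>x y. x \<in> H \<Longrightarrow> y \<in> H \<Longrightarrow> x + y \<in> H" "\<And>x. x \<in> H \<Longrightarrow> - x \<in> H"
    and \<beta>: "\<And>x y. x \<in> H \<Longrightarrow> y \<in> H \<Longrightarrow> \<beta> (x + y) = \<beta> x + \<beta> y" and x: "x \<in> H"
  shows "\<beta> (of_int n *\<^sub>R x) = of_int n *\<^sub>R \<beta> x"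
proof -
  have b0: "\<beta> 0 = 0" using \<beta>[of 0 0] H(1) by simp
  have s: "of_int m *\<^sub>R x \<in> H" for m by (rule subgroup_scale_int[OF H x])
  show ?thesis
  proof (induction n rule: int_induct[where k = 0])
    case (step1 i)
    then show ?case using \<beta>[OF s[of i] x] by (simp add: scaleR_left_distrib)
  next
    case (step2 i)
    then show ?case using \<beta>[OF s[of "i - 1"] x] by (simp add: scaleR_left_diff_distrib)
  qed (simp add: b0)
qed

lemma lattice_functional:
  fixes X :: "'e::euclidean_space set"
  assumes X: "lattice_in X" and h: "\<And>x y. x \<in> X \<Longrightarrow> y \<in> X \<Longrightarrow> h (x + y) = h x + (h y :: real)"
  obtains \<nu> where "\<nu> \<in> span X" "\<And>x. x \<in> X \<Longrightarrow> h x = \<nu> \<bullet> x"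
proof -
  \<comment> \<open>The trivial flag; only a lattice basis with integral dual coordinates is wanted
    here.\<close>
  have D0: "{0} = span (X \<inter> {0})"
    by (metis Int_lower2 span_empty span_insert_0 span_mono subset_singletonD subspace_single_0 span_eq_iff)
  obtain n b d where b: "adapted_basis X {0} n (dim {0::'e}) b d" and d: "\<And>i. i < n \<Longrightarrow> d i \<in> span X"
    using adapted_basis_exists[OF X D0] by metis
  note hz = additive_scale_int[OF lattice_in_0[OF X] lattice_in_add[OF X] lattice_in_minus[OF X] h, simplified]
  have h0: "h 0 = 0" using h[of 0 0] lattice_in_0[OF X] by simp
  have hs: "h (\<Sum>i\<in>I. f i) = (\<Sum>i\<in>I. h (f i))" if "finite I" "\<And>i. i \<in> I \<Longrightarrow> f i \<in> X" for I and f :: "nat \<Rightarrow> 'e"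
    using that
  proof (induction I rule: finite_induct)
    case (insert i I)
    then show ?case using h[of "f i" "sum f I"] lattice_in_sum[OF X, of I f] by simp
  qed (simp add: h0)
  define \<nu> where "\<nu> = (\<Sum>i<n. h (b i) *\<^sub>R d i)"
  have "h x = \<nu> \<bullet> x" if x: "x \<in> X" for x
  proof -
    have "x = (\<Sum>i<n. (d i \<bullet> x) *\<^sub>R b i)" using b x span_base unfolding adapted_basis_def by blast
    also have "\<dots> = (\<Sum>i<n. of_int \<lfloor>d i \<bullet> x\<rfloor> *\<^sub>R b i)"
      using b x unfolding adapted_basis_def by (intro sum.cong) (auto simp: of_int_floor_cancel)
    finally have "h x = (\<Sum>i<n. h (of_int \<lfloor>d i \<bullet> x\<rfloor> *\<^sub>R b i))"
      using hs[of "{..<n}" "\<lambda>i. of_int \<lfloor>d i \<bullet> x\<rfloor> *\<^sub>R b i"] b lattice_in_scale[OF X]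
      unfolding adapted_basis_def by auto
    also have "\<dots> = (\<Sum>i<n. (d i \<bullet> x) * h (b i))"
    proof (intro sum.cong refl)
      fix i assume "i \<in> {..<n}"
      then have "d i \<bullet> x \<in> \<int>" "b i \<in> X" using b x unfolding adapted_basis_def by auto
      then show "h (of_int \<lfloor>d i \<bullet> x\<rfloor> *\<^sub>R b i) = (d i \<bullet> x) * h (b i)"
        using hz[of "b i" "\<lfloor>d i \<bullet> x\<rfloor>"] by (metis Ints_cases floor_of_int)
    qed
    finally show ?thesis unfolding \<nu>_def inner_sum_left by (simp add: mult.commute)
  qed
  moreover have "\<nu> \<in> span X" unfolding \<nu>_def by (intro span_sum span_scale d) auto
  ultimately show thesis using that by blast
qed

text \<open>A basis of the free group \<open>X'\<close> lifts to \<open>X\<close>, and subtracting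
  the lift of \<open>r x\<close> from \<open>x\<close> splits the lattice. After a real vector is
  split in the same way, independence of \<open>B'\<close> forces the lifted part of a kernel vector
  to vanish.\<close>

lemma lattice_kernel_span:
  fixes X :: "'e::euclidean_space set" and X' :: "'f::euclidean_space set"
  assumes X: "lattice_in X" and X': "lattice_in X'" and r: "linear r" "r ` X = X'"
    and v: "v \<in> span X" "r v = 0"
  shows "v \<in> span (X \<inter> {x. r x = 0})"
proof -
  interpret r: linear r by (rule r(1))
  obtain B' where B': "independent B'" "X' = {\<Sum>b\<in>B'. of_int (n b) *\<^sub>R b |n :: 'f \<Rightarrow> int. True}"
    using X' unfolding lattice_in_def by blast
  have fB': "finite B'" using B'(1) independent_imp_finite by blast
  have "\<exists>x\<in>X. r x = b" if "b \<in> B'" for b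
  proof -
    have "b = (\<Sum>c\<in>B'. of_int (if c = b then 1 else 0) *\<^sub>R c)"
      using fB' that by (subst sum.remove[of _ b]) (auto intro!: sum.neutral)
    then have "b \<in> X'" unfolding B'(2) by (intro CollectI exI[of _ "\<lambda>c. if c = b then 1 else 0"]) simp
    then show ?thesis using r(2) by auto
  qed
  then obtain l where l: "\<And>b. b \<in> B' \<Longrightarrow> l b \<in> X \<and> r (l b) = b" by metis
  define Y where "Y = X \<inter> {x. r x = 0}"
  have "\<exists>t. v - (\<Sum>b\<in>B'. t b *\<^sub>R l b) \<in> span (Y)"
    using v(1)
  proof (induction rule: span_induct_alt)
    case base
    then show ?case by (intro exI[of _ "\<lambda>_. 0"]) (simp add: span_zero)
  next
    case (step c x y)
    then obtain t where t: "y - (\<Sum>b\<in>B'. t b *\<^sub>R l b) \<in> span (Y)" by blast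
    have "r x \<in> X'" using step r(2) by auto
    then obtain n :: "'f \<Rightarrow> int" where n: "r x = (\<Sum>b\<in>B'. of_int (n b) *\<^sub>R b)" unfolding B'(2) by auto
    define w where "w = x - (\<Sum>b\<in>B'. of_int (n b) *\<^sub>R l b)"
    have "w \<in> X" unfolding w_def using step l
      by (intro lattice_in_diff[OF X] lattice_in_sum[OF X] lattice_in_scale[OF X]) auto
    moreover have "r w = 0" unfolding w_def r.diff r.sum n using l by (simp add: r.scale)
    ultimately have "w \<in> Y" unfolding Y_def by simp
    then have "c *\<^sub>R w + (y - (\<Sum>b\<in>B'. t b *\<^sub>R l b)) \<in> span (Y)"
      using t by (intro span_add span_scale) (auto intro: span_base)
    moreover have "c *\<^sub>R w + (y - (\<Sum>b\<in>B'. t b *\<^sub>R l b)) =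
        c *\<^sub>R x + y - (\<Sum>b\<in>B'. (c * of_int (n b) + t b) *\<^sub>R l b)"
      unfolding w_def by (simp add: scaleR_add_left sum.distrib scaleR_sum_right algebra_simps)
    ultimately show ?case by (intro exI[of _ "\<lambda>b. c * of_int (n b) + t b"]) simp
  qed
  then obtain t where t: "v - (\<Sum>b\<in>B'. t b *\<^sub>R l b) \<in> span (Y)" by blast
  have "r y = 0" if "y \<in> span Y" for y
    using that by (induction rule: span_induct_alt) (auto simp: Y_def r.add r.scale)
  then have "r (v - (\<Sum>b\<in>B'. t b *\<^sub>R l b)) = 0" using t by blast
  then have "(\<Sum>b\<in>B'. t b *\<^sub>R b) = 0" unfolding r.diff r.sum v(2) using l by (simp add: r.scale)
  then have "\<forall>b\<in>B'. t b = 0" using B'(1) fB' independentD by blast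
  then show ?thesis using t unfolding Y_def by simp
qed

text \<open>Pigeonhole: \<open>g m\<close> is the multiple \<open>m x\<close> reduced modulo
  \<open>H\<close> to a lattice point of bounded size, so two different multiples of
  \<open>x\<close> leave the same residue.\<close>

lemma lattice_torsion:
  fixes X :: "'e::euclidean_space set"
  assumes X: "lattice_in X" and H: "H \<subseteq> X" "0 \<in> H" "\<And>x y. x \<in> H \<Longrightarrow> y \<in> H \<Longrightarrow> x + y \<in> H" "\<And>x. x \<in> H \<Longrightarrow> - x \<in> H"
    and x: "x \<in> X \<inter> span H"
  obtains m :: nat where "m > 0" "of_nat m *\<^sub>R x \<in> H"
proof -
  obtain C where C: "C \<subseteq> H" "independent C" "H \<subseteq> span C"
    using maximal_independent_subset by blast
  have fC: "finite C" using C independent_imp_finite by auto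
  have "span H \<subseteq> span C" using C(3) span_minimal by blast
  then obtain t where t: "x = (\<Sum>u\<in>C. t u *\<^sub>R u)" using x span_finite[OF fC] by auto
  define w where "w m = (\<Sum>u\<in>C. of_int \<lfloor>of_nat m * t u\<rfloor> *\<^sub>R u)" for m :: nat
  have wH: "w m \<in> H" for m
    unfolding w_def using fC C(1)
  proof (induction C rule: finite_induct)
    case (insert u C)
    then show ?case using H(3) subgroup_scale_int[OF H(2-4), of u] by auto
  qed (simp add: H(2))
  define g where "g m = of_nat m *\<^sub>R x - w m" for m :: nat
  have gX: "g m \<in> X" for m
    unfolding g_def using wH H(1) x by (intro lattice_in_diff[OF X] lattice_in_scale_nat[OF X]) auto
  have "norm (g m) \<le> (\<Sum>u\<in>C. norm u)" for m
  proof -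
    have "g m = (\<Sum>u\<in>C. frac (of_nat m * t u) *\<^sub>R u)"
      unfolding g_def w_def t by (simp add: scaleR_sum_right frac_def scaleR_diff_left sum_subtractf)
    also have "norm \<dots> \<le> (\<Sum>u\<in>C. norm u)"
      by (rule sum_norm_le) (auto simp: frac_ge_0 less_imp_le[OF frac_lt_1] intro: mult_left_le_one_le)
    finally show ?thesis .
  qed
  then have "range g \<subseteq> X \<inter> cball 0 (\<Sum>u\<in>C. norm u)" using gX by auto
  then have "finite (range g)" using finite_lattice_bounded[OF X bounded_cball] finite_subset by blast
  then have "\<not> inj g" using finite_imageD infinite_UNIV_nat by blast
  then obtain m1 m2 where m: "m1 < m2" "g m1 = g m2" unfolding inj_def by (metis linorder_neqE_nat)
  have "of_nat (m2 - m1) *\<^sub>R x = w m2 + - w m1"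
    using m unfolding g_def by (simp add: of_nat_diff algebra_simps)
  then have "of_nat (m2 - m1) *\<^sub>R x \<in> H" using wH H(3,4) by metis
  then show thesis using that[of "m2 - m1"] m(1) by simp
qed

lemma additive_image_near_subspace:
  fixes X :: "'e::euclidean_space set" and \<beta> :: "'e \<Rightarrow> 'v::euclidean_space"
  assumes X: "lattice_in X" and H: "H \<subseteq> X" "0 \<in> H" "\<And>x y. x \<in> H \<Longrightarrow> y \<in> H \<Longrightarrow> x + y \<in> H" "\<And>x. x \<in> H \<Longrightarrow> - x \<in> H"
    and \<beta>: "\<And>x y. x \<in> H \<Longrightarrow> y \<in> H \<Longrightarrow> \<beta> (x + y) = \<beta> x + \<beta> y"
  obtains W M where "subspace W" "dim W \<le> dim H" "\<And>x. x \<in> H \<Longrightarrow> \<exists>y\<in>W. norm (\<beta> x - y) \<le> M"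
proof -
  obtain C where C: "C \<subseteq> H" "independent C" "H \<subseteq> span C" "card C = dim H"
    using basis_exists by metis
  have fC: "finite C" using C independent_imp_finite by auto
  have b0: "\<beta> 0 = 0" using \<beta>[of 0 0] H(2) by simp
  have scale: "of_int n *\<^sub>R x \<in> H" if "x \<in> H" for x n by (rule subgroup_scale_int[OF H(2-4) that])
  have bs: "\<beta> (of_int n *\<^sub>R u) \<in> span (\<beta> ` C)" if "u \<in> C" for u n
  proof -
    have "\<beta> (of_int n *\<^sub>R u) = of_int n *\<^sub>R \<beta> u"
      using additive_scale_int[OF H(2-4) \<beta>, of u n] that C(1) by blast
    then show ?thesis using that by (simp add: span_scale span_base)
  qed
  have bsum: "(\<Sum>u\<in>C'. of_int (n u) *\<^sub>R u) \<in> H \<and> \<beta> (\<Sum>u\<in>C'. of_int (n u) *\<^sub>R u) \<in> span (\<beta> ` C)"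
    if "finite C'" "C' \<subseteq> C" for C' n
    using that
  proof (induction C' rule: finite_induct)
    case (insert u C')
    have "of_int (n u) *\<^sub>R u \<in> H" using scale insert.prems C(1) by auto
    moreover have "\<beta> (of_int (n u) *\<^sub>R u) \<in> span (\<beta> ` C)" using bs insert.prems by auto
    ultimately show ?case using insert H(3) \<beta> by (auto intro: span_add)
  qed (simp add: H(2) b0 span_zero)
  define K where "K = X \<inter> cball 0 (\<Sum>u\<in>C. norm u)"
  have finK: "finite K" unfolding K_def by (rule finite_lattice_bounded[OF X bounded_cball])
  define M where "M = (\<Sum>f\<in>K. norm (\<beta> f))"
  have "\<exists>y\<in>span (\<beta> ` C). norm (\<beta> x - y) \<le> M" if x: "x \<in> H" for x
  proof -
    have "x \<in> span C" using C(3) x by blast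
    then obtain t where t: "x = (\<Sum>u\<in>C. t u *\<^sub>R u)" unfolding span_finite[OF fC] by auto
    define w where "w = (\<Sum>u\<in>C. of_int \<lfloor>t u\<rfloor> *\<^sub>R u)"
    have w: "w \<in> H" "\<beta> w \<in> span (\<beta> ` C)" using bsum[OF fC, of "\<lambda>u. \<lfloor>t u\<rfloor>"] w_def by auto
    define f where "f = x + - w"
    have fH: "f \<in> H" unfolding f_def using H(3,4) x w(1) by blast
    have "f = (\<Sum>u\<in>C. frac (t u) *\<^sub>R u)"
      unfolding f_def w_def t by (simp add: frac_def scaleR_diff_left sum_subtractf)
    then have "norm f \<le> (\<Sum>u\<in>C. norm u)"
      by (simp add: sum_norm_le frac_ge_0 less_imp_le[OF frac_lt_1] mult_left_le_one_le)
    then have "f \<in> K" unfolding K_def using fH H(1) by auto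
    then have "norm (\<beta> f) \<le> M" unfolding M_def using finK by (intro member_le_sum) auto
    moreover have "\<beta> x = \<beta> f + \<beta> w" using \<beta>[OF fH w(1)] by (simp add: f_def)
    ultimately show ?thesis using w(2) by (intro bexI[of _ "\<beta> w"]) auto
  qed
  moreover have "dim (span (\<beta> ` C)) \<le> dim H"
    using C(4) fC by (metis card_image_le dim_le_card' dim_span finite_imageI le_trans)
  ultimately show thesis using that[of "span (\<beta> ` C)" M] by (simp add: subspace_span)
qed

text \<open>For \<open>x \<in> V\<close> all multiples \<open>n x\<close> are within
  \<open>M\<close> of \<open>W\<close>, but their component orthogonal to \<open>W\<close> grows
  linearly in \<open>n\<close> unless it is 0.\<close>

lemma subspace_near_dense:
  fixes V W :: "'v::euclidean_space set"
  assumes "subspace V" "subspace W" and near: "\<And>x. x \<in> V \<Longrightarrow> \<exists>y\<in>W. norm (x - y) \<le> M"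
  shows "V \<subseteq> W"
proof
  fix x assume x: "x \<in> V"
  obtain y z where yz: "y \<in> span W" "x = y + z" "\<And>w. w \<in> span W \<Longrightarrow> orthogonal z w"
    using orthogonal_subspace_decomp_exists[of W x] by metis
  have W: "span W = W" using assms(2) span_eq_iff by blast
  have le: "real n * norm z \<le> M" for n :: nat
  proof -
    have "real n *\<^sub>R x \<in> V" using x assms(1) subspace_scale by blast
    then obtain u where u: "u \<in> W" "norm (real n *\<^sub>R x - u) \<le> M" using near by blast
    have w: "real n *\<^sub>R y - u \<in> W" using u yz(1) W assms(2) by (simp add: subspace_diff subspace_scale)
    have "orthogonal (real n *\<^sub>R z) (real n *\<^sub>R y - u)" using yz(3)[of "real n *\<^sub>R y - u"] w W
      by (simp add: orthogonal_def)
    then have "(norm (real n *\<^sub>R z + (real n *\<^sub>R y - u)))\<^sup>2 = (norm (real n *\<^sub>R z))\<^sup>2 + (norm (real n *\<^sub>R y - u))\<^sup>2"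
      by (rule norm_add_Pythagorean)
    then have "(norm (real n *\<^sub>R z))\<^sup>2 \<le> (norm (real n *\<^sub>R z + (real n *\<^sub>R y - u)))\<^sup>2" by simp
    then have "norm (real n *\<^sub>R z) \<le> norm (real n *\<^sub>R z + (real n *\<^sub>R y - u))"
      by (rule power2_le_imp_le) simp
    also have "real n *\<^sub>R z + (real n *\<^sub>R y - u) = real n *\<^sub>R x - u" using yz(2) by (simp add: algebra_simps)
    finally show ?thesis using u(2) by simp
  qed
  have "norm z = 0"
  proof (rule ccontr)
    assume "norm z \<noteq> 0"
    then obtain n :: nat where "M / norm z < real n" using reals_Archimedean2 by blast
    then show False using le[of n] \<open>norm z \<noteq> 0\<close> by (simp add: field_simps)
  qed
  then show "x \<in> W" using yz(1,2) W by simp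
qed

subsection \<open>Characters\<close>

lemma torus_pts_nz: "a \<in> torus_pts X \<Longrightarrow> x \<in> X \<Longrightarrow> a x \<noteq> 0"
  and torus_pts_add: "a \<in> torus_pts X \<Longrightarrow> x \<in> X \<Longrightarrow> y \<in> X \<Longrightarrow> a (x + y) = a x * a y"
  and torus_pts_ext: "a \<in> torus_pts X \<Longrightarrow> a \<in> extensional X"
  unfolding torus_pts_def by auto

lemma torus_pts_eqI:
  "a \<in> torus_pts X \<Longrightarrow> b \<in> torus_pts X \<Longrightarrow> (\<And>x. x \<in> X \<Longrightarrow> a x = b x) \<Longrightarrow> a = b"
  using torus_pts_ext extensionalityI by metis

lemma torus_pts_0:
  assumes "lattice_in X" "a \<in> torus_pts X"
  shows "a 0 = 1"
  using torus_pts_add[OF assms(2), of 0 0] lattice_in_0[OF assms(1)] torus_pts_nz[OF assms(2), of 0] by simp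

lemma torus_pts_diff:
  assumes "lattice_in X" "a \<in> torus_pts X" "x \<in> X" "y \<in> X"
  shows "a (x - y) = a x / a y"
  using torus_pts_add[OF assms(2), of "x - y" y] lattice_in_diff[OF assms(1), of x y] assms
    torus_pts_nz[OF assms(2), of y] by (simp add: field_simps)

lemma torus_pts_minus:
  assumes "lattice_in X" "a \<in> torus_pts X" "x \<in> X"
  shows "a (- x) = inverse (a x)"
  using torus_pts_diff[OF assms(1,2) lattice_in_0[OF assms(1)] assms(3)] torus_pts_0[OF assms(1,2)]
  by (simp add: field_simps)

lemma torus_pts_sum:
  assumes "lattice_in X" "a \<in> torus_pts X" "\<And>i. i \<in> A \<Longrightarrow> f i \<in> X"
  shows "a (\<Sum>i\<in>A. f i) = (\<Prod>i\<in>A. a (f i))"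
  using assms(3)
proof (induction A rule: infinite_finite_induct)
  case (insert i A)
  then show ?case using torus_pts_add[OF assms(2), of "f i" "sum f A"] lattice_in_sum[OF assms(1), of A f] by simp
qed (simp_all add: torus_pts_0[OF assms(1,2)])

lemma torus_pts_scale:
  assumes "lattice_in X" "a \<in> torus_pts X" "x \<in> X"
  shows "a (of_int n *\<^sub>R x) = a x powi n"
proof -
  have nat: "a (of_nat m *\<^sub>R x) = a x ^ m" for m
  proof (induction m)
    case (Suc m)
    have "of_nat m *\<^sub>R x \<in> X" by (rule lattice_in_scale_nat[OF assms(1,3)])
    then show ?case using torus_pts_add[OF assms(2), of "of_nat m *\<^sub>R x" x] assms(3) Suc by (simp add: algebra_simps)
  qed (simp add: torus_pts_0[OF assms(1,2)])
  show ?thesis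
  proof (cases "n \<ge> 0")
    case True
    then show ?thesis using nat[of "nat n"] by (simp add: power_int_def)
  next
    case False
    then have "of_int n *\<^sub>R x = - (of_nat (nat (- n)) *\<^sub>R x)" by simp
    moreover have "of_nat (nat (- n)) *\<^sub>R x \<in> X" by (rule lattice_in_scale_nat[OF assms(1,3)])
    ultimately show ?thesis using nat[of "nat (- n)"] torus_pts_minus[OF assms(1,2), of "of_nat (nat (- n)) *\<^sub>R x"] False
      by (simp add: power_int_def power_inverse)
  qed
qed

lemma torus_group_simps [simp]:
  "x \<in> X \<Longrightarrow> (a \<otimes>\<^bsub>torus_group X\<^esub> b) x = a x * b x"
  "x \<in> X \<Longrightarrow> \<one>\<^bsub>torus_group X\<^esub> x = 1"
  "carrier (torus_group X) = torus_pts X"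
  by (simp_all add: torus_group_def)

lemma torus_mult_closed:
  assumes "lattice_in X" "a \<in> torus_pts X" "b \<in> torus_pts X"
  shows "a \<otimes>\<^bsub>torus_group X\<^esub> b \<in> torus_pts X"
  using assms lattice_in_add[OF assms(1)] unfolding torus_group_def torus_pts_def by auto

lemma torus_one_closed: "lattice_in X \<Longrightarrow> \<one>\<^bsub>torus_group X\<^esub> \<in> torus_pts X"
  using lattice_in_add[of X] unfolding torus_group_def torus_pts_def by auto

lemma torus_inv_closed:
  assumes "lattice_in X" "a \<in> torus_pts X"
  shows "restrict (\<lambda>x. inverse (a x)) X \<in> torus_pts X"
  using assms lattice_in_add[OF assms(1)] unfolding torus_pts_def by auto

lemma torus_mult_commute:
  "a \<otimes>\<^bsub>torus_group X\<^esub> b = b \<otimes>\<^bsub>torus_group X\<^esub> a"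
  unfolding torus_group_def by (auto simp: mult.commute)

lemma torus_one_left:
  "a \<in> torus_pts X \<Longrightarrow> \<one>\<^bsub>torus_group X\<^esub> \<otimes>\<^bsub>torus_group X\<^esub> a = a"
  unfolding torus_group_def using torus_pts_ext[of a X] by (auto simp: fun_eq_iff extensional_def)

lemma torus_mult_inv:
  "lattice_in X \<Longrightarrow> a \<in> torus_pts X \<Longrightarrow>
    a \<otimes>\<^bsub>torus_group X\<^esub> restrict (\<lambda>x. inverse (a x)) X = \<one>\<^bsub>torus_group X\<^esub>"
  unfolding torus_group_def using torus_pts_nz[of a X] by (auto simp: fun_eq_iff)

text \<open>A complex one-parameter subgroup of the torus with direction \<open>\<nu>\<close>: the
  parameter \<open>t = 1\<close> gives the point with real positive values
  \<open>exp (\<nu> \<bullet> x)\<close>, the parameter \<open>\<i>\<close> a point of the compact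
  torus.\<close>

definition exp_char :: "'e::euclidean_space set \<Rightarrow> 'e \<Rightarrow> complex \<Rightarrow> 'e \<Rightarrow> complex" where
  "exp_char X \<nu> t = restrict (\<lambda>x. exp (t * of_real (\<nu> \<bullet> x))) X"

lemma exp_char_torus: "lattice_in X \<Longrightarrow> exp_char X \<nu> t \<in> torus_pts X"
  using lattice_in_add[of X]
  unfolding torus_pts_def exp_char_def by (auto simp: inner_add_right exp_add algebra_simps)

lemma exp_char_apply [simp]: "x \<in> X \<Longrightarrow> exp_char X \<nu> t x = exp (t * of_real (\<nu> \<bullet> x))"
  by (simp add: exp_char_def)

text \<open>The logarithm of the modulus turns a multiplicative function on the lattice into an
  additive one, which is an inner product.\<close>

lemma torus_log:
  assumes "lattice_in X" "a \<in> torus_pts X"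
  obtains \<nu> where "\<nu> \<in> span X" "\<And>x. x \<in> X \<Longrightarrow> cmod (a x) = exp (\<nu> \<bullet> x)"
proof -
  obtain \<nu> where \<nu>: "\<nu> \<in> span X" "\<And>x. x \<in> X \<Longrightarrow> ln (cmod (a x)) = \<nu> \<bullet> x"
  proof (rule lattice_functional[OF assms(1), of "\<lambda>x. ln (cmod (a x))"])
    fix x y assume "x \<in> X" "y \<in> X"
    then show "ln (cmod (a (x + y))) = ln (cmod (a x)) + ln (cmod (a y))"
      using torus_pts_add[OF assms(2)] torus_pts_nz[OF assms(2)] by (simp add: norm_mult ln_mult)
  qed (use that in blast)
  have "cmod (a x) = exp (\<nu> \<bullet> x)" if "x \<in> X" for x
    using \<nu>(2)[OF that] torus_pts_nz[OF assms(2) that] by (metis exp_ln zero_less_norm_iff)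
  then show thesis using \<nu>(1) that by blast
qed

text \<open>The coordinates of \<open>T\<close> given by a lattice basis: \<open>c i\<close> is the
  value at \<open>b i\<close>. The floor only turns the integral real number
  \<open>d i \<bullet> x\<close> into an exponent of type \<open>int\<close>.\<close>

definition basis_char :: "'e::euclidean_space set \<Rightarrow> nat \<Rightarrow> (nat \<Rightarrow> 'e) \<Rightarrow> (nat \<Rightarrow> complex) \<Rightarrow> 'e \<Rightarrow> complex" where
  "basis_char X n d c = restrict (\<lambda>x. \<Prod>i<n. c i powi \<lfloor>d i \<bullet> x\<rfloor>) X"

lemma basis_char_torus:
  assumes X: "lattice_in X" and b: "adapted_basis X D n k b d" and c: "\<And>i. i < n \<Longrightarrow> c i \<noteq> 0"
  shows "basis_char X n d c \<in> torus_pts X"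
proof -
  have "\<lfloor>d i \<bullet> (x + y)\<rfloor> = \<lfloor>d i \<bullet> x\<rfloor> + \<lfloor>d i \<bullet> y\<rfloor>" if "x \<in> X" "y \<in> X" "i < n" for x y i
  proof -
    have "d i \<bullet> x \<in> \<int>" using b that unfolding adapted_basis_def by blast
    then obtain m where "d i \<bullet> x = of_int m" by (auto elim: Ints_cases)
    then show ?thesis by (simp add: inner_add_right)
  qed
  then show ?thesis
    using c lattice_in_add[OF X] unfolding torus_pts_def basis_char_def
    by (auto simp: power_int_add prod.distrib)
qed

lemma torus_pts_basis_expand:
  assumes X: "lattice_in X" and b: "adapted_basis X D n k b d" and a: "a \<in> torus_pts X" and x: "x \<in> X"
  shows "a x = (\<Prod>i<n. a (b i) powi \<lfloor>d i \<bullet> x\<rfloor>)"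
proof -
  have int: "d i \<bullet> x \<in> \<int>" if "i < n" for i using b x that unfolding adapted_basis_def by blast
  have "x = (\<Sum>i<n. (d i \<bullet> x) *\<^sub>R b i)" using b x span_base unfolding adapted_basis_def by blast
  also have "\<dots> = (\<Sum>i<n. of_int \<lfloor>d i \<bullet> x\<rfloor> *\<^sub>R b i)"
    using int by (intro sum.cong) (auto elim: Ints_cases)
  finally have "a x = a (\<Sum>i<n. of_int \<lfloor>d i \<bullet> x\<rfloor> *\<^sub>R b i)" by simp
  also have "\<dots> = (\<Prod>i<n. a (b i) powi \<lfloor>d i \<bullet> x\<rfloor>)"
  proof -
    have "b i \<in> X" if "i < n" for i using b that unfolding adapted_basis_def by blast
    then show ?thesis using torus_pts_scale[OF X a] lattice_in_scale[OF X]
      by (subst torus_pts_sum[OF X a]) (auto intro!: prod.cong)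
  qed
  finally show ?thesis .
qed

lemma basis_char_apply:
  assumes b: "adapted_basis X D n k b d" and i: "i < n"
  shows "basis_char X n d c (b i) = c i"
proof -
  have "basis_char X n d c (b i) = (\<Prod>j<n. c j powi (if j = i then 1 else 0))"
    using b i unfolding basis_char_def adapted_basis_def by (auto intro!: prod.cong)
  also have "\<dots> = (\<Prod>j<n. if j = i then c j else 1)" by (intro prod.cong) auto
  finally show ?thesis using i by simp
qed

subsection \<open>Uniqueness of absolutely convergent Fourier series\<close>

text \<open>Averaging the series with its translate by a unitary character multiplies the
  coefficient at \<open>x\<close> by \<open>(1 + e x) / 2\<close>. The character is normalized to
  \<open>e x0 = 1\<close> and chosen with \<open>e y = -1\<close>, so the coefficient at
  \<open>y\<close> dies, that at \<open>x0\<close> survives, and none grows. This replaces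
  integration over the compact torus.\<close>

lemma fourier_damping:
  fixes X :: "'e::euclidean_space set"
  assumes X: "lattice_in X" and x0: "x0 \<in> X" and F: "finite F" "F \<subseteq> X - {x0}"
    and c: "\<And>a. a \<in> torus_pts X \<Longrightarrow> ((\<lambda>x. c x * a x) has_sum 0) X"
  shows "\<exists>c'. (\<forall>a\<in>torus_pts X. ((\<lambda>x. c' x * a x) has_sum (0::complex)) X) \<and> c' x0 = c x0 \<and>
    (\<forall>x. cmod (c' x) \<le> cmod (c x)) \<and> (\<forall>x\<in>F. c' x = 0)"
  using F
proof (induction F rule: finite_induct)
  case empty
  then show ?case using c by auto
next
  case (insert y F)
  then obtain c' where c': "\<And>a. a \<in> torus_pts X \<Longrightarrow> ((\<lambda>x. c' x * a x) has_sum 0) X" "c' x0 = c x0"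
    "\<And>x. cmod (c' x) \<le> cmod (c x)" "\<And>x. x \<in> F \<Longrightarrow> c' x = 0" by blast
  have y: "y \<in> X" "y \<noteq> x0" using insert.prems by auto
  define \<nu> where "\<nu> = (pi / (norm (y - x0))\<^sup>2) *\<^sub>R (y - x0)"
  define e where "e x = exp (\<i> * of_real (\<nu> \<bullet> (x - x0)))" for x
  have ey: "e y = -1"
  proof -
    have "\<nu> \<bullet> (y - x0) = pi" unfolding \<nu>_def using y by (simp add: power2_norm_eq_inner)
    then show ?thesis by (simp add: e_def)
  qed
  have e0: "e x0 = 1" by (simp add: e_def)
  have ne: "cmod (e x) = 1" for x by (simp add: e_def)
  define c'' where "c'' x = c' x * ((1 + e x) / 2)" for x
  have "((\<lambda>x. c'' x * a x) has_sum 0) X" if a: "a \<in> torus_pts X" for a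
  proof -
    have ae: "a \<otimes>\<^bsub>torus_group X\<^esub> exp_char X \<nu> \<i> \<in> torus_pts X"
      by (intro torus_mult_closed X a exp_char_torus)
    have "((\<lambda>x. (c' x * a x) * (1 / 2) + (c' x * (a \<otimes>\<^bsub>torus_group X\<^esub> exp_char X \<nu> \<i>) x) *
        (exp (- \<i> * of_real (\<nu> \<bullet> x0)) / 2)) has_sum (0 * (1/2) + 0 * (exp (- \<i> * of_real (\<nu> \<bullet> x0)) / 2))) X"
      by (intro has_sum_add has_sum_cmult_left c' a ae)
    moreover have "c'' x * a x = (c' x * a x) * (1 / 2) + (c' x * (a \<otimes>\<^bsub>torus_group X\<^esub> exp_char X \<nu> \<i>) x) *
        (exp (- \<i> * of_real (\<nu> \<bullet> x0)) / 2)" if "x \<in> X" for x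
    proof -
      have "e x = exp (\<i> * of_real (\<nu> \<bullet> x)) * exp (- \<i> * of_real (\<nu> \<bullet> x0))"
        unfolding e_def exp_add[symmetric] by (simp add: inner_diff_right algebra_simps)
      then show ?thesis using that by (simp add: c''_def algebra_simps add_divide_distrib)
    qed
    ultimately show ?thesis by (subst has_sum_cong) auto
  qed
  moreover have "cmod (c'' x) \<le> cmod (c x)" for x
  proof -
    have "cmod (1 + e x) \<le> 2" using norm_triangle_ineq[of 1 "e x"] ne[of x] by simp
    then have "cmod (c'' x) \<le> cmod (c' x)"
      unfolding c''_def norm_mult by (intro mult_right_le_one_le) (auto simp: norm_divide)
    then show ?thesis using c'(3)[of x] by linarith
  qed
  ultimately show ?case using c' ey e0 by (intro exI[of _ c'']) (auto simp: c''_def)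
qed

text \<open>All but a tail of total modulus at most half of \<open>cmod (c x0)\<close> is damped
  away. What remains of the series still sums to 0, and the tail is too small to cancel the
  coefficient at \<open>x0\<close>.\<close>

lemma fourier_uniqueness:
  fixes X :: "'e::euclidean_space set"
  assumes X: "lattice_in X" and x0: "x0 \<in> X"
    and c: "\<And>a. a \<in> torus_pts X \<Longrightarrow> ((\<lambda>x. c x * a x) has_sum (0::complex)) X"
  shows "c x0 = 0"
proof (rule ccontr)
  assume nz: "c x0 \<noteq> 0"
  define e where "e = cmod (c x0)"
  have e: "e > 0" using nz by (simp add: e_def)
  have "((\<lambda>x. c x * \<one>\<^bsub>torus_group X\<^esub> x) has_sum 0) X" by (intro c torus_one_closed X)
  then have "c summable_on X" by (subst (asm) has_sum_cong[of _ _ c]) (auto simp: summable_on_def)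
  then have abs: "(\<lambda>x. cmod (c x)) summable_on X" by (simp add: summable_on_iff_abs_summable_on_complex)
  obtain F where F: "finite F" "F \<subseteq> X" "dist (sum (\<lambda>x. cmod (c x)) F) (infsum (\<lambda>x. cmod (c x)) X) \<le> e / 2"
    using infsum_finite_approximation[OF abs, of "e/2"] e by auto
  obtain c' where c': "\<And>a. a \<in> torus_pts X \<Longrightarrow> ((\<lambda>x. c' x * a x) has_sum 0) X" "c' x0 = c x0"
    "\<And>x. cmod (c' x) \<le> cmod (c x)" "\<And>x. x \<in> F - {x0} \<Longrightarrow> c' x = 0"
  proof -
    have "finite (F - {x0})" "F - {x0} \<subseteq> X - {x0}" using F by auto
    from fourier_damping[OF X x0 this c] show ?thesis using that by blast
  qed
  have "((\<lambda>x. c' x * \<one>\<^bsub>torus_group X\<^esub> x) has_sum 0) X" by (intro c' torus_one_closed X)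
  then have s0: "(c' has_sum 0) X" by (subst (asm) has_sum_cong[of _ _ c']) auto
  define F' where "F' = insert x0 F"
  have F': "finite F'" "F' \<subseteq> X" using F x0 by (auto simp: F'_def)
  have "(c' has_sum (0 - sum c' F')) (X - F')"
    by (intro has_sum_Diff s0 F' has_sum_finite)
  moreover have "sum c' F' = c x0"
  proof -
    have "sum c' F' = c' x0 + sum c' (F - {x0})" unfolding F'_def using F(1) by (metis sum.insert_remove)
    then show ?thesis using c'(2,4) by simp
  qed
  ultimately have s1: "(c' has_sum (- c x0)) (X - F')" by simp
  have abs1: "(\<lambda>x. cmod (c x)) summable_on (X - F')" using abs summable_on_subset_banach by blast
  have "cmod (- c x0) \<le> infsum (\<lambda>x. cmod (c x)) (X - F')"
  proof -
    have "(\<lambda>x. cmod (c' x)) summable_on (X - F')"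
      using summable_on_comparison_test[OF abs1, of "\<lambda>x. cmod (c' x)"] c'(3) by auto
    then have "cmod (infsum c' (X - F')) \<le> infsum (\<lambda>x. cmod (c' x)) (X - F')" by (rule norm_infsum_bound)
    also have "\<dots> \<le> infsum (\<lambda>x. cmod (c x)) (X - F')"
      by (intro infsum_mono) (use c'(3) \<open>(\<lambda>x. cmod (c' x)) summable_on (X - F')\<close> abs1 in auto)
    finally show ?thesis using s1 infsumI by metis
  qed
  also have "\<dots> = infsum (\<lambda>x. cmod (c x)) X - sum (\<lambda>x. cmod (c x)) F'"
    using infsum_Diff[OF abs, of F'] F' by simp
  also have "\<dots> \<le> infsum (\<lambda>x. cmod (c x)) X - sum (\<lambda>x. cmod (c x)) F"
    unfolding F'_def using F(1) by (cases "x0 \<in> F") (auto simp: insert_absorb)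
  also have "\<dots> \<le> e / 2" using F(3) unfolding dist_real_def by linarith
  finally show False using e by (simp add: e_def)
qed

subsection \<open>Exponential families\<close>

lemma abs_le_exp_sum: "\<bar>y\<bar> \<le> exp y + exp (- y)" for y :: real
  using exp_ge_add_one_self[of y] exp_ge_add_one_self[of "- y"] exp_ge_zero[of y] exp_ge_zero[of "- y"]
  by linarith

text \<open>An explicit Taylor remainder takes the place of differentiation under the sum. Its
  factor \<open>exp \<bar>x\<bar>\<close> does no harm, since an exponential factor is a shift of
  the parameter of an exponential family.\<close>

lemma exp_second_order: "exp x - 1 - x \<le> x\<^sup>2 * exp \<bar>x\<bar>" for x :: real
proof -
  have pos: "exp t - 1 \<le> t * exp t" for t :: real
    using exp_ge_add_one_self[of "- t"] mult_right_mono[of "1 - t" "exp (- t)" "exp t"]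
    by (simp add: exp_minus algebra_simps)
  have "\<bar>exp x - 1\<bar> \<le> \<bar>x\<bar> * exp \<bar>x\<bar>"
  proof (cases "x \<ge> 0")
    case True
    then show ?thesis using pos[of x] by simp
  next
    case False
    have "1 - exp x \<le> - x * 1" using exp_ge_add_one_self[of x] by linarith
    also have "\<dots> \<le> - x * exp (- x)" using False by (intro mult_left_mono) auto
    finally show ?thesis using False by simp
  qed
  then have "\<bar>x\<bar> * \<bar>exp x - 1\<bar> \<le> \<bar>x\<bar> * (\<bar>x\<bar> * exp \<bar>x\<bar>)" by (rule mult_left_mono) simp
  moreover have "exp x - 1 - x \<le> \<bar>x\<bar> * \<bar>exp x - 1\<bar>"
  proof -
    have "x * (exp x - 1) \<le> \<bar>x\<bar> * \<bar>exp x - 1\<bar>" unfolding abs_mult[symmetric] by (rule abs_ge_self)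
    moreover have "exp x - 1 - x \<le> x * (exp x - 1)" using pos[of x] by (simp add: algebra_simps)
    ultimately show ?thesis by linarith
  qed
  moreover have "\<bar>x\<bar> * (\<bar>x\<bar> * exp \<bar>x\<bar>) = x\<^sup>2 * exp \<bar>x\<bar>" by (metis abs_mult_self_eq mult.assoc power2_eq_square)
  ultimately show ?thesis by linarith
qed

text \<open>A discrete measure \<open>c\<close> with vector values \<open>u\<close> whose Laplace
  transform is finite at every \<open>l\<close>. Its weighted averages after tilting by
  \<open>exp (l \<bullet> u w)\<close> are the averages along a torus orbit.\<close>

locale exp_family =
  fixes E :: "'w set" and c :: "'w \<Rightarrow> real" and u :: "'w \<Rightarrow> 'e::euclidean_space"
  assumes nonneg: "w \<in> E \<Longrightarrow> c w \<ge> 0"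
    and summable: "(\<lambda>w. c w * exp (l \<bullet> u w)) summable_on E"
begin

text \<open>A linear factor is dominated by the two exponentials of opposite sign, so first moments
  at \<open>l\<close> are controlled by the Laplace transform at \<open>l + \<nu>\<close> and
  \<open>l - \<nu>\<close>.\<close>

lemma summable_abs: "(\<lambda>w. c w * exp (l \<bullet> u w) * \<bar>\<nu> \<bullet> u w\<bar>) summable_on E"
proof (rule summable_on_comparison_test)
  show "(\<lambda>w. c w * exp ((l + \<nu>) \<bullet> u w) + c w * exp ((l - \<nu>) \<bullet> u w)) summable_on E"
    by (intro summable_on_add summable)
  fix w assume w: "w \<in> E"
  have "c w * exp (l \<bullet> u w) * \<bar>\<nu> \<bullet> u w\<bar> \<le> c w * exp (l \<bullet> u w) * (exp (\<nu> \<bullet> u w) + exp (- (\<nu> \<bullet> u w)))"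
    using nonneg[OF w] abs_le_exp_sum by (intro mult_left_mono) auto
  then show "c w * exp (l \<bullet> u w) * \<bar>\<nu> \<bullet> u w\<bar> \<le> c w * exp ((l + \<nu>) \<bullet> u w) + c w * exp ((l - \<nu>) \<bullet> u w)"
    by (simp add: inner_add_left inner_diff_left exp_add exp_diff exp_minus field_simps)
qed (use nonneg in auto)

lemma summable_vec: "(\<lambda>w. (c w * exp (l \<bullet> u w)) *\<^sub>R u w) summable_on E"
proof -
  have "(\<lambda>w. \<Sum>b\<in>B. c w * exp (l \<bullet> u w) * \<bar>b \<bullet> u w\<bar>) summable_on E" for B :: "'e set"
  proof (induction B rule: infinite_finite_induct)
    case (insert x F)
    then show ?case by (simp add: summable_on_add summable_abs)
  qed simp_all
  then have "(\<lambda>w. \<Sum>b\<in>Basis. c w * exp (l \<bullet> u w) * \<bar>b \<bullet> u w\<bar>) summable_on E" .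
  then have "(\<lambda>w. norm ((c w * exp (l \<bullet> u w)) *\<^sub>R u w)) summable_on E"
  proof (rule summable_on_comparison_test)
    fix w assume w: "w \<in> E"
    have "norm (u w) \<le> (\<Sum>b\<in>Basis. \<bar>b \<bullet> u w\<bar>)" using norm_le_l1[of "u w"] by (simp add: inner_commute)
    then have "c w * exp (l \<bullet> u w) * norm (u w) \<le> c w * exp (l \<bullet> u w) * (\<Sum>b\<in>Basis. \<bar>b \<bullet> u w\<bar>)"
      using nonneg[OF w] by (intro mult_left_mono) auto
    then show "norm ((c w * exp (l \<bullet> u w)) *\<^sub>R u w) \<le> (\<Sum>b\<in>Basis. c w * exp (l \<bullet> u w) * \<bar>b \<bullet> u w\<bar>)"
      using nonneg[OF w] by (simp add: sum_distrib_left abs_mult)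
  qed auto
  then show ?thesis by (rule abs_summable_summable)
qed

lemma summable_inner: "(\<lambda>w. c w * exp (l \<bullet> u w) * (\<nu> \<bullet> u w)) summable_on E"
  and infsum_inner: "\<nu> \<bullet> infsum (\<lambda>w. (c w * exp (l \<bullet> u w)) *\<^sub>R u w) E = infsum (\<lambda>w. c w * exp (l \<bullet> u w) * (\<nu> \<bullet> u w)) E"
proof -
  have "((\<lambda>w. \<nu> \<bullet> ((c w * exp (l \<bullet> u w)) *\<^sub>R u w)) has_sum
      \<nu> \<bullet> infsum (\<lambda>w. (c w * exp (l \<bullet> u w)) *\<^sub>R u w) E) E"
    using has_sum_bounded_linear[OF bounded_linear_inner_right has_sum_infsum[OF summable_vec]] by blast
  then have h: "((\<lambda>w. c w * exp (l \<bullet> u w) * (\<nu> \<bullet> u w)) has_sum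
      \<nu> \<bullet> infsum (\<lambda>w. (c w * exp (l \<bullet> u w)) *\<^sub>R u w) E) E"
    by simp
  then show "(\<lambda>w. c w * exp (l \<bullet> u w) * (\<nu> \<bullet> u w)) summable_on E" using summable_on_def by blast
  show "\<nu> \<bullet> infsum (\<lambda>w. (c w * exp (l \<bullet> u w)) *\<^sub>R u w) E = infsum (\<lambda>w. c w * exp (l \<bullet> u w) * (\<nu> \<bullet> u w)) E"
    using infsumI[OF h] by simp
qed

text \<open>Strict monotonicity of the gradient: the difference of the two critical equations,
  paired with \<open>m - l\<close>, is a sum of nonnegative terms, so each term is 0. The term at a
  point with \<open>c w > 0\<close> and \<open>\<nu> \<bullet> u w > 0\<close> cannot be.\<close>

lemma critical_unique:
  assumes D: "subspace D" and l: "l \<in> D" "m \<in> D"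
    and spread: "\<And>\<nu>. \<nu> \<in> D \<Longrightarrow> \<nu> \<noteq> 0 \<Longrightarrow> \<exists>w\<in>E. c w > 0 \<and> \<nu> \<bullet> u w > 0"
    and crit: "infsum (\<lambda>w. (c w * exp (l \<bullet> u w)) *\<^sub>R u w) E = 0" "infsum (\<lambda>w. (c w * exp (m \<bullet> u w)) *\<^sub>R u w) E = 0"
  shows "l = m"
proof (rule ccontr)
  assume ne: "l \<noteq> m"
  define \<nu> where "\<nu> = m - l"
  have \<nu>: "\<nu> \<in> D" "\<nu> \<noteq> 0" using ne D l subspace_diff \<nu>_def by auto
  then obtain w where w: "w \<in> E" "c w > 0" "\<nu> \<bullet> u w > 0" using spread by blast
  define f where "f w = c w * exp (m \<bullet> u w) * (\<nu> \<bullet> u w) - c w * exp (l \<bullet> u w) * (\<nu> \<bullet> u w)" for w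
  have "(f has_sum (\<nu> \<bullet> infsum (\<lambda>w. (c w * exp (m \<bullet> u w)) *\<^sub>R u w) E - \<nu> \<bullet> infsum (\<lambda>w. (c w * exp (l \<bullet> u w)) *\<^sub>R u w) E)) E"
    unfolding f_def infsum_inner diff_conv_add_uminus
    by (intro has_sum_add has_sum_uminus[THEN iffD2] has_sum_infsum summable_inner) (simp add: has_sum_infsum summable_inner)
  then have "(f has_sum 0) E" unfolding crit by simp
  then have fs: "f summable_on E" and f0: "infsum f E = 0" using summable_on_def infsumI by blast+
  have fn: "f w \<ge> 0" if "w \<in> E" for w
  proof -
    have "f w = c w * ((exp (m \<bullet> u w) - exp (l \<bullet> u w)) * (m \<bullet> u w - l \<bullet> u w))"
      by (simp add: f_def \<nu>_def inner_diff_left algebra_simps)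
    moreover have "(exp (m \<bullet> u w) - exp (l \<bullet> u w)) * (m \<bullet> u w - l \<bullet> u w) \<ge> 0"
      by (cases "m \<bullet> u w \<ge> l \<bullet> u w") (auto intro: mult_nonneg_nonneg mult_nonpos_nonpos)
    ultimately show ?thesis using nonneg[OF that] by simp
  qed
  have "f w = 0" using nonneg_infsum_le_0D[of f E w] f0 fs fn w(1) by auto
  then have "exp (m \<bullet> u w) = exp (l \<bullet> u w)" using w by (auto simp: f_def)
  then show False using w(3) by (simp add: \<nu>_def inner_diff_left)
qed

text \<open>The Laplace transform, or partition function; formally its gradient at \<open>l\<close>
  is the vector whose vanishing is the critical equation.\<close>

definition Z :: "'e \<Rightarrow> real" where "Z l = infsum (\<lambda>w. c w * exp (l \<bullet> u w)) E"

text \<open>A finite convex function on a whole Euclidean space is continuous, so no uniform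
  convergence has to be established.\<close>

lemma Z_continuous: "continuous_on UNIV Z"
proof -
  have "convex_on UNIV Z"
  proof (rule convex_onI)
    fix t :: real and x y :: 'e
    assume t: "0 < t" "t < 1"
    have "Z ((1 - t) *\<^sub>R x + t *\<^sub>R y) \<le> infsum (\<lambda>w. (1 - t) * (c w * exp (x \<bullet> u w)) + t * (c w * exp (y \<bullet> u w))) E"
      unfolding Z_def
    proof (intro infsum_mono summable summable_on_add summable_on_cmult_right)
      fix w assume w: "w \<in> E"
      have "exp ((1 - t) * (x \<bullet> u w) + t * (y \<bullet> u w)) \<le> (1 - t) * exp (x \<bullet> u w) + t * exp (y \<bullet> u w)"
        using convex_onD[OF exp_convex, of t "x \<bullet> u w" "y \<bullet> u w"] t by simp
      then have "c w * exp ((1 - t) * (x \<bullet> u w) + t * (y \<bullet> u w)) \<le> c w * ((1 - t) * exp (x \<bullet> u w) + t * exp (y \<bullet> u w))"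
        using nonneg[OF w] by (intro mult_left_mono)
      then show "c w * exp (((1 - t) *\<^sub>R x + t *\<^sub>R y) \<bullet> u w) \<le> (1 - t) * (c w * exp (x \<bullet> u w)) + t * (c w * exp (y \<bullet> u w))"
        by (simp add: inner_add_left algebra_simps)
    qed
    also have "\<dots> = (1 - t) * Z x + t * Z y"
      unfolding Z_def by (subst infsum_add) (auto intro: summable_on_cmult_right summable simp: infsum_cmult_right')
    finally show "Z ((1 - t) *\<^sub>R x + t *\<^sub>R y) \<le> (1 - t) * Z x + t * Z y" .
  qed simp
  then show ?thesis by (rule convex_on_continuous[OF open_UNIV])
qed

lemma Z_ge: "w \<in> E \<Longrightarrow> c w * exp (l \<bullet> u w) \<le> Z l"
  unfolding Z_def using finite_sum_le_infsum[OF summable, of "{w}" l] nonneg by auto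

text \<open>The first-order condition without a derivative: along \<open>\<nu>\<close> the function
  grows at most by \<open>s (\<nu> \<bullet> A) + s\<^sup>2 K\<close>, with \<open>K\<close>
  independent of the step \<open>s\<close>, so a negative slope would contradict minimality.\<close>

lemma minimum_critical:
  assumes D: "subspace D" and l: "l \<in> D" and min: "\<And>m. m \<in> D \<Longrightarrow> Z l \<le> Z m"
    and uD: "\<And>w. w \<in> E \<Longrightarrow> c w \<noteq> 0 \<Longrightarrow> u w \<in> D"
  shows "infsum (\<lambda>w. (c w * exp (l \<bullet> u w)) *\<^sub>R u w) E = 0"
proof -
  define A where "A = infsum (\<lambda>w. (c w * exp (l \<bullet> u w)) *\<^sub>R u w) E"
  have ge: "\<nu> \<bullet> A \<ge> 0" if \<nu>: "\<nu> \<in> D" for \<nu>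
  proof (rule ccontr)
    assume neg: "\<not> \<nu> \<bullet> A \<ge> 0"
    \<comment> \<open>The remainder at unit step, which dominates all smaller steps. The bound of
      the square by an exponential trades it for the tilts at \<open>l + 2 *\<^sub>R \<nu>\<close>
      and \<open>l - 2 *\<^sub>R \<nu>\<close>.\<close>
    define B where "B w = c w * exp (l \<bullet> u w) * ((\<nu> \<bullet> u w)\<^sup>2 * exp \<bar>\<nu> \<bullet> u w\<bar>)" for w
    have Bs: "B summable_on E"
    proof (rule summable_on_comparison_test)
      show "(\<lambda>w. 2 * (c w * exp ((l + 2 *\<^sub>R \<nu>) \<bullet> u w)) + 2 * (c w * exp ((l - 2 *\<^sub>R \<nu>) \<bullet> u w))) summable_on E"
        by (intro summable_on_add summable_on_cmult_right summable)
      fix w assume w: "w \<in> E"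
      define y where "y = \<nu> \<bullet> u w"
      have "\<bar>y\<bar>\<^sup>2 / 2 \<le> exp \<bar>y\<bar>" using exp_lower_Taylor_quadratic[of "\<bar>y\<bar>"] by simp
      then have "y\<^sup>2 * exp \<bar>y\<bar> \<le> (2 * exp \<bar>y\<bar>) * exp \<bar>y\<bar>" by (intro mult_right_mono) auto
      also have "\<dots> = 2 * exp (2 * \<bar>y\<bar>)" by (simp add: exp_double power2_eq_square)
      also have "\<dots> \<le> 2 * (exp (2 * y) + exp (- (2 * y)))" by (cases "y \<ge> 0") auto
      finally have "B w \<le> c w * exp (l \<bullet> u w) * (2 * (exp (2 * y) + exp (- (2 * y))))"
        unfolding B_def y_def[symmetric] using nonneg[OF w] by (intro mult_left_mono) auto
      then show "B w \<le> 2 * (c w * exp ((l + 2 *\<^sub>R \<nu>) \<bullet> u w)) + 2 * (c w * exp ((l - 2 *\<^sub>R \<nu>) \<bullet> u w))"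
        unfolding y_def by (simp add: inner_add_left inner_diff_left exp_add exp_diff exp_minus field_simps)
    qed (use nonneg in \<open>auto simp: B_def\<close>)
    define K where "K = infsum B E"
    have K0: "K \<ge> 0" unfolding K_def by (intro infsum_nonneg) (use nonneg in \<open>auto simp: B_def\<close>)
    have step: "0 \<le> s * (\<nu> \<bullet> A) + s\<^sup>2 * K" if s: "0 < s" "s \<le> 1" for s
    proof -
      have "Z l \<le> Z (l + s *\<^sub>R \<nu>)" using min D l \<nu> by (simp add: subspace_add subspace_scale)
      also have "\<dots> \<le> infsum (\<lambda>w. c w * exp (l \<bullet> u w) + s * (c w * exp (l \<bullet> u w) * (\<nu> \<bullet> u w)) + s\<^sup>2 * B w) E"
        unfolding Z_def
      proof (intro infsum_mono summable summable_on_add summable_on_cmult_right summable_inner Bs)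
        fix w assume w: "w \<in> E"
        define y where "y = \<nu> \<bullet> u w"
        have "exp (s * y) \<le> 1 + s * y + (s * y)\<^sup>2 * exp \<bar>s * y\<bar>" using exp_second_order[of "s * y"] by simp
        also have "exp \<bar>s * y\<bar> \<le> exp \<bar>y\<bar>" using s by (simp add: abs_mult mult_left_le_one_le)
        then have "1 + s * y + (s * y)\<^sup>2 * exp \<bar>s * y\<bar> \<le> 1 + s * y + (s * y)\<^sup>2 * exp \<bar>y\<bar>"
          by (simp add: mult_left_mono)
        finally have "c w * exp (l \<bullet> u w) * exp (s * y) \<le> c w * exp (l \<bullet> u w) * (1 + s * y + (s * y)\<^sup>2 * exp \<bar>y\<bar>)"
          using nonneg[OF w] by (intro mult_left_mono) auto
        then show "c w * exp ((l + s *\<^sub>R \<nu>) \<bullet> u w) \<le>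
            c w * exp (l \<bullet> u w) + s * (c w * exp (l \<bullet> u w) * (\<nu> \<bullet> u w)) + s\<^sup>2 * B w"
          unfolding B_def y_def by (simp add: inner_add_left exp_add power_mult_distrib algebra_simps)
      qed
      also have "\<dots> = Z l + s * (\<nu> \<bullet> A) + s\<^sup>2 * K"
        unfolding Z_def A_def K_def infsum_inner
        by (subst infsum_add; (intro summable summable_on_add summable_on_cmult_right summable_inner Bs)?)+
           (simp add: infsum_cmult_right')
      finally show ?thesis by simp
    qed
    \<comment> \<open>Small enough that the quadratic term uses up at most half of the negative
      linear term; \<open>K + 1\<close> keeps the denominator positive when
      \<open>K = 0\<close>.\<close>
    define s where "s = min 1 (- (\<nu> \<bullet> A) / (2 * (K + 1)))"
    have "0 < - (\<nu> \<bullet> A) / (2 * (K + 1))" using neg K0 by (intro divide_pos_pos) simp_all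
    then have s: "0 < s" "s \<le> 1" unfolding s_def by auto
    have "s * (K + 1) \<le> - (\<nu> \<bullet> A) / 2"
    proof -
      have "s \<le> - (\<nu> \<bullet> A) / (2 * (K + 1))" unfolding s_def by simp
      then show ?thesis using K0 by (simp add: field_simps)
    qed
    then have "s * K \<le> - (\<nu> \<bullet> A) / 2" using s by (simp add: algebra_simps)
    then have "s * (\<nu> \<bullet> A + s * K) < 0" using neg s by (intro mult_pos_neg) auto
    then show False using step[OF s] by (simp add: power2_eq_square algebra_simps)
  qed
  \<comment> \<open>Minimality tests only directions in \<open>D\<close>. The vector
    \<open>A\<close> may be tested against itself because all its summands lie in \<open>D\<close>
    and \<open>D\<close> is closed.\<close>
  have AD: "A \<in> D"
  proof -
    have *: "((\<lambda>w. (c w * exp (l \<bullet> u w)) *\<^sub>R u w) has_sum A) E"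
      unfolding A_def by (intro has_sum_infsum summable_vec)
    have "sum (\<lambda>w. (c w * exp (l \<bullet> u w)) *\<^sub>R u w) F \<in> D" if "finite F" "F \<subseteq> E" for F
    proof (rule subspace_sum[OF D])
      fix w assume "w \<in> F"
      then show "(c w * exp (l \<bullet> u w)) *\<^sub>R u w \<in> D"
        using uD[of w] that subspace_scale[OF D] subspace_0[OF D] by (cases "c w = 0") auto
    qed
    then show ?thesis
      using * closed_subspace[OF D] unfolding has_sum_def
      by (intro Lim_in_closed_set[of D _ "finite_subsets_at_top E"])
        (auto intro: eventually_finite_subsets_at_top_weakI)
  qed
  have "- A \<bullet> A \<ge> 0" using ge[of "- A"] AD D by (simp add: subspace_neg)
  then show ?thesis unfolding A_def[symmetric] by (metis inner_ge_zero inner_minus_left inner_eq_zero_iff neg_0_le_iff_le order_antisym)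
qed

text \<open>Coercivity needs only finitely many terms: by compactness of the unit sphere of
  \<open>D\<close>, finitely many support points have open half-spaces covering it. Their terms
  alone bound \<open>norm l\<close> on the set where \<open>Z l \<le> Z 0\<close>, and a minimum
  over a ball is then a minimum over \<open>D\<close>.\<close>

lemma critical_exists:
  assumes D: "subspace D" and uD: "\<And>w. w \<in> E \<Longrightarrow> c w \<noteq> 0 \<Longrightarrow> u w \<in> D"
    and spread: "\<And>\<nu>. \<nu> \<in> D \<Longrightarrow> \<nu> \<noteq> 0 \<Longrightarrow> \<exists>w\<in>E. c w > 0 \<and> \<nu> \<bullet> u w > 0"
  shows "\<exists>l\<in>D. infsum (\<lambda>w. (c w * exp (l \<bullet> u w)) *\<^sub>R u w) E = 0"
proof -
  define S where "S = D \<inter> sphere 0 1"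
  define E' where "E' = {w \<in> E. c w > 0}"
  have cS: "compact S" unfolding S_def using closed_subspace[OF D] by (simp add: closed_Int_compact)
  have "S \<subseteq> (\<Union>w\<in>E'. {\<nu>. \<nu> \<bullet> u w > 0})" unfolding S_def E'_def using spread by force
  moreover have "open {\<nu>. \<nu> \<bullet> u w > 0}" for w by (simp add: open_Collect_less continuous_on_inner)
  ultimately obtain F where F: "F \<subseteq> E'" "finite F" "S \<subseteq> (\<Union>w\<in>F. {\<nu>. \<nu> \<bullet> u w > 0})"
    using compactE_image[OF cS, of E' "\<lambda>w. {\<nu>. \<nu> \<bullet> u w > 0}"] by metis
  have "\<exists>R. \<forall>l\<in>D. Z l \<le> Z 0 \<longrightarrow> norm l \<le> R"
  proof (cases "S = {}")
    case True
    have "l = 0" if "l \<in> D" for l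
    proof (rule ccontr)
      assume "l \<noteq> 0"
      then have "(1 / norm l) *\<^sub>R l \<in> S" unfolding S_def using that subspace_scale[OF D] by auto
      then show False using True by blast
    qed
    then show ?thesis by (intro exI[of _ 0]) auto
  next
    case False
    then have Fne: "F \<noteq> {}" using F(3) by blast
    define h where "h \<nu> = (\<Sum>w\<in>F. max 0 (\<nu> \<bullet> u w))" for \<nu>
    have "continuous_on S h" unfolding h_def by (intro continuous_intros)
    then obtain \<nu>0 where \<nu>0: "\<nu>0 \<in> S" "\<And>\<nu>. \<nu> \<in> S \<Longrightarrow> h \<nu>0 \<le> h \<nu>"
      using continuous_attains_inf[OF cS False] by blast
    have "h \<nu>0 > 0"
    proof -
      obtain w where "w \<in> F" "\<nu>0 \<bullet> u w > 0" using F(3) \<nu>0(1) by blast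
      then show ?thesis unfolding h_def using F(2) by (intro sum_pos2[of F w]) auto
    qed
    \<comment> \<open>A summand of \<open>h\<close> must reach the mean: \<open>h\<close> is at
      least \<open>h \<nu>0\<close> on the sphere and has \<open>card F\<close> summands.\<close>
    define e where "e = h \<nu>0 / card F"
    have e: "e > 0" unfolding e_def using \<open>h \<nu>0 > 0\<close> F(2) Fne by (simp add: card_gt_0_iff)
    define m where "m = Min (c ` F)"
    have m: "m > 0" "\<And>w. w \<in> F \<Longrightarrow> m \<le> c w" unfolding m_def using F(1,2) Fne by (auto simp: E'_def)
    have "norm l \<le> Z 0 / m / e" if l: "l \<in> D" "Z l \<le> Z 0" for l
    proof (cases "l = 0")
      case True
      have "Z 0 \<ge> 0" unfolding Z_def by (intro infsum_nonneg) (use nonneg in auto)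
      then show ?thesis using True m(1) e by simp
    next
      case False
      define \<nu> where "\<nu> = (1 / norm l) *\<^sub>R l"
      have \<nu>: "\<nu> \<in> S" unfolding \<nu>_def S_def using False l(1) subspace_scale[OF D] by auto
      have "\<exists>w\<in>F. \<nu> \<bullet> u w \<ge> e"
      proof (rule ccontr)
        assume "\<not> ?thesis"
        then have "h \<nu> < (\<Sum>w\<in>F. e)" unfolding h_def using F(2) Fne e by (intro sum_strict_mono) (auto simp: not_le)
        also have "\<dots> = h \<nu>0" unfolding e_def using F(2) Fne by simp
        finally show False using \<nu>0(2)[OF \<nu>] by simp
      qed
      then obtain w where w: "w \<in> F" "\<nu> \<bullet> u w \<ge> e" by blast
      have "l \<bullet> u w = norm l * (\<nu> \<bullet> u w)" unfolding \<nu>_def using False by simp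
      then have lw: "norm l * e \<le> l \<bullet> u w" using w(2) by (simp add: mult_left_mono)
      have "m * (norm l * e) \<le> m * exp (l \<bullet> u w)"
        using m(1) lw exp_ge_add_one_self[of "l \<bullet> u w"] by (intro mult_left_mono) linarith+
      also have "\<dots> \<le> c w * exp (l \<bullet> u w)" using m(2)[OF w(1)] by simp
      also have "\<dots> \<le> Z 0" using Z_ge[of w l] w(1) F(1) l(2) by (auto simp: E'_def)
      finally show ?thesis using m(1) e by (simp add: field_simps)
    qed
    then show ?thesis by blast
  qed
  then obtain R where R: "\<And>l. l \<in> D \<Longrightarrow> Z l \<le> Z 0 \<Longrightarrow> norm l \<le> R" by blast
  have R0: "R \<ge> 0" using R[of 0] subspace_0[OF D] by simp
  have "compact (D \<inter> cball 0 R)" using closed_subspace[OF D] by (simp add: closed_Int_compact)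
  moreover have "0 \<in> D \<inter> cball 0 R" using R0 subspace_0[OF D] by simp
  moreover have "continuous_on (D \<inter> cball 0 R) Z" using Z_continuous continuous_on_subset by blast
  ultimately obtain l where l: "l \<in> D \<inter> cball 0 R" "\<And>m. m \<in> D \<inter> cball 0 R \<Longrightarrow> Z l \<le> Z m"
    using continuous_attains_inf by (metis empty_iff)
  have "Z l \<le> Z m" if "m \<in> D" for m
  proof (cases "Z m \<le> Z 0")
    case True
    then show ?thesis using l(2)[of m] R[OF that] that by simp
  next
    case False
    then show ?thesis using l(2)[of 0] R0 subspace_0[OF D] by simp
  qed
  then show ?thesis using minimum_critical[OF D _ _ uD, of l] l(1) by blast
qed

end

text \<open>The sum may be infinite, so convexity is applied through a separating hyperplane: a
  strict inequality at \<open>y\<close> would contradict the averaged inequality of the points in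
  \<open>S\<close>.\<close>

lemma weighted_average_in_closed_convex:
  fixes v :: "'w \<Rightarrow> 'e::euclidean_space"
  assumes avg: "is_weighted_average E c v y" and c: "\<And>w. w \<in> E \<Longrightarrow> c w \<ge> 0"
    and S: "convex S" "closed S" and v: "\<And>w. w \<in> E \<Longrightarrow> c w \<noteq> 0 \<Longrightarrow> v w \<in> S"
  shows "y \<in> S"
proof (rule ccontr)
  assume "y \<notin> S"
  then obtain a b where ab: "a \<bullet> y < b" "\<And>x. x \<in> S \<Longrightarrow> a \<bullet> x > b"
    using separating_hyperplane_closed_point[OF S] by metis
  have sc: "c summable_on E" "infsum c E \<noteq> 0" "(\<lambda>w. c w *\<^sub>R v w) summable_on E"
    "y = infsum (\<lambda>w. c w *\<^sub>R v w) E /\<^sub>R infsum c E"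
    using avg unfolding is_weighted_average_def by auto
  have pos: "infsum c E > 0" using sc(2) infsum_nonneg[of E c] c by force
  have h: "((\<lambda>w. a \<bullet> (c w *\<^sub>R v w)) has_sum (a \<bullet> infsum (\<lambda>w. c w *\<^sub>R v w) E)) E"
    using has_sum_bounded_linear[OF bounded_linear_inner_right has_sum_infsum[OF sc(3)]] by blast
  have "infsum (\<lambda>w. b * c w) E \<le> infsum (\<lambda>w. a \<bullet> (c w *\<^sub>R v w)) E"
  proof (intro infsum_mono summable_on_cmult_right sc(1))
    show "(\<lambda>w. a \<bullet> (c w *\<^sub>R v w)) summable_on E" using h summable_on_def by blast
    fix w assume w: "w \<in> E"
    show "b * c w \<le> a \<bullet> (c w *\<^sub>R v w)"
    proof (cases "c w = 0")
      case False
      then have "b < a \<bullet> v w" using ab(2) v w by blast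
      then have "b * c w \<le> (a \<bullet> v w) * c w" using c[OF w] by (intro mult_right_mono) auto
      then show ?thesis by (simp add: mult.commute)
    qed simp
  qed
  then have "b * infsum c E \<le> a \<bullet> infsum (\<lambda>w. c w *\<^sub>R v w) E"
    using infsumI[OF h] by (simp add: infsum_cmult_right')
  also have "\<dots> = (a \<bullet> y) * infsum c E" using sc(4) pos by simp
  finally show False using ab(1) pos by (simp add: mult_le_cancel_right)
qed

subsection \<open>Sheaves of functions\<close>

lemma function_sheaf_open:
  assumes "function_sheaf X" "h \<in> funs X U"
  shows "openin (spc X) U"
proof -
  have "\<forall>U. \<forall>h\<in>funs X U. openin (spc X) U"
    using assms(1) unfolding function_sheaf_def by (elim conjE)
  then show ?thesis using assms(2) by blast
qed

lemma function_sheaf_cong: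
  assumes "function_sheaf X" "h \<in> funs X U" "\<And>x. x \<in> U \<Longrightarrow> h' x = h x"
  shows "h' \<in> funs X U"
proof -
  have "\<forall>U h h'. h \<in> funs X U \<and> (\<forall>x\<in>U. h' x = h x) \<longrightarrow> h' \<in> funs X U"
    using assms(1) unfolding function_sheaf_def by (elim conjE)
  then show ?thesis using assms(2,3) by blast
qed

lemma function_sheaf_restrict:
  assumes "function_sheaf X" "h \<in> funs X U" "openin (spc X) V" "V \<subseteq> U"
  shows "h \<in> funs X V"
proof -
  have "\<forall>U V h. h \<in> funs X U \<and> openin (spc X) V \<and> V \<subseteq> U \<longrightarrow> h \<in> funs X V"
    using assms(1) unfolding function_sheaf_def by (elim conjE)
  then show ?thesis using assms(2-) by blast
qed

lemma function_sheaf_local: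
  assumes "function_sheaf X" "openin (spc X) U" "\<And>x. x \<in> U \<Longrightarrow> \<exists>V. x \<in> V \<and> V \<subseteq> U \<and> h \<in> funs X V"
  shows "h \<in> funs X U"
proof -
  have "\<forall>U h. openin (spc X) U \<and> (\<forall>x\<in>U. \<exists>V. x \<in> V \<and> V \<subseteq> U \<and> h \<in> funs X V) \<longrightarrow> h \<in> funs X U"
    using assms(1) unfolding function_sheaf_def by (elim conjE)
  then show ?thesis using assms(2-) by blast
qed

text \<open>The property that lets fractions be pulled back along maps to an \<open>alg_space\<close>.\<close>

definition local_ring_sheaf :: "'a cspace \<Rightarrow> bool" where
  "local_ring_sheaf Y \<longleftrightarrow> function_sheaf Y \<and>
     (\<forall>W c. openin (spc Y) W \<longrightarrow> (\<lambda>_. c) \<in> funs Y W) \<and>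
     (\<forall>W. \<forall>f\<in>funs Y W. \<forall>g\<in>funs Y W. (\<lambda>x. f x + g x) \<in> funs Y W \<and> (\<lambda>x. f x * g x) \<in> funs Y W) \<and>
     (\<forall>W. \<forall>f\<in>funs Y W. openin (spc Y) {x \<in> W. f x \<noteq> 0} \<and> (\<lambda>x. 1 / f x) \<in> funs Y {x \<in> W. f x \<noteq> 0})"

lemma local_ring_sheaf_sheaf: "local_ring_sheaf Y \<Longrightarrow> function_sheaf Y"
  unfolding local_ring_sheaf_def by (elim conjE)

lemma local_ring_sheaf_const: "local_ring_sheaf Y \<Longrightarrow> openin (spc Y) W \<Longrightarrow> (\<lambda>_. c) \<in> funs Y W"
  unfolding local_ring_sheaf_def by blast

lemma local_ring_sheaf_add: "local_ring_sheaf Y \<Longrightarrow> f \<in> funs Y W \<Longrightarrow> g \<in> funs Y W \<Longrightarrow> (\<lambda>x. f x + g x) \<in> funs Y W"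
  unfolding local_ring_sheaf_def by blast

lemma local_ring_sheaf_mult: "local_ring_sheaf Y \<Longrightarrow> f \<in> funs Y W \<Longrightarrow> g \<in> funs Y W \<Longrightarrow> (\<lambda>x. f x * g x) \<in> funs Y W"
  unfolding local_ring_sheaf_def by blast

lemma local_ring_sheaf_inverse:
  assumes "local_ring_sheaf Y" "f \<in> funs Y W"
  shows "openin (spc Y) {x \<in> W. f x \<noteq> 0}" "(\<lambda>x. 1 / f x) \<in> funs Y {x \<in> W. f x \<noteq> 0}"
  using assms unfolding local_ring_sheaf_def by blast+

lemma cmorphism_comp:
  assumes "cmorphism X Y f" "cmorphism Y Z g"
  shows "cmorphism X Z (g \<circ> f)"
  unfolding cmorphism_def
proof (intro conjI allI ballI)
  show "continuous_map (spc X) (spc Z) (g \<circ> f)"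
    using assms unfolding cmorphism_def by (blast intro: continuous_map_compose)
  fix V h assume h: "h \<in> funs Z V"
  have "h \<circ> g \<in> funs Y {y \<in> pts Y. g y \<in> V}" using h assms(2) unfolding cmorphism_def by blast
  then have "h \<circ> g \<circ> f \<in> funs X {x \<in> pts X. f x \<in> {y \<in> pts Y. g y \<in> V}}"
    using assms(1) unfolding cmorphism_def by blast
  moreover have "{x \<in> pts X. f x \<in> {y \<in> pts Y. g y \<in> V}} = {x \<in> pts X. (g \<circ> f) x \<in> V}"
    using assms(1) unfolding cmorphism_def by (auto simp: continuous_map_def)
  ultimately show "h \<circ> (g \<circ> f) \<in> funs X {x \<in> pts X. (g \<circ> f) x \<in> V}" by (simp add: o_assoc)
qed

lemma cmorphism_pts: "cmorphism X Y f \<Longrightarrow> x \<in> pts X \<Longrightarrow> f x \<in> pts Y"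
  unfolding cmorphism_def by (auto simp: continuous_map_def)

text \<open>Testing the generators suffices: their nonvanishing loci generate the topology, and a
  local fraction is pulled back by inverting the pulled-back denominator. The condition
  \<open>cover\<close> puts the image into the space, whose points are those where some generator is
  nonzero.\<close>

lemma cmorphism_alg_space:
  assumes Y: "local_ring_sheaf Y"
    and gen: "\<And>D f. (D, f) \<in> \<D> \<Longrightarrow> f \<circ> g \<in> funs Y {y \<in> pts Y. g y \<in> D}"
    and cover: "\<And>y. y \<in> pts Y \<Longrightarrow> \<exists>D f. (D, f) \<in> \<D> \<and> g y \<in> D \<and> f (g y) \<noteq> 0"
  shows "cmorphism Y (alg_space \<D>) g"
proof -
  define \<tau> where "\<tau> = topology_generated_by {{x \<in> D. f x \<noteq> 0} |D f. (D, f) \<in> \<D>}"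
  have spc: "spc (alg_space \<D>) = \<tau>" by (simp add: alg_space_def \<tau>_def Let_def)
  have sh: "function_sheaf Y" using Y by (rule local_ring_sheaf_sheaf)
  have op: "openin (spc Y) {y \<in> pts Y. g y \<in> D \<and> f (g y) \<noteq> 0}" if "(D, f) \<in> \<D>" for D f
  proof -
    have "openin (spc Y) {y \<in> {y \<in> pts Y. g y \<in> D}. (f \<circ> g) y \<noteq> 0}"
      by (rule local_ring_sheaf_inverse(1)[OF Y gen[OF that]])
    then show ?thesis by (simp add: conj_assoc)
  qed
  have cont: "continuous_map (spc Y) \<tau> g"
    unfolding \<tau>_def continuous_on_generated_topo_iff
  proof (intro conjI allI impI)
    fix U assume "U \<in> {{x \<in> D. f x \<noteq> 0} |D f. (D, f) \<in> \<D>}"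
    then obtain D f where U: "U = {x \<in> D. f x \<noteq> 0}" "(D, f) \<in> \<D>" by blast
    have "g -` U \<inter> pts Y = {y \<in> pts Y. g y \<in> D \<and> f (g y) \<noteq> 0}" using U(1) by auto
    then show "openin (spc Y) (g -` U \<inter> pts Y)" using op[OF U(2)] by simp
  next
    show "g ` pts Y \<subseteq> \<Union> {{x \<in> D. f x \<noteq> 0} |D f. (D, f) \<in> \<D>}"
    proof (rule image_subsetI)
      fix y assume "y \<in> pts Y"
      then obtain D f where "(D, f) \<in> \<D>" "g y \<in> D" "f (g y) \<noteq> 0" using cover by blast
      then show "g y \<in> \<Union> {{x \<in> D. f x \<noteq> 0} |D f. (D, f) \<in> \<D>}"
        by (intro UnionI[of "{x \<in> D. f x \<noteq> 0}"]) auto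
    qed
  qed
  have "h \<circ> g \<in> funs Y {y \<in> pts Y. g y \<in> W}" if h: "h \<in> funs (alg_space \<D>) W" for W h
  proof (rule function_sheaf_local[OF sh])
    have W: "openin \<tau> W" using h unfolding alg_space_def \<tau>_def by (simp add: Let_def)
    show oW: "openin (spc Y) {y \<in> pts Y. g y \<in> W}" using cont W openin_continuous_map_preimage by blast
    fix y assume y: "y \<in> {y \<in> pts Y. g y \<in> W}"
    have "g y \<in> W" using y by simp
    moreover have "\<forall>x\<in>W. \<exists>D a b. (D, a) \<in> \<D> \<and> (D, b) \<in> \<D> \<and> x \<in> D \<and> b x \<noteq> 0 \<and>
           (\<forall>y\<in>W \<inter> D. b y \<noteq> 0 \<longrightarrow> h y = a y / b y)"
      using h unfolding alg_space_def by (simp add: Let_def)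
    ultimately have "\<exists>D a b. (D, a) \<in> \<D> \<and> (D, b) \<in> \<D> \<and> g y \<in> D \<and> b (g y) \<noteq> 0 \<and>
           (\<forall>y\<in>W \<inter> D. b y \<noteq> 0 \<longrightarrow> h y = a y / b y)" by (rule bspec[rotated])
    then obtain D a b where Dab: "(D, a) \<in> \<D> \<and> (D, b) \<in> \<D> \<and> g y \<in> D \<and> b (g y) \<noteq> 0 \<and>
           (\<forall>y\<in>W \<inter> D. b y \<noteq> 0 \<longrightarrow> h y = a y / b y)" by (elim exE)
    have *: "(D, a) \<in> \<D>" "(D, b) \<in> \<D>" "g y \<in> D" "b (g y) \<noteq> 0"
      using Dab by blast+
    have frac: "h z = a z / b z" if "z \<in> W" "z \<in> D" "b z \<noteq> 0" for z
      using Dab that by blast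
    define N where "N = {y \<in> pts Y. g y \<in> D \<and> b (g y) \<noteq> 0}"
    define V where "V = {y \<in> pts Y. g y \<in> W} \<inter> N"
    have N': "{x \<in> {y \<in> pts Y. g y \<in> D}. (b \<circ> g) x \<noteq> 0} = N" unfolding N_def by auto
    have oV: "openin (spc Y) V" unfolding V_def using oW op[OF *(2)] N_def by blast
    have "(\<lambda>x. 1 / (b \<circ> g) x) \<in> funs Y N"
      using local_ring_sheaf_inverse(2)[OF Y gen[OF *(2)]] unfolding N' .
    then have 1: "(\<lambda>x. 1 / (b \<circ> g) x) \<in> funs Y V" using function_sheaf_restrict[OF sh _ oV] V_def by blast
    have 2: "a \<circ> g \<in> funs Y V" using function_sheaf_restrict[OF sh gen[OF *(1)] oV] V_def N_def by blast
    have "(\<lambda>x. (a \<circ> g) x * (1 / (b \<circ> g) x)) \<in> funs Y V"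
      by (rule local_ring_sheaf_mult[OF Y 2 1])
    then have "h \<circ> g \<in> funs Y V"
      by (rule function_sheaf_cong[OF sh]) (use frac in \<open>auto simp: V_def N_def\<close>)
    then show "\<exists>V. y \<in> V \<and> V \<subseteq> {y \<in> pts Y. g y \<in> W} \<and> h \<circ> g \<in> funs Y V"
      using y *(3,4) by (intro exI[of _ V]) (auto simp: V_def N_def)
  qed
  then show ?thesis unfolding cmorphism_def spc using cont by blast
qed

lemma pts_csubspace: "pts (csubspace X S) = pts X \<inter> S"
  by (simp add: csubspace_def)

lemma cmorphism_into_csubspace:
  assumes Y: "function_sheaf Y" and g: "cmorphism Y X g" and S: "g ` pts Y \<subseteq> S"
  shows "cmorphism Y (csubspace X S) g"
  unfolding cmorphism_def
proof (intro conjI allI ballI)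
  show cont: "continuous_map (spc Y) (spc (csubspace X S)) g"
    using g S unfolding cmorphism_def csubspace_def by (auto simp: continuous_map_in_subtopology)
  fix W h assume h: "h \<in> funs (csubspace X S) W"
  have W: "openin (spc (csubspace X S)) W" using h by (simp add: csubspace_def)
  show "h \<circ> g \<in> funs Y {y \<in> pts Y. g y \<in> W}"
  proof (rule function_sheaf_local[OF Y])
    show oW: "openin (spc Y) {y \<in> pts Y. g y \<in> W}" using cont W openin_continuous_map_preimage by blast
    fix y assume y: "y \<in> {y \<in> pts Y. g y \<in> W}"
    then obtain U h' where U: "h' \<in> funs X U" "g y \<in> U" "\<And>z. z \<in> U \<inter> W \<Longrightarrow> h z = h' z"
      using h by (fastforce simp: csubspace_def)
    define V where "V = {y \<in> pts Y. g y \<in> W} \<inter> {y \<in> pts Y. g y \<in> U}"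
    have 1: "h' \<circ> g \<in> funs Y {y \<in> pts Y. g y \<in> U}" using g U(1) unfolding cmorphism_def by blast
    have oV: "openin (spc Y) V" unfolding V_def using oW function_sheaf_open[OF Y 1] by blast
    have "h' \<circ> g \<in> funs Y V" using function_sheaf_restrict[OF Y 1 oV] V_def by blast
    then have "h \<circ> g \<in> funs Y V" by (rule function_sheaf_cong[OF Y]) (use U(3) in \<open>auto simp: V_def\<close>)
    then show "\<exists>V. y \<in> V \<and> V \<subseteq> {y \<in> pts Y. g y \<in> W} \<and> h \<circ> g \<in> funs Y V"
      using y U(2) by (intro exI[of _ V]) (auto simp: V_def)
  qed
qed

lemma funs_csubspace:
  assumes "function_sheaf X" "h \<in> funs X W"
  shows "h \<in> funs (csubspace X S) (W \<inter> S)"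
  using assms function_sheaf_open[OF assms] unfolding csubspace_def
  by (auto simp: openin_subtopology_Int)

lemma cmorphism_from_csubspace:
  assumes X: "function_sheaf X" and g: "cmorphism Y (csubspace X S) g"
  shows "cmorphism Y X g"
  unfolding cmorphism_def
proof (intro conjI allI ballI)
  show "continuous_map (spc Y) (spc X) g"
    using g unfolding cmorphism_def csubspace_def by (auto simp: continuous_map_in_subtopology)
  fix W h assume "h \<in> funs X W"
  then have "h \<circ> g \<in> funs Y {y \<in> pts Y. g y \<in> W \<inter> S}"
    using funs_csubspace[OF X] g unfolding cmorphism_def by blast
  moreover have "{y \<in> pts Y. g y \<in> W \<inter> S} = {y \<in> pts Y. g y \<in> W}"
    using cmorphism_pts[OF g] unfolding pts_csubspace by blast
  ultimately show "h \<circ> g \<in> funs Y {y \<in> pts Y. g y \<in> W}" by simp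
qed

lemma closed_immersion_cmorphism:
  "closed_immersion X Y f \<Longrightarrow> function_sheaf Y \<Longrightarrow> cmorphism X Y f"
  unfolding closed_immersion_def cisomorphism_def using cmorphism_from_csubspace by blast

lemma closed_immersion_inj:
  "closed_immersion X Y f \<Longrightarrow> x \<in> pts X \<Longrightarrow> y \<in> pts X \<Longrightarrow> f x = f y \<Longrightarrow> x = y"
  unfolding closed_immersion_def cisomorphism_def by metis

text \<open>A topological space with its continuous complex functions. A morphism from it to a
  variety is a map that makes regular functions continuous, so that continuity for the analytic
  topology can be obtained from the algebraic criterion \<open>cmorphism_alg_space\<close>.\<close>

definition continuous_space :: "'a topology \<Rightarrow> 'a cspace" where
  "continuous_space T = \<lparr>spc = T, funs = (\<lambda>W. {h. openin T W \<and> (\<forall>S. open S \<longrightarrow> openin T {x \<in> W. h x \<in> S})})\<rparr>"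

lemma spc_continuous_space [simp]: "spc (continuous_space T) = T"
  by (simp add: continuous_space_def)

lemma continuous_space_funs:
  "h \<in> funs (continuous_space T) W \<longleftrightarrow> openin T W \<and> continuous_map (subtopology T W) euclidean h"
proof (cases "openin T W")
  case True
  then have "topspace T \<inter> W = W" using openin_subset by blast
  then show ?thesis
    using True unfolding continuous_space_def continuous_map_def
    by (simp add: openin_open_subtopology del: openin_subtopology_refl)
qed (simp add: continuous_space_def)

lemma function_sheaf_continuous_space: "function_sheaf (continuous_space T)"
  unfolding function_sheaf_def
proof (intro conjI allI ballI impI)
  fix U h assume "h \<in> funs (continuous_space T) U"
  then show "openin (spc (continuous_space T)) U" by (simp add: continuous_space_funs)
next
  fix U h h' assume *: "h \<in> funs (continuous_space T) U \<and> (\<forall>x\<in>U. h' x = h x)"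
  then show "h' \<in> funs (continuous_space T) U"
    unfolding continuous_space_funs by (auto intro: continuous_map_eq)
next
  fix U V h assume "h \<in> funs (continuous_space T) U \<and> openin (spc (continuous_space T)) V \<and> V \<subseteq> U"
  then show "h \<in> funs (continuous_space T) V"
    unfolding continuous_space_funs by (auto intro: continuous_map_from_subtopology_mono)
next
  fix U h assume *: "openin (spc (continuous_space T)) U \<and>
    (\<forall>x\<in>U. \<exists>V. x \<in> V \<and> V \<subseteq> U \<and> h \<in> funs (continuous_space T) V)"
  have "openin T {x \<in> U. h x \<in> S}" if "open S" for S
  proof (subst openin_subopen, safe)
    fix x assume x: "x \<in> U" "h x \<in> S"
    then obtain V where V: "x \<in> V" "V \<subseteq> U" "h \<in> funs (continuous_space T) V" using * by blast
    then have "openin T {x \<in> V. h x \<in> S}" using that by (simp add: continuous_space_def)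
    then show "\<exists>N. openin T N \<and> x \<in> N \<and> N \<subseteq> {x \<in> U. h x \<in> S}" using x V by (intro exI[of _ "{x \<in> V. h x \<in> S}"]) auto
  qed
  then show "h \<in> funs (continuous_space T) U" using * by (simp add: continuous_space_def)
qed

lemma local_ring_sheaf_continuous_space: "local_ring_sheaf (continuous_space T)"
  unfolding local_ring_sheaf_def
proof (intro conjI allI ballI impI)
  fix W f assume f: "f \<in> funs (continuous_space T) W"
  have "openin T {x \<in> W. f x \<in> - {0}}" using f unfolding continuous_space_def by (simp add: open_Compl del: Compl_iff)
  then show op: "openin (spc (continuous_space T)) {x \<in> W. f x \<noteq> 0}" by simp
  have "continuous_map (subtopology T {x \<in> W. f x \<noteq> 0}) euclidean f"
    using f unfolding continuous_space_funs by (auto intro: continuous_map_from_subtopology_mono)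
  then have "continuous_map (subtopology T {x \<in> W. f x \<noteq> 0}) euclidean (\<lambda>x. 1 / f x)"
    by (auto simp: continuous_map_atin intro!: tendsto_divide)
  then show "(\<lambda>x. 1 / f x) \<in> funs (continuous_space T) {x \<in> W. f x \<noteq> 0}"
    using op by (simp add: continuous_space_funs)
next
  fix W f g assume "f \<in> funs (continuous_space T) W" "g \<in> funs (continuous_space T) W"
  then show "(\<lambda>x. f x + g x) \<in> funs (continuous_space T) W" "(\<lambda>x. f x * g x) \<in> funs (continuous_space T) W"
    unfolding continuous_space_funs by (auto simp: continuous_map_atin intro!: tendsto_add tendsto_mult)
qed (auto simp: function_sheaf_continuous_space continuous_space_funs)

subsection \<open>Analytic spaces\<close>

lemma an_space_generator:
  assumes "(D, f) \<in> \<D>" "open S"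
  shows "openin (spc (an_space \<D>)) {x \<in> D. f x \<in> S}"
  unfolding an_space_def Let_def using assms by (auto intro!: topology_generated_by_Basis)

lemma an_space_generator_continuous:
  assumes "(D, f) \<in> \<D>"
  shows "f \<in> funs (continuous_space (spc (an_space \<D>))) D"
  using an_space_generator[OF assms] an_space_generator[OF assms, of UNIV]
  by (simp add: continuous_space_def)

lemma pts_an_space: "pts (an_space \<D>) = \<Union> (fst ` \<D>)"
proof
  have "pts (an_space \<D>) = \<Union> {{x \<in> D. f x \<in> S} |D f S. (D, f) \<in> \<D> \<and> open S}"
    unfolding an_space_def Let_def by (simp add: topology_generated_by_topspace)
  moreover have "x \<in> \<Union> (fst ` \<D>)" if "x \<in> {x \<in> D. f x \<in> S}" "(D, f) \<in> \<D>" for x D f S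
    using that by force
  ultimately show "pts (an_space \<D>) \<subseteq> \<Union> (fst ` \<D>)" by blast
  show "\<Union> (fst ` \<D>) \<subseteq> pts (an_space \<D>)"
  proof safe
    fix x D f assume "(D, f) \<in> \<D>" "x \<in> fst (D, f)"
    then show "x \<in> pts (an_space \<D>)"
      using openin_subset[OF an_space_generator[of D f \<D> UNIV]] by auto
  qed
qed

lemma an_space_funs_continuous:
  assumes h: "h \<in> funs (an_space \<D>) W"
  shows "h \<in> funs (continuous_space (spc (an_space \<D>))) W"
proof (rule function_sheaf_local[OF function_sheaf_continuous_space])
  define \<tau> where "\<tau> = spc (an_space \<D>)"
  have W: "openin \<tau> W" using h unfolding an_space_def \<tau>_def by (simp add: Let_def)
  then show "openin (spc (continuous_space (spc (an_space \<D>)))) W" by (simp add: \<tau>_def)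
  fix x assume "x \<in> W"
  moreover have "\<forall>x\<in>W. \<exists>(n::nat) f r F N. 0 < r \<and> openin \<tau> N \<and> x \<in> N \<and> N \<subseteq> W \<and>
           (\<forall>k<n. \<exists>D. (D, f k) \<in> \<D> \<and> N \<subseteq> D) \<and>
           (let val = (\<lambda>y k. if k < n then f k y else 0) in
              holomorphic_polydisc n (val x) r F \<and>
              (\<forall>y\<in>N. val y \<in> polydisc n (val x) r \<and> h y = F (val y)))"
    using h unfolding \<tau>_def an_space_def Let_def by simp
  ultimately have "\<exists>(n::nat) f r F N. 0 < r \<and> openin \<tau> N \<and> x \<in> N \<and> N \<subseteq> W \<and>
           (\<forall>k<n. \<exists>D. (D, f k) \<in> \<D> \<and> N \<subseteq> D) \<and>
           (let val = (\<lambda>y k. if k < n then f k y else 0) in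
              holomorphic_polydisc n (val x) r F \<and>
              (\<forall>y\<in>N. val y \<in> polydisc n (val x) r \<and> h y = F (val y)))" by (rule bspec[rotated])
  then obtain n :: nat and f r F N where ex: "0 < r \<and> openin \<tau> N \<and> x \<in> N \<and> N \<subseteq> W \<and>
           (\<forall>k<n. \<exists>D. (D, f k) \<in> \<D> \<and> N \<subseteq> D) \<and>
           (let val = (\<lambda>y k. if k < n then f k y else 0) in
              holomorphic_polydisc n (val x) r F \<and>
              (\<forall>y\<in>N. val y \<in> polydisc n (val x) r \<and> h y = F (val y)))" by (elim exE)
  have *: "openin \<tau> N" "x \<in> N" "N \<subseteq> W" "\<And>k. k < n \<Longrightarrow> \<exists>D. (D, f k) \<in> \<D> \<and> N \<subseteq> D"
    using ex by blast+
  have hol: "holomorphic_polydisc n (\<lambda>k. if k < n then f k x else 0) r F"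
    using ex unfolding Let_def by (elim conjE)
  have "\<forall>y\<in>N. (\<lambda>k. if k < n then f k y else 0) \<in> polydisc n (\<lambda>k. if k < n then f k x else 0) r \<and>
       h y = F (\<lambda>k. if k < n then f k y else 0)"
    using ex unfolding Let_def by (elim conjE)
  then have val: "(\<lambda>k. if k < n then f k y else 0) \<in> polydisc n (\<lambda>k. if k < n then f k x else 0) r"
      "h y = F (\<lambda>k. if k < n then f k y else 0)" if "y \<in> N" for y
    using that by (auto dest: bspec)
  define val where "val = (\<lambda>y k. if k < n then f k y else 0)"
  have "continuous_map (subtopology \<tau> N) euclidean (\<lambda>y. val y k)" for k
  proof (cases "k < n")
    case True
    then obtain D where D: "(D, f k) \<in> \<D>" "N \<subseteq> D" using *(4) by blast
    have "f k \<in> funs (continuous_space \<tau>) N"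
      using function_sheaf_restrict[OF function_sheaf_continuous_space an_space_generator_continuous[OF D(1)]] *(1) D(2)
      by (simp add: \<tau>_def)
    then show ?thesis using True by (simp add: val_def continuous_space_funs)
  qed (simp add: val_def)
  then have "continuous_map (subtopology \<tau> N) euclidean val"
    unfolding euclidean_product_topology[symmetric] continuous_map_componentwise_UNIV by blast
  then have "continuous_map (subtopology \<tau> N) (top_of_set (polydisc n (val x) r)) val"
    using val(1) by (auto simp: continuous_map_in_subtopology val_def)
  moreover have "continuous_map (top_of_set (polydisc n (val x) r)) euclidean F"
    using hol by (simp add: holomorphic_polydisc_def val_def)
  ultimately have "continuous_map (subtopology \<tau> N) euclidean (F \<circ> val)" by (rule continuous_map_compose)
  then have "continuous_map (subtopology \<tau> N) euclidean h"
    by (rule continuous_map_eq) (simp add: val(2) val_def)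
  then show "\<exists>V. x \<in> V \<and> V \<subseteq> W \<and> h \<in> funs (continuous_space (spc (an_space \<D>))) V"
    using * by (intro exI[of _ N]) (simp add: continuous_space_funs \<tau>_def)
qed

lemma an_space_const:
  assumes "openin (spc (an_space \<D>)) W"
  shows "(\<lambda>_. c) \<in> funs (an_space \<D>) W"
proof -
  have "continuous_on (polydisc 0 (\<lambda>_. 0) 1) (\<lambda>_. c)" by (rule continuous_on_const)
  then have "\<forall>x\<in>W. \<exists>(n::nat) f r F N. 0 < r \<and> openin (spc (an_space \<D>)) N \<and> x \<in> N \<and> N \<subseteq> W \<and>
           (\<forall>k<n. \<exists>D. (D, f k) \<in> \<D> \<and> N \<subseteq> D) \<and>
           (let val = (\<lambda>y k. if k < n then f k y else 0) in
              holomorphic_polydisc n (val x) r F \<and>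
              (\<forall>y\<in>N. val y \<in> polydisc n (val x) r \<and> c = F (val y)))"
    using assms unfolding Let_def
    by (intro ballI exI[of _ "0::nat"] exI[of _ "\<lambda>_ _. 0"] exI[of _ "1::real"] exI[of _ "\<lambda>_. c"] exI[of _ W])
       (simp add: holomorphic_polydisc_def polydisc_def)
  then show ?thesis using assms unfolding an_space_def Let_def by simp
qed

lemma analytification_open: "h \<in> funs X U \<Longrightarrow> openin (spc (analytification X)) U"
  using an_space_generator[of U h "{(U, f). f \<in> funs X U}" UNIV] by (simp add: analytification_def)

lemma analytification_continuous:
  "h \<in> funs X U \<Longrightarrow> h \<in> funs (continuous_space (spc (analytification X))) U"
  unfolding analytification_def by (rule an_space_generator_continuous) simp

text \<open>The analytic topology is the coarsest one that makes regular functions continuous on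
  open domains, so pulling regular functions back to continuous ones is all that continuity asks
  for.\<close>

lemma continuous_map_analytification:
  assumes g: "cmorphism (continuous_space T) X g" and sub: "g ` topspace T \<subseteq> pts (analytification X)"
  shows "continuous_map T (spc (analytification X)) g"
proof -
  have *: "openin T {y \<in> topspace T. g y \<in> D \<and> f (g y) \<in> S}" if "f \<in> funs X D" "open S" for f D S
  proof -
    have "f \<circ> g \<in> funs (continuous_space T) {y \<in> topspace T. g y \<in> D}"
      using g that unfolding cmorphism_def by simp
    then have "openin T {y \<in> {y \<in> topspace T. g y \<in> D}. (f \<circ> g) y \<in> S}"
      using that(2) unfolding continuous_space_def by simp
    then show ?thesis by (simp add: conj_assoc)
  qed
  have sub': "g ` topspace T \<subseteq> \<Union> {{x \<in> D. f x \<in> S} |D f S. (D, f) \<in> {(U, f). f \<in> funs X U} \<and> open S}"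
    using sub unfolding analytification_def an_space_def Let_def by (simp add: topology_generated_by_topspace)
  have "openin T (g -` {x \<in> D. f x \<in> S} \<inter> topspace T)" if "f \<in> funs X D" "open S" for f D S
  proof -
    have "g -` {x \<in> D. f x \<in> S} \<inter> topspace T = {y \<in> topspace T. g y \<in> D \<and> f (g y) \<in> S}" by auto
    then show ?thesis using *[OF that] by simp
  qed
  then have "continuous_map T (topology_generated_by {{x \<in> D. f x \<in> S} |D f S. (D, f) \<in> {(U, f). f \<in> funs X U} \<and> open S}) g"
    unfolding continuous_on_generated_topo_iff using sub' by auto
  then show ?thesis unfolding analytification_def an_space_def Let_def by simp
qed

lemma pts_analytification:
  assumes "function_sheaf X" "\<And>x. x \<in> pts X \<Longrightarrow> \<exists>U f. f \<in> funs X U \<and> x \<in> U"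
  shows "pts (analytification X) = pts X"
  unfolding analytification_def pts_an_space
  using assms(2) openin_subset[OF function_sheaf_open[OF assms(1)]] by fastforce

text \<open>A closed diagonal provides enough functions on \<open>X\<close>, as the diagonal lies in the space \<open>alg_prod X X\<close>.\<close>

lemma closed_diagonal_functions:
  assumes diag: "closedin (spc (alg_prod X X)) ((\<lambda>x. (x, x)) ` pts X)" and x: "x \<in> pts X"
  shows "\<exists>U f. f \<in> funs X U \<and> x \<in> U \<and> f x \<noteq> 0"
proof -
  have "(x, x) \<in> pts (alg_prod X X)" using closedin_subset[OF diag] x by blast
  then obtain U V and m :: nat and f g where *: "x \<in> U" "x \<in> V"
      "\<forall>k<m. f k \<in> funs X U \<and> g k \<in> funs X V" "(\<Sum>k<m. f k x * g k x) \<noteq> 0"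
    unfolding alg_prod_def alg_space_def Let_def by (auto simp: topology_generated_by_topspace)
  then obtain k where "k < m" "f k x * g k x \<noteq> 0" by (metis (mono_tags, lifting) lessThan_iff sum.neutral)
  then show ?thesis using * by (intro exI[of _ U] exI[of _ "f k"]) auto
qed

lemma cmorphism_pair_const:
  assumes Y: "local_ring_sheaf Y" and g: "cmorphism Y G g" and p: "p \<in> pts P"
    and G: "function_sheaf G" "\<And>x. x \<in> pts G \<Longrightarrow> \<exists>U f. f \<in> funs G U \<and> x \<in> U \<and> f x \<noteq> 0"
    and P: "function_sheaf P" "\<And>x. x \<in> pts P \<Longrightarrow> \<exists>U f. f \<in> funs P U \<and> x \<in> U \<and> f x \<noteq> 0"
  shows "cmorphism Y (alg_prod G P) (\<lambda>y. (g y, p))"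
  unfolding alg_prod_def
proof (rule cmorphism_alg_space[OF Y])
  have Ysh: "function_sheaf Y" using Y by (rule local_ring_sheaf_sheaf)
  fix D h
  assume "(D, h) \<in> {(U \<times> V, \<lambda>(x, y). \<Sum>k<m. f k x * g k y) |U V (m::nat) f g.
     openin (spc G) U \<and> openin (spc P) V \<and> (\<forall>k<m. f k \<in> funs G U \<and> g k \<in> funs P V)}"
  then obtain U V and m :: nat and f f' where *: "D = U \<times> V" "h = (\<lambda>(x, y). \<Sum>k<m. f k x * f' k y)"
    "openin (spc G) U" "\<And>k. k < m \<Longrightarrow> f k \<in> funs G U" by blast
  define W where "W = {y \<in> pts Y. g y \<in> U}"
  have oW: "openin (spc Y) W" unfolding W_def
    using g *(3) unfolding cmorphism_def by (blast intro: openin_continuous_map_preimage)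
  have const: "(\<lambda>_. c) \<in> funs Y W" for c using Y oW by (rule local_ring_sheaf_const)
  show "h \<circ> (\<lambda>y. (g y, p)) \<in> funs Y {y \<in> pts Y. (g y, p) \<in> D}"
  proof (cases "p \<in> V")
    case True
    have "(\<lambda>y. \<Sum>k<j. f k (g y) * f' k p) \<in> funs Y W" if "j \<le> m" for j
      using that
    proof (induction j)
      case (Suc j)
      have "f j \<circ> g \<in> funs Y W" unfolding W_def using g *(4)[of j] Suc.prems unfolding cmorphism_def by auto
      then have "(\<lambda>y. f j (g y) * f' j p) \<in> funs Y W"
        using local_ring_sheaf_mult[OF Y _ const[of "f' j p"]] by (simp add: o_def)
      then show ?case using Suc local_ring_sheaf_add[OF Y] by simp
    qed (simp add: const)
    then have "h \<circ> (\<lambda>y. (g y, p)) \<in> funs Y W" by (simp add: *(2) o_def)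
    then show ?thesis using True by (simp add: *(1) W_def)
  next
    case False
    then have e: "{y \<in> pts Y. (g y, p) \<in> D} = {}" using *(1) by auto
    show ?thesis unfolding e by (rule function_sheaf_local[OF Ysh]) auto
  qed
next
  fix y assume y: "y \<in> pts Y"
  obtain U f where U: "f \<in> funs G U" "g y \<in> U" "f (g y) \<noteq> 0" using G(2) cmorphism_pts[OF g y] by blast
  obtain V f' where V: "f' \<in> funs P V" "p \<in> V" "f' p \<noteq> 0" using P(2) p by blast
  have "(U \<times> V, \<lambda>(x, y). \<Sum>k<(1::nat). f x * f' y) \<in> {(U \<times> V, \<lambda>(x, y). \<Sum>k<m. f k x * g k y) |U V (m::nat) f g.
     openin (spc G) U \<and> openin (spc P) V \<and> (\<forall>k<m. f k \<in> funs G U \<and> g k \<in> funs P V)}"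
    using U(1) V(1) function_sheaf_open[OF G(1) U(1)] function_sheaf_open[OF P(1) V(1)]
    by (intro CollectI exI[of _ U] exI[of _ V] exI[of _ "1::nat"] exI[of _ "\<lambda>_. f"] exI[of _ "\<lambda>_. f'"]) auto
  then show "\<exists>D h. (D, h) \<in> {(U \<times> V, \<lambda>(x, y). \<Sum>k<m. f k x * g k y) |U V (m::nat) f g.
     openin (spc G) U \<and> openin (spc P) V \<and> (\<forall>k<m. f k \<in> funs G U \<and> g k \<in> funs P V)} \<and>
     (g y, p) \<in> D \<and> h (g y, p) \<noteq> 0"
    using U(2,3) V(2,3) by (intro exI[of _ "U \<times> V"] exI[of _ "\<lambda>(x, y). \<Sum>k<(1::nat). f x * f' y"]) auto
qed

text \<open>Sums of products of regular functions are continuous for the product of the analytic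
  topologies. Hence that product topology is finer than the Zariski topology of
  \<open>alg_prod X X\<close>, and the diagonal stays closed in it.\<close>

lemma Hausdorff_analytification:
  assumes X: "function_sheaf X" and diag: "closedin (spc (alg_prod X X)) ((\<lambda>x. (x, x)) ` pts X)"
  shows "Hausdorff_space (spc (analytification X))"
proof -
  define \<tau> where "\<tau> = spc (analytification X)"
  note fn = closed_diagonal_functions[OF diag]
  have ptsX: "topspace \<tau> = pts X" unfolding \<tau>_def using pts_analytification[OF X] fn by blast
  define \<S> where "\<S> = {{x \<in> D. f x \<noteq> 0} |D f. (D, f) \<in> {(U \<times> V, \<lambda>(x, y). \<Sum>k<m. f k x * g k y) |U V (m::nat) f g.
     openin (spc X) U \<and> openin (spc X) V \<and> (\<forall>k<m. f k \<in> funs X U \<and> g k \<in> funs X V)}}"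
  have spc: "spc (alg_prod X X) = topology_generated_by \<S>"
    unfolding alg_prod_def alg_space_def Let_def \<S>_def by simp
  have "continuous_map (prod_topology \<tau> \<tau>) (spc (alg_prod X X)) id"
    unfolding spc continuous_on_generated_topo_iff
  proof (intro conjI allI impI)
    fix O' assume "O' \<in> \<S>"
    then obtain U V and m :: nat and f g where *: "O' = {z \<in> U \<times> V. (\<lambda>(x, y). \<Sum>k<m. f k x * g k y) z \<noteq> 0}"
      "\<And>k. k < m \<Longrightarrow> f k \<in> funs X U \<and> g k \<in> funs X V" unfolding \<S>_def by blast
    have "openin (prod_topology \<tau> \<tau>) O'"
    \<comment> \<open>Analytic openness of \<open>U\<close> and \<open>V\<close> is read off from
      regular functions on them, and an empty sum provides none.\<close>
    proof (cases "m = 0")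
      case True
      then have "O' = {}" using *(1) by auto
      then show ?thesis by simp
    next
      case False
      have UV: "openin \<tau> U" "openin \<tau> V" using *(2)[of 0] False analytification_open \<tau>_def by blast+
      have U: "continuous_map (subtopology \<tau> U) euclidean (f k)" "continuous_map (subtopology \<tau> V) euclidean (g k)" if "k < m" for k
        using *(2)[OF that] analytification_continuous[of _ X] unfolding \<tau>_def continuous_space_funs by blast+
      have st: "prod_topology (subtopology \<tau> U) (subtopology \<tau> V) = subtopology (prod_topology \<tau> \<tau>) (U \<times> V)"
        by (simp add: subtopology_Times)
      have "continuous_map (subtopology (prod_topology \<tau> \<tau>) (U \<times> V)) euclidean (\<lambda>z. f k (fst z) * g k (snd z))" if "k < m" for k
      proof -
        have "continuous_map (prod_topology (subtopology \<tau> U) (subtopology \<tau> V)) euclidean (f k \<circ> fst)"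
          "continuous_map (prod_topology (subtopology \<tau> U) (subtopology \<tau> V)) euclidean (g k \<circ> snd)"
          using continuous_map_compose[OF continuous_map_fst U(1)[OF that]]
            continuous_map_compose[OF continuous_map_snd U(2)[OF that]] by blast+
        then show ?thesis unfolding st by (auto simp: continuous_map_atin o_def intro!: tendsto_mult)
      qed
      then have "continuous_map (subtopology (prod_topology \<tau> \<tau>) (U \<times> V)) euclidean (\<lambda>z. \<Sum>k<m. f k (fst z) * g k (snd z))"
        by (intro continuous_map_sum) auto
      moreover have "openin (prod_topology \<tau> \<tau>) (U \<times> V)" using UV by (simp add: openin_prod_Times_iff)
      ultimately have "(\<lambda>z. \<Sum>k<m. f k (fst z) * g k (snd z)) \<in> funs (continuous_space (prod_topology \<tau> \<tau>)) (U \<times> V)"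
        by (simp add: continuous_space_funs)
      then have "openin (prod_topology \<tau> \<tau>) {z \<in> U \<times> V. (\<Sum>k<m. f k (fst z) * g k (snd z)) \<noteq> 0}"
        using local_ring_sheaf_inverse(1)[OF local_ring_sheaf_continuous_space] by fastforce
      then show ?thesis by (simp add: *(1) case_prod_unfold)
    qed
    then show "openin (prod_topology \<tau> \<tau>) (id -` O' \<inter> topspace (prod_topology \<tau> \<tau>))"
      unfolding vimage_id id_apply by (rule openin_Int[OF _ openin_topspace])
  next
    show "id ` topspace (prod_topology \<tau> \<tau>) \<subseteq> \<Union> \<S>"
    proof
      fix z assume "z \<in> id ` topspace (prod_topology \<tau> \<tau>)"
      then obtain x y where z: "z = (x, y)" "x \<in> pts X" "y \<in> pts X" using ptsX by auto
      obtain U f where U: "f \<in> funs X U" "x \<in> U" "f x \<noteq> 0" using fn[OF z(2)] by blast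
      obtain V f' where V: "f' \<in> funs X V" "y \<in> V" "f' y \<noteq> 0" using fn[OF z(3)] by blast
      have "(U \<times> V, \<lambda>(x, y). \<Sum>k<(1::nat). f x * f' y) \<in> {(U \<times> V, \<lambda>(x, y). \<Sum>k<m. f k x * g k y) |U V (m::nat) f g.
         openin (spc X) U \<and> openin (spc X) V \<and> (\<forall>k<m. f k \<in> funs X U \<and> g k \<in> funs X V)}"
        using U(1) V(1) function_sheaf_open[OF X U(1)] function_sheaf_open[OF X V(1)]
        by (intro CollectI exI[of _ U] exI[of _ V] exI[of _ "1::nat"] exI[of _ "\<lambda>_. f"] exI[of _ "\<lambda>_. f'"]) auto
      then have "{z \<in> U \<times> V. (\<lambda>(x, y). \<Sum>k<(1::nat). f x * f' y) z \<noteq> 0} \<in> \<S>" unfolding \<S>_def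
        by - (rule CollectI, rule exI[of _ "U \<times> V"], rule exI[of _ "\<lambda>(x, y). \<Sum>k<(1::nat). f x * f' y"], rule conjI[OF refl])
      moreover have "z \<in> {z \<in> U \<times> V. (\<lambda>(x, y). \<Sum>k<(1::nat). f x * f' y) z \<noteq> 0}" using U V z by auto
      ultimately show "z \<in> \<Union> \<S>" by blast
    qed
  qed
  then have "closedin (prod_topology \<tau> \<tau>) {z \<in> topspace (prod_topology \<tau> \<tau>). id z \<in> (\<lambda>x. (x, x)) ` pts X}"
    using diag by (rule closedin_continuous_map_preimage)
  moreover have "{z \<in> topspace (prod_topology \<tau> \<tau>). id z \<in> (\<lambda>x. (x, x)) ` pts X} = (\<lambda>x. (x, x)) ` topspace \<tau>"
    using ptsX by auto
  ultimately have "closedin (prod_topology \<tau> \<tau>) ((\<lambda>x. (x, x)) ` topspace \<tau>)" by simp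
  then show ?thesis unfolding \<tau>_def Hausdorff_space_closedin_diagonal .
qed

subsection \<open>Projective spaces and tori\<close>

lemma alg_space_generator: "(D, f) \<in> \<D> \<Longrightarrow> openin (spc (alg_space \<D>)) {x \<in> D. f x \<noteq> 0}"
  unfolding alg_space_def Let_def by (simp, rule topology_generated_by_Basis) blast

lemma cpoly_in_funs:
  assumes Y: "local_ring_sheaf Y" and f: "f \<in> cpoly n" and v: "\<And>i. i < n \<Longrightarrow> (\<lambda>y. v y i) \<in> funs Y W" and W: "openin (spc Y) W"
  shows "(\<lambda>y. f (v y)) \<in> funs Y W"
  using f
proof induction
  case (const c)
  then show ?case using local_ring_sheaf_const[OF Y W] by simp
next
  case (coord i)
  then show ?case using v by simp
next
  case (add f g)
  then show ?case using local_ring_sheaf_add[OF Y] by simp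
next
  case (mult f g)
  then show ?case using local_ring_sheaf_mult[OF Y] by simp
qed

definition punctured :: "nat \<Rightarrow> (nat \<Rightarrow> complex) set" where
  "punctured N = {v. (\<exists>k\<le>N. v k \<noteq> 0) \<and> (\<forall>k>N. v k = 0)}"

lemma proj_point_eq_iff: "proj_point v = proj_point w \<longleftrightarrow> (\<exists>c. c \<noteq> 0 \<and> w = (\<lambda>k. c * v k))"
proof
  assume "proj_point v = proj_point w"
  moreover have "w \<in> proj_point w" unfolding proj_point_def by (auto intro!: exI[of _ 1])
  ultimately show "\<exists>c. c \<noteq> 0 \<and> w = (\<lambda>k. c * v k)" unfolding proj_point_def by auto
next
  assume "\<exists>c. c \<noteq> 0 \<and> w = (\<lambda>k. c * v k)"
  then obtain c where c: "c \<noteq> 0" "w = (\<lambda>k. c * v k)" by blast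
  show "proj_point v = proj_point w"
  proof
    show "proj_point v \<subseteq> proj_point w"
    proof
      fix u assume "u \<in> proj_point v"
      then obtain d where "d \<noteq> 0" "u = (\<lambda>k. d * v k)" unfolding proj_point_def by auto
      then show "u \<in> proj_point w" unfolding proj_point_def c(2) using c(1) by (auto intro!: exI[of _ "d / c"])
    qed
    show "proj_point w \<subseteq> proj_point v"
    proof
      fix u assume "u \<in> proj_point w"
      then obtain d where "d \<noteq> 0" "u = (\<lambda>k. d * (c * v k))" unfolding proj_point_def c(2) by auto
      then show "u \<in> proj_point v" unfolding proj_point_def using c(1) by (auto intro!: exI[of _ "d * c"])
    qed
  qed
qed

lemma proj_point_normalize:
  assumes "v i \<noteq> 0"
  shows "(THE w. w \<in> proj_point v \<and> w i = 1) = (\<lambda>k. v k / v i)"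
proof (rule the_equality)
  show "(\<lambda>k. v k / v i) \<in> proj_point v \<and> v i / v i = 1"
    unfolding proj_point_def using assms by (auto intro!: exI[of _ "1 / v i"])
  fix w assume "w \<in> proj_point v \<and> w i = 1"
  then obtain c where "w = (\<lambda>k. c * v k)" "c * v i = 1" unfolding proj_point_def by auto
  then show "w = (\<lambda>k. v k / v i)" using assms by (auto simp: field_simps)
qed

lemma proj_point_chart:
  assumes "w \<in> punctured N"
  shows "proj_point w \<in> {proj_point v |v. (\<forall>k>N. v k = 0) \<and> v i \<noteq> 0} \<longleftrightarrow> w i \<noteq> 0"
proof
  assume "proj_point w \<in> {proj_point v |v. (\<forall>k>N. v k = 0) \<and> v i \<noteq> 0}"
  then obtain v where "proj_point w = proj_point v" "v i \<noteq> 0" by blast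
  then show "w i \<noteq> 0" unfolding proj_point_eq_iff by auto
qed (use assms in \<open>auto simp: punctured_def\<close>)

lemma pts_proj_space: "x \<in> pts (proj_space N) \<Longrightarrow> \<exists>v\<in>punctured N. x = proj_point v"
  unfolding proj_space_def alg_space_def Let_def punctured_def
  by (auto simp: topology_generated_by_topspace)

text \<open>On the chart of index \<open>i\<close> the normalized representative is
  \<open>v / v i\<close>, so polynomial functions of it are continuous on the cone. Classical limits
  in projective space can therefore be taken on representing vectors.\<close>

lemma proj_point_cmorphism:
  "cmorphism (continuous_space (top_of_set (punctured N))) (proj_space N) proj_point"
  unfolding proj_space_def
proof (rule cmorphism_alg_space[OF local_ring_sheaf_continuous_space])
  define Y where "Y = continuous_space (top_of_set (punctured N))"
  have Y: "local_ring_sheaf Y" unfolding Y_def by (rule local_ring_sheaf_continuous_space)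
  have co: "(\<lambda>v. v k) \<in> funs Y (punctured N)" for k
    unfolding Y_def continuous_space_funs
    using continuous_on_subset[OF continuous_on_product_coordinates[of k] subset_UNIV, of "punctured N"]
    by (simp add: subtopology_subtopology)
  fix D h
  assume "(D, h) \<in> {({proj_point v |v. (\<forall>k>N. v k = 0) \<and> v i \<noteq> 0}, \<lambda>l. f (THE v. v \<in> l \<and> v i = 1)) |i f.
       i \<le> N \<and> f \<in> cpoly (Suc N)}"
  then obtain i f where D: "D = {proj_point v |v. (\<forall>k>N. v k = 0) \<and> v i \<noteq> 0}"
    and h: "h = (\<lambda>l. f (THE v. v \<in> l \<and> v i = 1))" and f: "f \<in> cpoly (Suc N)" by blast
  have D': "{y \<in> punctured N. proj_point y \<in> D} = {v \<in> punctured N. v i \<noteq> 0}"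
    unfolding D using proj_point_chart by auto
  have o: "openin (spc Y) {v \<in> punctured N. v i \<noteq> 0}" and inv: "(\<lambda>v. 1 / v i) \<in> funs Y {v \<in> punctured N. v i \<noteq> 0}"
    using local_ring_sheaf_inverse[OF Y co[of i]] by auto
  have "(\<lambda>v. v k * (1 / v i)) \<in> funs Y {v \<in> punctured N. v i \<noteq> 0}" for k
    by (rule local_ring_sheaf_mult[OF Y function_sheaf_restrict[OF local_ring_sheaf_sheaf[OF Y] co o] inv]) auto
  then have "(\<lambda>v. f (\<lambda>k. v k * (1 / v i))) \<in> funs Y {v \<in> punctured N. v i \<noteq> 0}"
    using cpoly_in_funs[OF Y f _ o, of "\<lambda>v k. v k * (1 / v i)"] by simp
  then have "h \<circ> proj_point \<in> funs Y {v \<in> punctured N. v i \<noteq> 0}"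
    by (rule function_sheaf_cong[OF local_ring_sheaf_sheaf[OF Y]]) (simp add: h proj_point_normalize)
  then show "h \<circ> proj_point \<in> funs (continuous_space (top_of_set (punctured N)))
      {y \<in> pts (continuous_space (top_of_set (punctured N))). proj_point y \<in> D}"
    unfolding Y_def by (simp add: D')
next
  fix v assume "v \<in> pts (continuous_space (top_of_set (punctured N)))"
  then have v: "v \<in> punctured N" by simp
  then obtain i where i: "i \<le> N" "v i \<noteq> 0" unfolding punctured_def by blast
  have "({proj_point v |v. (\<forall>k>N. v k = 0) \<and> v i \<noteq> 0}, \<lambda>l. 1) \<in>
      {({proj_point v |v. (\<forall>k>N. v k = 0) \<and> v i \<noteq> 0}, \<lambda>l. f (THE v. v \<in> l \<and> v i = 1)) |i f.
       i \<le> N \<and> f \<in> cpoly (Suc N)}"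
    by (rule CollectI, rule exI[of _ i], rule exI[of _ "\<lambda>_. 1"]) (simp add: i(1) cpoly.const)
  then show "\<exists>D f. (D, f) \<in> {({proj_point v |v. (\<forall>k>N. v k = 0) \<and> v i \<noteq> 0}, \<lambda>l. f (THE v. v \<in> l \<and> v i = 1)) |i f.
       i \<le> N \<and> f \<in> cpoly (Suc N)} \<and> proj_point v \<in> D \<and> f (proj_point v) \<noteq> 0"
    using proj_point_chart[OF v, of i] i(2)
    by - (rule exI[of _ "{proj_point v |v. (\<forall>k>N. v k = 0) \<and> v i \<noteq> 0}"], rule exI[of _ "\<lambda>_. 1"], rule conjI, assumption, rule conjI, blast, rule one_neq_zero)
qed

text \<open>The map \<open>\<kappa>\<close> parametrizes \<open>P\<close> with its analytic topology
  by the affine cone \<open>C\<close> over it without the origin. Closedness of \<open>C\<close>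
  among nonzero vectors gives both the compactness of \<open>P\<close> and the existence of limits
  in \<open>P\<close>.\<close>

lemma projective_parametrization:
  assumes P: "function_sheaf P" "pts (analytification P) = pts P" and f: "closed_immersion P (proj_space N) f"
  obtains C \<kappa> where "closedin (top_of_set (punctured N)) C"
    "C = {v \<in> punctured N. proj_point v \<in> f ` pts P}"
    "continuous_map (top_of_set C) (spc (analytification P)) \<kappa>"
    "\<And>v. v \<in> C \<Longrightarrow> \<kappa> v \<in> pts P \<and> f (\<kappa> v) = proj_point v"
proof -
  define C where "C = {v \<in> punctured N. proj_point v \<in> f ` pts P}"
  have cl: "closedin (spc (proj_space N)) (f ` pts P)" using f unfolding closed_immersion_def by blast
  have "closedin (top_of_set (punctured N)) {v \<in> topspace (top_of_set (punctured N)). proj_point v \<in> f ` pts P}"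
    using proj_point_cmorphism[of N] cl unfolding cmorphism_def
    by (intro closedin_continuous_map_preimage) auto
  then have clC: "closedin (top_of_set (punctured N)) C" unfolding C_def by simp
  obtain g where g: "cmorphism (csubspace (proj_space N) (f ` pts P)) P g"
      "\<forall>x\<in>pts P. g (f x) = x" "\<forall>y\<in>pts (csubspace (proj_space N) (f ` pts P)). f (g y) = y"
    using f unfolding closed_immersion_def cisomorphism_def by blast
  have incl: "cmorphism (continuous_space (top_of_set C)) (continuous_space (top_of_set (punctured N))) id"
    unfolding cmorphism_def
  proof (intro conjI allI ballI)
    show cont: "continuous_map (spc (continuous_space (top_of_set C))) (spc (continuous_space (top_of_set (punctured N)))) id"
      using C_def by (auto simp: continuous_map_in_subtopology)
    fix V h assume h: "h \<in> funs (continuous_space (top_of_set (punctured N))) V"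
    have "openin (top_of_set (punctured N)) V" using h by (simp add: continuous_space_funs)
    then have o: "openin (top_of_set C) {x \<in> C. x \<in> V}"
      using openin_continuous_map_preimage[OF cont] by simp
    moreover have "openin (top_of_set C) {x \<in> {x \<in> C. x \<in> V}. h x \<in> S}" if "open S" for S
    proof -
      have "openin (top_of_set (punctured N)) {x \<in> V. h x \<in> S}" using h that by (simp add: continuous_space_def)
      then show ?thesis
        using openin_continuous_map_preimage[OF cont, of "{x \<in> V. h x \<in> S}"] by (simp add: conj_assoc)
    qed
    ultimately show "h \<circ> id \<in> funs (continuous_space (top_of_set C)) {x \<in> pts (continuous_space (top_of_set C)). id x \<in> V}"
      by (simp add: continuous_space_def)
  qed
  have "cmorphism (continuous_space (top_of_set C)) (proj_space N) (proj_point \<circ> id)"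
    by (rule cmorphism_comp[OF incl proj_point_cmorphism])
  then have "cmorphism (continuous_space (top_of_set C)) (csubspace (proj_space N) (f ` pts P)) (proj_point \<circ> id)"
    by (rule cmorphism_into_csubspace[OF function_sheaf_continuous_space]) (auto simp: C_def)
  then have *: "cmorphism (continuous_space (top_of_set C)) P (g \<circ> (proj_point \<circ> id))"
    using g(1) by (rule cmorphism_comp)
  have pp: "(g \<circ> (proj_point \<circ> id)) v \<in> pts P \<and> f ((g \<circ> (proj_point \<circ> id)) v) = proj_point v" if "v \<in> C" for v
    using that g(2) unfolding C_def by auto
  have "continuous_map (top_of_set C) (spc (analytification P)) (g \<circ> (proj_point \<circ> id))"
    by (rule continuous_map_analytification[OF *]) (use pp P(2) in auto)
  then show thesis using that clC pp C_def by blast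
qed

lemma compact_analytification:
  assumes P: "function_sheaf P" "pts (analytification P) = pts P" and f: "closed_immersion P (proj_space N) f"
  shows "compact_space (spc (analytification P))"
proof -
  obtain C \<kappa> where C: "closedin (top_of_set (punctured N)) C" "C = {v \<in> punctured N. proj_point v \<in> f ` pts P}"
    "continuous_map (top_of_set C) (spc (analytification P)) \<kappa>"
    "\<And>v. v \<in> C \<Longrightarrow> \<kappa> v \<in> pts P \<and> f (\<kappa> v) = proj_point v"
    by (rule projective_parametrization[OF assms]) (rule that, assumption+)
  \<comment> \<open>Representatives whose coordinate \<open>i\<close> equals 1 and whose other
    coordinates have modulus at most 1. Dividing by a coordinate of largest modulus brings every
    point into one of these compact sets.\<close>
  define B where "B i = PiE UNIV (\<lambda>k. if k = i then {1::complex} else if k \<le> N then cball 0 1 else {0})" for i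
  have "compactin (product_topology (\<lambda>_. euclidean) UNIV) (B i)" for i
    unfolding B_def compactin_PiE by auto
  then have cB: "compact (B i)" for i by (simp add: euclidean_product_topology)
  define K where "K = (\<Union>i\<le>N. B i)"
  have cK: "compact K" unfolding K_def using cB by (intro compact_UN) auto
  have Kp: "K \<subseteq> punctured N"
  proof
    fix v assume "v \<in> K"
    then obtain i where i: "i \<le> N" "v \<in> B i" unfolding K_def by blast
    have v: "v k \<in> (if k = i then {1} else if k \<le> N then cball 0 1 else {0})" for k
      using i(2) unfolding B_def by (rule PiE_mem) simp
    have "v i = 1" using v[of i] by simp
    moreover have "v k = 0" if "k > N" for k using v[of k] that i(1) by simp
    ultimately show "v \<in> punctured N" unfolding punctured_def using i(1) by force
  qed
  obtain A where A: "closed A" "C = punctured N \<inter> A" using C(1) by (auto simp: closedin_closed)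
  have "K \<inter> C = K \<inter> A" using Kp A(2) by blast
  then have "compact (K \<inter> C)" using cK A(1) by (simp add: compact_Int_closed)
  then have "compactin (top_of_set C) (K \<inter> C)" by (simp add: compactin_subtopology)
  then have "compactin (spc (analytification P)) (\<kappa> ` (K \<inter> C))" using C(3) by (rule image_compactin)
  moreover have "\<kappa> ` (K \<inter> C) = topspace (spc (analytification P))"
  proof
    show "\<kappa> ` (K \<inter> C) \<subseteq> topspace (spc (analytification P))" using C(4) P(2) by auto
    show "topspace (spc (analytification P)) \<subseteq> \<kappa> ` (K \<inter> C)"
    proof
      fix p assume "p \<in> topspace (spc (analytification P))"
      then have p: "p \<in> pts P" using P(2) by simp
      have "f p \<in> pts (proj_space N)"
        using f p unfolding closed_immersion_def by (meson closedin_subset imageI subsetD)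
      then obtain v where v: "v \<in> punctured N" "f p = proj_point v" using pts_proj_space by blast
      have "Max ((\<lambda>k. cmod (v k)) ` {..N}) \<in> (\<lambda>k. cmod (v k)) ` {..N}" by (rule Max_in) auto
      then obtain i where i: "i \<in> {..N}" "Max ((\<lambda>k. cmod (v k)) ` {..N}) = cmod (v i)" by blast
      have vi_max: "cmod (v k) \<le> cmod (v i)" if "k \<in> {..N}" for k
        unfolding i(2)[symmetric] using that by (intro Max_ge) auto
      have vi: "v i \<noteq> 0" using v(1) vi_max unfolding punctured_def by force
      define w where "w = (\<lambda>k. (1 / v i) * v k)"
      have pw: "proj_point w = f p" unfolding v(2) w_def using proj_point_eq_iff vi by (metis divide_eq_0_iff one_neq_zero)
      have "w \<in> B i" unfolding B_def w_def using vi i(1) vi_max v(1)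
        by (auto simp: punctured_def norm_divide divide_le_eq_1)
      then have wK: "w \<in> K" unfolding K_def using i(1) by blast
      then have wC: "w \<in> C" using Kp pw p C(2) by auto
      have "\<kappa> w = p" using closed_immersion_inj[OF f _ p, of "\<kappa> w"] C(4)[OF wC] pw by simp
      then show "p \<in> \<kappa> ` (K \<inter> C)" using wK wC by blast
    qed
  qed
  ultimately show ?thesis by (simp add: compact_space_def)
qed

section \<open>The algebraic torus and maps into it\<close>

lemma pts_torus:
  fixes X :: "'e::euclidean_space set"
  assumes "lattice_in X"
  shows "pts (torus X) = torus_pts X"
proof
  show "pts (torus X) \<subseteq> torus_pts X"
    unfolding torus_def alg_space_def Let_def by (auto simp: topology_generated_by_topspace)
  have "(torus_pts X, \<lambda>a :: 'e \<Rightarrow> complex. \<Sum>x\<in>{0}. 1 * a x) \<in> {(torus_pts X, \<lambda>a :: 'e \<Rightarrow> complex. \<Sum>x\<in>S. c x * a x) |S c. finite S \<and> S \<subseteq> X}"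
    using lattice_in_0[OF assms] by (intro CollectI exI[of _ "{0}"] exI[of _ "\<lambda>_. 1"]) auto
  then have "openin (spc (torus X)) {a \<in> torus_pts X. (\<Sum>x\<in>{0}. 1 * a x) \<noteq> 0}"
    unfolding torus_def by (rule alg_space_generator)
  moreover have "{a \<in> torus_pts X. (\<Sum>x\<in>{0}. 1 * a x) \<noteq> 0} = torus_pts X"
    by (simp add: torus_pts_0[OF assms] cong: conj_cong)
  ultimately show "torus_pts X \<subseteq> pts (torus X)" using openin_subset by metis
qed

text \<open>Regular functions are local fractions; the denominator is the character of 0, which is
  constantly 1.\<close>

lemma torus_character_fun:
  fixes X :: "'e::euclidean_space set"
  assumes "lattice_in X" "x \<in> X"
  shows "(\<lambda>a. a x) \<in> funs (torus X) (torus_pts X)"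
proof -
  have o: "openin (spc (torus X)) (torus_pts X)" using pts_torus[OF assms(1)] openin_topspace by metis
  have 1: "(torus_pts X, \<lambda>a :: 'e \<Rightarrow> complex. \<Sum>y\<in>{x}. 1 * a y) \<in> {(torus_pts X, \<lambda>a :: 'e \<Rightarrow> complex. \<Sum>x\<in>S. c x * a x) |S c. finite S \<and> S \<subseteq> X}"
    using assms(2) by (intro CollectI exI[of _ "{x}"] exI[of _ "\<lambda>_. 1"]) auto
  have 2: "(torus_pts X, \<lambda>a :: 'e \<Rightarrow> complex. \<Sum>y\<in>{0}. 1 * a y) \<in> {(torus_pts X, \<lambda>a :: 'e \<Rightarrow> complex. \<Sum>x\<in>S. c x * a x) |S c. finite S \<and> S \<subseteq> X}"
    using lattice_in_0[OF assms(1)] by (intro CollectI exI[of _ "{0}"] exI[of _ "\<lambda>_. 1"]) auto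
  have "\<forall>a\<in>torus_pts X. \<exists>D f g. (D, f) \<in> {(torus_pts X, \<lambda>a :: 'e \<Rightarrow> complex. \<Sum>x\<in>S. c x * a x) |S c. finite S \<and> S \<subseteq> X} \<and>
    (D, g) \<in> {(torus_pts X, \<lambda>a :: 'e \<Rightarrow> complex. \<Sum>x\<in>S. c x * a x) |S c. finite S \<and> S \<subseteq> X} \<and> a \<in> D \<and> g a \<noteq> 0 \<and>
    (\<forall>y\<in>torus_pts X \<inter> D. g y \<noteq> 0 \<longrightarrow> y x = f y / g y)"
    by (intro ballI exI[of _ "torus_pts X"] exI[of _ "\<lambda>a :: 'e \<Rightarrow> complex. \<Sum>y\<in>{x}. 1 * a y"] exI[of _ "\<lambda>a :: 'e \<Rightarrow> complex. \<Sum>y\<in>{0}. 1 * a y"] conjI 1 2)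
       (auto simp: torus_pts_0[OF assms(1)])
  then show ?thesis using o unfolding torus_def alg_space_def Let_def by simp
qed

lemma pts_analytification_torus:
  assumes "lattice_in X"
  shows "pts (analytification (torus X)) = torus_pts X"
proof -
  have "U \<subseteq> torus_pts X" if "f \<in> funs (torus X) U" for f U
  proof -
    have "openin (spc (torus X)) U" using that unfolding torus_def alg_space_def Let_def by simp
    then show ?thesis using openin_subset pts_torus[OF assms] by metis
  qed
  moreover have "\<exists>f. f \<in> funs (torus X) (torus_pts X)"
    using torus_character_fun[OF assms lattice_in_0[OF assms]] by blast
  ultimately show ?thesis unfolding analytification_def pts_an_space by force
qed

lemma cmorphism_torus:
  fixes X :: "'e::euclidean_space set"
  assumes Y: "local_ring_sheaf Y" and X: "lattice_in X" and g: "\<And>y. y \<in> pts Y \<Longrightarrow> g y \<in> torus_pts X"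
    and c: "\<And>x. x \<in> X \<Longrightarrow> (\<lambda>y. g y x) \<in> funs Y (pts Y)"
  shows "cmorphism Y (torus X) g"
  unfolding torus_def
proof (rule cmorphism_alg_space[OF Y])
  fix D and f :: "('e \<Rightarrow> complex) \<Rightarrow> complex" assume "(D, f) \<in> {(torus_pts X, \<lambda>a :: 'e \<Rightarrow> complex. \<Sum>x\<in>S. c x * a x) |S c. finite S \<and> S \<subseteq> X}"
  then obtain S c where f: "D = torus_pts X" "f = (\<lambda>a :: 'e \<Rightarrow> complex. \<Sum>x\<in>S. c x * a x)" "finite S" "S \<subseteq> X" by blast
  have "(\<lambda>y. \<Sum>x\<in>S. c x * g y x) \<in> funs Y (pts Y)"
    using f(3,4)
  proof (induction S rule: finite_induct)
    case empty
    then show ?case using local_ring_sheaf_const[OF Y openin_topspace] by simp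
  next
    case (insert x S)
    have "(\<lambda>y. c x * g y x) \<in> funs Y (pts Y)"
      using local_ring_sheaf_mult[OF Y local_ring_sheaf_const[OF Y openin_topspace] assms(4)] insert.prems by auto
    then show ?case using insert local_ring_sheaf_add[OF Y] by simp
  qed
  moreover have "{y \<in> pts Y. g y \<in> D} = pts Y" using g f(1) by auto
  ultimately show "f \<circ> g \<in> funs Y {y \<in> pts Y. g y \<in> D}" by (simp add: f(2) o_def)
next
  fix y assume y: "y \<in> pts Y"
  have "(torus_pts X, \<lambda>a :: 'e \<Rightarrow> complex. \<Sum>y\<in>{0}. 1 * a y) \<in> {(torus_pts X, \<lambda>a :: 'e \<Rightarrow> complex. \<Sum>x\<in>S. c x * a x) |S c. finite S \<and> S \<subseteq> X}"
    using lattice_in_0[OF X] by (intro CollectI exI[of _ "{0}"] exI[of _ "\<lambda>_. 1"]) auto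
  then show "\<exists>D f. (D, f) \<in> {(torus_pts X, \<lambda>a :: 'e \<Rightarrow> complex. \<Sum>x\<in>S. c x * a x) |S c. finite S \<and> S \<subseteq> X} \<and> g y \<in> D \<and> f (g y) \<noteq> 0"
    using g[OF y] torus_pts_0[OF X g[OF y]]
    by (intro exI[of _ "torus_pts X"] exI[of _ "\<lambda>a :: 'e \<Rightarrow> complex. \<Sum>y\<in>{0}. 1 * a y"]) simp
qed

lemma continuous_map_torus:
  assumes X: "lattice_in X" and g: "\<And>y. y \<in> topspace T \<Longrightarrow> g y \<in> torus_pts X"
    and c: "\<And>x. x \<in> X \<Longrightarrow> continuous_map T euclidean (\<lambda>y. g y x)"
  shows "continuous_map T (spc (analytification (torus X))) g"
proof (rule continuous_map_analytification)
  show "cmorphism (continuous_space T) (torus X) g"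
    by (rule cmorphism_torus[OF local_ring_sheaf_continuous_space X])
       (use g c in \<open>auto simp: continuous_space_funs\<close>)
  show "g ` topspace T \<subseteq> pts (analytification (torus X))"
    unfolding pts_analytification_torus[OF X] using g by blast
qed

lemma continuous_map_basis_char:
  fixes X :: "'e::euclidean_space set"
  assumes X: "lattice_in X" and ab: "adapted_basis X D n k b d" and B: "\<And>c i. c \<in> B \<Longrightarrow> c i \<noteq> 0"
  shows "continuous_map (top_of_set B) (spc (analytification (torus X))) (basis_char X n d)"
proof (rule continuous_map_torus[OF X])
  fix c assume "c \<in> topspace (top_of_set B)"
  then show "basis_char X n d c \<in> torus_pts X" using basis_char_torus[OF X ab] B by simp
next
  fix x assume x: "x \<in> X"
  have "continuous_on B (\<lambda>c. \<Prod>i<n. c i powi \<lfloor>d i \<bullet> x\<rfloor>)"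
    by (intro continuous_intros continuous_on_subset[OF continuous_on_product_coordinates]) (use B in auto)
  then show "continuous_map (top_of_set B) euclidean (\<lambda>c. basis_char X n d c x)"
    using x by (simp add: basis_char_def)
qed

subsection \<open>Algebraic curves parametrized by the punctured line\<close>

text \<open>The multiplicative group with its coordinate \<open>t\<close>, the source of
  one-parameter subgroups. Polynomials in one variable make the orders at 0, and after
  \<open>t \<mapsto> 1 / t\<close> at infinity, directly accessible.\<close>

definition punctured_line :: "complex cspace" where
  "punctured_line = alg_space {(- {0}, poly p) |p. True}"

lemma punctured_line_generator: "openin (spc punctured_line) {t. t \<noteq> 0 \<and> poly p t \<noteq> 0}"
  using alg_space_generator[of "- {0}" "poly p" "{(- {0}, poly p) |p. True}"]
  by (auto simp: punctured_line_def)

lemma pts_punctured_line: "pts punctured_line = - {0}"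
proof
  show "pts punctured_line \<subseteq> - {0}"
    unfolding punctured_line_def alg_space_def Let_def by (auto simp: topology_generated_by_topspace)
  have "{t. t \<noteq> 0 \<and> poly 1 t \<noteq> 0} = - {0::complex}" by auto
  then show "- {0} \<subseteq> pts punctured_line" using openin_subset[OF punctured_line_generator[of 1]] by simp
qed

lemma punctured_line_basis:
  assumes "openin (spc punctured_line) W" "t \<in> W"
  shows "\<exists>b. poly b t \<noteq> 0 \<and> (\<forall>s. s \<noteq> 0 \<longrightarrow> poly b s \<noteq> 0 \<longrightarrow> s \<in> W)"
proof -
  have "generate_topology_on {{x \<in> D. f x \<noteq> 0} |D f. (D, f) \<in> {(- {0}, poly p) |p. True}} W"
    using assms(1) unfolding punctured_line_def alg_space_def Let_def by (simp add: openin_topology_generated_by_iff)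
  then show ?thesis using assms(2)
  proof (induction arbitrary: t)
    case (Int U V)
    obtain a where "poly a t \<noteq> 0" "\<forall>s. s \<noteq> 0 \<longrightarrow> poly a s \<noteq> 0 \<longrightarrow> s \<in> U"
      using Int.IH(1) Int.prems by blast
    moreover obtain b where "poly b t \<noteq> 0" "\<forall>s. s \<noteq> 0 \<longrightarrow> poly b s \<noteq> 0 \<longrightarrow> s \<in> V"
      using Int.IH(2) Int.prems by blast
    ultimately show ?case by (intro exI[of _ "a * b"]) auto
  next
    case (UN K)
    then show ?case by (meson UnionE UnionI)
  next
    case (Basis U)
    then show ?case by auto
  qed simp
qed

text \<open>The nonvanishing locus of the denominator serves as the neighbourhood of
  \<open>t\<close>, lying inside \<open>W\<close>. One polynomial thus records both the open set and
  the fraction; shrinking means multiplying numerator and denominator by a further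
  polynomial.\<close>

abbreviation rational_at :: "complex set \<Rightarrow> (complex \<Rightarrow> complex) \<Rightarrow> complex \<Rightarrow> bool" where
  "rational_at W h t \<equiv>
    \<exists>a b. poly b t \<noteq> 0 \<and> (\<forall>s. s \<noteq> 0 \<longrightarrow> poly b s \<noteq> 0 \<longrightarrow> s \<in> W \<and> h s = poly a s / poly b s)"

lemma punctured_line_funs:
  "h \<in> funs punctured_line W \<longleftrightarrow> openin (spc punctured_line) W \<and>
    (\<forall>t\<in>W. rational_at W h t)"
  (is "_ \<longleftrightarrow> _ \<and> ?R")
proof
  assume h: "h \<in> funs punctured_line W"
  then have o: "openin (spc punctured_line) W" unfolding punctured_line_def alg_space_def Let_def by simp
  have *: "\<forall>t\<in>W. \<exists>a b. poly b t \<noteq> 0 \<and> (\<forall>s\<in>W \<inter> - {0}. poly b s \<noteq> 0 \<longrightarrow> h s = poly a s / poly b s)"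
    using h unfolding punctured_line_def alg_space_def Let_def by fastforce
  have ?R
  proof
    fix t assume t: "t \<in> W"
    then obtain a b where ab: "poly b t \<noteq> 0" "\<And>s. s \<in> W \<Longrightarrow> s \<noteq> 0 \<Longrightarrow> poly b s \<noteq> 0 \<Longrightarrow> h s = poly a s / poly b s"
      using * by blast
    obtain c where c: "poly c t \<noteq> 0" "\<forall>s. s \<noteq> 0 \<longrightarrow> poly c s \<noteq> 0 \<longrightarrow> s \<in> W"
      using punctured_line_basis[OF o t] by blast
    show "rational_at W h t"
      using ab c by (intro exI[of _ "a * c"] exI[of _ "b * c"]) auto
  qed
  then show "openin (spc punctured_line) W \<and> ?R" using o by blast
next
  assume *: "openin (spc punctured_line) W \<and> ?R"
  then have sub: "W \<subseteq> - {0}" using openin_subset pts_punctured_line by metis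
  have "\<exists>D f g. (D, f) \<in> {(- {0}, poly p) |p. True} \<and> (D, g) \<in> {(- {0}, poly p) |p. True} \<and> t \<in> D \<and> g t \<noteq> 0 \<and>
      (\<forall>y\<in>W \<inter> D. g y \<noteq> 0 \<longrightarrow> h y = f y / g y)" if t: "t \<in> W" for t
  proof -
    obtain a b where "poly b t \<noteq> 0 \<and> (\<forall>s. s \<noteq> 0 \<longrightarrow> poly b s \<noteq> 0 \<longrightarrow> s \<in> W \<and> h s = poly a s / poly b s)" using * t by blast
    then show ?thesis using t sub by (intro exI[of _ "- {0}"] exI[of _ "poly a"] exI[of _ "poly b"]) auto
  qed
  then show "h \<in> funs punctured_line W" using * unfolding punctured_line_def alg_space_def Let_def by simp
qed

lemma local_ring_sheaf_punctured_line: "local_ring_sheaf punctured_line"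
  unfolding local_ring_sheaf_def function_sheaf_def
proof (intro conjI allI ballI impI)
  fix U h assume "h \<in> funs punctured_line U"
  then show "openin (spc punctured_line) U" by (simp add: punctured_line_funs)
next
  fix U h h' assume *: "h \<in> funs punctured_line U \<and> (\<forall>x\<in>U. h' x = h x)"
  show "h' \<in> funs punctured_line U"
    unfolding punctured_line_funs
  proof (intro conjI ballI)
    show "openin (spc punctured_line) U" using * by (simp add: punctured_line_funs)
    fix t assume "t \<in> U"
    then obtain a b where "poly b t \<noteq> 0" "\<And>s. s \<noteq> 0 \<Longrightarrow> poly b s \<noteq> 0 \<Longrightarrow> s \<in> U \<and> h s = poly a s / poly b s"
      using * unfolding punctured_line_funs by blast
    then show "rational_at U h' t"
      using * by (intro exI[of _ a] exI[of _ b]) auto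
  qed
next
  fix U V h assume *: "h \<in> funs punctured_line U \<and> openin (spc punctured_line) V \<and> V \<subseteq> U"
  show "h \<in> funs punctured_line V"
    unfolding punctured_line_funs
  proof (intro conjI ballI)
    show o: "openin (spc punctured_line) V" using * by blast
    fix t assume t: "t \<in> V"
    then obtain a b where "poly b t \<noteq> 0" "\<And>s. s \<noteq> 0 \<Longrightarrow> poly b s \<noteq> 0 \<Longrightarrow> s \<in> U \<and> h s = poly a s / poly b s"
      using * unfolding punctured_line_funs by blast
    moreover obtain c where "poly c t \<noteq> 0" "\<forall>s. s \<noteq> 0 \<longrightarrow> poly c s \<noteq> 0 \<longrightarrow> s \<in> V"
      using punctured_line_basis[OF o t] by blast
    ultimately show "rational_at V h t"
      by (intro exI[of _ "a * c"] exI[of _ "b * c"]) auto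
  qed
next
  fix U h assume *: "openin (spc punctured_line) U \<and> (\<forall>x\<in>U. \<exists>V. x \<in> V \<and> V \<subseteq> U \<and> h \<in> funs punctured_line V)"
  show "h \<in> funs punctured_line U"
    unfolding punctured_line_funs
  proof (intro conjI ballI)
    show "openin (spc punctured_line) U" using * by blast
    fix t assume "t \<in> U"
    then obtain V where V: "t \<in> V" "V \<subseteq> U" "h \<in> funs punctured_line V" using * by blast
    then obtain a b where "poly b t \<noteq> 0" "\<And>s. s \<noteq> 0 \<Longrightarrow> poly b s \<noteq> 0 \<Longrightarrow> s \<in> V \<and> h s = poly a s / poly b s"
      unfolding punctured_line_funs by blast
    then show "rational_at U h t"
      using V(2) by blast
  qed
next
  fix W and c :: complex assume o: "openin (spc punctured_line) W"
  show "(\<lambda>_. c) \<in> funs punctured_line W"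
    unfolding punctured_line_funs
  proof (intro conjI ballI o)
    fix t assume "t \<in> W"
    then obtain b where "poly b t \<noteq> 0" "\<forall>s. s \<noteq> 0 \<longrightarrow> poly b s \<noteq> 0 \<longrightarrow> s \<in> W"
      using punctured_line_basis[OF o] by blast
    then show "rational_at W (\<lambda>s. c) t"
      by (intro exI[of _ "[:c:] * b"] exI[of _ b]) auto
  qed
next
  fix W f g assume f: "f \<in> funs punctured_line W" and g: "g \<in> funs punctured_line W"
  have *: "\<exists>a b a' b'. poly b t \<noteq> 0 \<and> poly b' t \<noteq> 0 \<and> (\<forall>s. s \<noteq> 0 \<longrightarrow> poly b s \<noteq> 0 \<longrightarrow> s \<in> W \<and> f s = poly a s / poly b s) \<and>
     (\<forall>s. s \<noteq> 0 \<longrightarrow> poly b' s \<noteq> 0 \<longrightarrow> s \<in> W \<and> g s = poly a' s / poly b' s)" if "t \<in> W" for t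
  proof -
    have "rational_at W f t"
      using f that unfolding punctured_line_funs by blast
    moreover have "rational_at W g t"
      using g that unfolding punctured_line_funs by blast
    ultimately show ?thesis by (elim exE conjE) (intro exI conjI)
  qed
  show "(\<lambda>x. f x + g x) \<in> funs punctured_line W"
    unfolding punctured_line_funs
  proof (intro conjI ballI)
    show "openin (spc punctured_line) W" using f by (simp add: punctured_line_funs)
    fix t assume t: "t \<in> W"
    obtain a b a' b' where "poly b t \<noteq> 0" "poly b' t \<noteq> 0" "\<forall>s. s \<noteq> 0 \<longrightarrow> poly b s \<noteq> 0 \<longrightarrow> s \<in> W \<and> f s = poly a s / poly b s"
      "\<forall>s. s \<noteq> 0 \<longrightarrow> poly b' s \<noteq> 0 \<longrightarrow> s \<in> W \<and> g s = poly a' s / poly b' s"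
      using *[OF t] by (elim exE conjE) (rule that)
    then show "rational_at W (\<lambda>s. f s + g s) t"
      by (intro exI[of _ "a * b' + a' * b"] exI[of _ "b * b'"]) (auto simp: add_frac_eq)
  qed
  show "(\<lambda>x. f x * g x) \<in> funs punctured_line W"
    unfolding punctured_line_funs
  proof (intro conjI ballI)
    show "openin (spc punctured_line) W" using f by (simp add: punctured_line_funs)
    fix t assume t: "t \<in> W"
    obtain a b a' b' where "poly b t \<noteq> 0" "poly b' t \<noteq> 0" "\<forall>s. s \<noteq> 0 \<longrightarrow> poly b s \<noteq> 0 \<longrightarrow> s \<in> W \<and> f s = poly a s / poly b s"
      "\<forall>s. s \<noteq> 0 \<longrightarrow> poly b' s \<noteq> 0 \<longrightarrow> s \<in> W \<and> g s = poly a' s / poly b' s"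
      using *[OF t] by (elim exE conjE) (rule that)
    then show "rational_at W (\<lambda>s. f s * g s) t"
      by (intro exI[of _ "a * a'"] exI[of _ "b * b'"]) auto
  qed
next
  fix W f assume f: "f \<in> funs punctured_line W"
  then have sub: "W \<subseteq> - {0}" unfolding punctured_line_funs using openin_subset pts_punctured_line by metis
  have *: "\<exists>a b. poly b t \<noteq> 0 \<and> poly a t \<noteq> 0 \<and> (\<forall>s. s \<noteq> 0 \<longrightarrow> poly b s \<noteq> 0 \<longrightarrow> s \<in> W \<and> f s = poly a s / poly b s)"
    if t: "t \<in> W" "f t \<noteq> 0" for t
  proof -
    obtain a b where ab: "poly b t \<noteq> 0" "\<And>s. s \<noteq> 0 \<Longrightarrow> poly b s \<noteq> 0 \<Longrightarrow> s \<in> W \<and> f s = poly a s / poly b s"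
      using f t(1) unfolding punctured_line_funs by blast
    have "t \<noteq> 0" using t(1) sub by auto
    then have "f t = poly a t / poly b t" using ab(2)[OF _ ab(1)] by blast
    then have "poly a t \<noteq> 0" using t(2) by auto
    then show ?thesis using ab by blast
  qed
  show o: "openin (spc punctured_line) {x \<in> W. f x \<noteq> 0}"
  proof (subst openin_subopen, safe)
    fix t assume "t \<in> W" "f t \<noteq> 0"
    then obtain a b where ab: "poly b t \<noteq> 0" "poly a t \<noteq> 0" "\<And>s. s \<noteq> 0 \<Longrightarrow> poly b s \<noteq> 0 \<Longrightarrow> s \<in> W \<and> f s = poly a s / poly b s"
      using * by blast
    show "\<exists>T. openin (spc punctured_line) T \<and> t \<in> T \<and> T \<subseteq> {x \<in> W. f x \<noteq> 0}"
      using ab sub \<open>t \<in> W\<close> punctured_line_generator[of "a * b"] by (intro exI[of _ "{s. s \<noteq> 0 \<and> poly (a * b) s \<noteq> 0}"]) auto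
  qed
  show "(\<lambda>x. 1 / f x) \<in> funs punctured_line {x \<in> W. f x \<noteq> 0}"
    unfolding punctured_line_funs
  proof (intro conjI ballI o)
    fix t assume "t \<in> {x \<in> W. f x \<noteq> 0}"
    then obtain a b where ab: "poly b t \<noteq> 0" "poly a t \<noteq> 0" "\<And>s. s \<noteq> 0 \<Longrightarrow> poly b s \<noteq> 0 \<Longrightarrow> s \<in> W \<and> f s = poly a s / poly b s"
      using * by blast
    show "rational_at {x \<in> W. f x \<noteq> 0} (\<lambda>s. 1 / f s) t"
      using ab by (intro exI[of _ "b * b"] exI[of _ "a * b"]) auto
  qed
qed

lemma punctured_line_powi: "(\<lambda>t. t powi n) \<in> funs punctured_line (- {0})"
proof -
  have o: "openin (spc punctured_line) (- {0})" using pts_punctured_line openin_topspace by metis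
  have p: "poly (monom 1 m) t = t ^ m" for m and t :: complex by (simp add: poly_monom)
  show ?thesis
  proof (cases "n \<ge> 0")
    case True
    show ?thesis unfolding punctured_line_funs
    proof (intro conjI ballI o)
      fix t :: complex
      show "rational_at (- {0}) (\<lambda>s. s powi n) t"
        using True by (intro exI[of _ "monom 1 (nat n)"] exI[of _ 1]) (auto simp: p power_int_def)
    qed
  next
    case False
    show ?thesis unfolding punctured_line_funs
    proof (intro conjI ballI o)
      fix t :: complex assume "t \<in> - {0}"
      then show "rational_at (- {0}) (\<lambda>s. s powi n) t"
        using False by (intro exI[of _ 1] exI[of _ "monom 1 (nat (- n))"]) (auto simp: p power_int_def field_simps)
    qed
  qed
qed

section \<open>Regular functions near the puncture\<close>

lemma poly_factor_0:
  fixes p :: "complex poly"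
  assumes "p \<noteq> 0"
  obtains e q where "poly q 0 \<noteq> 0" "\<And>t. poly p t = t ^ e * poly q t"
proof -
  obtain q where q: "p = [:- 0, 1:] ^ order 0 p * q" "\<not> [:- 0, 1:] dvd q" using order_decomp[OF assms] by metis
  have "poly p t = t ^ order 0 p * poly q t" for t by (subst q(1)) simp
  moreover have "poly q 0 \<noteq> 0" using q(2) by (metis poly_eq_0_iff_dvd minus_zero)
  ultimately show thesis using that by blast
qed

text \<open>Extracting the powers of \<open>t\<close> from numerator and denominator leaves three
  cases: zero near 0, a nonnegative order, or a pole.\<close>

lemma punctured_line_funs_at_0:
  assumes F: "F \<in> funs punctured_line (- {0})"
  obtains "\<forall>\<^sub>F t in at 0. F t = 0"
  | n :: nat and p q :: "complex poly" where "poly p 0 \<noteq> 0" "poly q 0 \<noteq> 0" "\<forall>\<^sub>F t in at 0. F t = t ^ n * (poly p t / poly q t)"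
  | n :: nat and p q :: "complex poly" where "n > 0" "poly p 0 \<noteq> 0" "poly q 0 \<noteq> 0" "\<forall>\<^sub>F t in at 0. t ^ n * F t = poly p t / poly q t"
proof -
  have "(1::complex) \<in> - {0}" by simp
  then obtain a b where ab: "poly b 1 \<noteq> 0" "\<And>s. s \<noteq> 0 \<Longrightarrow> poly b s \<noteq> 0 \<Longrightarrow> F s = poly a s / poly b s"
    using F unfolding punctured_line_funs by blast
  have b0: "b \<noteq> 0" using ab(1) by auto
  have "finite {s. poly b s = 0}" using poly_roots_finite[OF b0] .
  then have "\<forall>\<^sub>F t in at 0. t \<notin> {s. poly b s = 0}"
    using islimpt_finite[of "{s. poly b s = 0}" 0] by (simp add: islimpt_iff_eventually)
  moreover have "\<forall>\<^sub>F t in at (0::complex). t \<noteq> 0" by (simp add: eventually_at_filter)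
  ultimately have ev: "\<forall>\<^sub>F t in at 0. F t = poly a t / poly b t \<and> t \<noteq> 0 \<and> poly b t \<noteq> 0"
    by eventually_elim (use ab(2) in auto)
  show thesis
  proof (cases "a = 0")
    case True
    have "\<forall>\<^sub>F t in at 0. F t = 0" using ev by eventually_elim (simp add: True)
    then show thesis by (rule that(1))
  next
    case False
    obtain e p where p: "poly p 0 \<noteq> 0" "\<And>t. poly a t = t ^ e * poly p t" using poly_factor_0[OF False] by metis
    obtain m q where q: "poly q 0 \<noteq> 0" "\<And>t. poly b t = t ^ m * poly q t" using poly_factor_0[OF b0] by metis
    show thesis
    proof (cases "m \<le> e")
      case True
      have "\<forall>\<^sub>F t in at 0. F t = t ^ (e - m) * (poly p t / poly q t)"
        using ev by eventually_elim (use True in \<open>auto simp: p q power_diff\<close>)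
      then show thesis using that(2) p(1) q(1) by blast
    next
      case False
      have "\<forall>\<^sub>F t in at 0. t ^ (m - e) * F t = poly p t / poly q t"
        using ev by eventually_elim (use False in \<open>auto simp: p q power_diff\<close>)
      then show thesis using that(3)[of "m - e"] p(1) q(1) False by simp
    qed
  qed
qed

lemma poly_quotient_tendsto: "poly q 0 \<noteq> 0 \<Longrightarrow> ((\<lambda>t. poly p t / poly q t) \<longlongrightarrow> poly p 0 / poly q 0) (at (0::complex))"
  by (intro tendsto_divide) (auto intro!: isContD poly_isCont)

lemma rational_limit_cases:
  assumes F: "F \<in> funs punctured_line (- {0})"
  obtains l where "(F \<longlongrightarrow> l) (at 0)"
  | n l where "n > (0::nat)" "l \<noteq> 0" "((\<lambda>t. t ^ n * F t) \<longlongrightarrow> l) (at 0)"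
  using F
proof (cases rule: punctured_line_funs_at_0)
  case 1
  then have "(F \<longlongrightarrow> 0) (at 0)" by (simp add: tendsto_eventually)
  then show thesis by (rule that(1))
next
  case (2 n p q)
  have "((\<lambda>t. t ^ n * (poly p t / poly q t)) \<longlongrightarrow> 0 ^ n * (poly p 0 / poly q 0)) (at 0)"
    by (intro tendsto_mult poly_quotient_tendsto 2 tendsto_power tendsto_ident_at)
  then have "(F \<longlongrightarrow> 0 ^ n * (poly p 0 / poly q 0)) (at 0)" using 2(3) by (subst tendsto_cong) auto
  then show thesis by (rule that(1))
next
  case (3 n p q)
  have "((\<lambda>t. t ^ n * F t) \<longlongrightarrow> poly p 0 / poly q 0) (at 0)"
    using poly_quotient_tendsto[OF 3(3), of p] by (subst tendsto_cong[OF 3(4)])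
  then show thesis using that(2)[of n "poly p 0 / poly q 0"] 3 by simp
qed

text \<open>How homogeneous coordinates converge: scaling all coordinates by \<open>t ^ n\<close>,
  with \<open>n\<close> the largest pole order, leaves a limit vector that is finite and nonzero.
  The coordinate \<open>k0\<close> without a limit makes \<open>n\<close> positive.\<close>

lemma common_pole_order:
  assumes F: "\<And>k. k \<le> (N::nat) \<Longrightarrow> F k \<in> funs punctured_line (- {0})"
    and k0: "k0 \<le> N" "\<nexists>l. (F k0 \<longlongrightarrow> l) (at 0)"
  obtains n v where "n > 0" "\<And>k. k \<le> N \<Longrightarrow> ((\<lambda>t. t ^ n * F k t) \<longlongrightarrow> v k) (at 0)" "\<exists>k\<le>N. v k \<noteq> 0"
proof -
  have "\<exists>m. \<exists>l. ((\<lambda>t. t ^ m * F k t) \<longlongrightarrow> l) (at 0) \<and> (m > 0 \<longrightarrow> l \<noteq> 0)" if "k \<le> N" for k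
    using F[OF that]
  proof (cases rule: rational_limit_cases)
    case (1 l)
    then show ?thesis by (intro exI[of _ 0] exI[of _ l]) simp
  next
    case (2 n l)
    then show ?thesis by blast
  qed
  then obtain m l where ml: "\<And>k. k \<le> N \<Longrightarrow> ((\<lambda>t. t ^ m k * F k t) \<longlongrightarrow> l k) (at 0) \<and> (m k > 0 \<longrightarrow> l k \<noteq> 0)"
    by metis
  define n where "n = Max (m ` {..N})"
  have n: "m k \<le> n" if "k \<le> N" for k unfolding n_def using that by (intro Max_ge) auto
  have "n \<in> m ` {..N}" unfolding n_def by (intro Max_in) auto
  then obtain k1 where k1: "k1 \<le> N" "m k1 = n" by auto
  have "n \<noteq> 0"
  proof
    assume "n = 0"
    then have "m k0 = 0" using n[OF k0(1)] by simp
    then show False using ml[OF k0(1)] k0(2) by auto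
  qed
  define v where "v k = 0 ^ (n - m k) * l k" for k
  have "((\<lambda>t. t ^ n * F k t) \<longlongrightarrow> v k) (at 0)" if "k \<le> N" for k
  proof -
    have "((\<lambda>t. t ^ (n - m k) * (t ^ m k * F k t)) \<longlongrightarrow> v k) (at 0)"
      unfolding v_def using ml[OF that] by (intro tendsto_mult tendsto_power tendsto_ident_at) auto
    moreover have "t ^ (n - m k) * (t ^ m k * F k t) = t ^ n * F k t" for t
      using n[OF that] by (simp add: mult.assoc[symmetric] power_add[symmetric])
    ultimately show ?thesis by simp
  qed
  moreover have "v k1 \<noteq> 0" unfolding v_def using ml[OF k1(1)] k1(2) \<open>n \<noteq> 0\<close> by simp
  ultimately show thesis using that[of n v] \<open>n \<noteq> 0\<close> k1(1) by auto
qed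

text \<open>Finite limits at 0 and at infinity make \<open>F\<close> bounded. Composing with
  \<open>exp\<close> removes the puncture, and Liouville applies.\<close>

lemma bounded_punctured_line_fun_constant:
  assumes F: "F \<in> funs punctured_line (- {0})"
    and l0: "(F \<longlongrightarrow> l0) (at 0)" and l1: "((\<lambda>t. F (1 / t)) \<longlongrightarrow> l1) (at 0)"
    and t: "t \<noteq> 0"
  shows "F t = F 1"
proof -
  have holF: "F holomorphic_on - {0}"
  proof (rule holomorphic_on_open[THEN iffD2, rule_format])
    show "open (- {0::complex})" by (simp add: open_Compl)
    fix s :: complex assume s: "s \<in> - {0}"
    then obtain a b where ab: "poly b s \<noteq> 0" "\<And>t. t \<noteq> 0 \<Longrightarrow> poly b t \<noteq> 0 \<Longrightarrow> F t = poly a t / poly b t"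
      using F unfolding punctured_line_funs by blast
    have op: "open {t. t \<noteq> 0 \<and> poly b t \<noteq> 0}"
      by (intro open_Collect_conj open_Collect_neq continuous_intros)
    obtain d where "((\<lambda>t. poly a t / poly b t) has_field_derivative d) (at s)"
      using ab(1) by (metis DERIV_divide poly_DERIV)
    then have "(F has_field_derivative d) (at s)"
      by (rule has_field_derivative_transform_within_open[OF _ op]) (use s ab in auto)
    then show "\<exists>d. (F has_field_derivative d) (at s)" by blast
  qed
  have "\<exists>B. \<forall>s. s \<noteq> 0 \<longrightarrow> cmod (F s) \<le> B"
  proof -
    obtain d0 where d0: "d0 > 0" "\<And>s. s \<noteq> 0 \<Longrightarrow> cmod s < d0 \<Longrightarrow> dist (F s) l0 < 1"
      using tendstoD[OF l0, of 1] unfolding eventually_at by auto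
    obtain d1 where d1: "d1 > 0" "\<And>s. s \<noteq> 0 \<Longrightarrow> cmod s < d1 \<Longrightarrow> dist (F (1 / s)) l1 < 1"
      using tendstoD[OF l1, of 1] unfolding eventually_at by auto
    define K where "K = cball 0 (1 / d1) - ball (0::complex) d0"
    have "compact K" unfolding K_def by (intro compact_diff) auto
    moreover have "continuous_on K F"
      by (rule continuous_on_subset[OF holomorphic_on_imp_continuous_on[OF holF]]) (use d0(1) K_def in auto)
    ultimately have "bounded (F ` K)" using compact_continuous_image compact_imp_bounded by blast
    then obtain B where B: "\<And>s. s \<in> K \<Longrightarrow> cmod (F s) \<le> B" unfolding bounded_iff by blast
    have "cmod (F s) \<le> max B (max (cmod l0 + 1) (cmod l1 + 1))" if s: "s \<noteq> 0" for s
    proof -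
      consider "cmod s < d0" | "cmod s > 1 / d1" | "s \<in> K" unfolding K_def by force
      then show ?thesis
      proof cases
        case 1
        then have "cmod (F s - l0) < 1" using d0(2)[OF s] by (simp add: dist_norm)
        then show ?thesis using norm_triangle_ineq2[of "F s" l0] by linarith
      next
        case 2
        then have "cmod (1 / s) < d1" using d1(1) s by (simp add: norm_divide field_simps)
        then have "cmod (F s - l1) < 1" using d1(2)[of "1 / s"] s by (simp add: dist_norm)
        then show ?thesis using norm_triangle_ineq2[of "F s" l1] by linarith
      next
        case 3
        then show ?thesis using B by fastforce
      qed
    qed
    then show ?thesis by blast
  qed
  then obtain B where B: "\<And>s. s \<noteq> 0 \<Longrightarrow> cmod (F s) \<le> B" by blast
  have h: "(F \<circ> exp) holomorphic_on UNIV"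
    by (rule holomorphic_on_compose_gen[OF _ holF]) (auto intro: holomorphic_intros)
  have b: "bounded (range (F \<circ> exp))" unfolding bounded_iff by (auto intro!: exI[of _ B] B)
  obtain c where c: "\<And>z. (F \<circ> exp) z = c" using Liouville_theorem[OF h b] unfolding constant_on_def by auto
  have "F t = c" using c[of "Ln t"] t by (simp add: exp_Ln)
  moreover have "F 1 = c" using c[of 0] by simp
  ultimately show ?thesis by simp
qed

subsection \<open>The cell complex\<close>

context semiabelic_complex
begin

abbreviation "cells \<equiv> pullback_cells X r \<rho>' C' I"

lemma span_image_X: "r ` span X = span X'"
  using r_linear r_image by (metis linear_span_image)

lemma cell'_span: "\<delta> \<in> C' \<Longrightarrow> \<rho>' ` \<delta> \<subseteq> span X'"
proof -
  assume "\<delta> \<in> C'"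
  then obtain V where "V \<subseteq> X'" "\<rho>' ` \<delta> = convex hull V" using cell_polytope by blast
  then show ?thesis by (metis convex_hull_subset_span order_trans span_mono)
qed

lemma cell'_lift:
  assumes "\<delta> \<in> C'" "q \<in> \<delta>"
  shows "\<exists>v\<in>span X. r v = \<rho>' q"
proof -
  have "\<rho>' q \<in> r ` span X" unfolding span_image_X using assms cell'_span by blast
  then show ?thesis by auto
qed

lemma fst_pullback_cell: "fst ` pullback_cell X r \<rho>' \<delta> i = {v \<in> span X. r v \<in> \<rho>' ` \<delta>}"
  unfolding pullback_cell_def by (force simp: image_iff)

lemma pullback_cell_inj: "\<delta> \<in> C' \<Longrightarrow> inj_on fst (pullback_cell X r \<rho>' \<delta> i)"
  using cell_inj unfolding pullback_cell_def inj_on_def by (auto simp: inj_on_def)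

lemma cells_inj: "\<delta> \<in> cells \<Longrightarrow> inj_on fst \<delta>"
  unfolding pullback_cells_def using pullback_cell_inj by auto

lemma cell'_nonempty: "\<delta> \<in> C' \<Longrightarrow> \<delta> \<noteq> {}"
proof
  assume d: "\<delta> \<in> C'" "\<delta> = {}"
  obtain V where V: "V \<noteq> {}" "\<rho>' ` \<delta> = convex hull V" using cell_polytope[OF d(1)] by blast
  have "convex hull V = {}" using V(2) d(2) by simp
  then show False using V(1) by (simp only: convex_hull_eq_empty)
qed

lemma pullback_cell_subset:
  assumes "\<delta> \<in> C'" "pullback_cell X r \<rho>' \<delta> i \<subseteq> pullback_cell X r \<rho>' \<epsilon> j"
  shows "\<delta> \<subseteq> \<epsilon>" "i = j"
proof -
  have *: "q \<in> \<epsilon> \<and> i = j" if q: "q \<in> \<delta>" for q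
  proof -
    obtain v where "v \<in> span X" "r v = \<rho>' q" using cell'_lift[OF assms(1) q] by blast
    then have "(v, q, i) \<in> pullback_cell X r \<rho>' \<delta> i" using q by (simp add: pullback_cell_def)
    then have "(v, q, i) \<in> pullback_cell X r \<rho>' \<epsilon> j" using assms(2) by blast
    then show ?thesis by (simp add: pullback_cell_def)
  qed
  then show "\<delta> \<subseteq> \<epsilon>" by blast
  show "i = j" using * cell'_nonempty[OF assms(1)] by blast
qed

lemma pullback_cell_eq:
  assumes "\<delta> \<in> C'" "\<epsilon> \<in> C'" "pullback_cell X r \<rho>' \<delta> i = pullback_cell X r \<rho>' \<epsilon> j"
  shows "\<delta> = \<epsilon>" "i = j"
  using pullback_cell_subset[of \<delta> i \<epsilon> j] pullback_cell_subset[of \<epsilon> j \<delta> i] assms by auto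

lemma cell_convex_closed:
  assumes "\<delta> \<in> cells"
  shows "convex (fst ` \<delta>)" "closed (fst ` \<delta>)" "fst ` \<delta> \<subseteq> span X" "fst ` \<delta> \<noteq> {}"
proof -
  obtain \<delta>' i where \<delta>': "\<delta>' \<in> C'" "\<delta> = pullback_cell X r \<rho>' \<delta>' i"
    using assms unfolding pullback_cells_def by blast
  obtain V where V: "finite V" "\<rho>' ` \<delta>' = convex hull V" using cell_polytope \<delta>'(1) by blast
  have e: "fst ` \<delta> = span X \<inter> r -` (convex hull V)"
    unfolding \<delta>'(2) fst_pullback_cell V(2) by auto
  show "convex (fst ` \<delta>)" unfolding e
    by (intro convex_Int convex_linear_vimage r_linear convex_convex_hull subspace_imp_convex subspace_span)
  have "closed (r -` (convex hull V))"
    by (rule continuous_closed_vimage)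
      (use V(1) linear_continuous_at[of r] r_linear linear_conv_bounded_linear
        in \<open>auto simp: finite_imp_compact_convex_hull compact_imp_closed\<close>)
  then show "closed (fst ` \<delta>)" unfolding e by (intro closed_Int closed_span)
  show "fst ` \<delta> \<subseteq> span X" unfolding e by auto
  obtain q where q: "q \<in> \<delta>'" using cell'_nonempty[OF \<delta>'(1)] by blast
  obtain v where "v \<in> span X" "r v = \<rho>' q" using cell'_lift[OF \<delta>'(1) q] by blast
  then show "fst ` \<delta> \<noteq> {}" unfolding \<delta>'(2) fst_pullback_cell using q by auto
qed

lemma act_zero: "q \<in> \<Union>cells \<Longrightarrow> \<alpha> 0 q = q"
  and act_add: "x \<in> X \<Longrightarrow> y \<in> X \<Longrightarrow> q \<in> \<Union>cells \<Longrightarrow> \<alpha> (x + y) q = \<alpha> x (\<alpha> y q)"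
  and act_cell: "x \<in> X \<Longrightarrow> \<delta> \<in> cells \<Longrightarrow> \<alpha> x ` \<delta> \<in> cells"
  and act_fst: "x \<in> X \<Longrightarrow> q \<in> \<Union>cells \<Longrightarrow> fst (\<alpha> x q) = fst q + x"
  using action unfolding lattice_action_def by blast+

lemma act_closed: "x \<in> X \<Longrightarrow> q \<in> \<Union>cells \<Longrightarrow> \<alpha> x q \<in> \<Union>cells"
  using act_cell by blast

lemma act_minus: "x \<in> X \<Longrightarrow> q \<in> \<Union>cells \<Longrightarrow> \<alpha> (- x) (\<alpha> x q) = q"
  "x \<in> X \<Longrightarrow> q \<in> \<Union>cells \<Longrightarrow> \<alpha> x (\<alpha> (- x) q) = q"
  using act_add[of "- x" x q] act_add[of x "- x" q] act_zero lattice_in_minus[OF X] by auto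

lemma act_minus_cell: "x \<in> X \<Longrightarrow> \<delta> \<in> cells \<Longrightarrow> \<alpha> (- x) ` \<alpha> x ` \<delta> = \<delta>"
proof -
  assume a: "x \<in> X" "\<delta> \<in> cells"
  have "\<alpha> (- x) (\<alpha> x q) = q" if "q \<in> \<delta>" for q by (rule act_minus(1)) (use a that in blast)+
  then show ?thesis unfolding image_image by simp
qed

lemma act_bij_IP:
  assumes "x \<in> X"
  shows "bij_betw (\<alpha> x) (integral_points X cells) (integral_points X cells)"
proof (rule bij_betw_byWitness[where f' = "\<alpha> (- x)"])
  have m: "- x \<in> X" using assms lattice_in_minus[OF X] by blast
  show "\<forall>a\<in>integral_points X cells. \<alpha> (- x) (\<alpha> x a) = a" "\<forall>a\<in>integral_points X cells. \<alpha> x (\<alpha> (- x) a) = a"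
    using act_minus[OF assms] unfolding integral_points_def by auto
  have "\<alpha> y ` integral_points X cells \<subseteq> integral_points X cells" if "y \<in> X" for y
  proof
    fix w assume "w \<in> \<alpha> y ` integral_points X cells"
    then obtain q where q: "w = \<alpha> y q" "q \<in> \<Union>cells" "fst q \<in> X" unfolding integral_points_def by blast
    then show "w \<in> integral_points X cells"
      unfolding integral_points_def using act_closed[OF that] act_fst[OF that] lattice_in_add[OF X] that by auto
  qed
  then show "\<alpha> x ` integral_points X cells \<subseteq> integral_points X cells" "\<alpha> (- x) ` integral_points X cells \<subseteq> integral_points X cells"
    using assms m by blast+
qed

lemma finite_cells_containing:
  assumes "w \<in> \<Union>cells"
  shows "finite {\<delta> \<in> cells. w \<in> \<delta>}"
proof -
  obtain v q i where w: "w = (v, q, i)" by (metis prod_cases3)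
  have "{\<delta> \<in> cells. w \<in> \<delta>} \<subseteq> (\<lambda>\<delta>'. pullback_cell X r \<rho>' \<delta>' i) ` {\<delta>' \<in> C'. q \<in> \<delta>'}"
    unfolding pullback_cells_def w by (auto simp: pullback_cell_def)
  then show ?thesis using locally_finite[of q] finite_surj by blast
qed

lemma face_containing_rel_interior:
  assumes "\<delta> \<in> C'" "is_face \<rho>' F \<delta>" "q \<in> F" "\<rho>' q \<in> rel_interior (\<rho>' ` \<delta>)"
  shows "F = \<delta>"
proof -
  have "\<rho>' ` F = \<rho>' ` \<delta>"
    using assms subset_of_face_of[of "\<rho>' ` F" "\<rho>' ` \<delta>" "\<rho>' ` \<delta>"] unfolding is_face_def
    by (meson disjoint_iff face_of_imp_subset image_eqI order_antisym order_refl)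
  then show ?thesis using inj_on_image_eq_iff[OF cell_inj[OF assms(1)]] assms(2) unfolding is_face_def by blast
qed

lemma rel_interior_pullback:
  assumes "\<delta>' \<in> C'" "v \<in> rel_interior (fst ` pullback_cell X r \<rho>' \<delta>' i)"
  shows "r v \<in> rel_interior (\<rho>' ` \<delta>')"
proof -
  have "r ` (fst ` pullback_cell X r \<rho>' \<delta>' i) = \<rho>' ` \<delta>'"
  proof
    show "r ` fst ` pullback_cell X r \<rho>' \<delta>' i \<subseteq> \<rho>' ` \<delta>'" unfolding fst_pullback_cell by auto
    show "\<rho>' ` \<delta>' \<subseteq> r ` fst ` pullback_cell X r \<rho>' \<delta>' i"
    proof
      fix y assume "y \<in> \<rho>' ` \<delta>'"
      then obtain q where q: "q \<in> \<delta>'" "y = \<rho>' q" by blast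
      obtain v where "v \<in> span X" "r v = \<rho>' q" using cell'_lift[OF assms(1) q(1)] by blast
      then show "y \<in> r ` fst ` pullback_cell X r \<rho>' \<delta>' i" unfolding fst_pullback_cell using q by force
    qed
  qed
  moreover have "convex (fst ` pullback_cell X r \<rho>' \<delta>' i)"
  \<comment> \<open>Convexity of the projection does not depend on the index, but the lemma about
    cells needs one in \<open>I\<close>; without any the projection is treated directly as a linear
    preimage.\<close>
  proof (cases "\<exists>i. i \<in> I")
    case True
    then obtain j where "j \<in> I" by blast
    then have "pullback_cell X r \<rho>' \<delta>' j \<in> cells" using assms(1) unfolding pullback_cells_def by blast
    then show ?thesis using cell_convex_closed(1) by (metis fst_pullback_cell)
  next
    case False
    obtain V where V: "\<rho>' ` \<delta>' = convex hull V" using cell_polytope assms(1) by blast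
    have e: "fst ` pullback_cell X r \<rho>' \<delta>' i = span X \<inter> r -` (convex hull V)"
      unfolding fst_pullback_cell V by auto
    show ?thesis unfolding e
      by (intro convex_Int convex_linear_vimage r_linear convex_convex_hull subspace_imp_convex subspace_span)
  qed
  ultimately show ?thesis using rel_interior_convex_linear_image[OF r_linear] assms(2) by fastforce
qed

text \<open>Two polytopes that meet at a point share a face through it, and a face through a
  relative interior point is the whole polytope. The index of the copy is part of the point.\<close>

lemma cell_eq_of_rel_interior:
  assumes "\<delta> \<in> cells" "\<epsilon> \<in> cells" "q \<in> \<delta>" "q \<in> \<epsilon>"
    and "fst q \<in> rel_interior (fst ` \<delta>)" "fst q \<in> rel_interior (fst ` \<epsilon>)"
  shows "\<delta> = \<epsilon>"
proof -
  obtain \<delta>' i where \<delta>': "\<delta>' \<in> C'" "\<delta> = pullback_cell X r \<rho>' \<delta>' i"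
    using assms(1) unfolding pullback_cells_def by blast
  obtain \<epsilon>' j where \<epsilon>': "\<epsilon>' \<in> C'" "\<epsilon> = pullback_cell X r \<rho>' \<epsilon>' j"
    using assms(2) unfolding pullback_cells_def by blast
  obtain v q' k where q: "q = (v, q', k)" by (metis prod_cases3)
  have k: "k = i" "k = j" "q' \<in> \<delta>'" "q' \<in> \<epsilon>'" "r v = \<rho>' q'"
    using assms(3,4) q \<delta>' \<epsilon>' by (auto simp: pullback_cell_def)
  have "r v \<in> rel_interior (\<rho>' ` \<delta>')" "r v \<in> rel_interior (\<rho>' ` \<epsilon>')"
    using rel_interior_pullback \<delta>' \<epsilon>' assms(5,6) q by auto
  then have ri: "\<rho>' q' \<in> rel_interior (\<rho>' ` \<delta>')" "\<rho>' q' \<in> rel_interior (\<rho>' ` \<epsilon>')" using k(5) by auto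
  obtain F where F: "q' \<in> F" "is_face \<rho>' F \<delta>'" "is_face \<rho>' F \<epsilon>'"
    using cell_inter[OF \<delta>'(1) \<epsilon>'(1)] k by blast
  have "F = \<delta>'" "F = \<epsilon>'" using face_containing_rel_interior F ri \<delta>'(1) \<epsilon>'(1) by blast+
  then show ?thesis using \<delta>' \<epsilon>' k by simp
qed

lemma face_pullback_cell:
  assumes "\<delta> \<in> cells" "\<delta> = pullback_cell X r \<rho>' \<delta>' i" "\<delta>' \<in> C'" "is_face \<rho>' F \<delta>'"
  shows "pullback_cell X r \<rho>' F i \<in> cells" "pullback_cell X r \<rho>' F i \<subseteq> \<delta>"
proof -
  have F: "F \<in> C'" "F \<subseteq> \<delta>'" using face_cell[OF assms(3,4)] assms(4) by (auto simp: is_face_def)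
  obtain \<epsilon> j where "\<epsilon> \<in> C'" "j \<in> I" "\<delta> = pullback_cell X r \<rho>' \<epsilon> j"
    using assms(1) unfolding pullback_cells_def by blast
  then have "i \<in> I" using pullback_cell_eq(2) assms(2,3) by metis
  then show "pullback_cell X r \<rho>' F i \<in> cells" using F(1) unfolding pullback_cells_def by blast
  show "pullback_cell X r \<rho>' F i \<subseteq> \<delta>" unfolding assms(2) using F(2) by (auto simp: pullback_cell_def)
qed

lemma pullback_cell_shift:
  assumes "v \<in> fst ` pullback_cell X r \<rho>' \<delta> i" "k \<in> span X" "r k = 0"
  shows "v + k \<in> fst ` pullback_cell X r \<rho>' \<delta> i"
  using assms linear_add[OF r_linear] unfolding fst_pullback_cell by (auto simp: span_add)

text \<open>All points \<open>v + n x\<close> stay in the projected cell, while its image under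
  \<open>r\<close> is a polytope and hence bounded.\<close>

lemma stabilizer_kernel:
  assumes "\<delta> \<in> cells" "x \<in> X" "\<alpha> x ` \<delta> = \<delta>"
  shows "r x = 0"
proof -
  obtain \<delta>' i where \<delta>': "\<delta>' \<in> C'" "\<delta> = pullback_cell X r \<rho>' \<delta>' i"
    using assms(1) unfolding pullback_cells_def by blast
  obtain V where V: "finite V" "\<rho>' ` \<delta>' = convex hull V" using cell_polytope \<delta>'(1) by blast
  then have "bounded (\<rho>' ` \<delta>')" by (simp add: finite_imp_bounded_convex_hull)
  then obtain B where B: "\<And>y. y \<in> \<rho>' ` \<delta>' \<Longrightarrow> norm y \<le> B" unfolding bounded_iff by blast
  have step: "v + x \<in> fst ` \<delta>" if v: "v \<in> fst ` \<delta>" for v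
  proof -
    obtain q where q: "q \<in> \<delta>" "v = fst q" using v by blast
    then have "fst (\<alpha> x q) = v + x" using act_fst[OF assms(2)] assms(1) by blast
    then show ?thesis using q assms(3) by (metis image_eqI)
  qed
  obtain v where v: "v \<in> fst ` \<delta>" using cell_convex_closed(4)[OF assms(1)] by blast
  have "v + of_nat n *\<^sub>R x \<in> fst ` \<delta>" for n
  proof (induction n)
    case (Suc n)
    then show ?case using step[of "v + of_nat n *\<^sub>R x"] by (simp add: algebra_simps)
  qed (simp add: v)
  then have "r v + of_nat n *\<^sub>R r x \<in> \<rho>' ` \<delta>'" for n
    unfolding \<delta>'(2) fst_pullback_cell using linear_add[OF r_linear] linear_cmul[OF r_linear] by force
  then have *: "norm (r v + of_nat n *\<^sub>R r x) \<le> B" for n using B by blast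
  have le: "real n * norm (r x) \<le> 2 * B" for n
  proof -
    have "norm (real n *\<^sub>R r x) \<le> norm (r v + of_nat n *\<^sub>R r x) + norm (r v)"
      using norm_triangle_ineq4[of "r v + of_nat n *\<^sub>R r x" "r v"] by simp
    then show ?thesis using *[of n] *[of 0] by simp
  qed
  show ?thesis
  proof (rule ccontr)
    assume "r x \<noteq> 0"
    then obtain n :: nat where "2 * B / norm (r x) < real n" using reals_Archimedean2 by blast
    then show False using le[of n] \<open>r x \<noteq> 0\<close> by (simp add: field_simps)
  qed
qed

end

subsection \<open>The covering space\<close>

context fixed_torus_action
begin

abbreviation "Tan \<equiv> spc (analytification (torus X))"
abbreviation "Pan \<equiv> spc (analytification P)"
abbreviation tmult (infixl "\<odot>" 70) where "a \<odot> b \<equiv> a \<otimes>\<^bsub>torus_group X\<^esub> b"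
abbreviation "tinv a \<equiv> restrict (\<lambda>x. inverse (a x)) X"

lemma sheaf_P: "function_sheaf P" and diagonal_P: "closedin (spc (alg_prod P P)) ((\<lambda>x. (x, x)) ` pts P)"
  using P unfolding variety_def algebraic_space_def by blast+

lemma sheaf_G: "function_sheaf G" and diagonal_G: "closedin (spc (alg_prod G G)) ((\<lambda>x. (x, x)) ` pts G)"
  and group_G: "group \<G>" and carrier_G: "carrier \<G> = pts G"
  using G unfolding algebraic_group_def variety_def algebraic_space_def by blast+

lemma pts_Pan: "topspace Pan = pts P"
  using pts_analytification[OF sheaf_P] closed_diagonal_functions[OF diagonal_P] by blast

lemma pts_Tan: "topspace Tan = torus_pts X"
  by (rule pts_analytification_torus[OF X])

lemma Hausdorff_P: "Hausdorff_space Pan"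
  by (rule Hausdorff_analytification[OF sheaf_P diagonal_P])

lemma compact_P: "compact_space Pan"
proof -
  obtain N f where "closed_immersion P (proj_space N) f" using ample unfolding ample_divisor_def by blast
  then show ?thesis using compact_analytification[OF sheaf_P] pts_Pan by blast
qed

lemma \<pi>_pts: "z \<in> pts Pt \<Longrightarrow> \<pi> z \<in> pts P"
  using cmorphism_pts[OF \<pi>_holomorphic] pts_Pan by blast

lemma \<pi>_continuous: "continuous_map (spc Pt) Pan \<pi>"
  using \<pi>_holomorphic unfolding cmorphism_def by blast

lemma dk_pts: "x \<in> X \<Longrightarrow> z \<in> pts Pt \<Longrightarrow> dk x z \<in> pts Pt"
  using cmorphism_pts[OF dk_holomorphic] by blast

lemma dk_continuous: "x \<in> X \<Longrightarrow> continuous_map (spc Pt) (spc Pt) (dk x)"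
  using dk_holomorphic unfolding cmorphism_def by blast

lemma minus_X: "x \<in> X \<Longrightarrow> - x \<in> X" by (rule lattice_in_minus[OF X])

lemma dk_minus: "x \<in> X \<Longrightarrow> z \<in> pts Pt \<Longrightarrow> dk (- x) (dk x z) = z"
  "x \<in> X \<Longrightarrow> z \<in> pts Pt \<Longrightarrow> dk x (dk (- x) z) = z"
  using dk_add[of "- x" x z] dk_add[of x "- x" z] minus_X[of x] dk_zero by auto

lemma \<pi>_dk: "x \<in> X \<Longrightarrow> z \<in> pts Pt \<Longrightarrow> \<pi> (dk x z) = \<pi> z"
  using \<pi>_quotient[of z "dk x z"] dk_pts by auto

lemma dk_image:
  assumes *: "x \<in> X" "S \<subseteq> pts Pt"
  shows "dk x ` S = {z \<in> pts Pt. dk (- x) z \<in> S}"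
proof (rule Set.set_eqI, rule iffI)
  fix z assume "z \<in> dk x ` S"
  then show "z \<in> {z \<in> pts Pt. dk (- x) z \<in> S}" using * dk_pts dk_minus(1) by auto
next
  fix z assume z: "z \<in> {z \<in> pts Pt. dk (- x) z \<in> S}"
  then have "z = dk x (dk (- x) z)" using dk_minus(2) * by auto
  then show "z \<in> dk x ` S" using z by blast
qed

lemma dk_open: "x \<in> X \<Longrightarrow> openin (spc Pt) N \<Longrightarrow> openin (spc Pt) (dk x ` N)"
  using dk_image openin_subset openin_continuous_map_preimage[OF dk_continuous[OF minus_X]] by metis

lemma dk_closed: "x \<in> X \<Longrightarrow> closedin (spc Pt) N \<Longrightarrow> closedin (spc Pt) (dk x ` N)"
  using dk_image closedin_subset closedin_continuous_map_preimage[OF dk_continuous[OF minus_X]] by metis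

text \<open>An evenly covered set with its section made explicit: \<open>g\<close> is the inverse of
  \<open>\<pi>\<close> on the chosen sheet \<open>V\<close>, and the other sheets are the deck
  translates of \<open>V\<close>.\<close>

definition sheet :: "'p set \<Rightarrow> 'b set \<Rightarrow> ('p \<Rightarrow> 'b) \<Rightarrow> bool" where
  "sheet U V g \<longleftrightarrow> openin Pan U \<and> openin (spc Pt) V \<and>
     {z \<in> pts Pt. \<pi> z \<in> U} = (\<Union>x\<in>X. dk x ` V) \<and>
     (\<forall>x\<in>X. \<forall>y\<in>X. x \<noteq> y \<longrightarrow> dk x ` V \<inter> dk y ` V = {}) \<and>
     cmorphism (csubspace (analytification P) U) (csubspace Pt V) g \<and>
     (\<forall>p\<in>U. g p \<in> V \<and> \<pi> (g p) = p) \<and> (\<forall>z\<in>V. \<pi> z \<in> U \<and> g (\<pi> z) = z)"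

lemma sheet_exists:
  assumes "p \<in> pts P"
  obtains U V g where "sheet U V g" "p \<in> U"
proof -
  obtain U V where UV: "openin Pan U" "p \<in> U" "openin (spc Pt) V"
        "{z \<in> pts Pt. \<pi> z \<in> U} = (\<Union>x\<in>X. dk x ` V)"
        "\<forall>x\<in>X. \<forall>y\<in>X. x \<noteq> y \<longrightarrow> dk x ` V \<inter> dk y ` V = {}"
        "cisomorphism (csubspace Pt V) (csubspace (analytification P) U) \<pi>"
    using evenly_covered[OF assms] by blast
  have pV: "pts (csubspace Pt V) = V" using openin_subset[OF UV(3)] by (auto simp: pts_csubspace)
  have pU: "pts (csubspace (analytification P) U) = U" using openin_subset[OF UV(1)] by (auto simp: pts_csubspace)
  obtain g where g: "cmorphism (csubspace (analytification P) U) (csubspace Pt V) g"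
      "\<forall>x\<in>V. g (\<pi> x) = x" "\<forall>y\<in>U. \<pi> (g y) = y"
    using UV(6) pU pV unfolding cisomorphism_def by auto
  have gV: "g q \<in> V" if "q \<in> U" for q using cmorphism_pts[OF g(1), of q] that unfolding pU pV by blast
  have "cmorphism (csubspace Pt V) (csubspace (analytification P) U) \<pi>" using UV(6) unfolding cisomorphism_def by blast
  from cmorphism_pts[OF this] have \<pi>U: "\<pi> z \<in> U" if "z \<in> V" for z using that unfolding pU pV .
  have "sheet U V g" unfolding sheet_def
    by (intro conjI UV g(1) ballI gV \<pi>U) (use g UV(5) in auto)
  then show thesis using that UV(2) by blast
qed

lemma sheet_subset: "sheet U V g \<Longrightarrow> V \<subseteq> pts Pt" "sheet U V g \<Longrightarrow> U \<subseteq> pts P"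
  unfolding sheet_def using openin_subset pts_Pan by blast+

lemma sheet_cover: "sheet U V g \<Longrightarrow> z \<in> pts Pt \<Longrightarrow> \<pi> z \<in> U \<Longrightarrow> \<exists>x\<in>X. \<exists>v\<in>V. z = dk x v"
proof -
  assume s: "sheet U V g" "z \<in> pts Pt" "\<pi> z \<in> U"
  then have "z \<in> {z \<in> pts Pt. \<pi> z \<in> U}" by blast
  moreover have "{z \<in> pts Pt. \<pi> z \<in> U} = (\<Union>x\<in>X. dk x ` V)" using s(1) unfolding sheet_def by (elim conjE)
  ultimately show ?thesis by auto
qed

lemma sheet_\<pi>: "sheet U V g \<Longrightarrow> x \<in> X \<Longrightarrow> v \<in> V \<Longrightarrow> \<pi> (dk x v) = \<pi> v"
  using \<pi>_dk sheet_subset by blast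

lemma sheet_inverse: "sheet U V g \<Longrightarrow> v \<in> V \<Longrightarrow> \<pi> v \<in> U \<and> g (\<pi> v) = v"
  unfolding sheet_def by blast

lemma \<pi>_surj: "p \<in> pts P \<Longrightarrow> \<exists>z\<in>pts Pt. \<pi> z = p"
proof -
  assume "p \<in> pts P"
  then obtain U V g where "sheet U V g" "p \<in> U" by (rule sheet_exists)
  then have "g p \<in> V" "\<pi> (g p) = p" "openin (spc Pt) V" unfolding sheet_def by blast+
  then show ?thesis using openin_subset by blast
qed

text \<open>Near a point, the image of \<open>N\<close> is the preimage under the continuous section
  \<open>g\<close> of a deck translate of \<open>N\<close>.\<close>

lemma \<pi>_open:
  assumes N: "openin (spc Pt) N"
  shows "openin Pan (\<pi> ` N)"
proof (subst openin_subopen, safe)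
  fix y assume y: "y \<in> N"
  have yP: "y \<in> pts Pt" using y openin_subset[OF N] by blast
  obtain U V g where s: "sheet U V g" "\<pi> y \<in> U" by (rule sheet_exists[OF \<pi>_pts[OF yP]])
  obtain x v where x: "x \<in> X" "v \<in> V" "y = dk x v" using sheet_cover[OF s(1) yP s(2)] by blast
  have oV: "openin (spc Pt) V" and oU: "openin Pan U" using s unfolding sheet_def by blast+
  have VP: "V \<subseteq> pts Pt" using openin_subset[OF oV] .
  have "openin (spc Pt) {v \<in> pts Pt. dk x v \<in> N}" by (rule openin_continuous_map_preimage[OF dk_continuous[OF x(1)] N])
  then have "openin (subtopology (spc Pt) V) ({v \<in> pts Pt. dk x v \<in> N} \<inter> V)" by (auto simp: openin_subtopology)
  moreover have "continuous_map (subtopology Pan U) (subtopology (spc Pt) V) g"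
    using s unfolding sheet_def cmorphism_def csubspace_def by simp
  ultimately have "openin (subtopology Pan U) {p \<in> topspace (subtopology Pan U). g p \<in> {v \<in> pts Pt. dk x v \<in> N} \<inter> V}"
    by (rule openin_continuous_map_preimage[rotated])
  then have o: "openin Pan {p \<in> topspace (subtopology Pan U). g p \<in> {v \<in> pts Pt. dk x v \<in> N} \<inter> V}"
    using oU openin_trans_full by blast
  moreover have "\<pi> y = \<pi> v" using x sheet_\<pi>[OF s(1)] by auto
  then have "\<pi> y \<in> {p \<in> topspace (subtopology Pan U). g p \<in> {v \<in> pts Pt. dk x v \<in> N} \<inter> V}"
    using s x y VP openin_subset[OF oU] unfolding sheet_def by auto
  moreover have "{p \<in> topspace (subtopology Pan U). g p \<in> {v \<in> pts Pt. dk x v \<in> N} \<inter> V} \<subseteq> \<pi> ` N"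
  proof
    fix p assume "p \<in> {p \<in> topspace (subtopology Pan U). g p \<in> {v \<in> pts Pt. dk x v \<in> N} \<inter> V}"
    then have p: "p \<in> U" "dk x (g p) \<in> N" "g p \<in> V" by auto
    have "\<pi> (g p) = p" using p(1) s(1) unfolding sheet_def by blast
    then have "\<pi> (dk x (g p)) = p" using sheet_\<pi>[OF s(1) x(1) p(3)] by simp
    then show "p \<in> \<pi> ` N" using p(2) by (metis imageI)
  qed
  ultimately show "\<exists>T. openin Pan T \<and> \<pi> y \<in> T \<and> T \<subseteq> \<pi> ` N" by blast
qed

text \<open>Points with different images are separated in \<open>P\<close>; points of one fibre lie
  in different, hence disjoint, translates of a sheet.\<close>

lemma Hausdorff_Pt: "Hausdorff_space (spc Pt)"
  unfolding Hausdorff_space_def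
proof (intro allI impI, elim conjE)
  fix z w assume zw: "z \<in> pts Pt" "w \<in> pts Pt" "z \<noteq> w"
  show "\<exists>U V. openin (spc Pt) U \<and> openin (spc Pt) V \<and> z \<in> U \<and> w \<in> V \<and> disjnt U V"
  proof (cases "\<pi> z = \<pi> w")
    case False
    then obtain U V where UV: "openin Pan U" "openin Pan V" "\<pi> z \<in> U" "\<pi> w \<in> V" "disjnt U V"
      using Hausdorff_P \<pi>_pts zw pts_Pan unfolding Hausdorff_space_def by metis
    have "openin (spc Pt) {z \<in> pts Pt. \<pi> z \<in> U}" "openin (spc Pt) {z \<in> pts Pt. \<pi> z \<in> V}"
      using openin_continuous_map_preimage[OF \<pi>_continuous] UV by auto
    moreover have "disjnt {z \<in> pts Pt. \<pi> z \<in> U} {z \<in> pts Pt. \<pi> z \<in> V}" using UV(5) unfolding disjnt_def by blast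
    ultimately show ?thesis using UV zw
      by (intro exI[of _ "{z \<in> pts Pt. \<pi> z \<in> U}"] exI[of _ "{z \<in> pts Pt. \<pi> z \<in> V}"]) auto
  next
    case True
    obtain U V g where s: "sheet U V g" "\<pi> z \<in> U" by (rule sheet_exists[OF \<pi>_pts[OF zw(1)]])
    obtain x v where x: "x \<in> X" "v \<in> V" "z = dk x v" using sheet_cover[OF s(1) zw(1) s(2)] by blast
    obtain y v' where y: "y \<in> X" "v' \<in> V" "w = dk y v'" using sheet_cover[OF s(1) zw(2)] s(2) True by auto
    note xy = x(1) y(1) x(2) y(2) x(3) y(3)
    have oV: "openin (spc Pt) V" using s unfolding sheet_def by blast
    have "x \<noteq> y"
    proof
      assume "x = y"
      have "\<pi> v = \<pi> v'" using True xy sheet_\<pi>[OF s(1)] by auto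
      then have "v = v'" using sheet_inverse[OF s(1)] xy by metis
      then show False using zw(3) xy \<open>x = y\<close> by simp
    qed
    then have "disjnt (dk x ` V) (dk y ` V)" using s xy unfolding sheet_def disjnt_def by blast
    then show ?thesis using xy dk_open[OF _ oV]
      by (intro exI[of _ "dk x ` V"] exI[of _ "dk y ` V"]) auto
  qed
qed

text \<open>The covering space is assumed only to carry a sheaf of functions. That its functions are
  continuous is transported from the analytification of \<open>P\<close> along the sheets.\<close>

lemma Pt_funs_continuous:
  assumes h: "h \<in> funs Pt W"
  shows "h \<in> funs (continuous_space (spc Pt)) W"
proof (rule function_sheaf_local[OF function_sheaf_continuous_space])
  have oW: "openin (spc Pt) W" by (rule function_sheaf_open[OF Pt h])
  then show "openin (spc (continuous_space (spc Pt))) W" by simp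
  fix z assume z: "z \<in> W"
  have zP: "z \<in> pts Pt" using z openin_subset[OF oW] by blast
  obtain U V g where s: "sheet U V g" "\<pi> z \<in> U" by (rule sheet_exists[OF \<pi>_pts[OF zP]])
  obtain x v where x: "x \<in> X" "v \<in> V" "z = dk x v" using sheet_cover[OF s(1) zP s(2)] by blast
  have oV: "openin (spc Pt) V" and oU: "openin Pan U" using s unfolding sheet_def by blast+
  have VP: "V \<subseteq> pts Pt" using openin_subset[OF oV] .
  define h' where "h' = h \<circ> dk x"
  define W' where "W' = {y \<in> pts Pt. dk x y \<in> W}"
  have "h' \<in> funs Pt W'" unfolding h'_def W'_def using dk_holomorphic[OF x(1)] h unfolding cmorphism_def by blast
  then have h1: "h' \<in> funs (csubspace Pt V) (W' \<inter> V)" by (rule funs_csubspace[OF Pt])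
  define W1 where "W1 = {p \<in> pts (csubspace (analytification P) U). g p \<in> W' \<inter> V}"
  have hg: "h' \<circ> g \<in> funs (csubspace (analytification P) U) W1"
    unfolding W1_def using s h1 unfolding sheet_def cmorphism_def by blast
  have pz: "\<pi> z = \<pi> v" using x sheet_\<pi>[OF s(1)] by auto
  have gv: "g (\<pi> z) = v" using sheet_inverse[OF s(1) x(2)] pz by simp
  have "\<pi> z \<in> W1" unfolding W1_def pts_csubspace using s gv x z VP openin_subset[OF oU] by (auto simp: W'_def)
  then have "\<exists>U1. \<exists>k\<in>funs (analytification P) U1. \<pi> z \<in> U1 \<and> (\<forall>y\<in>U1 \<inter> W1. (h' \<circ> g) y = k y)"
    using hg unfolding csubspace_def by simp
  then obtain U1 k where k: "k \<in> funs (analytification P) U1" "\<pi> z \<in> U1" "\<forall>y\<in>U1 \<inter> W1. (h' \<circ> g) y = k y" by blast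
  have kc: "k \<in> funs (continuous_space Pan) U1"
    using an_space_funs_continuous k(1) unfolding analytification_def by blast
  define N where "N = dk x ` (V \<inter> W') \<inter> {y \<in> pts Pt. \<pi> y \<in> U1}"
  have oW': "openin (spc Pt) W'" unfolding W'_def by (rule openin_continuous_map_preimage[OF dk_continuous[OF x(1)] oW])
  have oU1: "openin Pan U1" using kc by (simp add: continuous_space_funs)
  have oN: "openin (spc Pt) N" unfolding N_def
    by (intro openin_Int dk_open x oV oW' openin_continuous_map_preimage[OF \<pi>_continuous oU1])
  have eq: "h y = (k \<circ> \<pi>) y" if "y \<in> N" for y
  proof -
    obtain v' where v': "v' \<in> V" "v' \<in> W'" "y = dk x v'" "\<pi> y \<in> U1" using \<open>y \<in> N\<close> unfolding N_def by blast
    have "\<pi> y = \<pi> v'" using v' sheet_\<pi>[OF s(1) x(1)] by auto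
    then have "g (\<pi> y) = v'" "\<pi> y \<in> U" using sheet_inverse[OF s(1) v'(1)] by auto
    then have "\<pi> y \<in> W1" unfolding W1_def pts_csubspace using v' openin_subset[OF oU] by auto
    then have "(h' \<circ> g) (\<pi> y) = k (\<pi> y)" using k(3) v'(4) by blast
    then show ?thesis using \<open>g (\<pi> y) = v'\<close> v' by (simp add: h'_def)
  qed
  have "continuous_map (subtopology (spc Pt) N) (subtopology Pan U1) \<pi>"
    using \<pi>_continuous by (auto simp: continuous_map_in_subtopology N_def intro: continuous_map_from_subtopology)
  moreover have "continuous_map (subtopology Pan U1) euclidean k" using kc by (simp add: continuous_space_funs)
  ultimately have "continuous_map (subtopology (spc Pt) N) euclidean (k \<circ> \<pi>)" by (rule continuous_map_compose)
  then have "continuous_map (subtopology (spc Pt) N) euclidean h" by (rule continuous_map_eq) (use eq in auto)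
  moreover have "z \<in> N" unfolding N_def using x z zP k(2) VP by (auto simp: W'_def)
  moreover have "N \<subseteq> W" unfolding N_def W'_def by auto
  ultimately show "\<exists>N. z \<in> N \<and> N \<subseteq> W \<and> h \<in> funs (continuous_space (spc Pt)) N"
    using oN by (intro exI[of _ N]) (simp add: continuous_space_funs)
qed

text \<open>The sheets over \<open>U\<close> are open and pairwise disjoint, so a connected set over
  \<open>U\<close> cannot pass from one to another. This takes the place of path lifting.\<close>

lemma connected_in_sheet:
  assumes s: "sheet U V g" and S: "connectedin (spc Pt) S" "\<pi> ` S \<subseteq> U" and x: "x \<in> X" "S \<inter> dk x ` V \<noteq> {}"
  shows "S \<subseteq> dk x ` V"
proof -
  have oV: "openin (spc Pt) V" using s unfolding sheet_def by blast
  define R where "R = (\<Union>y\<in>X - {x}. dk y ` V)"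
  have "openin (spc Pt) R" unfolding R_def using dk_open oV by blast
  moreover have "openin (spc Pt) (dk x ` V)" by (rule dk_open[OF x(1) oV])
  moreover have "S \<subseteq> dk x ` V \<union> R"
  proof
    fix z assume z: "z \<in> S"
    then have "z \<in> {z \<in> pts Pt. \<pi> z \<in> U}" using S connectedin_subset_topspace by blast
    then have "z \<in> (\<Union>x\<in>X. dk x ` V)" using s unfolding sheet_def by blast
    then show "z \<in> dk x ` V \<union> R" unfolding R_def by blast
  qed
  moreover have "dk x ` V \<inter> R = {}" unfolding R_def using s x(1) unfolding sheet_def by blast
  ultimately have "S \<inter> R = {}" using S(1) x(2) unfolding connectedin by blast
  then show ?thesis using \<open>S \<subseteq> dk x ` V \<union> R\<close> by blast
qed

lemma sheet_inj:
  assumes s: "sheet U V g" and x: "x \<in> X" and zw: "z \<in> dk x ` V" "w \<in> dk x ` V" "\<pi> z = \<pi> w"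
  shows "z = w"
proof -
  obtain v v' where v: "v \<in> V" "v' \<in> V" "z = dk x v" "w = dk x v'" using zw by blast
  then have "\<pi> v = \<pi> v'" using zw(3) sheet_\<pi>[OF s x] by auto
  then have "v = v'" using sheet_inverse[OF s] v by metis
  then show ?thesis using v by simp
qed

section \<open>Continuity of the torus action on the covering\<close>

lemma ta_topspace: "pts (an_prod (analytification (torus X)) Pt) = torus_pts X \<times> pts Pt"
proof -
  have c: "(\<lambda>_. 0) \<in> funs (analytification (torus X)) (torus_pts X)"
    unfolding analytification_def
    by (rule an_space_const) (use pts_Tan openin_topspace[of Tan] in \<open>simp add: analytification_def\<close>)
  have sub: "U \<subseteq> torus_pts X" if "f \<in> funs (analytification (torus X)) U" for f U
    using that an_space_funs_continuous openin_subset[of Tan U] pts_Tan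
    unfolding analytification_def continuous_space_funs by blast
  have sub2: "V \<subseteq> pts Pt" if "f \<in> funs Pt V" for f V using function_sheaf_open[OF Pt that] openin_subset by blast
  show ?thesis
  proof
    show "pts (an_prod (analytification (torus X)) Pt) \<subseteq> torus_pts X \<times> pts Pt"
      unfolding an_prod_def pts_an_space
    proof (rule Union_least)
      fix D assume "D \<in> fst ` ({(U \<times> V, f \<circ> fst) |U V f. f \<in> funs (analytification (torus X)) U \<and> openin (spc Pt) V} \<union>
        {(U \<times> V, g \<circ> snd) |U V g. openin Tan U \<and> g \<in> funs Pt V})"
      then consider (a) U V f where "D = U \<times> V" "f \<in> funs (analytification (torus X)) U" "openin (spc Pt) V"
        | (b) U V f where "D = U \<times> V" "openin Tan U" "f \<in> funs Pt V" by auto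
      then show "D \<subseteq> torus_pts X \<times> pts Pt"
      proof cases
        case a
        then show ?thesis using sub[OF a(2)] openin_subset[OF a(3)] by auto
      next
        case b
        then show ?thesis using sub2[OF b(3)] openin_subset[OF b(2)] pts_Tan by auto
      qed
    qed
    have "(torus_pts X \<times> pts Pt, (\<lambda>_. 0) \<circ> fst) \<in>
      {(U \<times> V, f \<circ> fst) |U V f. f \<in> funs (analytification (torus X)) U \<and> openin (spc Pt) V} \<union>
      {(U \<times> V, g \<circ> snd) |U V g. openin Tan U \<and> g \<in> funs Pt V}"
      by (intro UnI1 CollectI exI[of _ "torus_pts X"] exI[of _ "pts Pt"] exI[of _ "\<lambda>_. 0"] conjI refl c openin_topspace)
    from Union_upper[OF imageI[OF this, of fst]] show "torus_pts X \<times> pts Pt \<subseteq> pts (an_prod (analytification (torus X)) Pt)"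
      unfolding an_prod_def pts_an_space fst_conv .
  qed
qed

lemma ta_pts: "a \<in> torus_pts X \<Longrightarrow> z \<in> pts Pt \<Longrightarrow> ta a z \<in> pts Pt"
  using cmorphism_pts[OF ta_holomorphic, of "(a, z)"] ta_topspace by auto

text \<open>The product is topologized by functions pulled back from the factors. These are
  continuous, by \<open>Pt_funs_continuous\<close> for the covering, so a pair of continuous maps is
  continuous into it.\<close>

lemma continuous_map_an_prod:
  assumes k: "continuous_map T Tan k1" "continuous_map T (spc Pt) k2"
  shows "continuous_map T (spc (an_prod (analytification (torus X)) Pt)) (\<lambda>y. (k1 y, k2 y))"
proof -
  define \<D> where "\<D> = {(U \<times> V, f \<circ> fst) |U V f. f \<in> funs (analytification (torus X)) U \<and> openin (spc Pt) V} \<union>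
      {(U \<times> V, g \<circ> snd) |U V g. openin Tan U \<and> g \<in> funs Pt V}"
  have spc: "spc (an_prod (analytification (torus X)) Pt) = topology_generated_by {{x \<in> D. f x \<in> S} |D f S. (D, f) \<in> \<D> \<and> open S}"
    unfolding an_prod_def an_space_def Let_def \<D>_def by simp
  have top: "topspace (topology_generated_by {{x \<in> D. f x \<in> S} |D f S. (D, f) \<in> \<D> \<and> open S}) = torus_pts X \<times> pts Pt"
    using ta_topspace unfolding spc .
  have 1: "openin T {y \<in> topspace T. k1 y \<in> U}" if "openin Tan U" for U
    using openin_continuous_map_preimage[OF k(1) that] .
  have 2: "openin T {y \<in> topspace T. k2 y \<in> V}" if "openin (spc Pt) V" for V
    using openin_continuous_map_preimage[OF k(2) that] .
  have *: "openin T {y \<in> topspace T. (k1 y, k2 y) \<in> D \<and> f (k1 y, k2 y) \<in> S}" if Df: "(D, f) \<in> \<D>" and S: "open S" for D f S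
  proof -
    consider (a) U V f' where "D = U \<times> V" "f = f' \<circ> fst" "f' \<in> funs (analytification (torus X)) U" "openin (spc Pt) V"
      | (b) U V f' where "D = U \<times> V" "f = f' \<circ> snd" "openin Tan U" "f' \<in> funs Pt V"
      using Df unfolding \<D>_def by blast
    then show ?thesis
    proof cases
      case a
      have "f' \<in> funs (continuous_space Tan) U"
        using a(3) an_space_funs_continuous unfolding analytification_def by blast
      then have "openin Tan {x \<in> U. f' x \<in> S}" using S by (simp add: continuous_space_def)
      then have "openin T ({y \<in> topspace T. k1 y \<in> {x \<in> U. f' x \<in> S}} \<inter> {y \<in> topspace T. k2 y \<in> V})"
        using 1 2 a(4) by blast
      moreover have "{y \<in> topspace T. k1 y \<in> {x \<in> U. f' x \<in> S}} \<inter> {y \<in> topspace T. k2 y \<in> V} =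
          {y \<in> topspace T. (k1 y, k2 y) \<in> D \<and> f (k1 y, k2 y) \<in> S}" using a by auto
      ultimately show ?thesis by simp
    next
      case b
      have "f' \<in> funs (continuous_space (spc Pt)) V" by (rule Pt_funs_continuous[OF b(4)])
      then have "openin (spc Pt) {x \<in> V. f' x \<in> S}" using S by (simp add: continuous_space_def)
      then have "openin T ({y \<in> topspace T. k1 y \<in> U} \<inter> {y \<in> topspace T. k2 y \<in> {x \<in> V. f' x \<in> S}})"
        using 1 2 b(3) by blast
      moreover have "{y \<in> topspace T. k1 y \<in> U} \<inter> {y \<in> topspace T. k2 y \<in> {x \<in> V. f' x \<in> S}} =
          {y \<in> topspace T. (k1 y, k2 y) \<in> D \<and> f (k1 y, k2 y) \<in> S}" using b by auto
      ultimately show ?thesis by simp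
    qed
  qed
  show ?thesis
    unfolding spc continuous_on_generated_topo_iff
  proof (intro conjI allI impI)
    fix W assume "W \<in> {{x \<in> D. f x \<in> S} |D f S. (D, f) \<in> \<D> \<and> open S}"
    then obtain D f S where W: "W = {x \<in> D. f x \<in> S}" "(D, f) \<in> \<D>" "open S" by blast
    have "(\<lambda>y. (k1 y, k2 y)) -` W \<inter> topspace T = {y \<in> topspace T. (k1 y, k2 y) \<in> D \<and> f (k1 y, k2 y) \<in> S}"
      unfolding W(1) by auto
    then show "openin T ((\<lambda>y. (k1 y, k2 y)) -` W \<inter> topspace T)" using *[OF W(2,3)] by simp
  next
    have "(\<lambda>y. (k1 y, k2 y)) ` topspace T \<subseteq> torus_pts X \<times> pts Pt"
      using continuous_map_image_subset_topspace[OF k(1)] continuous_map_image_subset_topspace[OF k(2)] pts_Tan by auto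
    then show "(\<lambda>y. (k1 y, k2 y)) ` topspace T \<subseteq> \<Union> {{x \<in> D. f x \<in> S} |D f S. (D, f) \<in> \<D> \<and> open S}"
      using top unfolding topology_generated_by_topspace by simp
  qed
qed

lemma ta_continuous_pair:
  assumes k: "continuous_map T Tan k1" "continuous_map T (spc Pt) k2"
  shows "continuous_map T (spc Pt) (\<lambda>y. ta (k1 y) (k2 y))"
proof -
  have "continuous_map (spc (an_prod (analytification (torus X)) Pt)) (spc Pt) (\<lambda>(a, z). ta a z)"
    using ta_holomorphic unfolding cmorphism_def by blast
  from continuous_map_compose[OF continuous_map_an_prod[OF k] this] show ?thesis by (simp add: o_def)
qed

lemma ta_continuous: "a \<in> torus_pts X \<Longrightarrow> continuous_map (spc Pt) (spc Pt) (ta a)"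
  using ta_continuous_pair[of "spc Pt" "\<lambda>_. a" "\<lambda>z. z"] pts_Tan by simp

end

subsection \<open>Torus orbits and the linearization\<close>

context fixed_torus_action
begin

abbreviation "Lf z \<equiv> bundle_fibre P \<Theta> 1 (\<pi> z)"
abbreviation "Zc z \<equiv> orbit_closure X Pt ta z"
abbreviation "orb z \<equiv> (\<lambda>a. ta a z) ` torus_pts X"
abbreviation "eig \<equiv> eigensection X P \<Theta> Pt \<pi> ta lin"

lemma tmult_closed: "a \<in> torus_pts X \<Longrightarrow> b \<in> torus_pts X \<Longrightarrow> a \<odot> b \<in> torus_pts X"
  by (rule torus_mult_closed[OF X])

lemma tinv_closed: "a \<in> torus_pts X \<Longrightarrow> tinv a \<in> torus_pts X"
  by (rule torus_inv_closed[OF X])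

lemma tinv_tmult: "a \<in> torus_pts X \<Longrightarrow> tinv a \<odot> a = \<one>\<^bsub>torus_group X\<^esub>"
  using torus_mult_inv[OF X] torus_mult_commute by metis

lemma ta_tinv: "a \<in> torus_pts X \<Longrightarrow> z \<in> pts Pt \<Longrightarrow> ta (tinv a) (ta a z) = z"
  using ta_mult[OF tinv_closed] tinv_tmult ta_one by metis

lemma ta_tinv': "a \<in> torus_pts X \<Longrightarrow> z \<in> pts Pt \<Longrightarrow> ta a (ta (tinv a) z) = z"
  using ta_mult[OF _ tinv_closed] torus_mult_inv[OF X] ta_one by metis

lemma ta_commute: "a \<in> torus_pts X \<Longrightarrow> b \<in> torus_pts X \<Longrightarrow> z \<in> pts Pt \<Longrightarrow> ta a (ta b z) = ta b (ta a z)"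
  using ta_mult torus_mult_commute by metis

lemma orb_subset: "z \<in> pts Pt \<Longrightarrow> orb z \<subseteq> pts Pt"
  using ta_pts by blast

lemma orb_self: "z \<in> pts Pt \<Longrightarrow> z \<in> orb z"
  using ta_one torus_one_closed[OF X] by (metis imageI)

lemma orb_eq:
  assumes "z \<in> pts Pt" "a \<in> torus_pts X"
  shows "orb (ta a z) = orb z"
proof
  show "orb (ta a z) \<subseteq> orb z"
  proof
    fix y assume "y \<in> orb (ta a z)"
    then obtain b where b: "b \<in> torus_pts X" "y = ta b (ta a z)" by blast
    then have "y = ta (b \<odot> a) z" using ta_mult[OF b(1) assms(2,1)] by simp
    then show "y \<in> orb z" using tmult_closed[OF b(1) assms(2)] by blast
  qed
  show "orb z \<subseteq> orb (ta a z)"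
  proof
    fix y assume "y \<in> orb z"
    then obtain b where b: "b \<in> torus_pts X" "y = ta b z" by blast
    have "y = ta (b \<odot> tinv a) (ta a z)"
      using ta_mult[OF b(1) tinv_closed[OF assms(2)] ta_pts[OF assms(2,1)]] ta_tinv[OF assms(2,1)] b(2) by simp
    then show "y \<in> orb (ta a z)" using tmult_closed[OF b(1) tinv_closed[OF assms(2)]] by blast
  qed
qed

lemma Zc_closed: "closedin (spc Pt) (Zc z)"
  unfolding orbit_closure_def by (rule closedin_closure_of)

lemma Zc_subset: "Zc z \<subseteq> pts Pt"
  using Zc_closed closedin_subset by blast

lemma orb_Zc: "z \<in> pts Pt \<Longrightarrow> orb z \<subseteq> Zc z"
  unfolding orbit_closure_def by (rule closure_of_subset[OF orb_subset])

lemma Zc_self: "z \<in> pts Pt \<Longrightarrow> z \<in> Zc z"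
  using orb_self orb_Zc by blast

lemma Zc_eq: "z \<in> pts Pt \<Longrightarrow> a \<in> torus_pts X \<Longrightarrow> Zc (ta a z) = Zc z"
  unfolding orbit_closure_def using orb_eq by simp

lemma Zc_invariant:
  assumes z: "z \<in> pts Pt" and a: "a \<in> torus_pts X" and y: "y \<in> Zc z"
  shows "ta a y \<in> Zc z"
proof -
  have "ta a ` (spc Pt closure_of orb z) \<subseteq> spc Pt closure_of (ta a ` orb z)"
    using ta_continuous[OF a] by (metis continuous_map_image_closure_subset)
  moreover have "ta a ` orb z \<subseteq> orb z"
  proof safe
    fix b assume b: "b \<in> torus_pts X"
    have "ta a (ta b z) = ta (a \<odot> b) z" using ta_mult[OF a b z] by simp
    then show "ta a (ta b z) \<in> orb z" using tmult_closed[OF a b] by blast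
  qed
  ultimately show ?thesis using y closure_of_mono unfolding orbit_closure_def by (metis imageI subsetD)
qed

lemma Zc_minimal:
  assumes z: "z \<in> pts Pt" and S: "closedin (spc Pt) S" "z \<in> S" "\<And>a y. a \<in> torus_pts X \<Longrightarrow> y \<in> S \<Longrightarrow> ta a y \<in> S"
  shows "Zc z \<subseteq> S"
  unfolding orbit_closure_def using S by (intro closure_of_minimal) auto

lemma Zc_mono: "z \<in> pts Pt \<Longrightarrow> y \<in> Zc z \<Longrightarrow> Zc y \<subseteq> Zc z"
  using Zc_minimal[OF _ Zc_closed] Zc_invariant Zc_subset by blast

lemma Zc_dk:
  assumes x: "x \<in> X" and z: "z \<in> pts Pt"
  shows "Zc (dk x z) = dk x ` Zc z"
proof -
  have *: "Zc (dk y w) \<subseteq> dk y ` Zc w" if y: "y \<in> X" and w: "w \<in> pts Pt" for y w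
  proof (rule Zc_minimal[OF dk_pts[OF y w] dk_closed[OF y Zc_closed]])
    show "dk y w \<in> dk y ` Zc w" using Zc_self[OF w] by blast
    fix a v assume a: "a \<in> torus_pts X" and "v \<in> dk y ` Zc w"
    then obtain u where u: "u \<in> Zc w" "v = dk y u" by blast
    have "ta a v = dk y (ta a u)" using ta_dk[OF a y] u Zc_subset by blast
    then show "ta a v \<in> dk y ` Zc w" using Zc_invariant[OF w a u(1)] by blast
  qed
  have "Zc z = Zc (dk (- x) (dk x z))" using dk_minus(1)[OF x z] by simp
  then have "Zc z \<subseteq> dk (- x) ` Zc (dk x z)" using *[OF minus_X[OF x] dk_pts[OF x z]] by simp
  then have "dk x ` Zc z \<subseteq> dk x ` dk (- x) ` Zc (dk x z)" by blast
  also have "\<dots> = Zc (dk x z)" unfolding image_image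
    using dk_minus(2)[OF x] Zc_subset by (intro image_cong[where g = id, simplified]) auto
  finally show ?thesis using *[OF x z] by blast
qed

lemma cell_in: "z \<in> pts Pt \<Longrightarrow> cell (Zc z) \<in> cells"
  using cell_bij unfolding bij_betw_def by blast

lemma cell_onto: "\<delta> \<in> cells \<Longrightarrow> \<exists>z\<in>pts Pt. cell (Zc z) = \<delta>"
proof -
  assume "\<delta> \<in> cells"
  then have "\<delta> \<in> cell ` (orbit_closure X Pt ta ` pts Pt)" using cell_bij unfolding bij_betw_def by simp
  then show ?thesis by auto
qed

lemma cell_subset_iff: "z \<in> pts Pt \<Longrightarrow> y \<in> pts Pt \<Longrightarrow> cell (Zc z) \<subseteq> cell (Zc y) \<longleftrightarrow> Zc z \<subseteq> Zc y"
  using cell_mono by blast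

lemma cell_eq_iff: "z \<in> pts Pt \<Longrightarrow> y \<in> pts Pt \<Longrightarrow> cell (Zc z) = cell (Zc y) \<longleftrightarrow> Zc z = Zc y"
  using cell_subset_iff by (metis order_antisym order_refl)

lemma cell_dk: "z \<in> pts Pt \<Longrightarrow> x \<in> X \<Longrightarrow> cell (Zc (dk x z)) = \<alpha> x ` cell (Zc z)"
  using cell_equivariant[of "Zc z" x] Zc_dk by auto

section \<open>Fibres of the line bundle and eigensections\<close>

lemma index_exists: "p \<in> pts P \<Longrightarrow> \<exists>i\<in>\<Theta>. p \<in> fst i"
proof -
  assume "p \<in> pts P"
  moreover have "(\<Union>i\<in>\<Theta>. fst i) = pts P" using cartier unfolding effective_cartier_def by (elim conjE)
  ultimately show ?thesis by auto
qed

lemma index_open: "i \<in> \<Theta> \<Longrightarrow> snd i \<in> funs P (fst i)"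
proof -
  assume i: "i \<in> \<Theta>"
  have "\<forall>(U, f)\<in>\<Theta>. f \<in> funs P U \<and>
        (\<forall>V h. V \<subseteq> U \<and> h \<in> funs P V \<and> (\<forall>p\<in>V. f p * h p = 0) \<longrightarrow> (\<forall>p\<in>V. h p = 0))"
    using cartier unfolding effective_cartier_def by (elim conjE)
  from bspec[OF this i] show ?thesis unfolding case_prod_unfold by (rule conjunct1)
qed

text \<open>One transition unit \<open>u\<close> serves the local equations and, through its powers,
  all bundles \<open>\<O>(m\<Theta>)\<close> at once; this is why quotients by powers of
  \<open>\<theta>\<close> do not depend on the index.\<close>

lemma fibre_change:
  assumes "i \<in> \<Theta>" "j \<in> \<Theta>" "p \<in> fst i" "p \<in> fst j"
  obtains u where "u \<noteq> 0" "snd i p = u * snd j p" "\<And>m v. v \<in> bundle_fibre P \<Theta> m p \<Longrightarrow> v i = u ^ m * v j"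
proof -
  have "\<forall>(U, f)\<in>\<Theta>. \<forall>(V, g)\<in>\<Theta>. \<exists>u\<in>funs P (U \<inter> V). \<forall>p\<in>U \<inter> V. u p \<noteq> 0 \<and> f p = u p * g p"
    using cartier unfolding effective_cartier_def by (elim conjE)
  from bspec[OF this assms(1)]
  have "\<forall>(V, g)\<in>\<Theta>. \<exists>u\<in>funs P (fst i \<inter> V). \<forall>p\<in>fst i \<inter> V. u p \<noteq> 0 \<and> snd i p = u p * g p"
    unfolding case_prod_unfold .
  from bspec[OF this assms(2)]
  have "\<exists>u\<in>funs P (fst i \<inter> fst j). \<forall>p\<in>fst i \<inter> fst j. u p \<noteq> 0 \<and> snd i p = u p * snd j p"
    unfolding case_prod_unfold .
  then obtain u where u: "u \<in> funs P (fst i \<inter> fst j)" "\<And>p. p \<in> fst i \<inter> fst j \<Longrightarrow> u p \<noteq> 0 \<and> snd i p = u p * snd j p" by blast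
  have "v i = u p ^ m * v j" if "v \<in> bundle_fibre P \<Theta> m p" for m v
    using that assms u unfolding bundle_fibre_def by blast
  then show thesis using that[of "u p"] u(2)[of p] assms by auto
qed

lemma fibre_zero:
  assumes v: "v \<in> bundle_fibre P \<Theta> m p" and i: "i \<in> \<Theta>" "p \<in> fst i" "v i = 0"
  shows "v = (\<lambda>_. 0)"
proof
  fix j
  show "v j = 0"
  proof (cases "j \<in> \<Theta> \<and> p \<in> fst j")
    case True
    then show ?thesis using fibre_change[of j i p] i v by (metis mult_zero_right)
  next
    case False
    then show ?thesis using v unfolding bundle_fibre_def by blast
  qed
qed

text \<open>A nonzero factor can always be taken: if the factor is 0, invertibility of the
  linearized action forces the coordinates of all fibre vectors to vanish, and then 1 does as
  well.\<close>

lemma lin_coordinate: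
  assumes a: "a \<in> torus_pts X" and z: "z \<in> pts Pt" and i: "i \<in> \<Theta>" "\<pi> z \<in> fst i" and j: "j \<in> \<Theta>" "\<pi> (ta a z) \<in> fst j"
  obtains \<mu> where "\<mu> \<noteq> 0" "\<And>v. v \<in> Lf z \<Longrightarrow> lin a z v j = \<mu> * v i"
proof -
  have ex: "\<exists>\<mu>. \<forall>v\<in>Lf z. lin a z v j = \<mu> * v i"
    if "a \<in> torus_pts X" "z \<in> pts Pt" "i \<in> \<Theta>" "\<pi> z \<in> fst i" "j \<in> \<Theta>" "\<pi> (ta a z) \<in> fst j" for a z i j
    using lin_holomorphic[OF that(3,5)] that by blast
  obtain \<mu> where \<mu>: "\<And>v. v \<in> Lf z \<Longrightarrow> lin a z v j = \<mu> * v i" using ex[OF a z i j] by blast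
  show thesis
  proof (cases "\<mu> = 0")
    case True
    have "v i = 0" if v: "v \<in> Lf z" for v
    proof -
      have l: "lin a z v \<in> Lf (ta a z)" by (rule lin_fibre[OF a z v])
      then have l0: "lin a z v = (\<lambda>_. 0)" using fibre_zero[OF l j] \<mu>[OF v] True by simp
      have "v = lin (tinv a \<odot> a) z v" using lin_one[OF z v] tinv_tmult[OF a] by simp
      also have "\<dots> = lin (tinv a) (ta a z) (lin a z v)" by (rule lin_mult[OF tinv_closed[OF a] a z v])
      finally have v': "v = lin (tinv a) (ta a z) (lin a z v)" .
      have pz: "\<pi> (ta (tinv a) (ta a z)) \<in> fst i" using ta_tinv[OF a z] i(2) by simp
      obtain \<mu>' where "\<And>v. v \<in> Lf (ta a z) \<Longrightarrow> lin (tinv a) (ta a z) v i = \<mu>' * v j"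
        using ex[OF tinv_closed[OF a] ta_pts[OF a z] j i(1) pz] by blast
      then have "v i = \<mu>' * lin a z v j" using v' l by metis
      then show ?thesis using l0 by simp
    qed
    then show thesis using that[of 1] \<mu> True by simp
  qed (use that \<mu> in blast)
qed

text \<open>The factor \<open>\<mu>\<close> depends on \<open>a\<close>, \<open>z\<close> and the
  two indices but not on the section, so it cancels in ratios of eigensections; only the characters
  remain.\<close>

lemma eig_coordinate:
  assumes a: "a \<in> torus_pts X" and z: "z \<in> pts Pt" and i: "i \<in> \<Theta>" "\<pi> z \<in> fst i" and j: "j \<in> \<Theta>" "\<pi> (ta a z) \<in> fst j"
  obtains \<mu> where "\<mu> \<noteq> 0" "\<And>Z x s. eig Z x s \<Longrightarrow> z \<in> Z \<Longrightarrow> s (ta a z) j = a x * \<mu> * s z i"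
    "\<And>v. v \<in> Lf z \<Longrightarrow> lin a z v j = \<mu> * v i"
proof -
  obtain \<mu> where \<mu>: "\<mu> \<noteq> 0" "\<And>v. v \<in> Lf z \<Longrightarrow> lin a z v j = \<mu> * v i"
    by (rule lin_coordinate[OF assms]) (rule that)
  have "s (ta a z) j = a x * \<mu> * s z i" if e: "eig Z x s" "z \<in> Z" for Z x s
  proof -
    have "s z \<in> Lf z" "s (ta a z) = (\<lambda>i. a x * lin a z (s z) i)" using e a unfolding eigensection_def by blast+
    then show ?thesis using \<mu>(2) by simp
  qed
  then show thesis using that \<mu> by blast
qed

lemma eig_continuous:
  assumes "eig Z x s" "i \<in> \<Theta>" "closedin (spc Pt) Z"
  shows "continuous_map (subtopology (spc Pt) {z \<in> Z. \<pi> z \<in> fst i}) euclidean (\<lambda>z. s z i)"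
proof -
  define W where "W = {z \<in> Z. \<pi> z \<in> fst i}"
  have h: "(\<lambda>z. s z i) \<in> funs (csubspace Pt Z) W" using assms(1,2) unfolding eigensection_def W_def by blast
  have "(\<lambda>z. s z i) \<in> funs (continuous_space (subtopology (spc Pt) Z)) W"
  proof (rule function_sheaf_local[OF function_sheaf_continuous_space])
    show o: "openin (spc (continuous_space (subtopology (spc Pt) Z))) W" using h by (simp add: csubspace_def)
    fix z assume z: "z \<in> W"
    then have "\<exists>U. \<exists>g\<in>funs Pt U. z \<in> U \<and> (\<forall>y\<in>U \<inter> W. s y i = g y)"
      using h unfolding csubspace_def by simp
    then obtain U g where g: "g \<in> funs Pt U" "z \<in> U" "\<And>y. y \<in> U \<inter> W \<Longrightarrow> s y i = g y" by blast
    have gc: "continuous_map (subtopology (spc Pt) U) euclidean g" "openin (spc Pt) U"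
      using Pt_funs_continuous[OF g(1)] by (simp_all add: continuous_space_funs)
    have "continuous_map (subtopology (spc Pt) (U \<inter> W)) euclidean g"
      by (rule continuous_map_from_subtopology_mono[OF gc(1)]) simp
    then have "continuous_map (subtopology (spc Pt) (U \<inter> W)) euclidean (\<lambda>z. s z i)"
      by (rule continuous_map_eq) (use g(3) in auto)
    moreover have "subtopology (subtopology (spc Pt) Z) (U \<inter> W) = subtopology (spc Pt) (U \<inter> W)"
      by (simp add: subtopology_subtopology W_def Int_absorb1 subset_iff)
    moreover have "openin (subtopology (spc Pt) Z) (U \<inter> W)"
    proof -
      have "openin (subtopology (spc Pt) Z) (U \<inter> Z)" using gc(2) by (auto simp: openin_subtopology)
      moreover have "U \<inter> W = (U \<inter> Z) \<inter> W" unfolding W_def by blast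
      ultimately show ?thesis using o by (simp add: openin_Int)
    qed
    ultimately show "\<exists>V. z \<in> V \<and> V \<subseteq> W \<and> (\<lambda>z. s z i) \<in> funs (continuous_space (subtopology (spc Pt) Z)) V"
      using z g(2) by (intro exI[of _ "U \<inter> W"]) (simp add: continuous_space_funs)
  qed
  moreover have "subtopology (subtopology (spc Pt) Z) W = subtopology (spc Pt) W"
    by (simp add: subtopology_subtopology W_def Int_absorb1 subset_iff)
  ultimately show ?thesis unfolding continuous_space_funs W_def[symmetric] by simp
qed

text \<open>The zero set of an eigensection is closed and invariant, so a nonzero eigensection on an orbit
  closure vanishes nowhere on the dense orbits.\<close>

lemma eig_nonzero:
  assumes e: "eig Z x s" and Z: "closedin (spc Pt) Z" "Zc z \<subseteq> Z" and z: "z \<in> pts Pt"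
    and y: "y \<in> Zc z" "s y \<noteq> (\<lambda>_. 0)"
  shows "s z \<noteq> (\<lambda>_. 0)"
proof
  assume s0: "s z = (\<lambda>_. 0)"
  have zZ: "z \<in> Z" using Zc_self[OF z] Z by blast
  have yP: "y \<in> pts Pt" using y Zc_subset by blast
  obtain i where i: "i \<in> \<Theta>" "\<pi> y \<in> fst i" using index_exists[OF \<pi>_pts[OF yP]] by blast
  have syi: "s y i \<noteq> 0"
  proof
    assume "s y i = 0"
    moreover have "s y \<in> Lf y" using e y(1) Z(2) unfolding eigensection_def by blast
    ultimately show False using fibre_zero i y(2) by blast
  qed
  define W where "W = {z \<in> Z. \<pi> z \<in> fst i}"
  have ZP: "Z \<subseteq> pts Pt" using closedin_subset[OF Z(1)] .
  have "openin Pan (fst i)" by (rule analytification_open[OF index_open[OF i(1)]])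
  then have oU: "openin (spc Pt) {z \<in> pts Pt. \<pi> z \<in> fst i}" by (rule openin_continuous_map_preimage[OF \<pi>_continuous])
  have oW: "openin (subtopology (spc Pt) Z) W"
    unfolding openin_subtopology W_def using oU ZP by (intro exI[of _ "{z \<in> pts Pt. \<pi> z \<in> fst i}"]) auto
  have "continuous_map (subtopology (spc Pt) W) euclidean (\<lambda>z. s z i)"
    unfolding W_def by (rule eig_continuous[OF e i(1) Z(1)])
  then have "openin (subtopology (spc Pt) W) {z \<in> topspace (subtopology (spc Pt) W). s z i \<in> - {0}}"
    by (rule openin_continuous_map_preimage) (simp add: open_Compl)
  moreover have tW: "topspace (subtopology (spc Pt) W) = W" using ZP W_def by auto
  have "{z \<in> topspace (subtopology (spc Pt) W). s z i \<in> - {0}} = {z \<in> W. s z i \<noteq> 0}" unfolding tW by auto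
  ultimately have "openin (subtopology (spc Pt) W) {z \<in> W. s z i \<noteq> 0}" by simp
  moreover have "subtopology (spc Pt) W = subtopology (subtopology (spc Pt) Z) W"
    by (simp add: subtopology_subtopology W_def Int_absorb1 subset_iff)
  ultimately have "openin (subtopology (spc Pt) Z) {z \<in> W. s z i \<noteq> 0}"
    using oW openin_trans_full by metis
  then obtain N where N: "openin (spc Pt) N" "{z \<in> W. s z i \<noteq> 0} = N \<inter> Z" unfolding openin_subtopology by blast
  have "y \<in> N" using N(2) y syi i W_def Z(2) by blast
  moreover have "y \<in> spc Pt closure_of orb z" using y(1) unfolding orbit_closure_def by simp
  ultimately obtain y' where y': "y' \<in> orb z" "y' \<in> N" using N(1) unfolding in_closure_of by blast
  then have "y' \<in> {z \<in> W. s z i \<noteq> 0}" using N(2) orb_Zc[OF z] Z by blast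
  then have y'': "s y' i \<noteq> 0" "\<pi> y' \<in> fst i" unfolding W_def by auto
  obtain a where a: "a \<in> torus_pts X" "y' = ta a z" using y'(1) by blast
  obtain j where j: "j \<in> \<Theta>" "\<pi> z \<in> fst j" using index_exists[OF \<pi>_pts[OF z]] by blast
  have py: "\<pi> (ta a z) \<in> fst i" using y'' a by simp
  obtain \<mu> where "\<And>Z x s. eig Z x s \<Longrightarrow> z \<in> Z \<Longrightarrow> s (ta a z) i = a x * \<mu> * s z j"
    by (rule eig_coordinate[OF a(1) z j i(1) py]) (rule that)
  from this[OF e zZ] show False using y'' a(2) s0 by simp
qed

end

subsection \<open>The moment map\<close>

text \<open>Centering at \<open>q\<close> removes the normalizing denominator, and turns a
  prescribed average into the critical equation of an exponential family.\<close>

lemma weighted_average_eq_iff: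
  fixes v :: "'w \<Rightarrow> 'e::euclidean_space"
  assumes "is_weighted_average E c v y"
  shows "y = q \<longleftrightarrow> infsum (\<lambda>w. c w *\<^sub>R (v w - q)) E = 0"
proof -
  have sc: "c summable_on E" "infsum c E \<noteq> 0" "(\<lambda>w. c w *\<^sub>R v w) summable_on E"
    "y = infsum (\<lambda>w. c w *\<^sub>R v w) E /\<^sub>R infsum c E"
    using assms unfolding is_weighted_average_def by auto
  have s: "(\<lambda>w. c w *\<^sub>R - q) summable_on E" using sc(1) by (intro summable_on_scaleR_left)
  have "infsum (\<lambda>w. c w *\<^sub>R v w + c w *\<^sub>R - q) E = infsum (\<lambda>w. c w *\<^sub>R v w) E + infsum (\<lambda>w. c w *\<^sub>R - q) E"
    by (rule infsum_add[OF sc(3) s])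
  also have "infsum (\<lambda>w. c w *\<^sub>R - q) E = infsum c E *\<^sub>R - q"
    by (rule infsum_scaleR_left) (use sc(1) in auto)
  also have "infsum (\<lambda>w. c w *\<^sub>R v w) E = infsum c E *\<^sub>R y" using sc(2,4) by simp
  also have "infsum c E *\<^sub>R y + infsum c E *\<^sub>R - q = infsum c E *\<^sub>R (y - q)" by (simp add: algebra_simps)
  finally have "infsum (\<lambda>w. c w *\<^sub>R (v w - q)) E = infsum c E *\<^sub>R (y - q)"
    by (simp add: algebra_simps)
  then show ?thesis using sc(2) by simp
qed

context theta_expansion
begin

abbreviation "IP \<equiv> integral_points X cells"

lemma IP_fst: "w \<in> IP \<Longrightarrow> fst w \<in> X"
  unfolding integral_points_def by blast

lemma \<xi>_fibre: "w \<in> IP \<Longrightarrow> z \<in> pts Pt \<Longrightarrow> \<xi> w z \<in> Lf z"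
  using \<xi>_eigensection unfolding eigensection_def by blast

section \<open>Supports and exponential moments of the theta series\<close>

definition supp :: "'b \<Rightarrow> ('e \<times> 'c \<times> 'i) set" where
  "supp z = {w \<in> IP. \<xi> w z \<noteq> (\<lambda>_. 0)}"

lemma supp_iff: "z \<in> pts Pt \<Longrightarrow> i \<in> \<Theta> \<Longrightarrow> \<pi> z \<in> fst i \<Longrightarrow> w \<in> supp z \<longleftrightarrow> w \<in> IP \<and> \<xi> w z i \<noteq> 0"
proof -
  assume z: "z \<in> pts Pt" and i: "i \<in> \<Theta>" "\<pi> z \<in> fst i"
  show ?thesis
  proof (cases "w \<in> IP \<and> \<xi> w z i = 0")
    case True
    then have "\<xi> w z = (\<lambda>_. 0)" using fibre_zero[OF \<xi>_fibre[of w z] i] z by blast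
    then show ?thesis using True unfolding supp_def by blast
  next
    case False
    then show ?thesis unfolding supp_def by fastforce
  qed
qed

lemma supp_cell: "z \<in> pts Pt \<Longrightarrow> w \<in> supp z \<Longrightarrow> w \<in> cell (Zc z)"
  unfolding supp_def using \<xi>_support by blast

lemma \<xi>_ta:
  assumes a: "a \<in> torus_pts X" and z: "z \<in> pts Pt" and i: "i \<in> \<Theta>" "\<pi> z \<in> fst i" and j: "j \<in> \<Theta>" "\<pi> (ta a z) \<in> fst j"
  obtains \<mu> where "\<mu> \<noteq> 0" "\<And>w. w \<in> IP \<Longrightarrow> \<xi> w (ta a z) j = a (fst w) * \<mu> * \<xi> w z i"
    "\<And>v. v \<in> Lf z \<Longrightarrow> lin a z v j = \<mu> * v i"
proof -
  obtain \<mu> where \<mu>: "\<mu> \<noteq> 0" "\<And>Z x s. eig Z x s \<Longrightarrow> z \<in> Z \<Longrightarrow> s (ta a z) j = a x * \<mu> * s z i"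
    "\<And>v. v \<in> Lf z \<Longrightarrow> lin a z v j = \<mu> * v i"
    by (rule eig_coordinate[OF assms]) (rule that)
  have "\<xi> w (ta a z) j = a (fst w) * \<mu> * \<xi> w z i" if "w \<in> IP" for w
    using \<mu>(2)[OF \<xi>_eigensection[OF that] z] .
  then show thesis using that[OF \<mu>(1) _ \<mu>(3)] by blast
qed

lemma supp_ta:
  assumes a: "a \<in> torus_pts X" and z: "z \<in> pts Pt"
  shows "supp (ta a z) = supp z"
proof -
  obtain i where i: "i \<in> \<Theta>" "\<pi> z \<in> fst i" using index_exists[OF \<pi>_pts[OF z]] by blast
  obtain j where j: "j \<in> \<Theta>" "\<pi> (ta a z) \<in> fst j" using index_exists[OF \<pi>_pts[OF ta_pts[OF a z]]] by blast
  obtain \<mu> where \<mu>: "\<mu> \<noteq> 0" "\<And>w. w \<in> IP \<Longrightarrow> \<xi> w (ta a z) j = a (fst w) * \<mu> * \<xi> w z i"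
    by (rule \<xi>_ta[OF a z i j]) (rule that)
  have "w \<in> supp (ta a z) \<longleftrightarrow> w \<in> supp z" for w
    using supp_iff[OF ta_pts[OF a z] j, of w] supp_iff[OF z i, of w] \<mu>(1) \<mu>(2)[of w] torus_pts_nz[OF a IP_fst, of w]
    by (cases "w \<in> IP") simp_all
  then show ?thesis by blast
qed

lemma theta_translate_nonzero:
  assumes z: "z \<in> pts Pt"
  shows "\<exists>a\<in>torus_pts X. \<forall>j\<in>\<Theta>. \<pi> (ta a z) \<in> fst j \<longrightarrow> snd j (\<pi> (ta a z)) \<noteq> 0"
proof -
  obtain g where g: "g \<in> pts G" "act g (\<pi> z) \<notin> divisor_support \<Theta>"
    using no_orbit[OF \<pi>_pts[OF z]] by blast
  obtain a where a: "a \<in> torus_pts X" "g = \<phi> a" using \<phi>_surj g(1) by blast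
  then have "\<pi> (ta a z) \<notin> divisor_support \<Theta>" using ta_lifts[OF a(1) z] g(2) by simp
  then show ?thesis using a(1) unfolding divisor_support_def by (auto simp: case_prod_unfold)
qed

lemma supp_nonempty:
  assumes z: "z \<in> pts Pt"
  shows "supp z \<noteq> {}"
proof
  assume e: "supp z = {}"
  obtain a where a: "a \<in> torus_pts X" "\<forall>j\<in>\<Theta>. \<pi> (ta a z) \<in> fst j \<longrightarrow> snd j (\<pi> (ta a z)) \<noteq> 0"
    using theta_translate_nonzero[OF z] by blast
  obtain j where j: "j \<in> \<Theta>" "\<pi> (ta a z) \<in> fst j" using index_exists[OF \<pi>_pts[OF ta_pts[OF a(1) z]]] by blast
  have 0: "\<xi> w (ta a z) j = 0" if "w \<in> IP" for w
    using supp_iff[OF ta_pts[OF a(1) z] j, of w] supp_ta[OF a(1) z] e that by auto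
  have "((\<lambda>w. \<xi> w (ta a z) j) has_sum snd j (\<pi> (ta a z))) IP" by (rule \<xi>_sum[OF ta_pts[OF a(1) z] j])
  moreover have "((\<lambda>w. \<xi> w (ta a z) j) has_sum 0) IP" by (rule has_sum_0) (use 0 in auto)
  ultimately have "snd j (\<pi> (ta a z)) = 0" using has_sum_unique by blast
  then show False using a(2) j by blast
qed

text \<open>Tilting by \<open>exp (l \<bullet> fst w)\<close> is, up to a constant, moving
  \<open>z\<close> by a real point of the torus. The theta series converges there too, and complex
  summability is absolute, so all exponential moments are finite.\<close>

lemma summable_exp:
  assumes z: "z \<in> pts Pt" and i: "i \<in> \<Theta>" "\<pi> z \<in> fst i"
  shows "(\<lambda>w. cmod (\<xi> w z i) * exp (l \<bullet> fst w)) summable_on IP"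
proof -
  define a where "a = exp_char X l 1"
  have a: "a \<in> torus_pts X" unfolding a_def by (rule exp_char_torus[OF X])
  obtain j where j: "j \<in> \<Theta>" "\<pi> (ta a z) \<in> fst j" using index_exists[OF \<pi>_pts[OF ta_pts[OF a z]]] by blast
  obtain \<mu> where \<mu>: "\<mu> \<noteq> 0" "\<And>w. w \<in> IP \<Longrightarrow> \<xi> w (ta a z) j = a (fst w) * \<mu> * \<xi> w z i"
    by (rule \<xi>_ta[OF a z i j]) (rule that)
  have "(\<lambda>w. \<xi> w (ta a z) j) summable_on IP" using \<xi>_sum[OF ta_pts[OF a z] j] summable_on_def by blast
  then have "(\<lambda>w. cmod (\<xi> w (ta a z) j)) summable_on IP" by (simp add: summable_on_iff_abs_summable_on_complex)
  then have "(\<lambda>w. (1 / cmod \<mu>) * cmod (\<xi> w (ta a z) j)) summable_on IP" by (rule summable_on_cmult_right)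
  moreover have "(1 / cmod \<mu>) * cmod (\<xi> w (ta a z) j) = cmod (\<xi> w z i) * exp (l \<bullet> fst w)" if "w \<in> IP" for w
    using \<mu>(2)[OF that] \<mu>(1) IP_fst[OF that] by (simp add: a_def norm_mult norm_exp_eq_Re)
  ultimately show ?thesis by (subst summable_on_cong) auto
qed

text \<open>Squares are summable because the moduli are bounded by their sum; half of the tilt goes
  to each factor of the square.\<close>

lemma exp_family_\<xi>:
  assumes z: "z \<in> pts Pt" and i: "i \<in> \<Theta>" "\<pi> z \<in> fst i"
  shows "exp_family IP (\<lambda>w. (cmod (\<xi> w z i))\<^sup>2) (\<lambda>w. fst w - q)"
proof
  fix l
  define b where "b w = cmod (\<xi> w z i) * exp ((1/2) *\<^sub>R l \<bullet> fst w)" for w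
  have b: "b summable_on IP" unfolding b_def by (rule summable_exp[OF assms])
  have "(\<lambda>w. exp (- (l \<bullet> q)) * infsum b IP * b w) summable_on IP" by (rule summable_on_cmult_right[OF b])
  then show "(\<lambda>w. (cmod (\<xi> w z i))\<^sup>2 * exp (l \<bullet> (fst w - q))) summable_on IP"
  proof (rule summable_on_comparison_test)
    fix w assume w: "w \<in> IP"
    have "b w \<le> infsum b IP" using finite_sum_le_infsum[OF b, of "{w}"] w by (auto simp: b_def)
    then have "b w * b w \<le> infsum b IP * b w" by (rule mult_right_mono) (simp add: b_def)
    then have le: "exp (- (l \<bullet> q)) * (b w * b w) \<le> exp (- (l \<bullet> q)) * (infsum b IP * b w)" by (rule mult_left_mono) simp
    have "exp (l \<bullet> (fst w - q)) = exp (- (l \<bullet> q)) * (exp ((1/2) *\<^sub>R l \<bullet> fst w) * exp ((1/2) *\<^sub>R l \<bullet> fst w))"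
      unfolding exp_add[symmetric] by (simp add: inner_diff_right)
    then have "(cmod (\<xi> w z i))\<^sup>2 * exp (l \<bullet> (fst w - q)) = exp (- (l \<bullet> q)) * (b w * b w)"
      by (simp add: b_def power2_eq_square)
    then show "(cmod (\<xi> w z i))\<^sup>2 * exp (l \<bullet> (fst w - q)) \<le> exp (- (l \<bullet> q)) * infsum b IP * b w"
      using le by (simp add: mult.assoc)
  qed auto
qed simp

definition idx :: "'p \<Rightarrow> 'p set \<times> ('p \<Rightarrow> complex)" where
  "idx p = (SOME i. i \<in> \<Theta> \<and> p \<in> fst i)"

lemma idx: "p \<in> pts P \<Longrightarrow> idx p \<in> \<Theta>" "p \<in> pts P \<Longrightarrow> p \<in> fst (idx p)"
  unfolding idx_def using index_exists someI_ex[of "\<lambda>i. i \<in> \<Theta> \<and> p \<in> fst i"] by blast+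

lemma idx_\<pi>: "z \<in> pts Pt \<Longrightarrow> idx (\<pi> z) \<in> \<Theta>" "z \<in> pts Pt \<Longrightarrow> \<pi> z \<in> fst (idx (\<pi> z))"
  using idx \<pi>_pts by auto

text \<open>One arbitrary trivialization of the fibre is used; another one multiplies all weights by
  the same positive factor, which cancels.\<close>

definition avg :: "'b \<Rightarrow> 'e" where
  "avg z = (let c = (\<lambda>w. (cmod (\<xi> w z (idx (\<pi> z))))\<^sup>2) in infsum (\<lambda>w. c w *\<^sub>R fst w) IP /\<^sub>R infsum c IP)"

lemma weights_summable:
  assumes z: "z \<in> pts Pt" and i: "i \<in> \<Theta>" "\<pi> z \<in> fst i"
  shows "(\<lambda>w. (cmod (\<xi> w z i))\<^sup>2) summable_on IP" "infsum (\<lambda>w. (cmod (\<xi> w z i))\<^sup>2) IP \<noteq> 0"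
    "(\<lambda>w. (cmod (\<xi> w z i))\<^sup>2 *\<^sub>R fst w) summable_on IP"
proof -
  interpret exp_family IP "\<lambda>w. (cmod (\<xi> w z i))\<^sup>2" "\<lambda>w. fst w - 0" by (rule exp_family_\<xi>[OF assms])
  show s: "(\<lambda>w. (cmod (\<xi> w z i))\<^sup>2) summable_on IP" using summable[of 0] by simp
  show "(\<lambda>w. (cmod (\<xi> w z i))\<^sup>2 *\<^sub>R fst w) summable_on IP" using summable_vec[of 0] by simp
  show "infsum (\<lambda>w. (cmod (\<xi> w z i))\<^sup>2) IP \<noteq> 0"
  proof
    assume "infsum (\<lambda>w. (cmod (\<xi> w z i))\<^sup>2) IP = 0"
    then have "(cmod (\<xi> w z i))\<^sup>2 = 0" if "w \<in> IP" for w
      using nonneg_infsum_le_0D[of "\<lambda>w. (cmod (\<xi> w z i))\<^sup>2" IP w] s that by simp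
    then show False using supp_nonempty[OF z] supp_iff[OF assms] by auto
  qed
qed

lemma avg_weighted:
  assumes z: "z \<in> pts Pt" and i: "i \<in> \<Theta>" "\<pi> z \<in> fst i"
  shows "is_weighted_average IP (\<lambda>w. (cmod (\<xi> w z i))\<^sup>2) fst (avg z)"
proof -
  define k where "k = idx (\<pi> z)"
  have k: "k \<in> \<Theta>" "\<pi> z \<in> fst k" unfolding k_def using idx_\<pi>[OF z] by auto
  obtain u where u: "u \<noteq> 0" "\<And>m v. v \<in> bundle_fibre P \<Theta> m (\<pi> z) \<Longrightarrow> v i = u ^ m * v k"
    by (rule fibre_change[OF i(1) k(1) i(2) k(2)]) (rule that)
  have e: "(cmod (\<xi> w z i))\<^sup>2 = (cmod u)\<^sup>2 * (cmod (\<xi> w z k))\<^sup>2" if "w \<in> IP" for w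
    using u(2)[OF \<xi>_fibre[OF that z]] by (simp add: norm_mult power_mult_distrib)
  have "infsum (\<lambda>w. (cmod (\<xi> w z i))\<^sup>2) IP = (cmod u)\<^sup>2 * infsum (\<lambda>w. (cmod (\<xi> w z k))\<^sup>2) IP"
    unfolding infsum_cmult_right'[symmetric] by (rule infsum_cong) (rule e)
  moreover have "infsum (\<lambda>w. (cmod (\<xi> w z i))\<^sup>2 *\<^sub>R fst w) IP = (cmod u)\<^sup>2 *\<^sub>R infsum (\<lambda>w. (cmod (\<xi> w z k))\<^sup>2 *\<^sub>R fst w) IP"
    unfolding infsum_scaleR_right[symmetric] by (rule infsum_cong) (simp add: e)
  ultimately have "avg z = infsum (\<lambda>w. (cmod (\<xi> w z i))\<^sup>2 *\<^sub>R fst w) IP /\<^sub>R infsum (\<lambda>w. (cmod (\<xi> w z i))\<^sup>2) IP"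
    unfolding avg_def Let_def k_def[symmetric] using u(1) by simp
  then show ?thesis unfolding is_weighted_average_def using weights_summable[OF assms] by blast
qed

lemma avg_in_cell:
  assumes z: "z \<in> pts Pt"
  shows "avg z \<in> fst ` cell (Zc z)"
proof (rule weighted_average_in_closed_convex[OF avg_weighted[OF z idx_\<pi>[OF z]]])
  show "convex (fst ` cell (Zc z))" "closed (fst ` cell (Zc z))"
    using cell_convex_closed[OF cell_in[OF z]] by blast+
  fix w assume "w \<in> IP" "(cmod (\<xi> w z (idx (\<pi> z))))\<^sup>2 \<noteq> 0"
  then have "w \<in> supp z" using supp_iff[OF z idx_\<pi>[OF z]] by simp
  then show "fst w \<in> fst ` cell (Zc z)" using supp_cell[OF z] by blast
qed simp

definition Mt :: "'b \<Rightarrow> 'e \<times> 'c \<times> 'i" where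
  "Mt z = (THE q. q \<in> cell (Zc z) \<and> fst q = avg z)"

lemma Mt_unique: "z \<in> pts Pt \<Longrightarrow> q \<in> cell (Zc z) \<Longrightarrow> fst q = avg z \<Longrightarrow> Mt z = q"
proof -
  assume z: "z \<in> pts Pt" and q: "q \<in> cell (Zc z)" "fst q = avg z"
  have "q' = q" if "q' \<in> cell (Zc z) \<and> fst q' = avg z" for q'
    by (rule inj_onD[OF cells_inj[OF cell_in[OF z]]]) (use that q in auto)
  then show ?thesis unfolding Mt_def using q by (intro the_equality) blast+
qed

lemma Mt: "z \<in> pts Pt \<Longrightarrow> Mt z \<in> cell (Zc z)" "z \<in> pts Pt \<Longrightarrow> fst (Mt z) = avg z"
  using avg_in_cell Mt_unique by force+

text \<open>Both sides are Fourier coefficients of the restriction of \<open>\<theta>\<close> to the orbit of \<open>z\<close>.\<close>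

lemma \<xi>_equivariant:
  assumes x: "x \<in> X" and z: "z \<in> pts Pt" and i: "i \<in> \<Theta>" "\<pi> z \<in> fst i" and w: "w \<in> IP"
  shows "\<xi> (\<alpha> x w) (dk x z) i = \<xi> w z i"
proof -
  define e where "e w = \<xi> w z i - \<xi> (\<alpha> x w) (dk x z) i" for w
  have dz: "dk x z \<in> pts Pt" by (rule dk_pts[OF x z])
  have pdz: "\<pi> (dk x z) = \<pi> z" by (rule \<pi>_dk[OF x z])
  have aw: "\<alpha> x w \<in> IP" if "w \<in> IP" for w using act_bij_IP[OF x] that unfolding bij_betw_def by blast
  have cellU: "cell (Zc z) \<subseteq> \<Union>cells" using cell_in[OF z] by blast
  \<comment> \<open>Both terms of the difference live on the cell of \<open>z\<close>: for the
    translated one, the deck transformation carries the cell along and acts injectively.\<close>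
  have esupp: "w \<in> cell (Zc z)" if "w \<in> IP" "e w \<noteq> 0" for w
  proof -
    have "\<xi> w z i \<noteq> 0 \<or> \<xi> (\<alpha> x w) (dk x z) i \<noteq> 0" using that(2) unfolding e_def by auto
    then show ?thesis
    proof
      assume "\<xi> w z i \<noteq> 0"
      then show ?thesis using supp_cell[OF z] supp_iff[OF z i] that(1) by blast
    next
      assume "\<xi> (\<alpha> x w) (dk x z) i \<noteq> 0"
      then have "\<alpha> x w \<in> cell (Zc (dk x z))"
        using supp_cell[OF dz] supp_iff[OF dz i(1)] i(2) pdz aw[OF that(1)] by auto
      then obtain w' where w': "w' \<in> cell (Zc z)" "\<alpha> x w = \<alpha> x w'" using cell_dk[OF z x] by auto
      have "w \<in> \<Union>cells" using that(1) unfolding integral_points_def by blast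
      then have "w = w'" using act_minus(1)[OF x] w' cellU by (metis subsetD)
      then show ?thesis using w'(1) by simp
    qed
  qed
  \<comment> \<open>The canonical section is pulled back from \<open>P\<close>, so its series at
    \<open>ta a z\<close> and at the deck translate have the same value. The shift of the weight by
    \<open>x\<close> is compensated by the factor \<open>a x\<close> in
    \<open>lin_commute\<close>.\<close>
  have sum0: "((\<lambda>w. e w * a (fst w)) has_sum 0) IP" if a: "a \<in> torus_pts X" for a
  proof -
    have az: "ta a z \<in> pts Pt" by (rule ta_pts[OF a z])
    obtain j where j: "j \<in> \<Theta>" "\<pi> (ta a z) \<in> fst j" using index_exists[OF \<pi>_pts[OF az]] by blast
    obtain \<mu> where \<mu>: "\<mu> \<noteq> 0" "\<And>w. w \<in> IP \<Longrightarrow> \<xi> w (ta a z) j = a (fst w) * \<mu> * \<xi> w z i"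
        "\<And>v. v \<in> Lf z \<Longrightarrow> lin a z v j = \<mu> * v i"
      by (rule \<xi>_ta[OF a z i j]) (rule that)
    have 1: "((\<lambda>w. \<xi> w (ta a z) j) has_sum snd j (\<pi> (ta a z))) IP" by (rule \<xi>_sum[OF az j])
    have tdz: "ta a (dk x z) = dk x (ta a z)" by (rule ta_dk[OF a x z])
    have ptdz: "\<pi> (ta a (dk x z)) = \<pi> (ta a z)" unfolding tdz by (rule \<pi>_dk[OF x az])
    have "((\<lambda>w. \<xi> w (ta a (dk x z)) j) has_sum snd j (\<pi> (ta a (dk x z)))) IP"
      by (rule \<xi>_sum[OF ta_pts[OF a dz] j(1)]) (use ptdz j in simp)
    then have 2: "((\<lambda>w. \<xi> (\<alpha> x w) (ta a (dk x z)) j) has_sum snd j (\<pi> (ta a z))) IP"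
      using has_sum_reindex_bij_betw[OF act_bij_IP[OF x], of "\<lambda>w. \<xi> w (ta a (dk x z)) j"] ptdz by simp
    have 3: "\<xi> (\<alpha> x w) (ta a (dk x z)) j = a (fst w) * \<mu> * \<xi> (\<alpha> x w) (dk x z) i" if w: "w \<in> IP" for w
    proof -
      have wU: "w \<in> \<Union>cells" using w unfolding integral_points_def by blast
      have f: "\<xi> (\<alpha> x w) (dk x z) \<in> Lf z" using \<xi>_fibre[OF aw[OF w] dz] pdz by simp
      have "\<xi> (\<alpha> x w) (ta a (dk x z)) = (\<lambda>k. a (fst (\<alpha> x w)) * lin a (dk x z) (\<xi> (\<alpha> x w) (dk x z)) k)"
        using \<xi>_eigensection[OF aw[OF w]] a dz unfolding eigensection_def by blast
      then have "\<xi> (\<alpha> x w) (ta a (dk x z)) j = a (fst w) * (a x * lin a (dk x z) (\<xi> (\<alpha> x w) (dk x z)) j)"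
        using act_fst[OF x wU] torus_pts_add[OF a IP_fst[OF w] x] by simp
      also have "a x * lin a (dk x z) (\<xi> (\<alpha> x w) (dk x z)) j = lin a z (\<xi> (\<alpha> x w) (dk x z)) j"
        by (subst lin_commute[OF a x z f]) simp
      finally show ?thesis using \<mu>(3)[OF f] by simp
    qed
    have "((\<lambda>w. \<xi> w (ta a z) j + - \<xi> (\<alpha> x w) (ta a (dk x z)) j) has_sum
        (snd j (\<pi> (ta a z)) + - snd j (\<pi> (ta a z)))) IP"
      by (intro has_sum_add 1) (use 2 in \<open>simp add: has_sum_uminus\<close>)
    then have "((\<lambda>w. (1 / \<mu>) * (\<xi> w (ta a z) j + - \<xi> (\<alpha> x w) (ta a (dk x z)) j)) has_sum (1 / \<mu>) * 0) IP"
      by (intro has_sum_cmult_right) simp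
    moreover have "(1 / \<mu>) * (\<xi> w (ta a z) j + - \<xi> (\<alpha> x w) (ta a (dk x z)) j) = e w * a (fst w)" if "w \<in> IP" for w
      using \<mu>(2)[OF that] 3[OF that] \<mu>(1) by (simp add: e_def algebra_simps)
    ultimately show ?thesis by (subst has_sum_cong) auto
  qed
  \<comment> \<open>Within a single cell an integral point is determined by its weight, so the
    series over points of the complex becomes a Fourier series over \<open>X\<close>.\<close>
  define S where "S = IP \<inter> cell (Zc z)"
  have injS: "inj_on fst S" using cells_inj[OF cell_in[OF z]] unfolding S_def by (auto intro: inj_on_subset)
  define c where "c u = (if u \<in> fst ` S then e (inv_into S fst u) else 0)" for u
  have cS: "c (fst w) = e w" if "w \<in> S" for w unfolding c_def using that injS by simp
  have "((\<lambda>u. c u * a u) has_sum 0) X" if a: "a \<in> torus_pts X" for a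
  proof -
    have "((\<lambda>w. e w * a (fst w)) has_sum 0) S \<longleftrightarrow> ((\<lambda>w. e w * a (fst w)) has_sum 0) IP"
      by (rule has_sum_cong_neutral) (use esupp S_def in auto)
    then have "((\<lambda>w. e w * a (fst w)) has_sum 0) S" using sum0[OF a] by blast
    then have "(((\<lambda>u. c u * a u) \<circ> fst) has_sum 0) S"
      by (subst has_sum_cong[of _ _ "\<lambda>w. e w * a (fst w)"]) (auto simp: cS)
    then have "((\<lambda>u. c u * a u) has_sum 0) (fst ` S)" using has_sum_reindex[OF injS] by blast
    moreover have "((\<lambda>u. c u * a u) has_sum 0) (fst ` S) \<longleftrightarrow> ((\<lambda>u. c u * a u) has_sum 0) X"
      by (rule has_sum_cong_neutral) (use IP_fst in \<open>auto simp: S_def c_def\<close>)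
    ultimately show ?thesis by blast
  qed
  then have c0: "c u = 0" if "u \<in> X" for u using fourier_uniqueness[OF X that] by blast
  have "e w = 0"
  proof (rule ccontr)
    assume ne: "e w \<noteq> 0"
    then have "w \<in> S" using esupp[OF w] w S_def by blast
    then show False using cS c0[OF IP_fst[OF w]] ne by simp
  qed
  then show ?thesis by (simp add: e_def)
qed

lemma Mt_equivariant:
  assumes x: "x \<in> X" and z: "z \<in> pts Pt"
  shows "Mt (dk x z) = \<alpha> x (Mt z)"
proof -
  define i where "i = idx (\<pi> z)"
  have i: "i \<in> \<Theta>" "\<pi> z \<in> fst i" unfolding i_def using idx_\<pi>[OF z] by auto
  have dz: "dk x z \<in> pts Pt" by (rule dk_pts[OF x z])
  have pdz: "\<pi> (dk x z) \<in> fst i" using \<pi>_dk[OF x z] i by simp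
  have U: "Mt z \<in> \<Union>cells" using Mt(1)[OF z] cell_in[OF z] by blast
  define c where "c w = (cmod (\<xi> w z i))\<^sup>2" for w
  define c' where "c' w = (cmod (\<xi> w (dk x z) i))\<^sup>2" for w
  have cc: "c' (\<alpha> x w) = c w" if "w \<in> IP" for w
    unfolding c_def c'_def using \<xi>_equivariant[OF x z i that] by simp
  have wa: "is_weighted_average IP c fst (avg z)" unfolding c_def by (rule avg_weighted[OF z i])
  have wa': "is_weighted_average IP c' fst (avg (dk x z))" unfolding c'_def by (rule avg_weighted[OF dz i(1) pdz])
  have "infsum (\<lambda>w. c' w *\<^sub>R (fst w - (avg z + x))) IP = infsum (\<lambda>w. c' (\<alpha> x w) *\<^sub>R (fst (\<alpha> x w) - (avg z + x))) IP"
    using infsum_reindex_bij_betw[OF act_bij_IP[OF x], of "\<lambda>w. c' w *\<^sub>R (fst w - (avg z + x))"] by simp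
  also have "\<dots> = infsum (\<lambda>w. c w *\<^sub>R (fst w - avg z)) IP"
  proof (rule infsum_cong)
    fix w assume w: "w \<in> IP"
    then have "w \<in> \<Union>cells" unfolding integral_points_def by blast
    then show "c' (\<alpha> x w) *\<^sub>R (fst (\<alpha> x w) - (avg z + x)) = c w *\<^sub>R (fst w - avg z)"
      using cc[OF w] act_fst[OF x] by simp
  qed
  also have "\<dots> = 0" using weighted_average_eq_iff[OF wa] by blast
  finally have "avg (dk x z) = avg z + x" using weighted_average_eq_iff[OF wa'] by blast
  moreover have "fst (\<alpha> x (Mt z)) = avg z + x" using act_fst[OF x U] Mt(2)[OF z] by simp
  moreover have "\<alpha> x (Mt z) \<in> cell (Zc (dk x z))" using cell_dk[OF z x] Mt(1)[OF z] by blast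
  ultimately show ?thesis using Mt_unique[OF dz] by simp
qed

lemma avg_ta_eq_iff:
  assumes z: "z \<in> pts Pt" and i: "i \<in> \<Theta>" "\<pi> z \<in> fst i" and a: "a \<in> torus_pts X"
    and \<nu>: "\<And>x. x \<in> X \<Longrightarrow> cmod (a x) = exp (\<nu> \<bullet> x)"
  shows "avg (ta a z) = q \<longleftrightarrow>
    infsum (\<lambda>w. ((cmod (\<xi> w z i))\<^sup>2 * exp ((2 *\<^sub>R \<nu>) \<bullet> (fst w - q))) *\<^sub>R (fst w - q)) IP = 0"
proof -
  have az: "ta a z \<in> pts Pt" by (rule ta_pts[OF a z])
  obtain j where j: "j \<in> \<Theta>" "\<pi> (ta a z) \<in> fst j" using index_exists[OF \<pi>_pts[OF az]] by blast
  obtain \<mu> where \<mu>: "\<mu> \<noteq> 0" "\<And>w. w \<in> IP \<Longrightarrow> \<xi> w (ta a z) j = a (fst w) * \<mu> * \<xi> w z i"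
    by (rule \<xi>_ta[OF a z i j]) (rule that)
  \<comment> \<open>Collects what does not depend on \<open>w\<close>: the coordinate change in the
    fibre and the recentering of the exponent from \<open>fst w\<close> to
    \<open>fst w - q\<close>.\<close>
  define K where "K = (cmod \<mu>)\<^sup>2 * exp ((2 *\<^sub>R \<nu>) \<bullet> q)"
  have K: "K \<noteq> 0" using \<mu>(1) by (simp add: K_def)
  have "(cmod (\<xi> w (ta a z) j))\<^sup>2 = K * ((cmod (\<xi> w z i))\<^sup>2 * exp ((2 *\<^sub>R \<nu>) \<bullet> (fst w - q)))" if w: "w \<in> IP" for w
  proof -
    have "(cmod (\<xi> w (ta a z) j))\<^sup>2 = (cmod \<mu>)\<^sup>2 * (cmod (\<xi> w z i))\<^sup>2 * (exp (\<nu> \<bullet> fst w))\<^sup>2"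
      unfolding \<mu>(2)[OF w] norm_mult \<nu>[OF IP_fst[OF w]] by (simp add: power_mult_distrib)
    also have "(exp (\<nu> \<bullet> fst w))\<^sup>2 = exp ((2 *\<^sub>R \<nu>) \<bullet> q) * exp ((2 *\<^sub>R \<nu>) \<bullet> (fst w - q))"
      unfolding exp_add[symmetric] by (simp add: inner_diff_right exp_double[symmetric] power2_eq_square[symmetric] algebra_simps)
    finally show ?thesis by (simp add: K_def)
  qed
  then have "infsum (\<lambda>w. (cmod (\<xi> w (ta a z) j))\<^sup>2 *\<^sub>R (fst w - q)) IP =
    infsum (\<lambda>w. K *\<^sub>R (((cmod (\<xi> w z i))\<^sup>2 * exp ((2 *\<^sub>R \<nu>) \<bullet> (fst w - q))) *\<^sub>R (fst w - q))) IP"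
    by (intro infsum_cong) simp
  also have "\<dots> = K *\<^sub>R infsum (\<lambda>w. ((cmod (\<xi> w z i))\<^sup>2 * exp ((2 *\<^sub>R \<nu>) \<bullet> (fst w - q))) *\<^sub>R (fst w - q)) IP"
    by (rule infsum_scaleR_right)
  finally show ?thesis using weighted_average_eq_iff[OF avg_weighted[OF az j], of q] K by simp
qed

end

subsection \<open>Directions of a cell\<close>

context fixed_torus_action
begin

text \<open>Spanned by differences of integral points, since these are the weights that sections
  provide and this makes the subspace rational. By \<open>diff_in_dir\<close> it contains the
  differences of all points of a cell.\<close>

definition dir :: "('e \<times> 'c \<times> 'i) set \<Rightarrow> 'e set" where
  "dir \<delta> = span {x - x' |x x'. x \<in> X \<inter> fst ` \<delta> \<and> x' \<in> X \<inter> fst ` \<delta>}"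

lemma subspace_dir: "subspace (dir \<delta>)"
  unfolding dir_def by (rule subspace_span)

lemma dir_diff: "x \<in> X \<Longrightarrow> x' \<in> X \<Longrightarrow> x \<in> fst ` \<delta> \<Longrightarrow> x' \<in> fst ` \<delta> \<Longrightarrow> x - x' \<in> dir \<delta>"
  unfolding dir_def by (rule span_base) blast

lemma dir_lattice: "dir \<delta> = span (X \<inter> dir \<delta>)"
proof
  have "{x - x' |x x'. x \<in> X \<inter> fst ` \<delta> \<and> x' \<in> X \<inter> fst ` \<delta>} \<subseteq> X \<inter> dir \<delta>"
    using lattice_in_diff[OF X] dir_diff by blast
  then show "dir \<delta> \<subseteq> span (X \<inter> dir \<delta>)" by (subst (1) dir_def) (rule span_mono)
  show "span (X \<inter> dir \<delta>) \<subseteq> dir \<delta>" by (rule span_minimal[OF _ subspace_dir]) simp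
qed

lemma integral_point_exists:
  assumes d: "\<delta> \<in> cells"
  obtains x where "x \<in> X" "x \<in> fst ` \<delta>"
proof -
  obtain \<delta>' i where \<delta>': "\<delta>' \<in> C'" "\<delta> = pullback_cell X r \<rho>' \<delta>' i"
    using d unfolding pullback_cells_def by blast
  obtain V where V: "V \<noteq> {}" "V \<subseteq> X'" "\<rho>' ` \<delta>' = convex hull V" using cell_polytope[OF \<delta>'(1)] by blast
  obtain y where y: "y \<in> V" using V(1) by blast
  then obtain x where x: "x \<in> X" "r x = y" using V(2) r_image by blast
  have "x \<in> fst ` \<delta>" unfolding \<delta>'(2) fst_pullback_cell V(3) using x y by (simp add: span_base hull_inc)
  then show thesis using that x(1) by blast
qed

lemma dir_kernel:
  assumes d: "\<delta> \<in> cells" and v: "v \<in> span X" "r v = 0"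
  shows "v \<in> dir \<delta>"
proof -
  obtain \<delta>' i where \<delta>': "\<delta>' \<in> C'" "\<delta> = pullback_cell X r \<rho>' \<delta>' i"
    using d unfolding pullback_cells_def by blast
  obtain x where x: "x \<in> X" "x \<in> fst ` \<delta>" by (rule integral_point_exists[OF d])
  have "k \<in> dir \<delta>" if k: "k \<in> X \<inter> {x. r x = 0}" for k
  proof -
    have "x + k \<in> fst ` \<delta>" unfolding \<delta>'(2)
      by (rule pullback_cell_shift[OF x(2)[unfolded \<delta>'(2)]]) (use k in \<open>auto simp: span_base\<close>)
    then have "(x + k) - x \<in> dir \<delta>" using dir_diff x k lattice_in_add[OF X] by blast
    then show ?thesis by simp
  qed
  then have "span (X \<inter> {x. r x = 0}) \<subseteq> dir \<delta>" by (intro span_minimal subspace_dir) blast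
  then show ?thesis using lattice_kernel_span[OF X X' r_linear r_image v] by blast
qed

text \<open>Vertices of the polytope lift to integral points of the cell. The convex combination of
  these lifts that lies over \<open>r u\<close> differs from \<open>u\<close> by a vector of the
  kernel of \<open>r\<close>, and such vectors are directions of every cell.\<close>

lemma diff_in_dir:
  assumes d: "\<delta> \<in> cells" and v: "v \<in> fst ` \<delta>" "v' \<in> fst ` \<delta>"
  shows "v - v' \<in> dir \<delta>"
proof -
  interpret r: linear r by (rule r_linear)
  obtain \<delta>' i where \<delta>': "\<delta>' \<in> C'" "\<delta> = pullback_cell X r \<rho>' \<delta>' i"
    using d unfolding pullback_cells_def by blast
  obtain V where V: "finite V" "V \<noteq> {}" "V \<subseteq> X'" "\<rho>' ` \<delta>' = convex hull V" using cell_polytope[OF \<delta>'(1)] by blast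
  have "\<forall>y\<in>V. \<exists>x\<in>X. r x = y" using V(3) r_image by blast
  then obtain l where l: "\<And>y. y \<in> V \<Longrightarrow> l y \<in> X \<and> r (l y) = y" by metis
  have l\<delta>: "l y \<in> fst ` \<delta>" if "y \<in> V" for y
    unfolding \<delta>'(2) fst_pullback_cell V(4) using l[OF that] that by (simp add: span_base hull_inc)
  obtain y0 where y0: "y0 \<in> V" using V(2) by blast
  have *: "u - l y0 \<in> dir \<delta>" if u: "u \<in> fst ` \<delta>" for u
  proof -
    have u': "u \<in> span X" "r u \<in> convex hull V" using u unfolding \<delta>'(2) fst_pullback_cell V(4) by auto
    obtain t where t: "\<forall>y\<in>V. 0 \<le> t y" "sum t V = 1" "(\<Sum>y\<in>V. t y *\<^sub>R y) = r u"
      using u'(2) convex_hull_finite[OF V(1)] by auto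
    define s where "s = (\<Sum>y\<in>V. t y *\<^sub>R l y)"
    have "r s = r u" unfolding s_def r.sum using l t(3) by (simp add: r.scale)
    moreover have "s \<in> span X" unfolding s_def using l by (intro span_sum span_scale span_base) auto
    ultimately have 1: "u - s \<in> dir \<delta>" using dir_kernel[OF d, of "u - s"] u'(1) by (simp add: span_diff r.diff)
    have "s - l y0 = (\<Sum>y\<in>V. t y *\<^sub>R (l y - l y0))"
      unfolding s_def scaleR_diff_right sum_subtractf scaleR_sum_left[symmetric] t(2) by simp
    also have "\<dots> \<in> dir \<delta>"
      using l l\<delta> y0 dir_diff by (intro subspace_sum[OF subspace_dir] subspace_scale[OF subspace_dir]) auto
    finally have "(u - s) + (s - l y0) \<in> dir \<delta>" using 1 subspace_add[OF subspace_dir] by blast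
    then show ?thesis by simp
  qed
  have "(v - l y0) - (v' - l y0) \<in> dir \<delta>" using *[OF v(1)] *[OF v(2)] subspace_diff[OF subspace_dir] by blast
  then show ?thesis by simp
qed

lemma aff_dim_dir:
  assumes d: "\<delta> \<in> cells" "aff_dim (fst ` \<delta>) = int k"
  shows "dim (dir \<delta>) = k"
proof -
  obtain x where x: "x \<in> X" "x \<in> fst ` \<delta>" by (rule integral_point_exists[OF d(1)])
  have "aff_dim (fst ` \<delta>) = int (dim ((\<lambda>y. - x + y) ` (fst ` \<delta>)))"
    by (rule aff_dim_eq_dim) (use x in \<open>simp add: hull_inc\<close>)
  moreover have "span ((\<lambda>y. - x + y) ` (fst ` \<delta>)) = dir \<delta>"
  proof
    show "span ((\<lambda>y. - x + y) ` (fst ` \<delta>)) \<subseteq> dir \<delta>"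
      using diff_in_dir[OF d(1) _ x(2)] by (intro span_minimal subspace_dir) (auto simp: image_subset_iff)
    show "dir \<delta> \<subseteq> span ((\<lambda>y. - x + y) ` (fst ` \<delta>))"
      unfolding dir_def
    proof (rule span_minimal[OF _ subspace_span], rule subsetI)
      fix u assume "u \<in> {x - x' |x x'. x \<in> X \<inter> fst ` \<delta> \<and> x' \<in> X \<inter> fst ` \<delta>}"
      then obtain y z where yz: "u = y - z" "y \<in> fst ` \<delta>" "z \<in> fst ` \<delta>" by blast
      then have "- x + y \<in> span ((\<lambda>y. - x + y) ` (fst ` \<delta>))" "- x + z \<in> span ((\<lambda>y. - x + y) ` (fst ` \<delta>))"
        by (blast intro: span_base)+
      then have "(- x + y) - (- x + z) \<in> span ((\<lambda>y. - x + y) ` (fst ` \<delta>))" by (rule span_diff)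
      then show "u \<in> span ((\<lambda>y. - x + y) ` (fst ` \<delta>))" using yz(1) by simp
    qed
  qed
  ultimately show ?thesis using d(2) by (metis dim_span of_nat_eq_iff)
qed

end

subsection \<open>One-parameter subgroups fixing an orbit closure\<close>

context theta_expansion
begin

definition one_param :: "('e \<Rightarrow> int) \<Rightarrow> complex \<Rightarrow> 'e \<Rightarrow> complex" where
  "one_param n t = restrict (\<lambda>x. t powi n x) X"

definition orbit_curve :: "('e \<Rightarrow> int) \<Rightarrow> 'b \<Rightarrow> complex \<Rightarrow> 'b" where
  "orbit_curve n z t = ta (one_param n t) z"

text \<open>The quotient of a section of \<open>\<O>(m\<Theta>)\<close> by
  \<open>\<theta>\<^sup>m\<close> along the curve: a genuine function, in which the chosen
  trivialization cancels.\<close>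

definition section_ratio ::
    "('e \<Rightarrow> int) \<Rightarrow> 'b \<Rightarrow> nat \<Rightarrow> (nat \<Rightarrow> 'p \<Rightarrow> 'p fibre_vec) \<Rightarrow> nat \<Rightarrow> complex \<Rightarrow> complex" where
  "section_ratio n z m s k t = (let p = \<pi> (orbit_curve n z t) in s k p (idx p) / (snd (idx p) p) ^ m)"

context
  fixes \<delta> :: "('e \<times> 'c \<times> 'i) set" and z :: 'b and n :: "'e \<Rightarrow> int"
    and m N :: nat and s :: "nat \<Rightarrow> 'p \<Rightarrow> 'p fibre_vec" and f :: "'p \<Rightarrow> (nat \<Rightarrow> complex) set"
  assumes z: "z \<in> pts Pt" and \<delta>: "cell (Zc z) = \<delta>"
    and n_add: "\<And>x y. x \<in> X \<Longrightarrow> y \<in> X \<Longrightarrow> n (x + y) = n x + n y"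
    and n_dir: "\<And>x. x \<in> X \<Longrightarrow> x \<in> dir \<delta> \<Longrightarrow> n x = 0"
    and theta_nz: "\<And>i. i \<in> \<Theta> \<Longrightarrow> \<pi> z \<in> fst i \<Longrightarrow> snd i (\<pi> z) \<noteq> 0"
    and m: "m > 0" and s: "\<And>k. k \<le> N \<Longrightarrow> bundle_section P \<Theta> m (s k)"
    and f: "closed_immersion P (proj_space N) f"
    and fs: "\<And>i p. i \<in> \<Theta> \<Longrightarrow> p \<in> fst i \<Longrightarrow> f p = proj_point (\<lambda>k. if k \<le> N then s k p i else 0)"
begin

abbreviation "lam \<equiv> one_param n"
abbreviation "curve \<equiv> orbit_curve n z"
abbreviation "ratio \<equiv> section_ratio n z m s"

lemma lam_torus: "t \<noteq> 0 \<Longrightarrow> lam t \<in> torus_pts X"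
  unfolding one_param_def torus_pts_def using n_add lattice_in_add[OF X] by (auto simp: power_int_add)

lemma lam_1: "lam 1 = \<one>\<^bsub>torus_group X\<^esub>"
  unfolding one_param_def torus_group_def by auto

lemma curve_pts: "t \<noteq> 0 \<Longrightarrow> curve t \<in> pts Pt"
  unfolding orbit_curve_def using ta_pts lam_torus z by blast

lemma curve_1: "curve 1 = z"
  unfolding orbit_curve_def lam_1 by (rule ta_one[OF z])

lemma curve_continuous: "continuous_map (top_of_set (- {0})) (spc Pt) curve"
proof -
  have "continuous_map (top_of_set (- {0})) Tan lam"
  proof (rule continuous_map_torus[OF X])
    fix x assume "x \<in> X"
    have "continuous_on (- {0}) (\<lambda>t::complex. t powi n x)" by (intro continuous_intros) auto
    then show "continuous_map (top_of_set (- {0})) euclidean (\<lambda>t. lam t x)"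
      using \<open>x \<in> X\<close> by (simp add: one_param_def)
  qed (use lam_torus in auto)
  then have "continuous_map (top_of_set (- {0})) (spc Pt) (\<lambda>t. ta (lam t) z)"
    by (rule ta_continuous_pair) (use z in simp)
  then show ?thesis by (simp add: orbit_curve_def[abs_def])
qed

text \<open>The kernel of \<open>r\<close> lies in the directions of every cell, so \<open>n\<close>
  vanishes on it and descends to \<open>X'\<close>. Thus the subgroup comes from \<open>T'\<close>,
  whose image in \<open>G\<close> is algebraic, whereas \<open>\<phi>\<close> is only
  holomorphic.\<close>

lemma lam_factors:
  obtains n' where "\<And>x. x \<in> X \<Longrightarrow> n x = n' (r x)" "\<And>x y. x \<in> X' \<Longrightarrow> y \<in> X' \<Longrightarrow> n' (x + y) = n' x + (n' y :: int)"
proof -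
  have ker: "n x = 0" if "x \<in> X" "r x = 0" for x
    using n_dir dir_kernel[OF cell_in[OF z]] \<delta> that by (auto simp: span_base)
  have nm: "n (x - y) = n x - n y" if "x \<in> X" "y \<in> X" for x y
    using n_add[of "x - y" y] lattice_in_diff[OF X] that by simp
  have inj: "n x = n y" if "x \<in> X" "y \<in> X" "r x = r y" for x y
    using ker[of "x - y"] nm[OF that(1,2)] lattice_in_diff[OF X] that linear_diff[OF r_linear] by auto
  define n' where "n' y = n (SOME x. x \<in> X \<and> r x = y)" for y
  have n': "n x = n' (r x)" if "x \<in> X" for x
  proof -
    have "(SOME y. y \<in> X \<and> r y = r x) \<in> X \<and> r (SOME y. y \<in> X \<and> r y = r x) = r x"
      by (rule someI[of _ x]) (use that in simp)
    then show ?thesis unfolding n'_def using inj[OF that] by metis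
  qed
  have "n' (x + y) = n' x + n' y" if xy: "x \<in> X'" "y \<in> X'" for x y
  proof -
    obtain u v where "u \<in> X" "v \<in> X" "x = r u" "y = r v" using xy r_image by blast
    then show ?thesis using n'[of "u + v"] n'[of u] n'[of v] n_add[of u v] lattice_in_add[OF X] linear_add[OF r_linear] by simp
  qed
  then show thesis using that n' by blast
qed

text \<open>The chain \<open>t \<mapsto> lam' t \<mapsto> \<iota> (lam' t) \<mapsto> act (\<iota>
  (lam' t)) (\<pi> z)\<close> is algebraic at each stage. It agrees with the projected curve because
  \<open>\<phi>\<close> restricts to \<open>\<iota>\<close> on \<open>T'\<close>.\<close>

lemma curve_algebraic: "cmorphism punctured_line P (\<pi> \<circ> curve)"
proof -
  obtain n' where n': "\<And>x. x \<in> X \<Longrightarrow> n x = n' (r x)" "\<And>x y. x \<in> X' \<Longrightarrow> y \<in> X' \<Longrightarrow> n' (x + y) = n' x + (n' y :: int)"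
    by (rule lam_factors) (rule that)
  define lam' where "lam' t = restrict (\<lambda>y. t powi n' y) X'" for t :: complex
  have l': "lam' t \<in> torus_pts X'" if "t \<noteq> 0" for t
    unfolding lam'_def torus_pts_def using that n'(2) lattice_in_add[OF X'] by (auto simp: power_int_add)
  have 1: "cmorphism punctured_line (torus X') lam'"
  proof (rule cmorphism_torus[OF local_ring_sheaf_punctured_line X'])
    fix y assume "y \<in> pts punctured_line"
    then show "lam' y \<in> torus_pts X'" using l' unfolding pts_punctured_line by auto
  next
    fix x assume "x \<in> X'"
    then show "(\<lambda>t. lam' t x) \<in> funs punctured_line (pts punctured_line)"
      unfolding pts_punctured_line lam'_def using punctured_line_powi[of "n' x"] by simp
  qed
  have 2: "cmorphism (torus X') G \<iota>" by (rule closed_immersion_cmorphism[OF \<iota>_immersion sheaf_G])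
  have 3: "cmorphism punctured_line (alg_prod G P) (\<lambda>t. ((\<iota> \<circ> lam') t, \<pi> z))"
    by (rule cmorphism_pair_const[OF local_ring_sheaf_punctured_line cmorphism_comp[OF 1 2] \<pi>_pts[OF z] sheaf_G _ sheaf_P])
      (use closed_diagonal_functions[OF diagonal_G] closed_diagonal_functions[OF diagonal_P] in blast)+
  have 4: "cmorphism punctured_line P ((\<lambda>(g, p). act g p) \<circ> (\<lambda>t. ((\<iota> \<circ> lam') t, \<pi> z)))"
    by (rule cmorphism_comp[OF 3 act_morphism])
  have eq: "((\<lambda>(g, p). act g p) \<circ> (\<lambda>t. ((\<iota> \<circ> lam') t, \<pi> z))) t = (\<pi> \<circ> curve) t" if t: "t \<in> - {0}" for t
  proof -
    have "lam t = restrict (\<lambda>x. lam' t (r x)) X"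
      unfolding one_param_def lam'_def using n'(1) r_image by (auto simp: fun_eq_iff)
    then have "\<phi> (lam t) = \<iota> (lam' t)" using \<phi>_lift[OF l'] t by simp
    then show ?thesis using ta_lifts[OF lam_torus z] t by (simp add: orbit_curve_def)
  qed
  show ?thesis
    unfolding cmorphism_def
  proof (intro conjI allI ballI)
    show "continuous_map (spc punctured_line) (spc P) (\<pi> \<circ> curve)"
      by (rule continuous_map_eq[of _ _ "(\<lambda>(g, p). act g p) \<circ> (\<lambda>t. ((\<iota> \<circ> lam') t, \<pi> z))"])
        (use 4 eq in \<open>auto simp: cmorphism_def pts_punctured_line\<close>)
    fix V h assume h: "h \<in> funs P V"
    define \<psi> where "\<psi> = (\<lambda>(g, p). act g p) \<circ> (\<lambda>t. ((\<iota> \<circ> lam') t, \<pi> z))"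
    have "h \<circ> \<psi> \<in> funs punctured_line {t \<in> pts punctured_line. \<psi> t \<in> V}"
      using 4 h unfolding \<psi>_def cmorphism_def by blast
    moreover have "{t \<in> pts punctured_line. \<psi> t \<in> V} = {t \<in> pts punctured_line. (\<pi> \<circ> curve) t \<in> V}"
      using eq unfolding pts_punctured_line \<psi>_def by auto
    ultimately have h': "h \<circ> \<psi> \<in> funs punctured_line {t \<in> pts punctured_line. (\<pi> \<circ> curve) t \<in> V}" by simp
    show "h \<circ> (\<pi> \<circ> curve) \<in> funs punctured_line {t \<in> pts punctured_line. (\<pi> \<circ> curve) t \<in> V}"
      by (rule function_sheaf_cong[OF local_ring_sheaf_sheaf[OF local_ring_sheaf_punctured_line] h'])
        (use eq in \<open>auto simp: \<psi>_def pts_punctured_line\<close>)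
  qed
qed

lemma weight_const:
  obtains n0 where "\<And>w. w \<in> supp z \<Longrightarrow> n (fst w) = n0"
proof -
  obtain w0 where w0: "w0 \<in> supp z" using supp_nonempty[OF z] by blast
  have "n (fst w) = n (fst w0)" if w: "w \<in> supp z" for w
  proof -
    have xx: "fst w \<in> X" "fst w0 \<in> X" using w w0 IP_fst unfolding supp_def by auto
    have "fst w - fst w0 \<in> dir \<delta>" using dir_diff xx supp_cell[OF z w] supp_cell[OF z w0] \<delta> by blast
    then have "n (fst w - fst w0) = 0" using n_dir lattice_in_diff[OF X] xx by blast
    then show ?thesis using n_add[of "fst w - fst w0" "fst w0"] xx lattice_in_diff[OF X] by simp
  qed
  then show thesis using that by blast
qed

text \<open>All weights of \<open>\<theta>\<close> on the curve agree, so \<open>\<theta>\<close> is proportional to each \<open>\<xi> w\<close> along it.\<close>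

lemma theta_curve:
  assumes t: "t \<noteq> 0" and j: "j \<in> \<Theta>" "\<pi> (curve t) \<in> fst j" and i: "i \<in> \<Theta>" "\<pi> z \<in> fst i"
  shows "snd j (\<pi> (curve t)) \<noteq> 0"
    "w \<in> IP \<Longrightarrow> snd j (\<pi> (curve t)) * \<xi> w z i = \<xi> w (curve t) j * snd i (\<pi> z)"
proof -
  obtain n0 where n0: "\<And>w. w \<in> supp z \<Longrightarrow> n (fst w) = n0" by (rule weight_const) (rule that)
  have a: "lam t \<in> torus_pts X" by (rule lam_torus[OF t])
  have j': "\<pi> (ta (lam t) z) \<in> fst j" using j(2) unfolding orbit_curve_def .
  obtain \<mu> where \<mu>0: "\<mu> \<noteq> 0" "\<And>w. w \<in> IP \<Longrightarrow> \<xi> w (ta (lam t) z) j = lam t (fst w) * \<mu> * \<xi> w z i"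
    by (rule \<xi>_ta[OF a z i j(1) j']) (rule that)
  note \<mu> = \<mu>0[folded orbit_curve_def]
  have e: "\<xi> w (curve t) j = (t powi n0 * \<mu>) * \<xi> w z i" if w: "w \<in> IP" for w
  proof (cases "w \<in> supp z")
    case True
    then show ?thesis using \<mu>(2)[OF w] n0[OF True] IP_fst[OF w] by (simp add: one_param_def)
  next
    case False
    then have "\<xi> w z i = 0" using supp_iff[OF z i, of w] w by blast
    then show ?thesis using \<mu>(2)[OF w] by simp
  qed
  have "((\<lambda>w. (t powi n0 * \<mu>) * \<xi> w z i) has_sum (t powi n0 * \<mu>) * snd i (\<pi> z)) IP"
    by (rule has_sum_cmult_right[OF \<xi>_sum[OF z i]])
  then have "((\<lambda>w. \<xi> w (curve t) j) has_sum (t powi n0 * \<mu>) * snd i (\<pi> z)) IP"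
    by (subst has_sum_cong[OF e])
  then have th: "snd j (\<pi> (curve t)) = (t powi n0 * \<mu>) * snd i (\<pi> z)"
    using \<xi>_sum[OF curve_pts[OF t] j] has_sum_unique by blast
  then show "snd j (\<pi> (curve t)) \<noteq> 0" using theta_nz[OF i] \<mu>(1) t by simp
  show "snd j (\<pi> (curve t)) * \<xi> w z i = \<xi> w (curve t) j * snd i (\<pi> z)" if "w \<in> IP"
    unfolding th e[OF that] by simp
qed

lemma ratio_eq:
  assumes t: "t \<noteq> 0" and j: "j \<in> \<Theta>" "\<pi> (curve t) \<in> fst j" and k: "k \<le> N"
  shows "ratio k t * (snd j (\<pi> (curve t))) ^ m = s k (\<pi> (curve t)) j"
proof -
  define p where "p = \<pi> (curve t)"
  have p: "p \<in> pts P" unfolding p_def by (rule \<pi>_pts[OF curve_pts[OF t]])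
  obtain i where i: "i \<in> \<Theta>" "\<pi> z \<in> fst i" using index_exists[OF \<pi>_pts[OF z]] by blast
  have nz: "snd (idx p) p \<noteq> 0" using theta_curve(1)[OF t _ _ i] idx[OF p] unfolding p_def by blast
  have jp: "p \<in> fst j" using j(2) p_def by simp
  obtain u where u: "u \<noteq> 0" "snd (idx p) p = u * snd j p" "\<And>m v. v \<in> bundle_fibre P \<Theta> m p \<Longrightarrow> v (idx p) = u ^ m * v j"
    by (rule fibre_change[OF idx(1)[OF p] j(1) idx(2)[OF p] jp]) (rule that)
  have "s k p \<in> bundle_fibre P \<Theta> m p" using s[OF k] p unfolding bundle_section_def by blast
  then have "s k p (idx p) = u ^ m * s k p j" by (rule u(3))
  then show ?thesis unfolding section_ratio_def Let_def p_def[symmetric] using nz u(1,2) by (simp add: power_mult_distrib)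
qed

text \<open>Since \<open>\<theta>\<close> has no zero on the curve, dividing by its power keeps the
  pulled-back section regular on the whole punctured line.\<close>

lemma ratio_regular:
  assumes k: "k \<le> N"
  shows "ratio k \<in> funs punctured_line (- {0})"
proof (rule function_sheaf_local[OF local_ring_sheaf_sheaf[OF local_ring_sheaf_punctured_line]])
  note L = local_ring_sheaf_punctured_line
  show "openin (spc punctured_line) (- {0})" using pts_punctured_line openin_topspace by metis
  fix t0 :: complex assume t0: "t0 \<in> - {0}"
  define j where "j = idx (\<pi> (curve t0))"
  have j: "j \<in> \<Theta>" "\<pi> (curve t0) \<in> fst j" unfolding j_def using idx_\<pi>[OF curve_pts] t0 by auto
  obtain i where i: "i \<in> \<Theta>" "\<pi> z \<in> fst i" using index_exists[OF \<pi>_pts[OF z]] by blast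
  define W where "W = {t \<in> - {0}. \<pi> (curve t) \<in> fst j}"
  have pull: "(\<lambda>t. h (\<pi> (curve t))) \<in> funs punctured_line W" if "h \<in> funs P (fst j)" for h
    using curve_algebraic that unfolding cmorphism_def W_def pts_punctured_line by (auto simp: o_def)
  have th: "(\<lambda>t. snd j (\<pi> (curve t))) \<in> funs punctured_line W" by (rule pull[OF index_open[OF j(1)]])
  have "(\<lambda>p. s k p j) \<in> funs P (fst j)" using s[OF k] j(1) unfolding bundle_section_def by blast
  then have sk: "(\<lambda>t. s k (\<pi> (curve t)) j) \<in> funs punctured_line W" by (rule pull)
  have oW: "openin (spc punctured_line) W" using th unfolding punctured_line_funs by blast
  have "{t \<in> W. snd j (\<pi> (curve t)) \<noteq> 0} = W" using theta_curve(1)[OF _ j(1) _ i] unfolding W_def by auto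
  then have inv: "(\<lambda>t. 1 / snd j (\<pi> (curve t))) \<in> funs punctured_line W"
    using local_ring_sheaf_inverse(2)[OF L th] by simp
  have "(\<lambda>t. (1 / snd j (\<pi> (curve t))) ^ l) \<in> funs punctured_line W" for l
  proof (induction l)
    case 0
    then show ?case using local_ring_sheaf_const[OF L oW] by simp
  next
    case (Suc l)
    then show ?case using local_ring_sheaf_mult[OF L inv Suc] by simp
  qed
  from local_ring_sheaf_mult[OF L sk this[of m]]
  have q: "(\<lambda>t. s k (\<pi> (curve t)) j * (1 / snd j (\<pi> (curve t))) ^ m) \<in> funs punctured_line W" .
  have "ratio k \<in> funs punctured_line W"
  proof (rule function_sheaf_cong[OF local_ring_sheaf_sheaf[OF L] q])
    fix t assume "t \<in> W"
    then have t: "t \<noteq> 0" "\<pi> (curve t) \<in> fst j" unfolding W_def by auto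
    show "ratio k t = s k (\<pi> (curve t)) j * (1 / snd j (\<pi> (curve t))) ^ m"
      using ratio_eq[OF t(1) j(1) t(2) k] theta_curve(1)[OF t(1) j(1) t(2) i] by (simp add: field_simps)
  qed
  then show "\<exists>V. t0 \<in> V \<and> V \<subseteq> - {0} \<and> ratio k \<in> funs punctured_line V"
    using t0 j(2) by (intro exI[of _ W]) (auto simp: W_def)
qed

text \<open>The common factor \<open>\<theta>\<^sup>m\<close> is invisible in homogeneous
  coordinates, so the ratios are coordinates of the projective embedding along the curve. The free
  scalar \<open>c\<close> allows a pole to be cleared.\<close>

lemma f_curve:
  assumes t: "t \<noteq> 0" and c: "c \<noteq> 0"
  shows "f (\<pi> (curve t)) = proj_point (\<lambda>k. if k \<le> N then c * ratio k t else 0)"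
    "(\<lambda>k. if k \<le> N then c * ratio k t else 0) \<in> punctured N"
proof -
  define p where "p = \<pi> (curve t)"
  have p: "p \<in> pts P" unfolding p_def by (rule \<pi>_pts[OF curve_pts[OF t]])
  define j where "j = idx p"
  have j: "j \<in> \<Theta>" "p \<in> fst j" unfolding j_def using idx[OF p] by auto
  obtain i where i: "i \<in> \<Theta>" "\<pi> z \<in> fst i" using index_exists[OF \<pi>_pts[OF z]] by blast
  have nz: "snd j p \<noteq> 0" using theta_curve(1)[OF t j(1) _ i] j(2) unfolding p_def by blast
  define d where "d = (snd j p) ^ m / c"
  have d: "d \<noteq> 0" using nz c by (simp add: d_def)
  have "s k p j = d * (c * ratio k t)" if "k \<le> N" for k
    using ratio_eq[OF t j(1) _ that] j(2) c unfolding p_def d_def by (simp add: mult.commute)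
  then have "(\<lambda>k. if k \<le> N then s k p j else 0) = (\<lambda>k. d * (if k \<le> N then c * ratio k t else 0))" by auto
  then have "proj_point (\<lambda>k. if k \<le> N then c * ratio k t else 0) = proj_point (\<lambda>k. if k \<le> N then s k p j else 0)"
    unfolding proj_point_eq_iff using d by blast
  then show fp: "f (\<pi> (curve t)) = proj_point (\<lambda>k. if k \<le> N then c * ratio k t else 0)"
    using fs[OF j] p_def by simp
  have "f p \<in> pts (proj_space N)"
    using f p unfolding closed_immersion_def by (meson closedin_subset imageI subsetD)
  then obtain v where v: "v \<in> punctured N" "f p = proj_point v" using pts_proj_space by blast
  then have "proj_point v = proj_point (\<lambda>k. if k \<le> N then c * ratio k t else 0)" using fp p_def by simp
  then obtain e where e: "e \<noteq> 0" "(\<lambda>k. if k \<le> N then c * ratio k t else 0) = (\<lambda>k. e * v k)"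
    unfolding proj_point_eq_iff by blast
  then show "(\<lambda>k. if k \<le> N then c * ratio k t else 0) \<in> punctured N"
    unfolding e(2) using v(1) by (auto simp: punctured_def)
qed

lemma curve_value_tendsto:
  assumes lim: "\<And>U. openin Pan U \<Longrightarrow> p \<in> U \<Longrightarrow> \<forall>\<^sub>F t in at 0. \<pi> (curve t) \<in> U"
    and h: "h \<in> funs P U" "p \<in> U"
  shows "((\<lambda>t. h (\<pi> (curve t))) \<longlongrightarrow> h p) (at 0)"
proof (rule topological_tendstoI)
  fix S assume S: "open S" "h p \<in> S"
  have "openin Pan {x \<in> U. h x \<in> S}" unfolding analytification_def
    by (rule an_space_generator[OF _ S(1)]) (use h(1) in simp)
  from lim[OF this] show "\<forall>\<^sub>F t in at 0. h (\<pi> (curve t)) \<in> S" using h(2) S(2) by (auto elim: eventually_mono)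
qed

lemma curve_connected:
  assumes e: "e > 0"
  shows "connectedin (spc Pt) (curve ` (ball 0 e - {0}))"
proof -
  have "connected (ball (0::complex) e - {0})" by (rule connected_punctured_ball) simp
  then have "connectedin (top_of_set (- {0::complex})) (ball 0 e - {0})" by (auto simp: connectedin_subtopology)
  then show ?thesis by (rule connectedin_continuous_map_image[OF curve_continuous])
qed

text \<open>A limit of the curve in \<open>P\<close> lifts to the covering, where \<open>\<theta>\<close> does not vanish.\<close>

lemma curve_limit_theta:
  assumes p: "p \<in> pts P" and lim: "\<And>U. openin Pan U \<Longrightarrow> p \<in> U \<Longrightarrow> \<forall>\<^sub>F t in at 0. \<pi> (curve t) \<in> U"
    and j: "j \<in> \<Theta>" "p \<in> fst j"
  shows "snd j p \<noteq> 0"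
proof -
  obtain U V g where s: "sheet U V g" "p \<in> U" by (rule sheet_exists[OF p])
  have oU: "openin Pan U" and oV: "openin (spc Pt) V" using s unfolding sheet_def by blast+
  obtain e where e0: "e > 0" "\<forall>t\<in>UNIV. t \<noteq> 0 \<and> dist t 0 < e \<longrightarrow> \<pi> (curve t) \<in> U"
    using lim[OF oU s(2)] unfolding eventually_at by blast
  have e: "e > 0" "\<And>t. t \<noteq> 0 \<Longrightarrow> cmod t < e \<Longrightarrow> \<pi> (curve t) \<in> U" using e0 by (auto simp: dist_norm)
  \<comment> \<open>The curve over a punctured disc is connected and lies over \<open>U\<close>,
    hence in a single sheet; the limit point \<open>p\<close> is lifted to the point
    \<open>z0\<close> of that same sheet.\<close>
  define S where "S = curve ` (ball 0 e - {0})"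
  have con: "connectedin (spc Pt) S" unfolding S_def by (rule curve_connected[OF e(1)])
  have SU: "\<pi> ` S \<subseteq> U" unfolding S_def by (auto intro!: e(2))
  define t0 where "t0 = complex_of_real (e / 2)"
  have t0: "t0 \<noteq> 0" "cmod t0 < e" unfolding t0_def using e(1) by (auto simp: norm_divide)
  have t0S: "curve t0 \<in> S" unfolding S_def using t0 by auto
  obtain x v where x: "x \<in> X" "v \<in> V" "curve t0 = dk x v"
    using sheet_cover[OF s(1) curve_pts[OF t0(1)] e(2)[OF t0]] by blast
  have "S \<inter> dk x ` V \<noteq> {}" using x t0S by blast
  then have SV: "S \<subseteq> dk x ` V" by (rule connected_in_sheet[OF s(1) con SU x(1)])
  have gp: "g p \<in> V" "\<pi> (g p) = p" using s unfolding sheet_def by blast+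
  define z0 where "z0 = dk x (g p)"
  have z0V: "z0 \<in> dk x ` V" unfolding z0_def using gp(1) by blast
  have pz0: "\<pi> z0 = p" unfolding z0_def using sheet_\<pi>[OF s(1) x(1) gp(1)] gp(2) by simp
  have z0P: "z0 \<in> pts Pt" unfolding z0_def using dk_pts x(1) gp(1) sheet_subset[OF s(1)] by blast
  \<comment> \<open>Since \<open>\<pi>\<close> is open, a neighbourhood of \<open>z0\<close> in the
    sheet projects to one of \<open>p\<close>, which the projected curve enters. Injectivity on the
    sheet brings this back to the curve itself.\<close>
  have near: "\<forall>\<^sub>F t in at 0. curve t \<in> M \<and> t \<noteq> 0" if M: "openin (spc Pt) M" "z0 \<in> M" for M
  proof -
    have "openin (spc Pt) (M \<inter> dk x ` V)" by (intro openin_Int M(1) dk_open x(1) oV)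
    then have "openin Pan (\<pi> ` (M \<inter> dk x ` V))" by (rule \<pi>_open)
    moreover have "p \<in> \<pi> ` (M \<inter> dk x ` V)" using M(2) z0V pz0 by blast
    ultimately have "\<forall>\<^sub>F t in at 0. \<pi> (curve t) \<in> \<pi> ` (M \<inter> dk x ` V)" by (rule lim)
    moreover have "\<forall>\<^sub>F t in at 0. t \<noteq> 0 \<and> cmod t < e"
      unfolding eventually_at using e(1) by (auto simp: dist_norm)
    ultimately show ?thesis
    proof eventually_elim
      case (elim t)
      then obtain y where y: "y \<in> M" "y \<in> dk x ` V" "\<pi> (curve t) = \<pi> y" by blast
      have "curve t \<in> S" unfolding S_def using elim by auto
      then have "curve t = y" using sheet_inj[OF s(1) x(1) _ y(2,3)] SV by blast
      then show ?case using y(1) elim by simp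
    qed
  qed
  obtain w where w: "w \<in> supp z0" using supp_nonempty[OF z0P] by blast
  have wIP: "w \<in> IP" using w unfolding supp_def by blast
  have pz0j: "\<pi> z0 \<in> fst j" using pz0 j(2) by simp
  have wz0: "\<xi> w z0 j \<noteq> 0" using supp_iff[OF z0P j(1) pz0j] w by blast
  obtain i where i: "i \<in> \<Theta>" "\<pi> z \<in> fst i" using index_exists[OF \<pi>_pts[OF z]] by blast
  define W where "W = {y \<in> pts Pt. \<pi> y \<in> fst j}"
  have oW: "openin (spc Pt) W" unfolding W_def
    by (rule openin_continuous_map_preimage[OF \<pi>_continuous analytification_open[OF index_open[OF j(1)]]])
  have c1: "continuous_map (subtopology (spc Pt) W) euclidean (\<lambda>y. \<xi> w y j)"
    unfolding W_def by (rule eig_continuous[OF \<xi>_eigensection[OF wIP] j(1) closedin_topspace])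
  have c2: "continuous_map (subtopology (spc Pt) W) euclidean (\<lambda>y. snd j (\<pi> y))"
  proof -
    have "continuous_map (subtopology Pan (fst j)) euclidean (snd j)"
      using analytification_continuous[OF index_open[OF j(1)]] by (simp add: continuous_space_funs)
    moreover have "continuous_map (subtopology (spc Pt) W) (subtopology Pan (fst j)) \<pi>"
      using \<pi>_continuous by (auto simp: continuous_map_in_subtopology W_def intro: continuous_map_from_subtopology)
    ultimately have "continuous_map (subtopology (spc Pt) W) euclidean (snd j \<circ> \<pi>)" by (rule continuous_map_compose[rotated])
    then show ?thesis by (simp add: o_def)
  qed
  \<comment> \<open>The proportionality of \<open>\<theta>\<close> and \<open>\<xi> w\<close> along
    the curve is a closed condition and holds at \<open>z0\<close>. As \<open>w\<close> is in the
    support of \<open>z0\<close>, it forces \<open>\<theta>\<close> to be nonzero at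
    \<open>p\<close>.\<close>
  define E where "E y = snd j (\<pi> y) * \<xi> w z i - \<xi> w y j * snd i (\<pi> z)" for y
  have "continuous_map (subtopology (spc Pt) W) euclidean E"
    unfolding E_def using c1 c2 by (auto simp: continuous_map_atin intro!: tendsto_diff tendsto_mult)
  then have "E \<in> funs (continuous_space (spc Pt)) W" using oW by (simp add: continuous_space_funs)
  then have oE: "openin (spc Pt) {y \<in> W. E y \<noteq> 0}"
    using local_ring_sheaf_inverse(1)[OF local_ring_sheaf_continuous_space] by fastforce
  have E0: "E z0 = 0"
  proof (rule ccontr)
    assume "E z0 \<noteq> 0"
    then have "z0 \<in> {y \<in> W. E y \<noteq> 0}" using z0P pz0j W_def by blast
    from near[OF oE this] have "\<forall>\<^sub>F t in at (0::complex). False"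
    proof eventually_elim
      case (elim t)
      then have "\<pi> (curve t) \<in> fst j" "t \<noteq> 0" unfolding W_def by auto
      then have "E (curve t) = 0" unfolding E_def using theta_curve(2)[OF _ j(1) _ i wIP] by simp
      then show ?case using elim by simp
    qed
    then show False by simp
  qed
  then have "snd j p * \<xi> w z i = \<xi> w z0 j * snd i (\<pi> z)" unfolding E_def pz0 by simp
  then show ?thesis using wz0 theta_nz[OF i] by auto
qed

text \<open>A pole would be cleared by a positive power \<open>t ^ q\<close>, and the rescaled
  coordinates would converge to a point \<open>p\<close> of \<open>P\<close>, which is closed in
  projective space. But \<open>\<theta>\<close> is nonzero at \<open>p\<close>, so
  \<open>s k / \<theta>\<^sup>m\<close> stays finite there and multiplication by
  \<open>t ^ q\<close> kills every limit coordinate.\<close>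

lemma ratio_limit:
  assumes k0: "k0 \<le> N"
  shows "\<exists>l. (ratio k0 \<longlongrightarrow> l) (at 0)"
proof (rule ccontr)
  assume no: "\<not> ?thesis"
  have reg: "ratio k \<in> funs punctured_line (- {0})" if "k \<le> N" for k by (rule ratio_regular[OF that])
  obtain q v where q: "q > 0" "\<And>k. k \<le> N \<Longrightarrow> ((\<lambda>t. t ^ q * ratio k t) \<longlongrightarrow> v k) (at 0)" "\<exists>k\<le>N. v k \<noteq> 0"
    by (rule common_pole_order[where F = ratio and N = N, OF _ k0 no]) (use reg that in blast)+
  define v' where "v' k = (if k \<le> N then v k else 0)" for k
  define c where "c t = (\<lambda>k. if k \<le> N then t ^ q * ratio k t else 0)" for t
  have v'p: "v' \<in> punctured N" unfolding punctured_def v'_def using q(3) by auto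
  have cp: "c t \<in> punctured N" "f (\<pi> (curve t)) = proj_point (c t)" if "t \<noteq> 0" for t
    unfolding c_def using f_curve[OF that, of "t ^ q"] that by auto
  have "((\<lambda>t. c t k) \<longlongrightarrow> v' k) (at 0)" for k
    using q(2)[of k] by (cases "k \<le> N") (simp_all add: c_def v'_def)
  then have "limitin (product_topology (\<lambda>_::nat. euclidean) UNIV) c v' (at 0)"
    unfolding limitin_componentwise by simp
  then have clim: "(c \<longlongrightarrow> v') (at 0)" by (simp add: euclidean_product_topology)
  have pP: "pts (analytification P) = pts P" by (rule pts_Pan)
  obtain C \<kappa> where C: "closedin (top_of_set (punctured N)) C" "C = {v \<in> punctured N. proj_point v \<in> f ` pts P}"
    "continuous_map (top_of_set C) Pan \<kappa>" "\<And>v. v \<in> C \<Longrightarrow> \<kappa> v \<in> pts P \<and> f (\<kappa> v) = proj_point v"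
    by (rule projective_parametrization[OF sheaf_P pP f]) (rule that, assumption+)
  obtain A where A: "closed A" "C = punctured N \<inter> A" using C(1) by (auto simp: closedin_closed)
  have cC: "c t \<in> C" if "t \<noteq> 0" for t unfolding C(2) using cp[OF that] \<pi>_pts[OF curve_pts[OF that]] by auto
  have ne0: "\<forall>\<^sub>F t in at (0::complex). t \<noteq> 0" by (simp add: eventually_at_filter)
  have "\<forall>\<^sub>F t in at 0. c t \<in> A" using ne0 by eventually_elim (use cC A(2) in blast)
  then have "v' \<in> A" by (rule Lim_in_closed_set[OF A(1) _ _ clim]) simp
  then have v'C: "v' \<in> C" using A(2) v'p by blast
  define p where "p = \<kappa> v'"
  have pP': "p \<in> pts P" unfolding p_def using C(4)[OF v'C] by blast
  have lim: "\<forall>\<^sub>F t in at 0. \<pi> (curve t) \<in> U" if U: "openin Pan U" "p \<in> U" for U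
  proof -
    have "openin (top_of_set C) {x \<in> C. \<kappa> x \<in> U}" using openin_continuous_map_preimage[OF C(3) U(1)] by simp
    then obtain O' where O': "open O'" "{x \<in> C. \<kappa> x \<in> U} = C \<inter> O'" by (auto simp: openin_open)
    have "v' \<in> O'" using O'(2) v'C U(2) p_def by blast
    then have "\<forall>\<^sub>F t in at 0. c t \<in> O'" using clim O'(1) by (simp add: topological_tendstoD)
    then show ?thesis using ne0
    proof eventually_elim
      case (elim t)
      then have k: "\<kappa> (c t) \<in> U" using O'(2) cC by blast
      have "f (\<kappa> (c t)) = f (\<pi> (curve t))" using C(4)[OF cC] cp(2) elim by simp
      then have "\<kappa> (c t) = \<pi> (curve t)"
        using closed_immersion_inj[OF f] C(4)[OF cC] \<pi>_pts[OF curve_pts] elim by blast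
      then show ?case using k by simp
    qed
  qed
  define j where "j = idx p"
  have j: "j \<in> \<Theta>" "p \<in> fst j" unfolding j_def using idx[OF pP'] by auto
  have nz: "snd j p \<noteq> 0" by (rule curve_limit_theta[OF pP' lim j])
  obtain k where k: "k \<le> N" "v k \<noteq> 0" using q(3) by blast
  have sf: "(\<lambda>p. s k p j) \<in> funs P (fst j)" using s[OF k(1)] j(1) unfolding bundle_section_def by blast
  have l1: "((\<lambda>t. (snd j (\<pi> (curve t))) ^ m * (t ^ q * ratio k t)) \<longlongrightarrow> (snd j p) ^ m * v k) (at 0)"
    by (intro tendsto_mult tendsto_power curve_value_tendsto[OF lim index_open[OF j(1)] j(2)] q(2)[OF k(1)])
  have l2: "((\<lambda>t. t ^ q * s k (\<pi> (curve t)) j) \<longlongrightarrow> 0 ^ q * s k p j) (at 0)"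
    by (intro tendsto_mult tendsto_power tendsto_ident_at curve_value_tendsto[OF lim sf j(2)])
  have "\<forall>\<^sub>F t in at 0. \<pi> (curve t) \<in> fst j" by (rule lim[OF analytification_open[OF index_open[OF j(1)]] j(2)])
  then have "\<forall>\<^sub>F t in at 0. (snd j (\<pi> (curve t))) ^ m * (t ^ q * ratio k t) = t ^ q * s k (\<pi> (curve t)) j"
    using ne0
  proof eventually_elim
    case (elim t)
    then show ?case using ratio_eq[OF _ j(1) _ k(1), of t] by (simp add: mult.commute mult.left_commute)
  qed
  then have "((\<lambda>t. t ^ q * s k (\<pi> (curve t)) j) \<longlongrightarrow> (snd j p) ^ m * v k) (at 0)"
    using l1 by (subst (asm) tendsto_cong)
  then have "(snd j p) ^ m * v k = 0 ^ q * s k p j" using l2 by (intro tendsto_unique[of "at 0"]) simp_all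
  moreover have "(0::complex) ^ q = 0" using q(1) by simp
  ultimately have "(snd j p) ^ m * v k = 0" by simp
  then show False using nz k(2) by simp
qed

text \<open>With finite limits at both ends all ratios are constant, so the curve in projective
  space, hence in \<open>P\<close>, is a point. The curve upstairs is connected over that point and
  cannot leave its sheet.\<close>

lemma curve_constant:
  assumes lim: "\<And>k. k \<le> N \<Longrightarrow> \<exists>l. ((\<lambda>t. ratio k (1 / t)) \<longlongrightarrow> l) (at 0)" and t: "t \<noteq> 0"
  shows "curve t = z"
proof -
  have const: "ratio k u = ratio k 1" if ku: "k \<le> N" "u \<noteq> 0" for k u
  proof -
    obtain l0 l1 where "(ratio k \<longlongrightarrow> l0) (at 0)" "((\<lambda>t. ratio k (1 / t)) \<longlongrightarrow> l1) (at 0)"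
      using ratio_limit[OF ku(1)] lim[OF ku(1)] by blast
    then show ?thesis by (rule bounded_punctured_line_fun_constant[OF ratio_regular[OF ku(1)] _ _ ku(2)])
  qed
  have \<pi>c: "\<pi> (curve u) = \<pi> z" if u: "u \<noteq> 0" for u
  proof -
    have "(\<lambda>k. if k \<le> N then 1 * ratio k u else 0) = (\<lambda>k. if k \<le> N then 1 * ratio k 1 else 0)"
      using const[OF _ u] by auto
    then have "f (\<pi> (curve u)) = f (\<pi> (curve 1))" using f_curve(1)[OF u, of 1] f_curve(1)[of 1 1] by simp
    then show ?thesis using closed_immersion_inj[OF f \<pi>_pts[OF curve_pts[OF u]] \<pi>_pts[OF z]] curve_1 by simp
  qed
  obtain U V g where sh: "sheet U V g" "\<pi> z \<in> U" by (rule sheet_exists[OF \<pi>_pts[OF z]])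
  define S where "S = curve ` (- {0})"
  have "connected (- {0::complex})" by (rule connected_punctured_universe) simp
  then have "connectedin (top_of_set (- {0::complex})) (- {0})" by (simp add: connectedin_subtopology)
  then have con: "connectedin (spc Pt) S" unfolding S_def by (rule connectedin_continuous_map_image[OF curve_continuous])
  obtain x v where x: "x \<in> X" "v \<in> V" "z = dk x v" using sheet_cover[OF sh(1) z sh(2)] by blast
  have zS: "z \<in> S" unfolding S_def using curve_1 by (intro image_eqI[of _ _ 1]) auto
  have SU: "\<pi> ` S \<subseteq> U"
  proof (rule image_subsetI)
    fix y assume "y \<in> S"
    then obtain u where "u \<noteq> 0" "y = curve u" unfolding S_def by auto
    then show "\<pi> y \<in> U" using \<pi>c sh(2) by simp
  qed
  have "S \<inter> dk x ` V \<noteq> {}" using zS x by blast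
  then have SV: "S \<subseteq> dk x ` V" by (rule connected_in_sheet[OF sh(1) con SU x(1)])
  have "curve t \<in> S" unfolding S_def using t by auto
  then show ?thesis using sheet_inj[OF sh(1) x(1)] SV zS \<pi>c[OF t] by blast
qed

end

lemma one_parameter_fixes_generic:
  assumes z: "z \<in> pts Pt"
    and n_add: "\<And>x y. x \<in> X \<Longrightarrow> y \<in> X \<Longrightarrow> n (x + y) = n x + (n y :: int)"
    and n_dir: "\<And>x. x \<in> X \<Longrightarrow> x \<in> dir (cell (Zc z)) \<Longrightarrow> n x = 0"
    and theta_nz: "\<And>i. i \<in> \<Theta> \<Longrightarrow> \<pi> z \<in> fst i \<Longrightarrow> snd i (\<pi> z) \<noteq> 0" and t: "t \<noteq> 0"
  shows "ta (one_param n t) z = z"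
proof -
  obtain m N s f where ms: "m > 0" "\<And>k. k \<le> N \<Longrightarrow> bundle_section P \<Theta> m (s k)"
     and f: "closed_immersion P (proj_space N) f"
     and fs: "\<And>i p. i \<in> \<Theta> \<Longrightarrow> p \<in> fst i \<Longrightarrow> f p = proj_point (\<lambda>k. if k \<le> N then s k p i else 0)"
    using ample unfolding ample_divisor_def by blast
  \<comment> \<open>The behaviour at infinity is that at 0 of the inverse subgroup, to which
    \<open>ratio_limit\<close> applies equally.\<close>
  have inv: "one_param (\<lambda>x. - n x) u = one_param n (1 / u)" for u
    unfolding one_param_def by (auto simp: power_int_minus power_int_divide_distrib field_simps)
  have rinv: "section_ratio (\<lambda>x. - n x) z m s k = (\<lambda>u. section_ratio n z m s k (1 / u))" for k
    unfolding section_ratio_def Let_def orbit_curve_def inv by simp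
  have "\<exists>l. (section_ratio (\<lambda>x. - n x) z m s k \<longlongrightarrow> l) (at 0)" if "k \<le> N" for k
    by (rule ratio_limit[OF z refl _ _ theta_nz ms f fs that]) (use n_add n_dir in auto)
  then have lim: "\<exists>l. ((\<lambda>u. section_ratio n z m s k (1 / u)) \<longlongrightarrow> l) (at 0)" if "k \<le> N" for k
    using that unfolding rinv by blast
  have "orbit_curve n z t = z"
    by (rule curve_constant[OF z refl n_add n_dir theta_nz ms f fs lim t])
  then show ?thesis unfolding orbit_curve_def .
qed

text \<open>The orbit contains a point where \<open>\<theta>\<close> does not vanish; as the torus
  is commutative, what fixes that point fixes all of the orbit.\<close>

lemma one_parameter_fixes:
  assumes z: "z \<in> pts Pt"
    and n_add: "\<And>x y. x \<in> X \<Longrightarrow> y \<in> X \<Longrightarrow> n (x + y) = n x + (n y :: int)"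
    and n_dir: "\<And>x. x \<in> X \<Longrightarrow> x \<in> dir (cell (Zc z)) \<Longrightarrow> n x = 0" and t: "t \<noteq> 0"
  shows "ta (one_param n t) z = z"
proof -
  obtain a where a: "a \<in> torus_pts X" "\<forall>j\<in>\<Theta>. \<pi> (ta a z) \<in> fst j \<longrightarrow> snd j (\<pi> (ta a z)) \<noteq> 0"
    using theta_translate_nonzero[OF z] by blast
  have l: "one_param n t \<in> torus_pts X"
    unfolding one_param_def torus_pts_def using n_add t lattice_in_add[OF X] by (auto simp: power_int_add)
  have "ta (one_param n t) (ta a z) = ta a z"
    by (rule one_parameter_fixes_generic[OF ta_pts[OF a(1) z] n_add _ _ t])
      (use n_dir a(2) Zc_eq[OF z a(1)] in auto)
  then have "ta a (ta (one_param n t) z) = ta a z" using ta_commute[OF l a(1) z] by simp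
  then show ?thesis using ta_tinv[OF a(1)] ta_pts[OF l z] z by metis
qed

text \<open>In adapted coordinates an element trivial on \<open>D\<close> has coordinate 1 at the
  first \<open>k\<close> places. It is therefore a product of values of the remaining coordinate
  subgroups, each of which is one-parameter and trivial on \<open>D\<close>.\<close>

lemma annihilator_fixes:
  assumes z: "z \<in> pts Pt" and a: "a \<in> torus_pts X" and a1: "\<And>x. x \<in> X \<Longrightarrow> x \<in> dir (cell (Zc z)) \<Longrightarrow> a x = 1"
  shows "ta a z = z"
proof -
  define D where "D = dir (cell (Zc z))"
  obtain n b d where b: "adapted_basis X D n (dim D) b d"
    using adapted_basis_exists[OF X] dir_lattice unfolding D_def by metis
  define k where "k = dim D"
  have kn: "k \<le> n" and bX: "\<And>i. i < n \<Longrightarrow> b i \<in> X"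
    and int: "\<And>x i. x \<in> X \<Longrightarrow> i < n \<Longrightarrow> d i \<bullet> x \<in> \<int>"
    and inD: "\<And>x. x \<in> X \<Longrightarrow> x \<in> D \<longleftrightarrow> (\<forall>i\<in>{k..<n}. d i \<bullet> x = 0)"
    and dual: "\<And>i j. i < n \<Longrightarrow> j < n \<Longrightarrow> d i \<bullet> b j = (if i = j then 1 else 0)"
    using b unfolding adapted_basis_def k_def by (auto simp: span_base)
  define part where "part J = basis_char X n d (\<lambda>i. if i \<in> J then a (b i) else 1)" for J :: "nat set"
  have pt: "part J \<in> torus_pts X" for J
    unfolding part_def by (rule basis_char_torus[OF X b]) (use torus_pts_nz[OF a bX] in auto)
  have "ta (part J) z = z" if "finite J" "J \<subseteq> {k..<n}" for J
    using that
  proof (induction J rule: finite_induct)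
    case empty
    have "part {} = \<one>\<^bsub>torus_group X\<^esub>"
      by (rule torus_pts_eqI[OF pt torus_one_closed[OF X]]) (simp add: part_def basis_char_def)
    then show ?case using ta_one[OF z] by simp
  next
    case (insert i J)
    then have i: "i < n" "k \<le> i" "i \<notin> J" by auto
    define m where "m x = \<lfloor>d i \<bullet> x\<rfloor>" for x
    have madd: "m (x + y) = m x + m y" if xy: "x \<in> X" "y \<in> X" for x y
    proof -
      obtain l where "d i \<bullet> x = of_int l" using int[OF xy(1) i(1)] by (auto elim: Ints_cases)
      then show ?thesis by (simp add: m_def inner_add_right)
    qed
    have mD: "m x = 0" if "x \<in> X" "x \<in> D" for x using inD[OF that(1)] that(2) i by (simp add: m_def)
    have nz: "a (b i) \<noteq> 0" by (rule torus_pts_nz[OF a bX[OF i(1)]])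
    have l: "one_param m (a (b i)) \<in> torus_pts X"
      unfolding one_param_def torus_pts_def using madd nz lattice_in_add[OF X] by (auto simp: power_int_add)
    have "part (insert i J) = one_param m (a (b i)) \<odot> part J"
    proof (rule torus_pts_eqI[OF pt tmult_closed[OF l pt]])
      fix x assume x: "x \<in> X"
      have "(\<Prod>j<n. (if j \<in> insert i J then a (b j) else 1) powi \<lfloor>d j \<bullet> x\<rfloor>) =
        (\<Prod>j<n. (if j = i then a (b i) powi \<lfloor>d i \<bullet> x\<rfloor> else 1) * (if j \<in> J then a (b j) else 1) powi \<lfloor>d j \<bullet> x\<rfloor>)"
        using i(3) by (intro prod.cong) auto
      also have "\<dots> = a (b i) powi \<lfloor>d i \<bullet> x\<rfloor> * (\<Prod>j<n. (if j \<in> J then a (b j) else 1) powi \<lfloor>d j \<bullet> x\<rfloor>)"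
        using i(1) by (simp add: prod.distrib)
      finally show "part (insert i J) x = (one_param m (a (b i)) \<odot> part J) x"
        using x by (simp add: part_def basis_char_def one_param_def m_def)
    qed
    then have "ta (part (insert i J)) z = ta (one_param m (a (b i))) (ta (part J) z)" using ta_mult[OF l pt z] by simp
    also have "ta (part J) z = z" using insert by auto
    also have "ta (one_param m (a (b i))) z = z"
      by (rule one_parameter_fixes[OF z madd _ nz]) (use mD D_def in auto)
    finally show ?case .
  qed
  then have "ta (part {k..<n}) z = z" by simp
  moreover have "part {k..<n} = a"
  proof (rule torus_pts_eqI[OF pt a])
    fix x assume x: "x \<in> X"
    have one: "a (b i) = 1" if i: "i < k" for i
    proof -
      have "b i \<in> D" using inD[OF bX, of i] dual i kn by auto
      then show ?thesis using a1[OF bX] i kn D_def by auto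
    qed
    have "part {k..<n} x = (\<Prod>i<n. a (b i) powi \<lfloor>d i \<bullet> x\<rfloor>)"
      unfolding part_def basis_char_def using x one by (auto intro!: prod.cong)
    then show "part {k..<n} x = a x" using torus_pts_basis_expand[OF X b a x] by simp
  qed
  ultimately show ?thesis by simp
qed

end

subsection \<open>Orbits and their closures\<close>

lemma continuous_space_preimage:
  "h \<in> funs (continuous_space T) U \<Longrightarrow> open S \<Longrightarrow> openin T {x \<in> U. h x \<in> S}"
  by (simp add: continuous_space_def)

context theta_expansion
begin

text \<open>A meromorphic quotient of two sections, with value 0 where the denominator
  vanishes.\<close>

definition quot :: "('b \<Rightarrow> 'p fibre_vec) \<Rightarrow> ('b \<Rightarrow> 'p fibre_vec) \<Rightarrow> 'b \<Rightarrow> complex" where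
  "quot s s' y = s y (idx (\<pi> y)) / s' y (idx (\<pi> y))"

lemma eig_fibre: "eig Z x s \<Longrightarrow> y \<in> Z \<Longrightarrow> s y \<in> Lf y"
  unfolding eigensection_def by blast

lemma eig_zero_iff: "eig Z x s \<Longrightarrow> y \<in> Z \<Longrightarrow> i \<in> \<Theta> \<Longrightarrow> \<pi> y \<in> fst i \<Longrightarrow> s y = (\<lambda>_. 0) \<longleftrightarrow> s y i = 0"
  using fibre_zero[OF eig_fibre] by (metis (no_types, lifting))

lemma quot_index:
  assumes e: "eig Z x s" "eig Z x' s'" and y: "y \<in> Z" "y \<in> pts Pt" and j: "j \<in> \<Theta>" "\<pi> y \<in> fst j"
  shows "quot s s' y = s y j / s' y j"
proof -
  define i where "i = idx (\<pi> y)"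
  have i: "i \<in> \<Theta>" "\<pi> y \<in> fst i" unfolding i_def using idx_\<pi>[OF y(2)] by auto
  obtain u where u: "u \<noteq> 0" "\<And>m v. v \<in> bundle_fibre P \<Theta> m (\<pi> y) \<Longrightarrow> v i = u ^ m * v j"
    by (rule fibre_change[OF i(1) j(1) i(2) j(2)]) (rule that)
  have "s y i = u ^ 1 * s y j" "s' y i = u ^ 1 * s' y j"
    using u(2)[OF eig_fibre[OF e(1) y(1)]] u(2)[OF eig_fibre[OF e(2) y(1)]] by auto
  then show ?thesis unfolding quot_def i_def[symmetric] using u(1) by simp
qed

lemma quot_ta:
  assumes e: "eig Z x s" "eig Z x' s'" and y: "y \<in> Z" "y \<in> pts Pt" and a: "a \<in> torus_pts X" "ta a y \<in> Z"
    and x: "x \<in> X" "x' \<in> X"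
  shows "quot s s' (ta a y) = a (x - x') * quot s s' y"
proof -
  define i where "i = idx (\<pi> y)"
  have i: "i \<in> \<Theta>" "\<pi> y \<in> fst i" unfolding i_def using idx_\<pi>[OF y(2)] by auto
  define j where "j = idx (\<pi> (ta a y))"
  have j: "j \<in> \<Theta>" "\<pi> (ta a y) \<in> fst j" unfolding j_def using idx_\<pi>[OF ta_pts[OF a(1) y(2)]] by auto
  obtain \<mu> where \<mu>: "\<mu> \<noteq> 0" "\<And>Z x s. eig Z x s \<Longrightarrow> y \<in> Z \<Longrightarrow> s (ta a y) j = a x * \<mu> * s y i"
    by (rule eig_coordinate[OF a(1) y(2) i j]) (rule that)
  show ?thesis
    unfolding quot_def i_def[symmetric] j_def[symmetric] \<mu>(2)[OF e(1) y(1)] \<mu>(2)[OF e(2) y(1)]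
      torus_pts_diff[OF X a(1) x] using \<mu>(1) by simp
qed

lemma index_preimage_open: "j \<in> \<Theta> \<Longrightarrow> openin (spc Pt) {y \<in> pts Pt. \<pi> y \<in> fst j}"
  by (rule openin_continuous_map_preimage[OF \<pi>_continuous analytification_open[OF index_open]])

lemma quot_continuous:
  assumes e: "eig Z x s" "eig Z x' s'" and Z: "closedin (spc Pt) Z"
  shows "openin (subtopology (spc Pt) Z) {y \<in> Z. s' y \<noteq> (\<lambda>_. 0)}"
    "quot s s' \<in> funs (continuous_space (subtopology (spc Pt) Z)) {y \<in> Z. s' y \<noteq> (\<lambda>_. 0)}"
proof -
  define T where "T = subtopology (spc Pt) Z"
  have ZP: "Z \<subseteq> pts Pt" by (rule closedin_subset[OF Z])
  note L = local_ring_sheaf_continuous_space[of T]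
  have loc: "\<exists>N. openin T N \<and> y \<in> N \<and> N \<subseteq> {y \<in> Z. s' y \<noteq> (\<lambda>_. 0)} \<and> quot s s' \<in> funs (continuous_space T) N"
    if y: "y \<in> Z" "s' y \<noteq> (\<lambda>_. 0)" for y
  proof -
    have yP: "y \<in> pts Pt" using y ZP by blast
    obtain j where j: "j \<in> \<Theta>" "\<pi> y \<in> fst j" using index_exists[OF \<pi>_pts[OF yP]] by blast
    define W where "W = {y \<in> Z. \<pi> y \<in> fst j}"
    have WW: "W = Z \<inter> {y \<in> pts Pt. \<pi> y \<in> fst j}" unfolding W_def using ZP by blast
    have oW: "openin T W" unfolding T_def WW by (rule openin_subtopology_Int2[OF index_preimage_open[OF j(1)]])
    have st: "subtopology T W = subtopology (spc Pt) W"
      unfolding T_def by (simp add: subtopology_subtopology W_def Int_absorb1 subset_iff)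
    have c: "(\<lambda>y. s y j) \<in> funs (continuous_space T) W" "(\<lambda>y. s' y j) \<in> funs (continuous_space T) W"
      unfolding continuous_space_funs st using oW eig_continuous[OF e(1) j(1) Z] eig_continuous[OF e(2) j(1) Z] W_def by auto
    define N where "N = {y \<in> W. s' y j \<noteq> 0}"
    have oN: "openin T N" and inv: "(\<lambda>y. 1 / s' y j) \<in> funs (continuous_space T) N"
      using local_ring_sheaf_inverse[OF L c(2)] unfolding N_def by auto
    have NW: "N \<subseteq> W" unfolding N_def by blast
    have "(\<lambda>y. s y j * (1 / s' y j)) \<in> funs (continuous_space T) N"
      by (rule local_ring_sheaf_mult[OF L function_sheaf_restrict[OF function_sheaf_continuous_space c(1) _ NW] inv])
        (use oN in simp)
    then have "quot s s' \<in> funs (continuous_space T) N"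
    proof (rule function_sheaf_cong[OF function_sheaf_continuous_space])
      fix y assume "y \<in> N"
      then have yy: "y \<in> Z" "\<pi> y \<in> fst j" unfolding N_def W_def by auto
      then show "quot s s' y = s y j * (1 / s' y j)"
        using quot_index[OF e yy(1) _ j(1) yy(2)] ZP by auto
    qed
    moreover have "y \<in> N" unfolding N_def W_def using y j eig_zero_iff[OF e(2) y(1) j] by blast
    moreover have "N \<subseteq> {y \<in> Z. s' y \<noteq> (\<lambda>_. 0)}" unfolding N_def W_def by fastforce
    ultimately show ?thesis using oN by blast
  qed
  show o: "openin (subtopology (spc Pt) Z) {y \<in> Z. s' y \<noteq> (\<lambda>_. 0)}"
    unfolding T_def[symmetric] by (subst openin_subopen) (use loc in blast)
  show "quot s s' \<in> funs (continuous_space (subtopology (spc Pt) Z)) {y \<in> Z. s' y \<noteq> (\<lambda>_. 0)}"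
    unfolding T_def[symmetric]
  proof (rule function_sheaf_local[OF function_sheaf_continuous_space])
    show "openin (spc (continuous_space T)) {y \<in> Z. s' y \<noteq> (\<lambda>_. 0)}"
      using o by (simp add: T_def)
  next
    fix y assume "y \<in> {y \<in> Z. s' y \<noteq> (\<lambda>_. 0)}"
    then show "\<exists>V. y \<in> V \<and> V \<subseteq> {y \<in> Z. s' y \<noteq> (\<lambda>_. 0)} \<and> quot s s' \<in> funs (continuous_space T) V"
      using loc[of y] by blast
  qed
qed

text \<open>The weight hypothesis yields a section that is nonzero somewhere on the orbit closure;
  it is then nonzero at every point with the same closure, before such points are known to form one
  orbit.\<close>

lemma weight_section:
  assumes z: "z \<in> pts Pt" and x: "x \<in> X" "x \<in> fst ` cell (Zc z)"
  obtains s where "eig (Zc z) x s" "\<And>y. y \<in> pts Pt \<Longrightarrow> Zc y = Zc z \<Longrightarrow> s y \<noteq> (\<lambda>_. 0)"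
proof -
  have "x \<in> {x \<in> X. \<exists>s. eig (Zc z) x s \<and> (\<exists>z'\<in>Zc z. s z' \<noteq> (\<lambda>_. 0))}"
    using cell_weights[of "Zc z"] z x by blast
  then obtain s z' where s: "eig (Zc z) x s" "z' \<in> Zc z" "s z' \<noteq> (\<lambda>_. 0)" by blast
  have "s y \<noteq> (\<lambda>_. 0)" if "y \<in> pts Pt" "Zc y = Zc z" for y
    by (rule eig_nonzero[OF s(1) Zc_closed _ that(1) _ s(3)]) (use that(2) s(2) in auto)
  then show thesis using that s(1) by blast
qed

lemma annihilator_eq:
  assumes z: "z \<in> pts Pt" and a: "a \<in> torus_pts X" "a' \<in> torus_pts X"
    and eq: "\<And>x. x \<in> X \<Longrightarrow> x \<in> dir (cell (Zc z)) \<Longrightarrow> a x = a' x"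
  shows "ta a z = ta a' z"
proof -
  have t: "tinv a' \<odot> a \<in> torus_pts X" by (intro tmult_closed tinv_closed a)
  have "ta (tinv a' \<odot> a) z = z"
    by (rule annihilator_fixes[OF z t]) (use eq torus_pts_nz[OF a(2)] in auto)
  then have "ta (tinv a') (ta a z) = z" using ta_mult[OF tinv_closed[OF a(2)] a(1) z] by simp
  then show ?thesis using ta_tinv'[OF a(2) ta_pts[OF a(1) z]] by simp
qed

text \<open>A quotient of sections of weights \<open>x\<close> and \<open>x'\<close> is multiplied
  by the character value at \<open>x - x'\<close> and is nonzero at \<open>z\<close>, so the image
  point determines that value.\<close>

lemma same_action_eq:
  assumes z: "z \<in> pts Pt" and a: "a \<in> torus_pts X" "a' \<in> torus_pts X" and eq: "ta a z = ta a' z"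
    and x: "x \<in> X" "x \<in> fst ` cell (Zc z)" "x' \<in> X" "x' \<in> fst ` cell (Zc z)"
  shows "a (x - x') = a' (x - x')"
proof -
  obtain s where s: "eig (Zc z) x s" "\<And>y. y \<in> pts Pt \<Longrightarrow> Zc y = Zc z \<Longrightarrow> s y \<noteq> (\<lambda>_. 0)" by (rule weight_section[OF z x(1,2)]) (rule that)
  obtain s' where s': "eig (Zc z) x' s'" "\<And>y. y \<in> pts Pt \<Longrightarrow> Zc y = Zc z \<Longrightarrow> s' y \<noteq> (\<lambda>_. 0)" by (rule weight_section[OF z x(3,4)]) (rule that)
  have zZ: "z \<in> Zc z" by (rule Zc_self[OF z])
  have "s z (idx (\<pi> z)) \<noteq> 0" "s' z (idx (\<pi> z)) \<noteq> 0"
    using s(2)[OF z refl] s'(2)[OF z refl] eig_zero_iff[OF s(1) zZ idx_\<pi>[OF z]] eig_zero_iff[OF s'(1) zZ idx_\<pi>[OF z]] by auto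
  then have "quot s s' z \<noteq> 0" by (simp add: quot_def)
  moreover have "a (x - x') * quot s s' z = a' (x - x') * quot s s' z"
    using quot_ta[OF s(1) s'(1) zZ z a(1) _ x(1,3)] quot_ta[OF s(1) s'(1) zZ z a(2) _ x(1,3)]
      Zc_invariant[OF z _ zZ] a eq by metis
  ultimately show ?thesis by simp
qed

text \<open>Ratios of eigensections are coordinates on the orbit along the cell. They are continuous where the
  denominator does not vanish; elsewhere their value is \<open>_ / 0 = 0\<close>, so that sets \<open>S e\<close> without 0 have
  open preimages.\<close>

lemma ratio_coordinates:
  assumes z: "z \<in> pts Pt"
  obtains E :: "'e set" and R :: "'e \<Rightarrow> 'b \<Rightarrow> complex" where
    "finite E" "independent E" "span E = dir (cell (Zc z))"
    "\<And>e. e \<in> E \<Longrightarrow> \<exists>x x'. e = x - x' \<and> x \<in> X \<and> x \<in> fst ` cell (Zc z) \<and> x' \<in> X \<and> x' \<in> fst ` cell (Zc z)"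
    "\<And>e u. e \<in> E \<Longrightarrow> u \<in> Zc z \<Longrightarrow> Zc u = Zc z \<Longrightarrow> R e u \<noteq> 0"
    "\<And>e u a. e \<in> E \<Longrightarrow> u \<in> Zc z \<Longrightarrow> a \<in> torus_pts X \<Longrightarrow> R e (ta a u) = a e * R e u"
    "\<And>S. \<forall>e. open (S e) \<and> 0 \<notin> S e \<Longrightarrow>
      openin (subtopology (spc Pt) (Zc z)) {u \<in> Zc z. \<forall>e\<in>E. R e u \<in> S e}"
proof -
  define B where "B = {x - x' |x x'. x \<in> X \<inter> fst ` cell (Zc z) \<and> x' \<in> X \<inter> fst ` cell (Zc z)}"
  obtain E where E: "E \<subseteq> B" "independent E" "B \<subseteq> span E"
    using maximal_independent_subset by blast
  have sp: "span E = dir (cell (Zc z))"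
    unfolding dir_def B_def[symmetric] using E(1,3) by (metis antisym span_minimal span_mono subspace_span)
  have fE: "finite E" by (rule independent_imp_finite[OF E(2)])
  have EB: "\<exists>x x'. e = x - x' \<and> x \<in> X \<and> x \<in> fst ` cell (Zc z) \<and> x' \<in> X \<and> x' \<in> fst ` cell (Zc z)"
    if "e \<in> E" for e using E(1) that unfolding B_def by blast
  have ZP: "u \<in> pts Pt" if "u \<in> Zc z" for u using that Zc_subset by blast
  define good where "good e f \<longleftrightarrow> (\<forall>u. u \<in> Zc z \<longrightarrow> Zc u = Zc z \<longrightarrow> f u \<noteq> 0) \<and>
      (\<forall>u a. u \<in> Zc z \<longrightarrow> a \<in> torus_pts X \<longrightarrow> f (ta a u) = a e * f u) \<and>
      (\<forall>S. open S \<longrightarrow> 0 \<notin> S \<longrightarrow> openin (subtopology (spc Pt) (Zc z)) {u \<in> Zc z. f u \<in> S})"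
    for e :: 'e and f :: "'b \<Rightarrow> complex"
  have "\<exists>f. good e f" if e: "e \<in> E" for e
  proof -
    obtain x x' where x: "e = x - x'" "x \<in> X" "x \<in> fst ` cell (Zc z)" "x' \<in> X" "x' \<in> fst ` cell (Zc z)"
      using EB[OF e] by blast
    obtain s where s: "eig (Zc z) x s" "\<And>y. y \<in> pts Pt \<Longrightarrow> Zc y = Zc z \<Longrightarrow> s y \<noteq> (\<lambda>_. 0)"
      by (rule weight_section[OF z x(2,3)]) (rule that)
    obtain s' where s': "eig (Zc z) x' s'" "\<And>y. y \<in> pts Pt \<Longrightarrow> Zc y = Zc z \<Longrightarrow> s' y \<noteq> (\<lambda>_. 0)"
      by (rule weight_section[OF z x(4,5)]) (rule that)
    have nz: "quot s s' u \<noteq> 0" if u: "u \<in> Zc z" "Zc u = Zc z" for u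
      using s(2)[OF ZP u(2)] s'(2)[OF ZP u(2)] u(1) eig_zero_iff[OF s(1) u(1) idx_\<pi>[OF ZP]]
        eig_zero_iff[OF s'(1) u(1) idx_\<pi>[OF ZP]] unfolding quot_def by simp
    have t: "quot s s' (ta a u) = a e * quot s s' u" if u: "u \<in> Zc z" "a \<in> torus_pts X" for u a
      unfolding x(1) by (rule quot_ta[OF s(1) s'(1) u(1) ZP[OF u(1)] u(2) Zc_invariant[OF z u(2,1)] x(2,4)])
    have o: "openin (subtopology (spc Pt) (Zc z)) {u \<in> Zc z. quot s s' u \<in> S}" if S: "open S" "0 \<notin> S" for S
    proof -
      have "s' u \<noteq> (\<lambda>_. 0)" if "quot s s' u \<in> S" for u using that S(2) unfolding quot_def by (cases "s' u = (\<lambda>_. 0)") auto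
      then have "{u \<in> Zc z. quot s s' u \<in> S} = {u \<in> {u \<in> Zc z. s' u \<noteq> (\<lambda>_. 0)}. quot s s' u \<in> S}" by blast
      then show ?thesis using continuous_space_preimage[OF quot_continuous(2)[OF s(1) s'(1) Zc_closed] S(1)] by simp
    qed
    show ?thesis unfolding good_def using nz t o by blast
  qed
  then obtain R where R: "\<And>e. e \<in> E \<Longrightarrow> good e (R e)" by metis
  have op: "openin (subtopology (spc Pt) (Zc z)) {u \<in> Zc z. \<forall>e\<in>E. R e u \<in> S e}"
    if S: "\<forall>e. open (S e) \<and> 0 \<notin> S e" for S
  proof (cases "E = {}")
    case True
    then show ?thesis using openin_topspace[of "subtopology (spc Pt) (Zc z)"] Zc_subset[of z] by (simp add: Int_absorb1)
  next
    case False
    have "openin (subtopology (spc Pt) (Zc z)) (\<Inter>e\<in>E. {u \<in> Zc z. R e u \<in> S e})"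
      using R S fE False unfolding good_def by (intro openin_INT2) auto
    moreover have "(\<Inter>e\<in>E. {u \<in> Zc z. R e u \<in> S e}) = {u \<in> Zc z. \<forall>e\<in>E. R e u \<in> S e}" using False by auto
    ultimately show ?thesis by simp
  qed
  show thesis
    by (rule that[of E R]) (use R in \<open>auto simp: fE E(2) sp EB op good_def\<close>)
qed

text \<open>The orbit of \<open>z\<close> under the compact set of characters with bounded modulus along the cell is closed;
  it contains all points of the orbit near a second point with the same orbit closure.\<close>

lemma same_closure_orbit:
  assumes z: "z \<in> pts Pt" and y: "y \<in> pts Pt" and eq: "Zc y = Zc z"
  shows "y \<in> orb z"
proof -
  define D where "D = dir (cell (Zc z))"
  obtain E R where E: "finite E" "independent E" "span E = D"
    and xy: "\<And>e. e \<in> E \<Longrightarrow> \<exists>x x'. e = x - x' \<and> x \<in> X \<and> x \<in> fst ` cell (Zc z) \<and> x' \<in> X \<and> x' \<in> fst ` cell (Zc z)"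
    and R: "\<And>e u. e \<in> E \<Longrightarrow> u \<in> Zc z \<Longrightarrow> Zc u = Zc z \<Longrightarrow> R e u \<noteq> 0"
      "\<And>e u a. e \<in> E \<Longrightarrow> u \<in> Zc z \<Longrightarrow> a \<in> torus_pts X \<Longrightarrow> R e (ta a u) = a e * R e u"
      "\<And>S. \<forall>e. open (S e) \<and> 0 \<notin> S e \<Longrightarrow> openin (subtopology (spc Pt) (Zc z)) {u \<in> Zc z. \<forall>e\<in>E. R e u \<in> S e}"
    by (rule ratio_coordinates[OF z, folded D_def]) (rule that, assumption+)
  have zZ: "z \<in> Zc z" and yZ: "y \<in> Zc z" using Zc_self z y eq by auto
  note Rta = R(2)[OF _ zZ] and Rnz = R(1)[OF _ zZ refl] R(1)[OF _ yZ eq]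
  \<comment> \<open>An annulus around the modulus at \<open>y\<close>, open and without 0. It
    confines the logarithm of the modulus to a window of radius \<open>ln 2\<close>.\<close>
  define A' where "A' e = {c. cmod (R e y) / 2 < cmod c \<and> cmod c < 2 * cmod (R e y)}" for e
  define N where "N = {u \<in> Zc z. \<forall>e\<in>E. R e u \<in> A' e}"
  have "open (A' e) \<and> 0 \<notin> A' e" for e
    unfolding A'_def by (intro conjI open_Collect_conj open_Collect_less continuous_intros) (simp add: not_less)
  then have oN: "openin (subtopology (spc Pt) (Zc z)) N" unfolding N_def by (intro R(3)) simp
  have yN: "y \<in> N" unfolding N_def A'_def using yZ Rnz(2) by (auto simp: divide_less_eq)
  \<comment> \<open>Bounds the logarithmic modulus, along \<open>E\<close>, of any torus element
    taking \<open>z\<close> into \<open>N\<close>; the inserted 0 covers an empty \<open>E\<close>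
    and makes the bound nonnegative.\<close>
  define M1 where "M1 = Max (insert 0 ((\<lambda>e. \<bar>ln (cmod (R e y)) - ln (cmod (R e z))\<bar> + ln 2) ` E))"
  have M1: "\<bar>ln (cmod (R e y)) - ln (cmod (R e z))\<bar> + ln 2 \<le> M1" if "e \<in> E" for e
    unfolding M1_def using that E(1) by (intro Max_ge) auto
  have bnd: "\<bar>\<nu> \<bullet> e\<bar> \<le> M1" if a: "a \<in> torus_pts X" "ta a z \<in> N" "\<And>x. x \<in> X \<Longrightarrow> cmod (a x) = exp (\<nu> \<bullet> x)" and e: "e \<in> E" for a \<nu> e
  proof -
    have eX: "e \<in> X" using xy[OF e] lattice_in_diff[OF X] by blast
    have "R e (ta a z) \<in> {c. cmod (R e y) / 2 < cmod c \<and> cmod c < 2 * cmod (R e y)}"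
      using a(2) e unfolding N_def A'_def by blast
    then have b: "cmod (R e y) / 2 < exp (\<nu> \<bullet> e) * cmod (R e z)" "exp (\<nu> \<bullet> e) * cmod (R e z) < 2 * cmod (R e y)"
      using Rta[OF e a(1)] a(3)[OF eX] by (auto simp: norm_mult)
    have p: "cmod (R e y) > 0" "cmod (R e z) > 0" using Rnz[OF e] by auto
    have "ln (cmod (R e y) / 2) < ln (exp (\<nu> \<bullet> e) * cmod (R e z))" using b(1) p by (subst ln_less_cancel_iff) auto
    then have 1: "ln (cmod (R e y)) - ln 2 < \<nu> \<bullet> e + ln (cmod (R e z))" using p by (simp add: ln_div ln_mult)
    have "ln (exp (\<nu> \<bullet> e) * cmod (R e z)) < ln (2 * cmod (R e y))" using b(2) p by (subst ln_less_cancel_iff) auto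
    then have 2: "\<nu> \<bullet> e + ln (cmod (R e z)) < ln 2 + ln (cmod (R e y))" using p by (simp add: ln_mult)
    show ?thesis using 1 2 M1[OF e] by (simp add: abs_le_iff) linarith
  qed
  obtain n b d where ab: "adapted_basis X D n (dim D) b d"
    using adapted_basis_exists[OF X] dir_lattice unfolding D_def by metis
  define k where "k = dim D"
  have kn: "k \<le> n" and bX: "\<And>i. i < n \<Longrightarrow> b i \<in> X"
    and inD: "\<And>x. x \<in> X \<Longrightarrow> x \<in> D \<longleftrightarrow> (\<forall>i\<in>{k..<n}. d i \<bullet> x = 0)"
    and dual: "\<And>i j. i < n \<Longrightarrow> j < n \<Longrightarrow> d i \<bullet> b j = (if i = j then 1 else 0)"
    using ab unfolding adapted_basis_def k_def by (auto simp: span_base)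
  have bD: "b i \<in> D" if "i < k" for i using inD[OF bX, of i] dual that kn by auto
  have "\<forall>i\<in>{..<k}. \<exists>t. b i = (\<Sum>e\<in>E. t e *\<^sub>R e)"
  proof
    fix i assume "i \<in> {..<k}"
    then have "b i \<in> span E" using bD E(3) by auto
    then show "\<exists>t. b i = (\<Sum>e\<in>E. t e *\<^sub>R e)" unfolding span_finite[OF E(1)] by auto
  qed
  then obtain t where t: "\<And>i. i < k \<Longrightarrow> b i = (\<Sum>e\<in>E. t i e *\<^sub>R e)" by (metis lessThan_iff)
  define M2 where "M2 = (\<Sum>i<k. \<Sum>e\<in>E. \<bar>t i e\<bar> * M1)"
  have M10: "M1 \<ge> 0" unfolding M1_def using E(1) by (intro Max_ge) auto
  have bnd2: "\<bar>\<nu> \<bullet> b i\<bar> \<le> M2" if a: "a \<in> torus_pts X" "ta a z \<in> N" "\<And>x. x \<in> X \<Longrightarrow> cmod (a x) = exp (\<nu> \<bullet> x)" and i: "i < k" for a \<nu> i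
  proof -
    have "\<bar>\<nu> \<bullet> b i\<bar> = \<bar>\<Sum>e\<in>E. t i e * (\<nu> \<bullet> e)\<bar>" unfolding t[OF i] by (simp add: inner_sum_right)
    also have "\<dots> \<le> (\<Sum>e\<in>E. \<bar>t i e * (\<nu> \<bullet> e)\<bar>)" by (rule sum_abs)
    also have "\<dots> \<le> (\<Sum>e\<in>E. \<bar>t i e\<bar> * M1)"
      by (intro sum_mono) (simp add: abs_mult mult_left_mono bnd[OF a])
    also have "\<dots> \<le> M2" unfolding M2_def using i M10 by (intro member_le_sum) (auto intro!: sum_nonneg)
    finally show ?thesis .
  qed
  define A where "A = {c. exp (- M2) \<le> cmod c \<and> cmod c \<le> exp M2}"
  have "closed A" unfolding A_def by (intro closed_Collect_conj closed_Collect_le continuous_intros)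
  moreover have "bounded A" unfolding A_def bounded_iff by auto
  ultimately have cA: "compact A" using compact_eq_bounded_closed by blast
  have A0: "c \<noteq> 0" if "c \<in> A" for c
  proof
    assume "c = 0"
    then have "exp (- M2) \<le> 0" using that unfolding A_def by simp
    then show False by (simp add: not_le[symmetric])
  qed
  \<comment> \<open>Only the first \<open>k\<close> coordinates range over a compact annulus; the
    others are set to 1, which by the annihilator does not change the point reached.\<close>
  define B where "B = PiE UNIV (\<lambda>i::nat. if i < k then A else {1})"
  have "compactin (product_topology (\<lambda>_. euclidean) UNIV) B"
    unfolding B_def compactin_PiE using cA by auto
  then have cB: "compact B" by (simp add: euclidean_product_topology)
  have Bnz: "c i \<noteq> 0" if c: "c \<in> B" for c i
  proof -
    have "c i \<in> (if i < k then A else {1})" using c unfolding B_def by (rule PiE_mem) simp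
    then show ?thesis using A0 by (auto split: if_splits)
  qed
  have "continuous_map (top_of_set B) Tan (basis_char X n d)" by (rule continuous_map_basis_char[OF X ab]) (rule Bnz)
  then have cont: "continuous_map (top_of_set B) (spc Pt) (\<lambda>c. ta (basis_char X n d c) z)"
    by (rule ta_continuous_pair) (use z in simp)
  define K where "K = (\<lambda>c. ta (basis_char X n d c) z) ` B"
  have "compactin (top_of_set B) B" using cB by (simp add: compactin_subtopology)
  then have "compactin (spc Pt) K" unfolding K_def using cont by (rule image_compactin)
  \<comment> \<open>Closedness is where the Hausdorff property enters: \<open>y\<close> is a limit
    of points of the orbit, near \<open>y\<close> these lie in \<open>K\<close>, so \<open>y\<close>
    is in \<open>K\<close> and thus in the orbit.\<close>
  then have clK: "closedin (spc Pt) K" using Hausdorff_Pt compactin_imp_closedin by blast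
  have sub: "orb z \<inter> N \<subseteq> K"
  proof
    fix u assume "u \<in> orb z \<inter> N"
    then obtain a where a: "a \<in> torus_pts X" "u = ta a z" "ta a z \<in> N" by blast
    obtain \<nu> where \<nu>: "\<And>x. x \<in> X \<Longrightarrow> cmod (a x) = exp (\<nu> \<bullet> x)" using torus_log[OF X a(1)] by metis
    define c where "c i = (if i < k then a (b i) else 1)" for i
    have "a (b i) \<in> A" if i: "i < k" for i
      using bnd2[OF a(1,3) \<nu> i] \<nu>[OF bX[of i]] i kn unfolding A_def by (auto simp: abs_le_iff)
    then have cB': "c \<in> B" unfolding B_def c_def by auto
    have ct: "basis_char X n d c \<in> torus_pts X" using basis_char_torus[OF X ab] Bnz[OF cB'] by blast
    have "a x = basis_char X n d c x" if x: "x \<in> X" "x \<in> dir (cell (Zc z))" for x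
    proof -
      have "d i \<bullet> x = 0" if "i \<in> {k..<n}" for i using inD[OF x(1)] x(2) that D_def by blast
      then show ?thesis unfolding torus_pts_basis_expand[OF X ab a(1) x(1)] basis_char_def c_def
        using x(1) by (auto intro!: prod.cong)
    qed
    then have "ta a z = ta (basis_char X n d c) z" by (rule annihilator_eq[OF z a(1) ct])
    then show "u \<in> K" unfolding K_def using a(2) cB' by blast
  qed
  obtain N' where N': "openin (spc Pt) N'" "N = N' \<inter> Zc z" using oN unfolding openin_subtopology by blast
  have "y \<in> K"
  proof (rule ccontr)
    assume "y \<notin> K"
    have "openin (spc Pt) (N' - K)" using N'(1) clK by (rule openin_diff)
    moreover have "y \<in> N' - K" using yN N'(2) \<open>y \<notin> K\<close> by blast
    moreover have "y \<in> spc Pt closure_of orb z" using yZ unfolding orbit_closure_def .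
    ultimately obtain u where u: "u \<in> orb z" "u \<in> N' - K" unfolding in_closure_of by blast
    then have "u \<in> N" using N'(2) orb_Zc[OF z] by blast
    then show False using sub u by blast
  qed
  then obtain c where c: "c \<in> B" "y = ta (basis_char X n d c) z" unfolding K_def by blast
  then show ?thesis using basis_char_torus[OF X ab] Bnz by blast
qed

end

subsection \<open>Stabilizers of cells\<close>

context theta_expansion
begin

text \<open>Some \<open>\<xi> w\<close> is nonzero near \<open>y\<close>, so every translate that
  meets this neighbourhood has \<open>w\<close> in its cell, and \<open>w\<close> lies in finitely
  many cells.\<close>

lemma dk_Zc_locally_finite:
  assumes z: "z \<in> pts Pt" and y: "y \<in> pts Pt"
  shows "\<exists>N. openin (spc Pt) N \<and> y \<in> N \<and> finite {S \<in> (\<lambda>x. dk x ` Zc z) ` X. S \<inter> N \<noteq> {}}"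
proof -
  obtain w where w: "w \<in> supp y" using supp_nonempty[OF y] by blast
  obtain i where i: "i \<in> \<Theta>" "\<pi> y \<in> fst i" using idx_\<pi>[OF y] by blast
  have wI: "w \<in> IP" using w unfolding supp_def by blast
  define U where "U = {u \<in> pts Pt. \<pi> u \<in> fst i}"
  define N where "N = {u \<in> U. \<xi> w u i \<in> - {0}}"
  have "continuous_map (subtopology (spc Pt) U) euclidean (\<lambda>u. \<xi> w u i)"
    unfolding U_def by (rule eig_continuous[OF \<xi>_eigensection[OF wI] i(1)]) simp
  moreover have U: "openin (spc Pt) U" unfolding U_def by (rule index_preimage_open[OF i(1)])
  ultimately have "(\<lambda>u. \<xi> w u i) \<in> funs (continuous_space (spc Pt)) U" unfolding continuous_space_funs by blast
  then have N: "openin (spc Pt) N" unfolding N_def by (rule continuous_space_preimage) auto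
  have yN: "y \<in> N" unfolding N_def U_def using supp_iff[OF y i, of w] w y i by auto
  define F where "F = {S \<in> (\<lambda>x. dk x ` Zc z) ` X. S \<inter> N \<noteq> {}}"
  have F: "\<exists>u\<in>pts Pt. S = Zc u \<and> w \<in> cell S" if S: "S \<in> F" for S
  proof -
    obtain x u where x: "x \<in> X" "S = dk x ` Zc z" "u \<in> S" "u \<in> N" using S unfolding F_def by blast
    define v where "v = dk x z"
    have v: "v \<in> pts Pt" "S = Zc v" unfolding v_def using dk_pts[OF x(1) z] Zc_dk[OF x(1) z] x(2) by auto
    have u: "u \<in> pts Pt" "\<pi> u \<in> fst i" "\<xi> w u i \<noteq> 0" using x(4) unfolding N_def U_def by auto
    then have "w \<in> supp u" using supp_iff[OF u(1) i(1) u(2)] wI by blast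
    then have "w \<in> cell (Zc u)" by (rule supp_cell[OF u(1)])
    moreover have "cell (Zc u) \<subseteq> cell (Zc v)"
      using cell_subset_iff[OF u(1) v(1)] Zc_mono[OF v(1)] x(3) v(2) by blast
    ultimately show ?thesis using v by blast
  qed
  have "inj_on cell F"
  proof (rule inj_onI)
    fix S S' assume "S \<in> F" "S' \<in> F" and eq: "cell S = cell S'"
    then obtain u u' where "u \<in> pts Pt" "S = Zc u" "u' \<in> pts Pt" "S' = Zc u'" using F[of S] F[of S'] by metis
    then show "S = S'" using cell_eq_iff[of u u'] eq by simp
  qed
  moreover have "cell ` F \<subseteq> {\<epsilon> \<in> cells. w \<in> \<epsilon>}"
  proof
    fix \<epsilon> assume "\<epsilon> \<in> cell ` F"
    then obtain S where S: "S \<in> F" "\<epsilon> = cell S" by (rule imageE)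
    from F[OF S(1)] obtain u where "u \<in> pts Pt" "S = Zc u" "w \<in> cell S" by (elim bexE conjE)
    then have "cell S \<in> cells" "w \<in> cell S" using cell_in[of u] by simp_all
    then show "\<epsilon> \<in> {\<epsilon> \<in> cells. w \<in> \<epsilon>}" unfolding S(2) by (intro CollectI conjI)
  qed
  moreover have "finite {\<epsilon> \<in> cells. w \<in> \<epsilon>}"
    by (rule finite_cells_containing) (use wI in \<open>simp add: integral_points_def\<close>)
  ultimately have "finite F" using finite_imageD[of cell F] finite_subset[of "cell ` F"] by blast
  then show ?thesis unfolding F_def by (intro exI[of _ N] conjI N yN)
qed

lemma dk_Zc_Union_closed:
  assumes z: "z \<in> pts Pt" and F: "F \<subseteq> (\<lambda>x. dk x ` Zc z) ` X"
  shows "closedin (spc Pt) (\<Union>F)"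
proof (rule closedin_locally_finite_Union)
  fix S assume "S \<in> F"
  then show "closedin (spc Pt) S" using F dk_closed Zc_closed by blast
next
  have "\<Union>F \<subseteq> pts Pt" using F dk_pts Zc_subset by blast
  moreover have "\<exists>V. openin (spc Pt) V \<and> y \<in> V \<and> finite {U \<in> F. U \<inter> V \<noteq> {}}" if y: "y \<in> pts Pt" for y
  proof -
    obtain N where N: "openin (spc Pt) N" "y \<in> N" "finite {S \<in> (\<lambda>x. dk x ` Zc z) ` X. S \<inter> N \<noteq> {}}"
      using dk_Zc_locally_finite[OF z y] by blast
    have "{U \<in> F. U \<inter> N \<noteq> {}} \<subseteq> {S \<in> (\<lambda>x. dk x ` Zc z) ` X. S \<inter> N \<noteq> {}}" using F by blast
    then show ?thesis using N finite_subset by blast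
  qed
  ultimately show "locally_finite_in (spc Pt) F" unfolding locally_finite_in_def by blast
qed

text \<open>A closed orbit has compact image in \<open>P\<close>, so the deck transformations preserving it act
  cocompactly modulo the compact torus; hence they span the directions of the cell.\<close>

lemma closed_orbit_stabilizer_span:
  assumes z: "z \<in> pts Pt" and cl: "Zc z = orb z"
  shows "dir (cell (Zc z)) = span {x \<in> X. \<alpha> x ` cell (Zc z) = cell (Zc z)}"
proof -
  define D where "D = dir (cell (Zc z))"
  define Z where "Z = Zc z"
  define H where "H = {x \<in> X. \<alpha> x ` cell (Zc z) = cell (Zc z)}"
  have ZP: "Z \<subseteq> pts Pt" unfolding Z_def by (rule Zc_subset)
  have Zorb: "Z = orb z" unfolding Z_def by (rule cl)
  have H_iff: "x \<in> H \<longleftrightarrow> x \<in> X \<and> dk x ` Z = Z" for x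
  proof (cases "x \<in> X")
    case True
    have "\<alpha> x ` cell (Zc z) = cell (Zc z) \<longleftrightarrow> cell (Zc (dk x z)) = cell (Zc z)"
      by (simp only: cell_dk[OF z True])
    also have "\<dots> \<longleftrightarrow> dk x ` Z = Z"
      using cell_eq_iff[OF dk_pts[OF True z] z] by (simp only: Zc_dk[OF True z] Z_def)
    finally show ?thesis unfolding H_def using True by simp
  qed (simp add: H_def)
  have dkorb: "dk x ` Z = orb (dk x z)" if x: "x \<in> X" for x
    unfolding Zorb image_image using ta_dk[OF _ x z] by (intro image_cong) auto
  \<comment> \<open>Translates of a closed orbit are again orbits, so they coincide or are
    disjoint.\<close>
  have meet: "x \<in> H" if x: "x \<in> X" "dk x ` Z \<inter> Z \<noteq> {}" for x
  proof -
    obtain u where u: "u \<in> dk x ` Z" "u \<in> Z" using x(2) by blast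
    obtain a where a: "a \<in> torus_pts X" "u = ta a (dk x z)" using u(1) unfolding dkorb[OF x(1)] by blast
    obtain b where b: "b \<in> torus_pts X" "u = ta b z" using u(2) unfolding Zorb by blast
    note ab = a b
    have "orb (dk x z) = orb u" using orb_eq[OF dk_pts[OF x(1) z] ab(1)] ab(2) by simp
    also have "\<dots> = orb z" using orb_eq[OF z ab(3)] ab(4) by simp
    finally show ?thesis unfolding H_iff dkorb[OF x(1)] using x(1) Zorb dkorb[OF x(1)] by blast
  qed
  have r0: "r x = 0" if "x \<in> H" for x using that stabilizer_kernel[OF cell_in[OF z], of x] unfolding H_def by blast
  have H0: "0 \<in> H"
  proof -
    have "dk 0 ` Z = id ` Z" by (intro image_cong) (use dk_zero ZP in auto)
    then show ?thesis unfolding H_iff using lattice_in_0[OF X] by simp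
  qed
  have Hadd: "x + y \<in> H" if xy: "x \<in> H" "y \<in> H" for x y
  proof -
    have xyX: "x \<in> X" "y \<in> X" "dk x ` Z = Z" "dk y ` Z = Z" using xy H_iff by auto
    have "dk (x + y) ` Z = dk x ` dk y ` Z" unfolding image_image
      by (intro image_cong) (use dk_add[OF xyX(1,2)] ZP in auto)
    then show ?thesis unfolding H_iff using xyX lattice_in_add[OF X] by simp
  qed
  have Hminus: "- x \<in> H" if x: "x \<in> H" for x
  proof -
    have xX: "x \<in> X" "dk x ` Z = Z" using x H_iff by auto
    have "dk (- x) ` Z = dk (- x) ` dk x ` Z" using xX by simp
    also have "\<dots> = id ` Z" unfolding image_image by (intro image_cong) (use dk_minus(1)[OF xX(1)] ZP in auto)
    finally show ?thesis unfolding H_iff using minus_X[OF xX(1)] by simp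
  qed
  obtain E R where E: "finite E" "independent E" "span E = D"
    and xy: "\<And>e. e \<in> E \<Longrightarrow> \<exists>x x'. e = x - x' \<and> x \<in> X \<and> x \<in> fst ` cell (Zc z) \<and> x' \<in> X \<and> x' \<in> fst ` cell (Zc z)"
    and R': "\<And>e u. e \<in> E \<Longrightarrow> u \<in> Zc z \<Longrightarrow> Zc u = Zc z \<Longrightarrow> R e u \<noteq> 0"
      "\<And>e u a. e \<in> E \<Longrightarrow> u \<in> Zc z \<Longrightarrow> a \<in> torus_pts X \<Longrightarrow> R e (ta a u) = a e * R e u"
      "\<And>S. \<forall>e. open (S e) \<and> 0 \<notin> S e \<Longrightarrow> openin (subtopology (spc Pt) (Zc z)) {u \<in> Zc z. \<forall>e\<in>E. R e u \<in> S e}"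
    by (rule ratio_coordinates[OF z, folded D_def]) (rule that, assumption+)
  note R = R'[folded Z_def]
  have ZcZ: "Zc y = Zc z" if y: "y \<in> Z" for y
  proof -
    obtain a where "a \<in> torus_pts X" "y = ta a z" using y Zorb by blast
    then show ?thesis using Zc_eq[OF z] by blast
  qed
  have zZ: "z \<in> Z" unfolding Z_def by (rule Zc_self[OF z])
  have Rnz: "R e u \<noteq> 0" if "e \<in> E" "u \<in> Z" for e u by (rule R(1)[OF that]) (simp add: ZcZ[OF that(2)] Z_def)
  note Rta = R(2)[OF _ zZ]
  define T where "T = subtopology (spc Pt) Z"
  \<comment> \<open>Increasing annuli without 0 exhaust the possible values of the coordinates, so
    the sets \<open>VV m\<close> form an increasing open exhaustion of the orbit.\<close>
  define B where "B m = {c. 1 / real (Suc m) < cmod c \<and> cmod c < real (Suc m)}" for m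
  define VV where "VV m = {u \<in> Z. \<forall>e\<in>E. R e u \<in> B m}" for m
  have "open (B m) \<and> 0 \<notin> B m" for m
    unfolding B_def by (intro conjI open_Collect_conj open_Collect_less continuous_intros) simp
  then have oV: "openin T (VV m)" for m unfolding T_def VV_def by (intro R(3)) simp
  have Bmono: "B m \<subseteq> B m'" if m: "m \<le> m'" for m m'
  proof
    fix c assume c: "c \<in> B m"
    have "1 / real (Suc m') \<le> 1 / real (Suc m)" using m by (intro divide_left_mono) auto
    then show "c \<in> B m'" using c m unfolding B_def by auto
  qed
  have VVmono: "VV m \<subseteq> VV m'" if "m \<le> m'" for m m'
    unfolding VV_def using Bmono[OF that] by blast
  have VVcover: "\<exists>m. u \<in> VV m" if u: "u \<in> Z" for u
  proof -
    have "\<forall>e\<in>E. \<exists>m. R e u \<in> B m"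
    proof
      fix e assume e: "e \<in> E"
      obtain m where m: "max (cmod (R e u)) (1 / cmod (R e u)) < real m" using reals_Archimedean2 by blast
      have p: "cmod (R e u) > 0" using Rnz[OF e u] by simp
      have "1 < real m * cmod (R e u)" using m p by (simp add: divide_less_eq)
      also have "\<dots> \<le> real (Suc m) * cmod (R e u)" using p by (intro mult_right_mono) auto
      finally have "1 < real (Suc m) * cmod (R e u)" .
      then have "R e u \<in> B m" unfolding B_def using m p by (auto simp: divide_less_eq mult.commute)
      then show "\<exists>m. R e u \<in> B m" by blast
    qed
    then obtain mm where mm: "\<And>e. e \<in> E \<Longrightarrow> R e u \<in> B (mm e)" by metis
    have "R e u \<in> B (\<Sum>e\<in>E. mm e)" if e: "e \<in> E" for e
      using mm[OF e] Bmono[OF member_le_sum[OF e, of mm]] E(1) by auto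
    then show ?thesis unfolding VV_def using u by blast
  qed
  \<comment> \<open>The other translates form a closed set disjoint from \<open>Z\<close>. Removing
    it makes images of open sets in \<open>P\<close> cut out exactly \<open>\<pi>\<close> VV
    m\<open>in\<close>\<pi> \<open>Z\<close>, so compactness downstairs selects one
    \<open>m\<close>.\<close>
  define F where "F = {S \<in> (\<lambda>x. dk x ` Zc z) ` X. S \<noteq> Z}"
  have clF: "closedin (spc Pt) (\<Union>F)" by (rule dk_Zc_Union_closed[OF z]) (auto simp: F_def)
  have disj: "Z \<inter> \<Union>F = {}"
  proof (rule ccontr)
    assume "Z \<inter> \<Union>F \<noteq> {}"
    then obtain x where x: "x \<in> X" "dk x ` Z \<noteq> Z" "dk x ` Z \<inter> Z \<noteq> {}" unfolding F_def Z_def by blast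
    then show False using meet H_iff by blast
  qed
  have pre: "{y \<in> pts Pt. \<pi> y \<in> \<pi> ` Z} = \<Union>((\<lambda>x. dk x ` Zc z) ` X)"
  proof (intro Set.set_eqI iffI)
    fix y assume "y \<in> {y \<in> pts Pt. \<pi> y \<in> \<pi> ` Z}"
    then obtain u where u: "y \<in> pts Pt" "u \<in> Z" "\<pi> u = \<pi> y" by auto
    then obtain x where "x \<in> X" "y = dk x u" using \<pi>_quotient[of u y] ZP by blast
    then show "y \<in> \<Union>((\<lambda>x. dk x ` Zc z) ` X)" using u(2) unfolding Z_def by blast
  next
    fix y assume "y \<in> \<Union>((\<lambda>x. dk x ` Zc z) ` X)"
    then obtain x u where x: "x \<in> X" "u \<in> Z" "y = dk x u" unfolding Z_def by blast
    then have "u \<in> pts Pt" using ZP by blast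
    then show "y \<in> {y \<in> pts Pt. \<pi> y \<in> \<pi> ` Z}" using \<pi>_dk[OF x(1)] dk_pts[OF x(1)] x by auto
  qed
  have clpre: "closedin (spc Pt) {y \<in> pts Pt. \<pi> y \<in> \<pi> ` Z}"
    unfolding pre by (rule dk_Zc_Union_closed[OF z order_refl])
  have \<pi>Z: "\<pi> ` Z \<subseteq> pts P" using \<pi>_pts ZP by blast
  have "pts P - \<pi> ` Z = \<pi> ` (pts Pt - {y \<in> pts Pt. \<pi> y \<in> \<pi> ` Z})"
  proof
    show "pts P - \<pi> ` Z \<subseteq> \<pi> ` (pts Pt - {y \<in> pts Pt. \<pi> y \<in> \<pi> ` Z})"
    proof
      fix p assume p: "p \<in> pts P - \<pi> ` Z"
      then obtain y where "y \<in> pts Pt" "\<pi> y = p" using \<pi>_surj[of p] by blast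
      then show "p \<in> \<pi> ` (pts Pt - {y \<in> pts Pt. \<pi> y \<in> \<pi> ` Z})" using p by blast
    qed
    show "\<pi> ` (pts Pt - {y \<in> pts Pt. \<pi> y \<in> \<pi> ` Z}) \<subseteq> pts P - \<pi> ` Z"
    proof (rule image_subsetI)
      fix y assume "y \<in> pts Pt - {y \<in> pts Pt. \<pi> y \<in> \<pi> ` Z}"
      then show "\<pi> y \<in> pts P - \<pi> ` Z" using \<pi>_pts[of y] by simp
    qed
  qed
  then have "openin Pan (pts P - \<pi> ` Z)"
    using \<pi>_open[OF openin_diff[OF openin_topspace clpre]] by simp
  then have "closedin Pan (\<pi> ` Z)" using \<pi>Z unfolding closedin_def pts_Pan by blast
  then have cp: "compactin Pan (\<pi> ` Z)" by (rule closedin_compact_space[OF compact_P])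
  have openV: "\<exists>O'. openin Pan O' \<and> O' \<inter> \<pi> ` Z = \<pi> ` VV m" for m
  proof -
    obtain N where N: "openin (spc Pt) N" "VV m = N \<inter> Z" using oV[of m] unfolding T_def openin_subtopology by blast
    have "openin Pan (\<pi> ` (N - \<Union>F))" by (rule \<pi>_open[OF openin_diff[OF N(1) clF]])
    moreover have "\<pi> ` (N - \<Union>F) \<inter> \<pi> ` Z = \<pi> ` VV m"
    proof
      show "\<pi> ` VV m \<subseteq> \<pi> ` (N - \<Union>F) \<inter> \<pi> ` Z" unfolding N(2) using disj by blast
      show "\<pi> ` (N - \<Union>F) \<inter> \<pi> ` Z \<subseteq> \<pi> ` VV m"
      proof
        fix p assume "p \<in> \<pi> ` (N - \<Union>F) \<inter> \<pi> ` Z"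
        then obtain u y where u: "u \<in> N" "u \<notin> \<Union>F" "p = \<pi> u" "y \<in> Z" "p = \<pi> y" by auto
        have uP: "u \<in> pts Pt" using openin_subset[OF N(1)] u(1) by blast
        then obtain x where x: "x \<in> X" "u = dk x y" using \<pi>_quotient[of y u] u ZP by auto
        have "dk x ` Z = Z" using u(2) x u(4) unfolding F_def Z_def by blast
        then have "u \<in> Z" using x(2) u(4) by blast
        then show "p \<in> \<pi> ` VV m" using u N(2) by blast
      qed
    qed
    ultimately show ?thesis by blast
  qed
  obtain QQ where QQ: "\<And>m. openin Pan (QQ m)" "\<And>m. QQ m \<inter> \<pi> ` Z = \<pi> ` VV m" using openV by metis
  obtain m where m: "\<pi> ` Z \<subseteq> \<pi> ` VV m"
  proof -
    have "\<pi> ` Z \<subseteq> \<Union>(range QQ)"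
    proof
      fix p assume "p \<in> \<pi> ` Z"
      then obtain m where "p \<in> \<pi> ` VV m" using VVcover by blast
      then show "p \<in> \<Union>(range QQ)" using QQ(2)[of m] by blast
    qed
    then obtain \<F> where "finite \<F>" "\<F> \<subseteq> range QQ" "\<pi> ` Z \<subseteq> \<Union>\<F>"
      using cp QQ(1) unfolding compactin_def by (metis (no_types, lifting) image_iff)
    then obtain M where M: "finite M" "\<pi> ` Z \<subseteq> (\<Union>m\<in>M. QQ m)" using finite_subset_image by metis
    have "\<pi> ` Z \<subseteq> \<pi> ` VV (\<Sum>m\<in>M. m)"
    proof
      fix p assume p: "p \<in> \<pi> ` Z"
      then obtain m where "m \<in> M" "p \<in> QQ m" using M by blast
      moreover have "m \<le> (\<Sum>m\<in>M. m)" using \<open>m \<in> M\<close> M(1) by (intro member_le_sum) auto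
      ultimately show "p \<in> \<pi> ` VV (\<Sum>m\<in>M. m)" using VVmono QQ(2) p by blast
    qed
    then show thesis by (rule that)
  qed
  have "\<forall>x\<in>H. \<exists>a. a \<in> torus_pts X \<and> dk x z = ta a z"
  proof
    fix x assume "x \<in> H"
    then have "dk x z \<in> orb z" using H_iff zZ Zorb by blast
    then show "\<exists>a. a \<in> torus_pts X \<and> dk x z = ta a z" by blast
  qed
  \<comment> \<open>The torus element realizing a deck transformation on \<open>Z\<close> is unique
    only up to the stabilizer of \<open>z\<close>. So multiplicativity of \<open>\<tau>\<close> can
    be claimed only at the differences of weights in \<open>E\<close>.\<close>
  then obtain \<tau> where \<tau>: "\<And>x. x \<in> H \<Longrightarrow> \<tau> x \<in> torus_pts X" "\<And>x. x \<in> H \<Longrightarrow> dk x z = ta (\<tau> x) z" by metis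
  have eX: "e \<in> X" if "e \<in> E" for e using xy[OF that] lattice_in_diff[OF X] by blast
  have dkta: "dk x (ta b z) = ta (b \<odot> \<tau> x) z" if x: "x \<in> H" and b: "b \<in> torus_pts X" for x b
    using x ta_dk[OF b _ z, of x] \<tau>[OF x] ta_mult[OF b \<tau>(1)[OF x] z] H_iff by simp
  have \<tau>add: "\<tau> (x + y) e = \<tau> x e * \<tau> y e" if x: "x \<in> H" "y \<in> H" and e: "e \<in> E" for x y e
  proof -
    have xyX: "x \<in> X" "y \<in> X" using x H_iff by auto
    have "ta (\<tau> (x + y)) z = dk x (dk y z)" using \<tau>(2)[OF Hadd[OF x]] dk_add[OF xyX z] by simp
    also have "\<dots> = ta (\<tau> y \<odot> \<tau> x) z" using \<tau>(2)[OF x(2)] dkta[OF x(1) \<tau>(1)[OF x(2)]] by simp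
    finally have eq: "ta (\<tau> (x + y)) z = ta (\<tau> y \<odot> \<tau> x) z" .
    obtain u u' where u: "e = u - u'" "u \<in> X" "u \<in> fst ` cell (Zc z)" "u' \<in> X" "u' \<in> fst ` cell (Zc z)"
      using xy[OF e] by blast
    have "\<tau> (x + y) e = (\<tau> y \<odot> \<tau> x) e"
      unfolding u(1) by (rule same_action_eq[OF z \<tau>(1)[OF Hadd[OF x]] tmult_closed[OF \<tau>(1)[OF x(2)] \<tau>(1)[OF x(1)]] eq u(2-5)])
    then show ?thesis using eX[OF e] by simp
  qed
  \<comment> \<open>The logarithmic moduli of the translation by \<open>x\<close>, stored as
    coefficients with respect to \<open>E\<close>; this identifies the space of logarithmic moduli
    with \<open>D\<close>.\<close>
  define \<beta> where "\<beta> x = (\<Sum>e\<in>E. ln (cmod (\<tau> x e)) *\<^sub>R e)" for x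
  have \<tau>nz: "cmod (\<tau> x e) > 0" if "x \<in> H" "e \<in> E" for x e using torus_pts_nz[OF \<tau>(1)[OF that(1)] eX[OF that(2)]] by simp
  have \<beta>add: "\<beta> (x + y) = \<beta> x + \<beta> y" if x: "x \<in> H" "y \<in> H" for x y
  proof -
    have "\<beta> (x + y) = (\<Sum>e\<in>E. ln (cmod (\<tau> x e)) *\<^sub>R e + ln (cmod (\<tau> y e)) *\<^sub>R e)"
      unfolding \<beta>_def
    proof (rule sum.cong[OF refl])
      fix e assume e: "e \<in> E"
      have "ln (cmod (\<tau> (x + y) e)) = ln (cmod (\<tau> x e)) + ln (cmod (\<tau> y e))"
        unfolding \<tau>add[OF x e] norm_mult using \<tau>nz[OF x(1) e] \<tau>nz[OF x(2) e] by (simp add: ln_mult)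
      then show "ln (cmod (\<tau> (x + y) e)) *\<^sub>R e = ln (cmod (\<tau> x e)) *\<^sub>R e + ln (cmod (\<tau> y e)) *\<^sub>R e"
        by (simp add: scaleR_left_distrib)
    qed
    then show ?thesis unfolding \<beta>_def by (simp add: sum.distrib)
  qed
  have HX: "H \<subseteq> X" unfolding H_def by blast
  obtain W M where W: "subspace W" "dim W \<le> dim H" "\<And>x. x \<in> H \<Longrightarrow> \<exists>y\<in>W. norm (\<beta> x - y) \<le> M"
    using additive_image_near_subspace[OF X HX H0 Hadd Hminus \<beta>add] by metis
  obtain d where d: "\<And>e e'. e \<in> E \<Longrightarrow> e' \<in> E \<Longrightarrow> d e \<bullet> e' = (if e = e' then 1 else 0)"
    using dual_vectors[OF E(2)] by metis
  define M0 where "M0 e = ln (real (Suc m)) + \<bar>ln (cmod (R e z))\<bar>" for e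
  \<comment> \<open>Cocompactness in logarithmic form: the orbit point with logarithmic modulus
    \<open>v\<close> is a deck translate, by some \<open>x\<close> in \<open>H\<close>, of a point
    of \<open>VV m\<close>. There the coordinates are bounded by \<open>m\<close>, so
    \<open>v\<close> is close to \<open>\<beta> x\<close>.\<close>
  have near: "\<exists>x\<in>H. norm (v - \<beta> x) \<le> (\<Sum>e\<in>E. M0 e * norm e)" if v: "v \<in> D" for v
  proof -
    obtain c where c: "v = (\<Sum>e\<in>E. c e *\<^sub>R e)" using v E(3)[symmetric] unfolding span_finite[OF E(1)] by auto
    define \<nu> where "\<nu> = (\<Sum>e\<in>E. c e *\<^sub>R d e)"
    have \<nu>: "\<nu> \<bullet> e = c e" if e: "e \<in> E" for e
    proof -
      have "\<nu> \<bullet> e = (\<Sum>e'\<in>E. c e' * (d e' \<bullet> e))" unfolding \<nu>_def by (simp add: inner_sum_left)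
      also have "\<dots> = (\<Sum>e'\<in>E. if e' = e then c e else 0)" by (intro sum.cong) (auto simp: d e)
      also have "\<dots> = c e" using e E(1) by simp
      finally show ?thesis .
    qed
    define a where "a = exp_char X \<nu> 1"
    have a: "a \<in> torus_pts X" unfolding a_def by (rule exp_char_torus[OF X])
    have ae: "cmod (a e) = exp (c e)" if e: "e \<in> E" for e unfolding a_def using eX[OF e] \<nu>[OF e] by simp
    have yZ: "ta a z \<in> Z" using Zorb a by blast
    then obtain u where u: "u \<in> VV m" "\<pi> (ta a z) = \<pi> u" using m by auto
    have uZ: "u \<in> Z" using u(1) unfolding VV_def by blast
    then obtain x where x: "x \<in> X" "ta a z = dk x u" using \<pi>_quotient[of u "ta a z"] u(2) yZ ZP by auto
    have xH: "x \<in> H" by (rule meet[OF x(1)]) (use yZ uZ x(2) in auto)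
    obtain b where b: "b \<in> torus_pts X" "u = ta b z" using uZ Zorb by blast
    have tz: "ta a z = ta (b \<odot> \<tau> x) z" using x(2) b dkta[OF xH] by simp
    have est: "\<bar>c e - ln (cmod (\<tau> x e))\<bar> \<le> M0 e" if e: "e \<in> E" for e
    proof -
      have "a e * R e z = R e (ta (b \<odot> \<tau> x) z)" using Rta[OF e a] tz by simp
      also have "\<dots> = \<tau> x e * R e u"
        using Rta[OF e tmult_closed[OF b(1) \<tau>(1)[OF xH]]] Rta[OF e b(1)] b(2) eX[OF e] by simp
      finally have "exp (c e) * cmod (R e z) = cmod (\<tau> x e) * cmod (R e u)"
        using ae[OF e] by (metis norm_mult)
      then have "ln (exp (c e) * cmod (R e z)) = ln (cmod (\<tau> x e) * cmod (R e u))" by simp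
      then have 1: "c e + ln (cmod (R e z)) = ln (cmod (\<tau> x e)) + ln (cmod (R e u))"
        using Rnz[OF e zZ] Rnz[OF e uZ] \<tau>nz[OF xH e] by (simp add: ln_mult)
      have "R e u \<in> B m" using u(1) e unfolding VV_def by blast
      then have b2: "1 / real (Suc m) < cmod (R e u)" "cmod (R e u) < real (Suc m)" unfolding B_def by auto
      have "ln (1 / real (Suc m)) < ln (cmod (R e u))" "ln (cmod (R e u)) < ln (real (Suc m))"
        using b2 Rnz[OF e uZ] by (subst ln_less_cancel_iff, auto)+
      then have "\<bar>ln (cmod (R e u))\<bar> \<le> ln (real (Suc m))" by (simp add: ln_div)
      then show ?thesis using 1 unfolding M0_def by linarith
    qed
    have "norm (v - \<beta> x) = norm (\<Sum>e\<in>E. (c e - ln (cmod (\<tau> x e))) *\<^sub>R e)"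
      unfolding c \<beta>_def by (simp add: sum_subtractf scaleR_left_diff_distrib)
    also have "\<dots> \<le> (\<Sum>e\<in>E. norm ((c e - ln (cmod (\<tau> x e))) *\<^sub>R e))" by (rule norm_sum)
    also have "\<dots> \<le> (\<Sum>e\<in>E. M0 e * norm e)" by (intro sum_mono) (simp add: mult_right_mono est)
    finally show ?thesis using xH by blast
  qed
  \<comment> \<open>Both errors are bounded, hence \<open>D\<close> lies in a subspace of dimension
    at most \<open>dim H\<close>; as \<open>H\<close> is contained in \<open>D\<close>, it spans
    \<open>D\<close>.\<close>
  have "D \<subseteq> W"
  proof (rule subspace_near_dense[OF _ W(1)])
    show "subspace D" unfolding D_def by (rule subspace_dir)
    fix v assume "v \<in> D"
    then obtain x where x: "x \<in> H" "norm (v - \<beta> x) \<le> (\<Sum>e\<in>E. M0 e * norm e)" using near by blast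
    obtain y where y: "y \<in> W" "norm (\<beta> x - y) \<le> M" using W(3)[OF x(1)] by blast
    have "norm (v - y) \<le> (\<Sum>e\<in>E. M0 e * norm e) + M"
      using norm_triangle_ineq[of "v - \<beta> x" "\<beta> x - y"] x(2) y(2) by simp
    then show "\<exists>y\<in>W. norm (v - y) \<le> (\<Sum>e\<in>E. M0 e * norm e) + M" using y(1) by blast
  qed
  then have dimD: "dim D \<le> dim H" using dim_subset[of D W] W(2) by linarith
  have HD: "H \<subseteq> D"
  proof
    fix x assume x: "x \<in> H"
    show "x \<in> D" unfolding D_def
      by (rule dir_kernel[OF cell_in[OF z] _ r0[OF x]]) (use x HX span_base in blast)
  qed
  have "span H = D"
  proof (rule subspace_dim_equal)
    show "subspace (span H)" "subspace D" unfolding D_def by (simp_all add: subspace_dir)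
    show "span H \<subseteq> D" using HD unfolding D_def by (simp add: span_minimal subspace_dir)
    show "dim (span H) \<ge> dim D" using dimD by simp
  qed
  then show ?thesis unfolding D_def H_def by simp
qed

text \<open>The cell over a vertex contains no smaller cell, so its orbit is closed and its
  stabilizer spans its directions, among them the kernel of \<open>r\<close>. That stabilizer
  preserves the original cell as well.\<close>

lemma kernel_stabilizer_span:
  assumes d: "\<delta> \<in> cells" and v: "v \<in> span X" "r v = 0"
  shows "v \<in> span {x \<in> X. \<alpha> x ` \<delta> = \<delta>}"
proof -
  obtain \<delta>' i where \<delta>': "\<delta> = pullback_cell X r \<rho>' \<delta>' i" "\<delta>' \<in> C'" "i \<in> I"
    using d unfolding pullback_cells_def by blast
  obtain V where V: "finite V" "V \<noteq> {}" "\<rho>' ` \<delta>' = convex hull V" using cell_polytope[OF \<delta>'(2)] by blast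
  have "\<exists>v. v extreme_point_of \<rho>' ` \<delta>'"
    unfolding V(3)
    using extreme_point_exists_convex[OF finite_imp_compact_convex_hull[OF V(1)] convex_convex_hull] V(2)
    by (metis convex_hull_eq_empty)
  then obtain v0 where "v0 extreme_point_of \<rho>' ` \<delta>'" by blast
  then have f: "{v0} face_of \<rho>' ` \<delta>'" by (simp add: face_of_singleton)
  then obtain q where q: "q \<in> \<delta>'" "\<rho>' q = v0" using face_of_imp_subset by fastforce
  have isf: "is_face \<rho>' {q} \<delta>'" unfolding is_face_def using q f by simp
  have qC: "{q} \<in> C'" by (rule face_cell[OF \<delta>'(2) isf])
  define \<epsilon> where "\<epsilon> = pullback_cell X r \<rho>' {q} i"
  have \<epsilon>: "\<epsilon> \<in> cells" "\<epsilon> \<subseteq> \<delta>" unfolding \<epsilon>_def by (rule face_pullback_cell[OF d \<delta>'(1,2) isf])+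
  obtain z where z: "z \<in> pts Pt" "cell (Zc z) = \<epsilon>" using cell_onto[OF \<epsilon>(1)] by blast
  have "Zc z = orb z"
  proof
    show "orb z \<subseteq> Zc z" by (rule orb_Zc[OF z(1)])
    show "Zc z \<subseteq> orb z"
    proof
      fix y assume y: "y \<in> Zc z"
      have yP: "y \<in> pts Pt" using y Zc_subset by blast
      have sub: "cell (Zc y) \<subseteq> \<epsilon>" using cell_subset_iff[OF yP z(1)] Zc_mono[OF z(1) y] z(2) by simp
      obtain \<epsilon>' j where e: "cell (Zc y) = pullback_cell X r \<rho>' \<epsilon>' j" "\<epsilon>' \<in> C'"
        using cell_in[OF yP] unfolding pullback_cells_def by blast
      have "\<epsilon>' \<subseteq> {q}" "j = i" using pullback_cell_subset[OF e(2) sub[unfolded e(1) \<epsilon>_def]] by auto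
      then have "\<epsilon>' = {q}" "j = i" using cell'_nonempty[OF e(2)] by auto
      then have "cell (Zc y) = cell (Zc z)" using e(1) z(2) \<epsilon>_def by simp
      then show "y \<in> orb z" using same_closure_orbit[OF z(1) yP] cell_eq_iff[OF yP z(1)] by blast
    qed
  qed
  then have "dir \<epsilon> = span {x \<in> X. \<alpha> x ` \<epsilon> = \<epsilon>}" using closed_orbit_stabilizer_span[OF z(1)] z(2) by simp
  moreover have "v \<in> dir \<epsilon>" by (rule dir_kernel[OF \<epsilon>(1) v])
  \<comment> \<open>An element stabilizing the vertex cell has \<open>r x = 0\<close>, so it acts
    trivially on the component in the underlying complex. The common vertex cell shows that the
    index of the copy is also unchanged.\<close>
  moreover have "{x \<in> X. \<alpha> x ` \<epsilon> = \<epsilon>} \<subseteq> {x \<in> X. \<alpha> x ` \<delta> = \<delta>}"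
  proof
    fix x assume "x \<in> {x \<in> X. \<alpha> x ` \<epsilon> = \<epsilon>}"
    then have x: "x \<in> X" "\<alpha> x ` \<epsilon> = \<epsilon>" by auto
    have rx: "r x = 0" by (rule stabilizer_kernel[OF \<epsilon>(1) x])
    obtain \<gamma> j where g: "\<alpha> x ` \<delta> = pullback_cell X r \<rho>' \<gamma> j" "\<gamma> \<in> C'"
      using act_cell[OF x(1) d] unfolding pullback_cells_def by blast
    have pr: "(\<lambda>w. fst (snd w)) ` pullback_cell X r \<rho>' \<eta> k = \<eta>" if h: "\<eta> \<in> C'" for \<eta> k
    proof (intro Set.set_eqI iffI)
      fix p assume p: "p \<in> \<eta>"
      then obtain v where "v \<in> span X" "r v = \<rho>' p" using cell'_lift[OF h] by blast
      then have "(v, p, k) \<in> pullback_cell X r \<rho>' \<eta> k" using p unfolding pullback_cell_def by simp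
      then show "p \<in> (\<lambda>w. fst (snd w)) ` pullback_cell X r \<rho>' \<eta> k" by force
    qed (auto simp: pullback_cell_def)
    have "(\<lambda>w. fst (snd w)) ` \<alpha> x ` \<delta> = (\<lambda>w. fst (snd w)) ` \<delta>"
      unfolding image_image
    proof (rule image_cong[OF refl])
      fix w assume w: "w \<in> \<delta>"
      have "fst (snd w) \<in> \<delta>'" using w \<delta>'(1) unfolding pullback_cell_def by auto
      then have "\<alpha>' 0 (fst (snd w)) = fst (snd w)" using action' \<delta>'(2) unfolding lattice_action_def by blast
      then show "fst (snd (\<alpha> x w)) = fst (snd w)" using action_extends[OF x(1), of w] w d rx by auto
    qed
    then have "(\<lambda>w. fst (snd w)) ` pullback_cell X r \<rho>' \<gamma> j = (\<lambda>w. fst (snd w)) ` pullback_cell X r \<rho>' \<delta>' i"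
      using g(1) \<delta>'(1) by simp
    then have gd: "\<gamma> = \<delta>'" by (simp only: pr[OF g(2)] pr[OF \<delta>'(2)])
    have "\<epsilon> \<subseteq> \<alpha> x ` \<delta>" using x(2) \<epsilon>(2) by blast
    then have "i = j" unfolding g(1) \<epsilon>_def by (rule pullback_cell_subset(2)[OF qC])
    then show "x \<in> {x \<in> X. \<alpha> x ` \<delta> = \<delta>}" using g(1) gd \<delta>'(1) x(1) by simp
  qed
  ultimately show ?thesis using span_mono by blast
qed

end

subsection \<open>The support of the theta function on an orbit\<close>

context theta_expansion
begin

text \<open>A deck transformation preserving the cell moves \<open>z\<close> inside its own orbit,
  along which the support is constant; equivariance of \<open>\<xi>\<close> then transports support
  points.\<close>

lemma supp_stabilizer:
  assumes z: "z \<in> pts Pt" and x: "x \<in> X" "\<alpha> x ` cell (Zc z) = cell (Zc z)" and w: "w \<in> supp z"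
  shows "\<alpha> x w \<in> supp z"
proof -
  have dz: "dk x z \<in> pts Pt" by (rule dk_pts[OF x(1) z])
  have "Zc (dk x z) = Zc z" using cell_dk[OF z x(1)] x(2) cell_eq_iff[OF dz z] by simp
  then obtain a where a: "a \<in> torus_pts X" "dk x z = ta a z" using same_closure_orbit[OF z dz] by blast
  obtain i where i: "i \<in> \<Theta>" "\<pi> z \<in> fst i" using idx_\<pi>[OF z] by blast
  have wI: "w \<in> IP" using w unfolding supp_def by blast
  then have aw: "\<alpha> x w \<in> IP" using act_bij_IP[OF x(1)] bij_betwE by blast
  have i': "\<pi> (dk x z) \<in> fst i" using \<pi>_dk[OF x(1) z] i(2) by simp
  have "\<xi> (\<alpha> x w) (dk x z) i \<noteq> 0" using \<xi>_equivariant[OF x(1) z i wI] supp_iff[OF z i, of w] w by simp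
  then have "\<alpha> x w \<in> supp (dk x z)" using supp_iff[OF dz i(1) i', of "\<alpha> x w"] aw by blast
  then show ?thesis using supp_ta[OF a(1) z] a(2) by simp
qed

text \<open>Iterating the stabilizer element produces support points \<open>fst w + n x\<close>, on
  which \<open>\<nu>\<close> would be unbounded.\<close>

lemma supp_bounded_stabilizer:
  assumes z: "z \<in> pts Pt" and c: "\<And>w. w \<in> supp z \<Longrightarrow> \<nu> \<bullet> fst w \<le> c"
    and x: "x \<in> X" "\<alpha> x ` cell (Zc z) = cell (Zc z)"
  shows "\<nu> \<bullet> x \<le> 0"
proof (rule ccontr)
  assume n: "\<not> \<nu> \<bullet> x \<le> 0"
  obtain w where w: "w \<in> supp z" using supp_nonempty[OF z] by blast
  have it: "(\<alpha> x ^^ n) w \<in> supp z \<and> fst ((\<alpha> x ^^ n) w) = fst w + real n *\<^sub>R x" for n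
  proof (induction n)
    case (Suc n)
    have "(\<alpha> x ^^ n) w \<in> \<Union>cells" using Suc unfolding supp_def integral_points_def by blast
    then show ?case using Suc supp_stabilizer[OF z x, of "(\<alpha> x ^^ n) w"] act_fst[OF x(1)] by (simp add: scaleR_left_distrib)
  qed (simp add: w)
  obtain n where "(c - \<nu> \<bullet> fst w) / (\<nu> \<bullet> x) < real n" using reals_Archimedean2 by blast
  then have "c < \<nu> \<bullet> fst w + real n * (\<nu> \<bullet> x)" using n by (simp add: divide_less_eq)
  also have "\<dots> = \<nu> \<bullet> fst ((\<alpha> x ^^ n) w)" using it[of n] by (simp add: inner_add_right)
  also have "\<dots> \<le> c" using c it[of n] by blast
  finally show False by simp
qed

text \<open>On the lattice the functional depends only on \<open>r x\<close>, so chosen lifts give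
  an additive function on \<open>X'\<close>, and this is an inner product.\<close>

lemma functional_factors:
  assumes k: "\<And>v. v \<in> span X \<Longrightarrow> r v = 0 \<Longrightarrow> \<nu> \<bullet> v = 0"
  obtains \<mu> where "\<And>v. v \<in> span X \<Longrightarrow> \<nu> \<bullet> v = \<mu> \<bullet> r v"
proof -
  define g where "g y = (SOME x. x \<in> X \<and> r x = y)" for y
  have g: "g y \<in> X \<and> r (g y) = y" if y: "y \<in> X'" for y
    unfolding g_def by (rule someI_ex) (use y r_image in blast)
  have wd: "\<nu> \<bullet> x = \<nu> \<bullet> g (r x)" if x: "x \<in> X" for x
  proof -
    have y: "r x \<in> X'" using x r_image by blast
    have "\<nu> \<bullet> (x - g (r x)) = 0"
      by (rule k) (use g[OF y] x in \<open>auto simp: linear_diff[OF r_linear] intro: span_base span_diff\<close>)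
    then show ?thesis by (simp add: inner_diff_right)
  qed
  obtain \<mu> where \<mu>: "\<And>y. y \<in> X' \<Longrightarrow> \<nu> \<bullet> g y = \<mu> \<bullet> y"
  proof (rule lattice_functional[OF X', of "\<lambda>y. \<nu> \<bullet> g y"])
    fix y y' assume y: "y \<in> X'" "y' \<in> X'"
    have "g y + g y' \<in> X" "r (g y + g y') = y + y'"
      using g[OF y(1)] g[OF y(2)] lattice_in_add[OF X] by (auto simp: linear_add[OF r_linear])
    then show "\<nu> \<bullet> g (y + y') = \<nu> \<bullet> g y + \<nu> \<bullet> g y'" using wd[of "g y + g y'"] by (simp add: inner_add_right)
  qed (rule that)
  have "\<nu> \<bullet> v = \<mu> \<bullet> r v" if v: "v \<in> span X" for v
  proof (rule linear_eq_on_span[OF _ _ _ v])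
    show "linear (\<lambda>v. \<nu> \<bullet> v)" by (rule bounded_linear.linear[OF bounded_linear_inner_right])
    show "linear (\<lambda>v. \<mu> \<bullet> r v)"
      using linear_compose[OF r_linear bounded_linear.linear[OF bounded_linear_inner_right[of \<mu>]]] by (simp add: o_def)
    fix x assume x: "x \<in> X"
    have "r x \<in> X'" using x r_image by blast
    then show "\<nu> \<bullet> x = \<mu> \<bullet> r x" using wd[OF x] \<mu> by simp
  qed
  then show thesis by (rule that)
qed

text \<open>The theta function is nonzero on every orbit, in particular on the orbits of faces; so its
  support meets every face and its closed convex hull is the cell.\<close>

lemma supp_spans_cell:
  assumes z: "z \<in> pts Pt" and c: "\<And>w. w \<in> supp z \<Longrightarrow> \<nu> \<bullet> fst w \<le> c"
    and y: "y \<in> fst ` cell (Zc z)"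
  shows "\<nu> \<bullet> y \<le> c"
proof -
  have d: "cell (Zc z) \<in> cells" by (rule cell_in[OF z])
  have st: "\<nu> \<bullet> x = 0" if x: "x \<in> X" "\<alpha> x ` cell (Zc z) = cell (Zc z)" for x
  proof -
    have "\<alpha> (- x) ` cell (Zc z) = cell (Zc z)" using act_minus_cell[OF x(1) d] x(2) by simp
    then have "\<nu> \<bullet> (- x) \<le> 0" using supp_bounded_stabilizer[of z \<nu> c "- x"] z c minus_X[OF x(1)] by blast
    moreover have "\<nu> \<bullet> x \<le> 0" by (rule supp_bounded_stabilizer[OF z c x])
    ultimately show ?thesis by simp
  qed
  have k: "\<nu> \<bullet> v = 0" if v: "v \<in> span X" "r v = 0" for v
  proof -
    have "v \<in> span {x \<in> X. \<alpha> x ` cell (Zc z) = cell (Zc z)}" by (rule kernel_stabilizer_span[OF d v])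
    moreover have "span {x \<in> X. \<alpha> x ` cell (Zc z) = cell (Zc z)} \<subseteq> {v. \<nu> \<bullet> v = 0}"
      by (intro span_minimal subspace_hyperplane subsetI) (simp add: st)
    ultimately show ?thesis by auto
  qed
  obtain \<mu> where \<mu>: "\<And>v. v \<in> span X \<Longrightarrow> \<nu> \<bullet> v = \<mu> \<bullet> r v" using functional_factors[of \<nu>] k by blast
  obtain \<delta>' i where \<delta>': "cell (Zc z) = pullback_cell X r \<rho>' \<delta>' i" "\<delta>' \<in> C'"
    using d unfolding pullback_cells_def by blast
  obtain V where V: "finite V" "V \<noteq> {}" "\<rho>' ` \<delta>' = convex hull V" using cell_polytope[OF \<delta>'(2)] by blast
  have cp: "compact (\<rho>' ` \<delta>')" and cv: "convex (\<rho>' ` \<delta>')" unfolding V(3) by (simp_all add: V(1) finite_imp_compact_convex_hull)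
  have "continuous_on (\<rho>' ` \<delta>') (\<lambda>k. \<mu> \<bullet> k)" by (intro continuous_intros)
  then obtain k0 where k0: "k0 \<in> \<rho>' ` \<delta>'" "\<And>k. k \<in> \<rho>' ` \<delta>' \<Longrightarrow> \<mu> \<bullet> k \<le> \<mu> \<bullet> k0"
    using continuous_attains_sup[OF cp] cell'_nonempty[OF \<delta>'(2)] by (metis image_is_empty)
  \<comment> \<open>The face on which the descended functional \<open>\<mu>\<close> is maximal. A
    support point of its orbit has the maximal value, and must also be a support point of the larger
    orbit.\<close>
  define F where "F = {q \<in> \<delta>'. \<mu> \<bullet> \<rho>' q = \<mu> \<bullet> k0}"
  have "\<rho>' ` F = \<rho>' ` \<delta>' \<inter> {k. \<mu> \<bullet> k = \<mu> \<bullet> k0}" unfolding F_def by auto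
  then have "\<rho>' ` F face_of \<rho>' ` \<delta>'" using face_of_Int_supporting_hyperplane_le[OF cv k0(2)] by simp
  then have isf: "is_face \<rho>' F \<delta>'" unfolding is_face_def F_def using k0(1) by auto
  define \<epsilon> where "\<epsilon> = pullback_cell X r \<rho>' F i"
  have \<epsilon>: "\<epsilon> \<in> cells" "\<epsilon> \<subseteq> cell (Zc z)" unfolding \<epsilon>_def by (rule face_pullback_cell[OF d \<delta>' isf])+
  obtain u where u: "u \<in> pts Pt" "cell (Zc u) = \<epsilon>" using cell_onto[OF \<epsilon>(1)] by blast
  have "u \<in> Zc z" using cell_subset_iff[OF u(1) z] \<epsilon>(2) u(2) Zc_self[OF u(1)] by blast
  obtain w where w: "w \<in> supp u" using supp_nonempty[OF u(1)] by blast
  have wI: "w \<in> IP" "\<xi> w u \<noteq> (\<lambda>_. 0)" using w unfolding supp_def by auto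
  \<comment> \<open>An eigensection nonzero at a point of the orbit closure is nonzero on the dense
    orbit: supports can only grow from a face to the cell.\<close>
  have "\<xi> w z \<noteq> (\<lambda>_. 0)"
    by (rule eig_nonzero[OF \<xi>_eigensection[OF wI(1)] closedin_topspace Zc_subset z \<open>u \<in> Zc z\<close> wI(2)])
  then have "w \<in> supp z" using wI(1) unfolding supp_def by blast
  have "w \<in> \<epsilon>" using supp_cell[OF u(1) w] u(2) by simp
  then obtain q where q: "fst w \<in> span X" "q \<in> F" "r (fst w) = \<rho>' q" unfolding \<epsilon>_def pullback_cell_def by auto
  have "\<mu> \<bullet> k0 = \<nu> \<bullet> fst w" using \<mu>[OF q(1)] q unfolding F_def by simp
  also have "\<dots> \<le> c" by (rule c[OF \<open>w \<in> supp z\<close>])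
  finally have "\<mu> \<bullet> k0 \<le> c" .
  moreover have "y \<in> span X" "r y \<in> \<rho>' ` \<delta>'" using y unfolding \<delta>'(1) fst_pullback_cell by auto
  ultimately show ?thesis using \<mu>[of y] k0(2)[of "r y"] by simp
qed

text \<open>If the average were on the relative boundary, a supporting hyperplane there would make
  all summands of the centered first moment nonnegative with sum 0. The whole support, hence the
  whole cell, would lie in the hyperplane.\<close>

lemma avg_rel_interior:
  assumes z: "z \<in> pts Pt"
  shows "avg z \<in> rel_interior (fst ` cell (Zc z))"
proof (rule ccontr)
  assume n: "avg z \<notin> rel_interior (fst ` cell (Zc z))"
  note S = cell_convex_closed[OF cell_in[OF z]]
  obtain a where a: "a \<noteq> 0" "\<And>y. y \<in> fst ` cell (Zc z) \<Longrightarrow> a \<bullet> avg z \<le> a \<bullet> y"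
    "\<And>y. y \<in> rel_interior (fst ` cell (Zc z)) \<Longrightarrow> a \<bullet> avg z < a \<bullet> y"
    using supporting_hyperplane_rel_boundary[OF S(1) avg_in_cell[OF z] n] by metis
  obtain i where i: "i \<in> \<Theta>" "\<pi> z \<in> fst i" using idx_\<pi>[OF z] by blast
  define c where "c w = (cmod (\<xi> w z i))\<^sup>2" for w
  interpret exp_family IP c "\<lambda>w. fst w - avg z" unfolding c_def by (rule exp_family_\<xi>[OF z i])
  have 0: "infsum (\<lambda>w. c w *\<^sub>R (fst w - avg z)) IP = 0"
    using weighted_average_eq_iff[OF avg_weighted[OF z i], of "avg z"] unfolding c_def by simp
  have sm: "(\<lambda>w. c w * (a \<bullet> (fst w - avg z))) summable_on IP"
    using summable_inner[of 0 a] by simp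
  have "infsum (\<lambda>w. c w * (a \<bullet> (fst w - avg z))) IP = 0"
    using infsum_inner[of a 0] 0 by simp
  moreover have nn: "c w * (a \<bullet> (fst w - avg z)) \<ge> 0" if w: "w \<in> IP" for w
  proof (cases "c w = 0")
    case False
    then have "w \<in> supp z" using supp_iff[OF z i, of w] w unfolding c_def by simp
    then have "fst w \<in> fst ` cell (Zc z)" using supp_cell[OF z] by blast
    then show ?thesis using a(2)[of "fst w"] unfolding c_def by (simp add: inner_diff_right)
  qed simp
  ultimately have z0: "c w * (a \<bullet> (fst w - avg z)) = 0" if "w \<in> IP" for w
    using nonneg_infsum_le_0D[of "\<lambda>w. c w * (a \<bullet> (fst w - avg z))" IP w] sm that by simp
  have "a \<bullet> y \<le> a \<bullet> avg z" if "y \<in> fst ` cell (Zc z)" for y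
  proof (rule supp_spans_cell[OF z _ that])
    fix w assume w: "w \<in> supp z"
    then have "w \<in> IP" "\<xi> w z i \<noteq> 0" using supp_iff[OF z i, of w] by auto
    then show "a \<bullet> fst w \<le> a \<bullet> avg z" using z0[of w] unfolding c_def by (simp add: inner_diff_right)
  qed
  moreover obtain y where y: "y \<in> rel_interior (fst ` cell (Zc z))"
    using S(1,4) rel_interior_eq_empty by blast
  moreover have "y \<in> fst ` cell (Zc z)" using y rel_interior_subset by blast
  ultimately show False using a(3)[of y] by force
qed

text \<open>Averages stay in relative interiors, and these are disjoint; so the value of the moment
  map determines the orbit closure.\<close>

lemma cell_of_Mt:
  assumes z: "z \<in> pts Pt" and d: "\<delta> \<in> cells" "Mt z \<in> \<delta>" "fst (Mt z) \<in> rel_interior (fst ` \<delta>)"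
  shows "cell (Zc z) = \<delta>"
  by (rule cell_eq_of_rel_interior[OF cell_in[OF z] d(1) Mt(1)[OF z] d(2) _ d(3)])
    (simp add: Mt(2)[OF z] avg_rel_interior[OF z])

end

subsection \<open>Stabilizers in the torus\<close>

text \<open>Openness is meant in the Zariski topology, in which stabilizers are assumed
  connected.\<close>

lemma torus_level_set_open:
  fixes X :: "'e::euclidean_space set"
  assumes X: "lattice_in X" and u: "u \<in> X"
  shows "openin (spc (torus X)) {s \<in> torus_pts X. s u \<noteq> 1}"
proof (cases "u = 0")
  case True
  then have "{s \<in> torus_pts X. s u \<noteq> 1} = {}" using torus_pts_0[OF X] by blast
  then show ?thesis by (simp only: openin_empty)
next
  case False
  define c where "c x = (if x = 0 then - 1 else 1 :: complex)" for x :: 'e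
  have "(torus_pts X, \<lambda>a. \<Sum>x\<in>{0, u}. c x * a x) \<in> {(torus_pts X, \<lambda>a. \<Sum>x\<in>S. c x * a x) |S c. finite S \<and> S \<subseteq> X}"
    using u lattice_in_0[OF X] by blast
  from alg_space_generator[OF this]
  have "openin (spc (torus X)) {a \<in> torus_pts X. (\<Sum>x\<in>{0, u}. c x * a x) \<noteq> 0}" unfolding torus_def .
  moreover have "{a \<in> torus_pts X. (\<Sum>x\<in>{0, u}. c x * a x) \<noteq> 0} = {s \<in> torus_pts X. s u \<noteq> 1}"
    using False torus_pts_0[OF X] by (auto simp: c_def)
  ultimately show ?thesis by simp
qed

text \<open>Where \<open>s u\<close> is an \<open>m\<close>-th root of unity and
  \<open>m > 0\<close>, the geometric sum is nonzero exactly for \<open>s u = 1\<close>. So this set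
  and the previous one split the elements with \<open>s u ^ m = 1\<close> into two open parts. The
  case \<open>u = 0\<close> is separate because the multiples of \<open>u\<close> then
  coincide.\<close>

lemma torus_root_set_open:
  fixes X :: "'e::euclidean_space set"
  assumes X: "lattice_in X" and u: "u \<in> X"
  shows "openin (spc (torus X)) {s \<in> torus_pts X. (\<Sum>j<m. s u ^ j) \<noteq> 0}"
proof (cases "u = 0")
  case True
  have "{s \<in> torus_pts X. (\<Sum>j<m. s u ^ j) \<noteq> 0} = (if m = 0 then {} else torus_pts X)"
  proof (cases "m = 0")
    case False
    have "(\<Sum>j<m. a u ^ j) = of_nat m" if "a \<in> torus_pts X" for a using torus_pts_0[OF X that] True by simp
    then show ?thesis using False by auto
  qed simp
  then show ?thesis using pts_torus[OF X] openin_topspace[of "spc (torus X)"] by auto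
next
  case False
  define S where "S = (\<lambda>j. of_nat j *\<^sub>R u) ` {..<m}"
  have inj: "inj_on (\<lambda>j. of_nat j *\<^sub>R u) {..<m}" using False by (auto simp: inj_on_def)
  have S: "finite S" "S \<subseteq> X" unfolding S_def using lattice_in_scale_nat[OF X u] by auto
  then have "(torus_pts X, \<lambda>a. \<Sum>x\<in>S. 1 * a x) \<in> {(torus_pts X, \<lambda>a. \<Sum>x\<in>S. c x * a x) |S c. finite S \<and> S \<subseteq> X}"
    by (intro CollectI exI[of _ S] exI[of _ "\<lambda>_. 1"] conjI refl)
  from alg_space_generator[OF this]
  have "openin (spc (torus X)) {a \<in> torus_pts X. (\<Sum>x\<in>S. 1 * a x) \<noteq> 0}" unfolding torus_def .
  moreover have "(\<Sum>x\<in>S. 1 * a x) = (\<Sum>j<m. a u ^ j)" if a: "a \<in> torus_pts X" for a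
  proof -
    have "(\<Sum>x\<in>S. 1 * a x) = (\<Sum>j<m. a (of_nat j *\<^sub>R u))" unfolding S_def by (simp add: sum.reindex[OF inj])
    also have "\<dots> = (\<Sum>j<m. a u ^ j)"
    proof (rule sum.cong[OF refl])
      fix j
      show "a (of_nat j *\<^sub>R u) = a u ^ j" using torus_pts_scale[OF X a u, of "int j"] by simp
    qed
    finally show ?thesis .
  qed
  ultimately show ?thesis by (simp cong: conj_cong)
qed

context theta_expansion
begin

text \<open>For \<open>x \<noteq> 0\<close> the iterates are infinitely many distinct integral
  points, along which the terms of a summable family tend to 0; they cannot start nonzero and never
  decrease.\<close>

lemma no_nondecreasing_chain:
  assumes z: "z \<in> pts Pt" and i: "i \<in> \<Theta>" "\<pi> z \<in> fst i" and x: "x \<in> X" "x \<noteq> 0"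
    and w: "w \<in> supp z" and c: "\<And>n. cmod (\<xi> ((\<alpha> x ^^ n) w) z i) \<le> cmod (\<xi> ((\<alpha> x ^^ Suc n) w) z i)"
  shows False
proof -
  define f where "f n = (\<alpha> x ^^ n) w" for n
  have f: "f n \<in> IP \<and> fst (f n) = fst w + real n *\<^sub>R x" for n
  proof (induction n)
    case 0
    then show ?case using w unfolding f_def supp_def by simp
  next
    case (Suc n)
    have "f n \<in> \<Union>cells" using Suc unfolding integral_points_def by blast
    moreover have "\<alpha> x (f n) \<in> IP" using Suc act_bij_IP[OF x(1)] bij_betwE by blast
    ultimately show ?case using Suc act_fst[OF x(1), of "f n"] by (simp add: f_def scaleR_left_distrib)
  qed
  have inj: "inj f"
  proof (rule injI)
    fix m n assume "f m = f n"
    then have "fst w + real m *\<^sub>R x = fst w + real n *\<^sub>R x" using f[of m] f[of n] by metis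
    then show "m = n" using x(2) by simp
  qed
  have "(\<lambda>w. cmod (\<xi> w z i)) summable_on IP" using summable_exp[OF z i, of 0] by simp
  then have "(\<lambda>w. cmod (\<xi> w z i)) summable_on range f" by (rule summable_on_subset_banach) (use f in blast)
  then have "(\<lambda>n. cmod (\<xi> (f n) z i)) summable_on UNIV"
    using summable_on_reindex[OF inj, of "\<lambda>w. cmod (\<xi> w z i)"] unfolding o_def by blast
  then have "summable (\<lambda>n. cmod (\<xi> (f n) z i))" by (simp add: summable_on_UNIV_nonneg_real_iff)
  then have lim: "(\<lambda>n. cmod (\<xi> (f n) z i)) \<longlonglongrightarrow> 0" by (rule summable_LIMSEQ_zero)
  have ge: "cmod (\<xi> w z i) \<le> cmod (\<xi> (f n) z i)" for n
  proof (induction n)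
    case (Suc n)
    then show ?case using c[of n] unfolding f_def by linarith
  qed (simp add: f_def)
  have "cmod (\<xi> w z i) \<le> 0" by (rule LIMSEQ_le_const[OF lim]) (use ge in blast)
  then show False using supp_iff[OF z i, of w] w by simp
qed

text \<open>Over a fixed point of \<open>P\<close> the element \<open>a\<close> acts on
  \<open>z\<close> as some deck translation \<open>x\<close>. Because \<open>a\<close> is trivial on
  the kernel of \<open>r\<close>, translation by \<open>x\<close> multiplies the moduli of
  \<open>\<xi>\<close> by a constant along the chain of \<open>w\<close>. In one of the directions
  \<open>x\<close> and \<open>- x\<close> they do not decrease, hence \<open>x = 0\<close>.\<close>

lemma stabilizer_kernel_character:
  assumes z: "z \<in> pts Pt" and a: "a \<in> torus_pts X" and k: "\<And>x. x \<in> X \<Longrightarrow> r x = 0 \<Longrightarrow> a x = 1"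
    and eq: "\<pi> (ta a z) = \<pi> z"
  shows "ta a z = z"
proof -
  have tz: "ta a z \<in> pts Pt" by (rule ta_pts[OF a z])
  obtain x where x: "x \<in> X" "ta a z = dk x z" using \<pi>_quotient[OF z tz] eq by auto
  have st: "\<alpha> x ` cell (Zc z) = cell (Zc z)" using cell_dk[OF z x(1)] x(2) Zc_eq[OF z a] by simp
  have rx: "r x = 0" by (rule stabilizer_kernel[OF cell_in[OF z] x(1) st])
  obtain i where i: "i \<in> \<Theta>" "\<pi> z \<in> fst i" using idx_\<pi>[OF z] by blast
  have i': "\<pi> (ta a z) \<in> fst i" using eq i(2) by simp
  obtain \<mu> where \<mu>: "\<mu> \<noteq> 0" "\<And>w. w \<in> IP \<Longrightarrow> \<xi> w (ta a z) i = a (fst w) * \<mu> * \<xi> w z i"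
    by (rule \<xi>_ta[OF a z i i(1) i']) (rule that)
  obtain w where w: "w \<in> supp z" using supp_nonempty[OF z] by blast
  have wI: "w \<in> IP" using w unfolding supp_def by blast
  define \<rho> where "\<rho> = cmod (a (fst w) * \<mu>)"
  have inv: "a (fst w' + y) = a (fst w')" if "w' \<in> IP" "y \<in> X" "r y = 0" for w' y
    using torus_pts_add[OF a IP_fst[OF that(1)] that(2)] k[OF that(2,3)] by simp
  have step: "\<rho> * cmod (\<xi> (\<alpha> x w') z i) = cmod (\<xi> w' z i)" if w': "w' \<in> IP" "a (fst w') = a (fst w)" for w'
  proof -
    have aw: "\<alpha> x w' \<in> IP" using act_bij_IP[OF x(1)] bij_betwE w'(1) by blast
    have f: "fst (\<alpha> x w') = fst w' + x" using act_fst[OF x(1)] w'(1) unfolding integral_points_def by blast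
    have "a (fst w) * \<mu> * \<xi> (\<alpha> x w') z i = \<xi> w' z i"
      using \<mu>(2)[OF aw] \<xi>_equivariant[OF x(1) z i w'(1)] x(2) inv[OF w'(1) x(1) rx] f w'(2) by simp
    then show ?thesis unfolding \<rho>_def norm_mult[symmetric] by simp
  qed
  have chain: "(\<alpha> y ^^ n) w \<in> IP \<and> a (fst ((\<alpha> y ^^ n) w)) = a (fst w)" if y: "y \<in> X" "r y = 0" for y n
  proof (induction n)
    case (Suc n)
    then have q: "(\<alpha> y ^^ n) w \<in> IP" by blast
    then have "\<alpha> y ((\<alpha> y ^^ n) w) \<in> IP" using act_bij_IP[OF y(1)] bij_betwE by blast
    moreover have "(\<alpha> y ^^ n) w \<in> \<Union>cells" using q unfolding integral_points_def by blast
    ultimately show ?case using Suc inv[OF q y] act_fst[OF y(1), of "(\<alpha> y ^^ n) w"] by simp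
  qed (simp add: wI)
  have mx: "- x \<in> X" "r (- x) = 0" using minus_X[OF x(1)] rx by (auto simp: linear_neg[OF r_linear])
  have "x = 0"
  proof (rule ccontr)
    assume x0: "x \<noteq> 0"
    show False
    proof (cases "\<rho> \<le> 1")
      case True
      show False
      proof (rule no_nondecreasing_chain[OF z i x(1) x0 w])
        fix n
        have "cmod (\<xi> ((\<alpha> x ^^ n) w) z i) = \<rho> * cmod (\<xi> ((\<alpha> x ^^ Suc n) w) z i)"
          using step[of "(\<alpha> x ^^ n) w"] chain[OF x(1) rx, of n] by simp
        also have "\<dots> \<le> 1 * cmod (\<xi> ((\<alpha> x ^^ Suc n) w) z i)" using True by (intro mult_right_mono) auto
        finally show "cmod (\<xi> ((\<alpha> x ^^ n) w) z i) \<le> cmod (\<xi> ((\<alpha> x ^^ Suc n) w) z i)" by simp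
      qed
    next
      case False
      show False
      proof (rule no_nondecreasing_chain[OF z i mx(1) _ w])
        fix n
        define w' where "w' = (\<alpha> (- x) ^^ n) w"
        have w': "w' \<in> IP" "(\<alpha> (- x) ^^ Suc n) w = \<alpha> (- x) w'" using chain[OF mx, of n] unfolding w'_def by auto
        have "\<alpha> x (\<alpha> (- x) w') = w'" using act_minus(2)[OF x(1), of w'] w'(1) unfolding integral_points_def by blast
        then have "\<rho> * cmod (\<xi> w' z i) = cmod (\<xi> (\<alpha> (- x) w') z i)"
          using step[of "\<alpha> (- x) w'"] chain[OF mx, of "Suc n"] w'(2) by simp
        moreover have "1 * cmod (\<xi> w' z i) \<le> \<rho> * cmod (\<xi> w' z i)" using False by (intro mult_right_mono) auto
        ultimately show "cmod (\<xi> ((\<alpha> (- x) ^^ n) w) z i) \<le> cmod (\<xi> ((\<alpha> (- x) ^^ Suc n) w) z i)"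
          using w'(2) unfolding w'_def by simp
      qed (use x0 in simp)
    qed
  qed
  then show ?thesis using x(2) dk_zero[OF z] by simp
qed

lemma torus_descend:
  assumes a: "a \<in> torus_pts X" and k: "\<And>x. x \<in> X \<Longrightarrow> r x = 0 \<Longrightarrow> a x = 1"
  obtains t where "t \<in> torus_pts X'" "\<And>x. x \<in> X \<Longrightarrow> t (r x) = a x"
proof -
  define g where "g y = (SOME x. x \<in> X \<and> r x = y)" for y
  have g: "g y \<in> X \<and> r (g y) = y" if y: "y \<in> X'" for y
    unfolding g_def by (rule someI_ex) (use y r_image in blast)
  have wd: "a x = a (g (r x))" if x: "x \<in> X" for x
  proof -
    have y: "r x \<in> X'" using x r_image by blast
    have "a (x - g (r x)) = 1"
      by (rule k) (use g[OF y] x lattice_in_diff[OF X] in \<open>auto simp: linear_diff[OF r_linear]\<close>)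
    then show ?thesis using torus_pts_diff[OF X a x] g[OF y] torus_pts_nz[OF a, of "g (r x)"] by simp
  qed
  define t where "t = restrict (\<lambda>y. a (g y)) X'"
  have "t \<in> torus_pts X'"
    unfolding torus_pts_def
  proof (intro CollectI conjI ballI)
    show "t \<in> extensional X'" unfolding t_def by simp
    fix y assume y: "y \<in> X'"
    then show "t y \<noteq> 0" using g[OF y] torus_pts_nz[OF a] unfolding t_def by simp
    fix y' assume y': "y' \<in> X'"
    have "g y + g y' \<in> X" "r (g y + g y') = y + y'"
      using g[OF y] g[OF y'] lattice_in_add[OF X] by (auto simp: linear_add[OF r_linear])
    then have "a (g (y + y')) = a (g y) * a (g y')" using wd[of "g y + g y'"] torus_pts_add[OF a] g[OF y] g[OF y'] by simp
    then show "t (y + y') = t y * t y'" unfolding t_def using y y' lattice_in_add[OF X' y y'] by simp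
  qed
  moreover have "t (r x) = a x" if x: "x \<in> X" for x
  proof -
    have "r x \<in> X'" using x r_image by blast
    then show ?thesis unfolding t_def using wd[OF x] by simp
  qed
  ultimately show thesis by (rule that)
qed

lemma torus_lift:
  assumes t: "t \<in> torus_pts X'"
  shows "restrict (\<lambda>x. t (r x)) X \<in> torus_pts X"
proof -
  have rX: "r x \<in> X'" if "x \<in> X" for x using r_image that by blast
  show ?thesis
    unfolding torus_pts_def using torus_pts_nz[OF t rX] torus_pts_add[OF t rX rX] lattice_in_add[OF X]
    by (auto simp: linear_add[OF r_linear])
qed

text \<open>Connectedness of the stabilizer in \<open>G\<close> removes the finite ambiguity left by the weights of
  sections.\<close>

lemma stabilizer_annihilates:
  assumes z: "z \<in> pts Pt" and a: "a \<in> torus_pts X" and eq: "ta a z = z"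
    and x: "x \<in> X" "x \<in> dir (cell (Zc z))"
  shows "a x = 1"
proof -
  define \<delta> where "\<delta> = cell (Zc z)"
  have d: "\<delta> \<in> cells" unfolding \<delta>_def by (rule cell_in[OF z])
  have one: "\<one>\<^bsub>torus_group X\<^esub> \<in> torus_pts X" by (rule torus_one_closed[OF X])
  have diff: "b (y - y') = 1"
    if b: "b \<in> torus_pts X" "ta b z = z" and y: "y \<in> X" "y \<in> fst ` \<delta>" "y' \<in> X" "y' \<in> fst ` \<delta>" for b y y'
  proof -
    have "b (y - y') = \<one>\<^bsub>torus_group X\<^esub> (y - y')"
      by (rule same_action_eq[OF z b(1) one _ y[unfolded \<delta>_def]]) (simp add: b(2) ta_one[OF z])
    then show ?thesis using lattice_in_diff[OF X y(1,3)] by simp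
  qed
  obtain x0 where x0: "x0 \<in> X" "x0 \<in> fst ` \<delta>" by (rule integral_point_exists[OF d])
  have ker: "b y = 1" if b: "b \<in> torus_pts X" "ta b z = z" and y: "y \<in> X" "r y = 0" for b y
  proof -
    obtain \<delta>' i where "\<delta> = pullback_cell X r \<rho>' \<delta>' i" using d unfolding pullback_cells_def by blast
    then have "x0 + y \<in> fst ` \<delta>" using pullback_cell_shift[of x0 \<delta>' i y] x0(2) y span_base[OF y(1)] by simp
    then show ?thesis using diff[OF b _ _ x0, of "x0 + y"] lattice_in_add[OF X x0(1) y(1)] by simp
  qed
  obtain t where t: "t \<in> torus_pts X'" "\<And>x. x \<in> X \<Longrightarrow> t (r x) = a x"
    using torus_descend[OF a] ker[OF a eq] by blast
  \<comment> \<open>Stabilizers in \<open>T'\<close> of the point of \<open>P\<close> really fix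
    \<open>z\<close> and not only its fibre: lifted characters are trivial on the kernel of
    \<open>r\<close>.\<close>
  have lift: "ta (restrict (\<lambda>x. s (r x)) X) z = z" if s: "s \<in> torus_pts X'" "act (\<iota> s) (\<pi> z) = \<pi> z" for s
  proof (rule stabilizer_kernel_character[OF z torus_lift[OF s(1)]])
    show "\<pi> (ta (restrict (\<lambda>x. s (r x)) X) z) = \<pi> z"
      using ta_lifts[OF torus_lift[OF s(1)] z] \<phi>_lift[OF s(1)] s(2) by simp
    fix x assume "x \<in> X" "r x = 0"
    then show "restrict (\<lambda>x. s (r x)) X x = 1" using torus_pts_0[OF X' s(1)] by simp
  qed
  define K' where "K' = {s \<in> torus_pts X'. act (\<iota> s) (\<pi> z) = \<pi> z}"
  \<comment> \<open>The characters trivial on the stabilizer. They contain the differences of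
    weights, but a direction \<open>x\<close> of the cell in \<open>X\<close> is a priori only a
    rational combination of such differences.\<close>
  define H where "H = {u \<in> X. \<forall>s\<in>K'. s (r u) = 1}"
  have rX: "r u \<in> X'" if "u \<in> X" for u using that r_image by blast
  have H: "H \<subseteq> X" "0 \<in> H" "\<And>u v. u \<in> H \<Longrightarrow> v \<in> H \<Longrightarrow> u + v \<in> H" "\<And>u. u \<in> H \<Longrightarrow> - u \<in> H"
  proof -
    show "H \<subseteq> X" unfolding H_def by blast
    show "0 \<in> H" unfolding H_def K'_def using lattice_in_0[OF X] torus_pts_0[OF X'] by (auto simp: linear_0[OF r_linear])
    show "u + v \<in> H" if "u \<in> H" "v \<in> H" for u v
    proof -
      have "s (r (u + v)) = 1" if "s \<in> K'" for s
      proof -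
        have "s \<in> torus_pts X'" "s (r u) = 1" "s (r v) = 1" "u \<in> X" "v \<in> X"
          using that \<open>u \<in> H\<close> \<open>v \<in> H\<close> unfolding H_def K'_def by auto
        then show ?thesis using torus_pts_add[of s X' "r u" "r v"] rX by (simp add: linear_add[OF r_linear])
      qed
      then show ?thesis using that lattice_in_add[OF X] unfolding H_def by blast
    qed
    show "- u \<in> H" if "u \<in> H" for u
    proof -
      have "s (r (- u)) = 1" if "s \<in> K'" for s
        using torus_pts_minus[OF X', of s "r u"] that \<open>u \<in> H\<close> rX unfolding H_def K'_def
        by (simp add: linear_neg[OF r_linear])
      then show ?thesis using that minus_X unfolding H_def by blast
    qed
  qed
  have "{y - y' |y y'. y \<in> X \<inter> fst ` \<delta> \<and> y' \<in> X \<inter> fst ` \<delta>} \<subseteq> H"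
  proof
    fix u assume "u \<in> {y - y' |y y'. y \<in> X \<inter> fst ` \<delta> \<and> y' \<in> X \<inter> fst ` \<delta>}"
    then obtain y y' where y: "u = y - y'" "y \<in> X" "y \<in> fst ` \<delta>" "y' \<in> X" "y' \<in> fst ` \<delta>" by blast
    have uX: "u \<in> X" using y lattice_in_diff[OF X] by simp
    have "s (r u) = 1" if s: "s \<in> K'" for s
    proof -
      have s': "s \<in> torus_pts X'" "act (\<iota> s) (\<pi> z) = \<pi> z" using s unfolding K'_def by auto
      show ?thesis using diff[OF torus_lift[OF s'(1)] lift[OF s'] y(2-5)] y(1) uX by simp
    qed
    then show "u \<in> H" unfolding H_def using uX by blast
  qed
  then have "x \<in> span H" using x(2) span_mono unfolding dir_def \<delta>_def[symmetric] by blast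
  \<comment> \<open>The finite ambiguity: some positive multiple of \<open>x\<close> is trivial on
    the stabilizer, so \<open>x\<close> takes only \<open>m\<close>-th roots of unity as
    values.\<close>
  then obtain m :: nat where m: "m > 0" "of_nat m *\<^sub>R x \<in> H" using lattice_torsion[OF X H, of x] x(1) by blast
  have root: "s (r x) ^ m = 1" if s: "s \<in> K'" for s
  proof -
    have "s (r (of_nat m *\<^sub>R x)) = 1" using m(2) s unfolding H_def by blast
    then show ?thesis using torus_pts_scale[OF X', of s "r x" "int m"] s rX[OF x(1)] unfolding K'_def
      by (simp add: linear_scale[OF r_linear])
  qed
  define T where "T = \<iota> ` torus_pts X'"
  obtain g where g: "cmorphism (csubspace G T) (torus X') g" "\<And>s. s \<in> torus_pts X' \<Longrightarrow> g (\<iota> s) = s"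
    using \<iota>_immersion unfolding closed_immersion_def cisomorphism_def pts_torus[OF X'] T_def by blast
  have TG: "T \<subseteq> pts G"
    using \<iota>_immersion closedin_subset unfolding closed_immersion_def pts_torus[OF X'] T_def by blast
  define K where "K = {h \<in> pts G. act h (\<pi> z) = \<pi> z}"
  have KT: "K \<subseteq> T" unfolding K_def T_def by (rule stabilizer_toric[OF \<pi>_pts[OF z]])
  have gK: "g h \<in> K'" if h: "h \<in> K" for h
  proof -
    obtain s where s: "s \<in> torus_pts X'" "h = \<iota> s" using h KT unfolding T_def by blast
    then show ?thesis using h g(2)[OF s(1)] unfolding K_def K'_def by simp
  qed
  have cg: "continuous_map (subtopology (spc G) T) (spc (torus X')) g"
    using g(1) unfolding cmorphism_def csubspace_def by simp
  have tT: "topspace (subtopology (spc G) T) = T" using TG by auto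
  have "\<exists>N. openin (spc G) N \<and> {h \<in> T. g h \<in> O'} = N \<inter> T" if O': "openin (spc (torus X')) O'" for O'
    using openin_continuous_map_preimage[OF cg O'] unfolding tT openin_subtopology by simp
  note pre = this
  \<comment> \<open>Zariski open sets of \<open>G\<close> separating the stabilizer elements with
    value different from 1 from those with value 1. The unit lies in the second part, so
    connectedness empties the first.\<close>
  obtain N1 where N1: "openin (spc G) N1" "{h \<in> T. g h \<in> {s \<in> torus_pts X'. s (r x) \<noteq> 1}} = N1 \<inter> T"
    using pre[OF torus_level_set_open[OF X' rX[OF x(1)]]] by blast
  obtain N2 where N2: "openin (spc G) N2" "{h \<in> T. g h \<in> {s \<in> torus_pts X'. (\<Sum>j<m. s (r x) ^ j) \<noteq> 0}} = N2 \<inter> T"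
    using pre[OF torus_root_set_open[OF X' rX[OF x(1)]], of m] by blast
  have k1: "h \<in> N1 \<longleftrightarrow> g h (r x) \<noteq> 1" and k2: "h \<in> N2 \<longleftrightarrow> g h (r x) = 1" if h: "h \<in> K" for h
  proof -
    have hT: "h \<in> T" using h KT by blast
    have gh: "g h \<in> torus_pts X'" "g h (r x) ^ m = 1" using gK[OF h] root[OF gK[OF h]] unfolding K'_def by auto
    show "h \<in> N1 \<longleftrightarrow> g h (r x) \<noteq> 1" using N1(2) hT gh(1) by blast
    have "(g h (r x) - 1) * (\<Sum>j<m. g h (r x) ^ j) = 0" using gh(2) power_diff_1_eq[of "g h (r x)" m] m(1) by simp
    then have "(\<Sum>j<m. g h (r x) ^ j) \<noteq> 0 \<longleftrightarrow> g h (r x) = 1" using m(1) by auto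
    then show "h \<in> N2 \<longleftrightarrow> g h (r x) = 1" using N2(2) hT gh(1) by blast
  qed
  have "connectedin (spc G) K" unfolding K_def by (rule stabilizer_connected[OF \<pi>_pts[OF z]])
  then have con: "\<not> (\<exists>E1 E2. openin (spc G) E1 \<and> openin (spc G) E2 \<and> K \<subseteq> E1 \<union> E2 \<and> E1 \<inter> E2 \<inter> K = {} \<and>
      E1 \<inter> K \<noteq> {} \<and> E2 \<inter> K \<noteq> {})" unfolding connectedin by blast
  have cov: "K \<subseteq> N1 \<union> N2" "N1 \<inter> N2 \<inter> K = {}" using k1 k2 by blast+
  have "\<one>\<^bsub>\<G>\<^esub> = \<iota> \<one>\<^bsub>torus_group X'\<^esub>"
  proof -
    have a1: "\<one>\<^bsub>torus_group X'\<^esub> \<in> torus_pts X'" by (rule torus_one_closed[OF X'])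
    then have ii: "\<iota> \<one>\<^bsub>torus_group X'\<^esub> \<in> carrier \<G>" using TG carrier_G unfolding T_def by blast
    have "\<iota> \<one>\<^bsub>torus_group X'\<^esub> = \<iota> (\<one>\<^bsub>torus_group X'\<^esub> \<otimes>\<^bsub>torus_group X'\<^esub> \<one>\<^bsub>torus_group X'\<^esub>)"
      using torus_one_left[OF a1] by simp
    also have "\<dots> = \<iota> \<one>\<^bsub>torus_group X'\<^esub> \<otimes>\<^bsub>\<G>\<^esub> \<iota> \<one>\<^bsub>torus_group X'\<^esub>"
      using \<iota>_hom a1 unfolding hom_def by simp
    finally show ?thesis using group.r_cancel_one'[OF group_G ii ii] by simp
  qed
  then have 1: "g \<one>\<^bsub>\<G>\<^esub> (r x) = 1" "\<one>\<^bsub>\<G>\<^esub> \<in> pts G"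
    using g(2)[OF torus_one_closed[OF X']] rX[OF x(1)] TG torus_one_closed[OF X'] unfolding T_def by auto
  have "\<one>\<^bsub>\<G>\<^esub> \<in> K" unfolding K_def using 1(2) act_one[OF \<pi>_pts[OF z]] by simp
  then have "N2 \<inter> K \<noteq> {}" using k2 1(1) by blast
  then have N1K: "N1 \<inter> K = {}" using con N1(1) N2(1) cov by blast
  have "restrict (\<lambda>x. t (r x)) X = a" by (rule torus_pts_eqI[OF torus_lift[OF t(1)] a]) (simp add: t(2))
  then have "act (\<iota> t) (\<pi> z) = \<pi> z" using ta_lifts[OF a z] \<phi>_lift[OF t(1)] eq by simp
  then have "\<iota> t \<in> K" unfolding K_def using TG t(1) unfolding T_def by blast
  then have "g (\<iota> t) (r x) = 1" using k1 N1K by blast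
  then show ?thesis using g(2)[OF t(1)] t(2)[OF x(1)] by simp
qed

end

subsection \<open>Fibers of the moment map\<close>

context theta_expansion
begin

text \<open>Otherwise \<open>\<nu>\<close> would be bounded by \<open>\<nu> \<bullet> q\<close> on
  the support, hence on the cell. At a relative interior point a maximum makes \<open>\<nu>\<close>
  constant on the cell, so orthogonal to its directions, including itself.\<close>

lemma support_spread:
  assumes z: "z \<in> pts Pt" and q: "q \<in> rel_interior (fst ` cell (Zc z))"
    and \<nu>: "\<nu> \<in> dir (cell (Zc z))" "\<nu> \<noteq> 0"
  shows "\<exists>w\<in>supp z. \<nu> \<bullet> (fst w - q) > 0"
proof (rule ccontr)
  assume "\<not> (\<exists>w\<in>supp z. \<nu> \<bullet> (fst w - q) > 0)"
  then have le: "\<nu> \<bullet> fst w \<le> \<nu> \<bullet> q" if "w \<in> supp z" for w using that by (force simp: inner_diff_right)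
  note S = cell_convex_closed[OF cell_in[OF z]]
  have max: "\<nu> \<bullet> y \<le> \<nu> \<bullet> q" if "y \<in> fst ` cell (Zc z)" for y by (rule supp_spans_cell[OF z le that])
  have eq: "\<nu> \<bullet> y = \<nu> \<bullet> q" if y: "y \<in> fst ` cell (Zc z)" for y
  proof -
    obtain e where e: "e > 1" "(1 - e) *\<^sub>R y + e *\<^sub>R q \<in> fst ` cell (Zc z)"
      using convex_rel_interior_iff[OF S(1,4), of q] q y by blast
    have "\<nu> \<bullet> ((1 - e) *\<^sub>R y + e *\<^sub>R q) \<le> \<nu> \<bullet> q" by (rule max[OF e(2)])
    then have "(e - 1) * (\<nu> \<bullet> q) \<le> (e - 1) * (\<nu> \<bullet> y)" by (simp add: inner_add_right algebra_simps)
    then have "\<nu> \<bullet> q \<le> \<nu> \<bullet> y" using e(1) by (simp add: mult_le_cancel_left)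
    then show ?thesis using max[OF y] by simp
  qed
  have "dir (cell (Zc z)) \<subseteq> {v. \<nu> \<bullet> v = 0}"
    unfolding dir_def
  proof (intro span_minimal subspace_hyperplane subsetI)
    fix v assume "v \<in> {x - x' |x x'. x \<in> X \<inter> fst ` cell (Zc z) \<and> x' \<in> X \<inter> fst ` cell (Zc z)}"
    then obtain x x' where "v = x - x'" "x \<in> fst ` cell (Zc z)" "x' \<in> fst ` cell (Zc z)" by blast
    then show "v \<in> {v. \<nu> \<bullet> v = 0}" using eq[of x] eq[of x'] by (simp add: inner_diff_right)
  qed
  then have "\<nu> \<bullet> \<nu> = 0" using \<nu>(1) by blast
  then show False using \<nu>(2) by simp
qed

text \<open>On the orbit of \<open>z\<close>, the points with average \<open>q\<close> are the critical points of the convex function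
  \<open>\<nu> \<mapsto> (\<Sum>w. \<bar>\<xi> w z\<bar>\<^sup>2 exp (2 \<nu> \<bullet> (fst w - q)))\<close> in the logarithmic modulus \<open>\<nu>\<close>.\<close>

lemma fixed_average_modulus:
  assumes z: "z \<in> pts Pt" and q: "q \<in> rel_interior (fst ` cell (Zc z))"
  obtains l where "\<And>a. a \<in> torus_pts X \<Longrightarrow>
    avg (ta a z) = q \<longleftrightarrow> (\<forall>x\<in>X \<inter> dir (cell (Zc z)). cmod (a x) = exp (l \<bullet> x))"
proof -
  define D where "D = dir (cell (Zc z))"
  have D: "subspace D" unfolding D_def by (rule subspace_dir)
  obtain i where i: "i \<in> \<Theta>" "\<pi> z \<in> fst i" using idx_\<pi>[OF z] by blast
  define c where "c w = (cmod (\<xi> w z i))\<^sup>2" for w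
  define u where "u w = fst w - q" for w :: "'e \<times> 'c \<times> 'i"
  interpret exp_family IP c u unfolding c_def u_def by (rule exp_family_\<xi>[OF z i])
  have supp_c: "w \<in> supp z \<longleftrightarrow> w \<in> IP \<and> c w \<noteq> 0" for w unfolding c_def using supp_iff[OF z i, of w] by simp
  have qS: "q \<in> fst ` cell (Zc z)" using q rel_interior_subset by blast
  have uD: "u w \<in> D" if "w \<in> IP" "c w \<noteq> 0" for w
  proof -
    have "w \<in> cell (Zc z)" using supp_cell[OF z] supp_c that by blast
    then show ?thesis unfolding u_def D_def by (intro diff_in_dir[OF cell_in[OF z] _ qS] imageI)
  qed
  have spread: "\<exists>w\<in>IP. c w > 0 \<and> \<nu> \<bullet> u w > 0" if \<nu>: "\<nu> \<in> D" "\<nu> \<noteq> 0" for \<nu>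
  proof -
    obtain w where w: "w \<in> supp z" "\<nu> \<bullet> (fst w - q) > 0"
      using support_spread[OF z q \<nu>[unfolded D_def]] by (elim bexE)
    have "w \<in> IP" "c w \<noteq> 0" using supp_c[of w] w(1) by simp_all
    moreover have "c w \<ge> 0" unfolding c_def by simp
    ultimately show ?thesis using w(2) unfolding u_def by (intro bexI[of _ w]) auto
  qed
  obtain l where l: "l \<in> D" "infsum (\<lambda>w. (c w * exp (l \<bullet> u w)) *\<^sub>R u w) IP = 0"
    using critical_exists[OF D uD spread] by blast
  \<comment> \<open>The factor \<open>1 / 2\<close> undoes the squaring of moduli in the weights:
    the critical parameter is twice the logarithmic modulus.\<close>
  have key: "avg (ta a z) = q \<longleftrightarrow> (\<forall>x\<in>X \<inter> D. cmod (a x) = exp (((1 / 2) *\<^sub>R l) \<bullet> x))" if a: "a \<in> torus_pts X" for a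
  proof -
    obtain \<nu> where \<nu>: "\<And>x. x \<in> X \<Longrightarrow> cmod (a x) = exp (\<nu> \<bullet> x)" using torus_log[OF X a] by metis
    \<comment> \<open>The component of \<open>\<nu>\<close> orthogonal to \<open>D\<close> does not
      affect the average, since \<open>fst w - q\<close> is in \<open>D\<close> for every support
      point; uniqueness is applied to the component in \<open>D\<close>.\<close>
    obtain y y' where y: "y \<in> span D" "\<And>w. w \<in> span D \<Longrightarrow> orthogonal y' w" "\<nu> = y + y'"
      using orthogonal_subspace_decomp_exists[of D \<nu>] by metis
    have yD: "y \<in> D" "2 *\<^sub>R y \<in> D" using y(1) D by (simp_all add: span_eq_iff[THEN iffD2] subspace_scale)
    have y'0: "y' \<bullet> w = 0" if "w \<in> D" for w using y(2)[of w] that by (simp add: span_base orthogonal_def)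
    have "avg (ta a z) = q \<longleftrightarrow> infsum (\<lambda>w. (c w * exp ((2 *\<^sub>R \<nu>) \<bullet> u w)) *\<^sub>R u w) IP = 0"
      unfolding c_def u_def by (rule avg_ta_eq_iff[OF z i a \<nu>])
    also have "infsum (\<lambda>w. (c w * exp ((2 *\<^sub>R \<nu>) \<bullet> u w)) *\<^sub>R u w) IP = infsum (\<lambda>w. (c w * exp ((2 *\<^sub>R y) \<bullet> u w)) *\<^sub>R u w) IP"
    proof (rule infsum_cong)
      fix w assume w: "w \<in> IP"
      show "(c w * exp ((2 *\<^sub>R \<nu>) \<bullet> u w)) *\<^sub>R u w = (c w * exp ((2 *\<^sub>R y) \<bullet> u w)) *\<^sub>R u w"
      proof (cases "c w = 0")
        case False
        then show ?thesis using y'0[OF uD[OF w False]] unfolding y(3) by (simp add: inner_add_left)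
      qed simp
    qed
    also have "\<dots> = 0 \<longleftrightarrow> 2 *\<^sub>R y = l"
      using critical_unique[OF D yD(2) l(1) spread _ l(2)] l(2) by blast
    also have "\<dots> \<longleftrightarrow> (\<forall>x\<in>X \<inter> D. \<nu> \<bullet> x = ((1 / 2) *\<^sub>R l) \<bullet> x)"
    proof
      assume "2 *\<^sub>R y = l"
      then show "\<forall>x\<in>X \<inter> D. \<nu> \<bullet> x = ((1 / 2) *\<^sub>R l) \<bullet> x" using y'0 unfolding y(3) by (auto simp: inner_add_left)
    next
      assume eq: "\<forall>x\<in>X \<inter> D. \<nu> \<bullet> x = ((1 / 2) *\<^sub>R l) \<bullet> x"
      have "span (X \<inter> D) \<subseteq> {x. (2 *\<^sub>R y - l) \<bullet> x = 0}"
      proof (intro span_minimal subspace_hyperplane subsetI)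
        fix x assume x: "x \<in> X \<inter> D"
        then have "(y + y') \<bullet> x = ((1 / 2) *\<^sub>R l) \<bullet> x" "y' \<bullet> x = 0" using eq y'0[of x] unfolding y(3) by blast+
        then have "y \<bullet> x = ((1 / 2) *\<^sub>R l) \<bullet> x" by (simp add: inner_add_left)
        then show "x \<in> {x. (2 *\<^sub>R y - l) \<bullet> x = 0}" by (simp add: inner_diff_left)
      qed
      moreover have "2 *\<^sub>R y - l \<in> span (X \<inter> D)"
        using subspace_diff[OF D yD(2) l(1)] dir_lattice[of "cell (Zc z)"] unfolding D_def by simp
      ultimately have "(2 *\<^sub>R y - l) \<bullet> (2 *\<^sub>R y - l) = 0" by blast
      then show "2 *\<^sub>R y = l" by simp
    qed
    also have "\<dots> \<longleftrightarrow> (\<forall>x\<in>X \<inter> D. cmod (a x) = exp (((1 / 2) *\<^sub>R l) \<bullet> x))" using \<nu> by auto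
    finally show ?thesis .
  qed
  show thesis by (rule that[OF key[unfolded D_def]])
qed

text \<open>Interior values determine the cell, the cell determines the orbit closure, and the
  closure determines the orbit; on one orbit the cell is fixed and only the average is left to
  compare.\<close>

lemma Mt_fibre_orbit:
  assumes z: "z \<in> pts Pt" and q: "q \<in> cell (Zc z)" "fst q \<in> rel_interior (fst ` cell (Zc z))"
  shows "{y \<in> pts Pt. Mt y = q} = {y \<in> orb z. avg y = fst q}"
proof (intro Set.set_eqI iffI)
  fix y assume "y \<in> {y \<in> pts Pt. Mt y = q}"
  then have y: "y \<in> pts Pt" "Mt y = q" by auto
  have "cell (Zc y) = cell (Zc z)" by (rule cell_of_Mt[OF y(1) cell_in[OF z]]) (simp_all add: y(2) q)
  then have "y \<in> orb z" using same_closure_orbit[OF z y(1)] cell_eq_iff[OF y(1) z] by blast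
  then show "y \<in> {y \<in> orb z. avg y = fst q}" using Mt(2)[OF y(1)] y(2) by simp
next
  fix y assume "y \<in> {y \<in> orb z. avg y = fst q}"
  then obtain a where a: "a \<in> torus_pts X" "y = ta a z" "avg y = fst q" by auto
  have y: "y \<in> pts Pt" unfolding a(2) by (rule ta_pts[OF a(1) z])
  have "q \<in> cell (Zc y)" unfolding a(2) Zc_eq[OF z a(1)] by (rule q(1))
  then show "y \<in> {y \<in> pts Pt. Mt y = q}" using Mt_unique[OF y] a(3) y by simp
qed

text \<open>Torus coordinates with prescribed moduli \<open>exp (l \<bullet> b j)\<close> and free
  phases \<open>s j\<close> along the cell; the remaining coordinates, which act trivially, are set
  to 1.\<close>

definition angle_char :: "nat \<Rightarrow> nat \<Rightarrow> (nat \<Rightarrow> 'e) \<Rightarrow> (nat \<Rightarrow> 'e) \<Rightarrow> 'e \<Rightarrow> (nat \<Rightarrow> complex) \<Rightarrow> 'e \<Rightarrow> complex" where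
  "angle_char n k b d l s = basis_char X n d (\<lambda>j. if j < k then s j * of_real (exp (l \<bullet> b j)) else 1)"

lemma angle_char_continuous:
  assumes ab: "adapted_basis X D n k b d"
  shows "continuous_map (product_topology (\<lambda>_. top_of_set (sphere (0::complex) 1)) {..<k}) Tan (angle_char n k b d l)"
proof -
  define T where "T = product_topology (\<lambda>_. top_of_set (sphere (0::complex) 1)) {..<k}"
  define g where "g s j = (if j < k then s j * of_real (exp (l \<bullet> b j)) else (1::complex))" for s :: "nat \<Rightarrow> complex" and j :: nat
  define B where "B = {c :: nat \<Rightarrow> complex. \<forall>j. c j \<noteq> 0}"
  have "continuous_map T euclidean (\<lambda>s. g s j)" for j
  proof (cases "j < k")
    case True
    have "continuous_map T (top_of_set (sphere (0::complex) 1)) (\<lambda>s. s j)"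
      unfolding T_def using continuous_map_product_projection[of j "{..<k}" "\<lambda>_. top_of_set (sphere (0::complex) 1)"] True by simp
    moreover have "continuous_map (top_of_set (sphere (0::complex) 1)) euclidean (\<lambda>c. c * of_real (exp (l \<bullet> b j)))"
      by (simp add: continuous_intros)
    ultimately have "continuous_map T euclidean ((\<lambda>c. c * of_real (exp (l \<bullet> b j))) \<circ> (\<lambda>s. s j))"
      by (rule continuous_map_compose)
    then show ?thesis using True by (simp add: g_def o_def)
  qed (simp add: g_def)
  then have "continuous_map T (product_topology (\<lambda>_. euclidean) UNIV) g" by (simp add: continuous_map_componentwise_UNIV)
  moreover have "g ` topspace T \<subseteq> B"
  proof (rule image_subsetI)
    fix s assume "s \<in> topspace T"
    then have "s j \<in> sphere 0 1" if "j < k" for j using that unfolding T_def by (auto simp: PiE_def Pi_def)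
    then have "s j \<noteq> 0" if "j < k" for j using that by force
    then show "g s \<in> B" unfolding B_def g_def by simp
  qed
  ultimately have "continuous_map T (top_of_set B) g"
    by (simp add: euclidean_product_topology continuous_map_in_subtopology image_subset_iff_funcset)
  moreover have "continuous_map (top_of_set B) Tan (basis_char X n d)"
    by (rule continuous_map_basis_char[OF X ab]) (simp add: B_def)
  ultimately have "continuous_map T Tan (basis_char X n d \<circ> g)" by (rule continuous_map_compose)
  moreover have "basis_char X n d \<circ> g = angle_char n k b d l" unfolding angle_char_def g_def by (simp add: fun_eq_iff)
  ultimately show ?thesis unfolding T_def by simp
qed

text \<open>The two inclusions about stabilizers enter separately: that the annihilator of the
  directions fixes \<open>z\<close> gives surjectivity of \<open>\<Psi>\<close> onto the fibre, that
  stabilizers annihilate the directions gives injectivity.\<close>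

lemma moment_fibre:
  assumes d: "\<delta> \<in> cells" and q: "q \<in> \<delta>" "fst q \<in> rel_interior (fst ` \<delta>)" and k: "aff_dim (fst ` \<delta>) = int k"
    and Mom: "\<And>z. z \<in> pts Pt \<Longrightarrow> Mom (\<pi> z) = lattice_orbit X \<alpha> (Mt z)"
  shows "subtopology Pan {p \<in> pts P. Mom p = lattice_orbit X \<alpha> q}
    homeomorphic_space product_topology (\<lambda>_. top_of_set (sphere (0::complex) 1)) {..<k}"
proof -
  obtain z where z: "z \<in> pts Pt" "cell (Zc z) = \<delta>" using cell_onto[OF d] by blast
  define D where "D = dir \<delta>"
  have dimD: "dim D = k" unfolding D_def by (rule aff_dim_dir[OF d k])
  have "D = span (X \<inter> D)" unfolding D_def by (rule dir_lattice)
  then obtain n b dd where ab: "adapted_basis X D n k b dd"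
    using adapted_basis_exists[OF X, of D, unfolded dimD] by metis
  have kn: "k \<le> n" and bX: "\<And>j. j < n \<Longrightarrow> b j \<in> X"
    and dual: "\<And>i j. i < n \<Longrightarrow> j < n \<Longrightarrow> dd i \<bullet> b j = (if i = j then 1 else 0)"
    and exp: "\<And>x. x \<in> X \<Longrightarrow> x = (\<Sum>j<n. (dd j \<bullet> x) *\<^sub>R b j)"
    and inD: "\<And>x. x \<in> X \<Longrightarrow> x \<in> D \<longleftrightarrow> (\<forall>j\<in>{k..<n}. dd j \<bullet> x = 0)"
    using ab unfolding adapted_basis_def by (auto simp: span_base)
  have bD: "b j \<in> D" if j: "j < k" for j using inD[OF bX, of j] dual j kn by auto
  obtain l where l: "\<And>a. a \<in> torus_pts X \<Longrightarrow> avg (ta a z) = fst q \<longleftrightarrow> (\<forall>x\<in>X \<inter> D. cmod (a x) = exp (l \<bullet> x))"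
    by (rule fixed_average_modulus[OF z(1), of "fst q", unfolded z(2) D_def[symmetric]]) (rule q(2), rule that)
  have fib: "{y \<in> pts Pt. Mt y = q} = {y \<in> orb z. avg y = fst q}"
    by (rule Mt_fibre_orbit[OF z(1)]) (simp_all add: z(2) q)
  define S where "S = product_topology (\<lambda>_. top_of_set (sphere (0::complex) 1)) {..<k}"
  have S1: "cmod (s j) = 1" if "s \<in> topspace S" "j < k" for s j using that unfolding S_def by (auto simp: PiE_def Pi_def)
  define A where "A = angle_char n k b dd l"
  have A_b: "A s (b j) = (if j < k then s j * of_real (exp (l \<bullet> b j)) else 1)" if j: "j < n" for s j
    unfolding A_def angle_char_def by (rule basis_char_apply[OF ab j])
  have A_torus: "A s \<in> torus_pts X" if s: "s \<in> topspace S" for s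
  proof -
    have "s j \<noteq> 0" if "j < k" for j using S1[OF s that] by auto
    then show ?thesis unfolding A_def angle_char_def by (intro basis_char_torus[OF X ab]) auto
  qed
  have A_mod: "cmod (A s x) = exp (l \<bullet> x)" if s: "s \<in> topspace S" and x: "x \<in> X" "x \<in> D" for s x
  proof -
    \<comment> \<open>The logarithm of the modulus of \<open>A s\<close> is linear, so it need only
      be compared with \<open>l\<close> on the first \<open>k\<close> basis vectors; the others have
      coefficient 0 in a vector of \<open>D\<close>.\<close>
    obtain \<nu> where \<nu>: "\<And>x. x \<in> X \<Longrightarrow> cmod (A s x) = exp (\<nu> \<bullet> x)" using torus_log[OF X A_torus[OF s]] by metis
    have "\<nu> \<bullet> b j = l \<bullet> b j" if j: "j < k" for j
    proof -
      have "exp (\<nu> \<bullet> b j) = exp (l \<bullet> b j)"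
        using \<nu>[OF bX[of j]] A_b[of j s] S1[OF s j] j kn by (simp add: norm_mult)
      then show ?thesis by simp
    qed
    then have "(dd j \<bullet> x) * (\<nu> \<bullet> b j) = (dd j \<bullet> x) * (l \<bullet> b j)" if j: "j < n" for j
      using inD[OF x(1)] x(2) j by (cases "j < k") auto
    then have "(\<Sum>j<n. (dd j \<bullet> x) * (\<nu> \<bullet> b j)) = (\<Sum>j<n. (dd j \<bullet> x) * (l \<bullet> b j))" by (intro sum.cong) simp_all
    moreover have "\<nu> \<bullet> x = (\<Sum>j<n. (dd j \<bullet> x) * (\<nu> \<bullet> b j))" "l \<bullet> x = (\<Sum>j<n. (dd j \<bullet> x) * (l \<bullet> b j))"
      by (subst exp[OF x(1)], simp add: inner_sum_right)+
    ultimately show ?thesis using \<nu>[OF x(1)] by simp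
  qed
  define \<Psi> where "\<Psi> s = ta (A s) z" for s
  have \<Psi>: "\<Psi> s \<in> pts Pt" "Mt (\<Psi> s) = q" if s: "s \<in> topspace S" for s
  proof -
    have "\<Psi> s \<in> {y \<in> orb z. avg y = fst q}"
      unfolding \<Psi>_def using A_torus[OF s] l[OF A_torus[OF s]] A_mod[OF s] by blast
    then have "\<Psi> s \<in> {y \<in> pts Pt. Mt y = q}" unfolding fib .
    then show "\<Psi> s \<in> pts Pt" "Mt (\<Psi> s) = q" by simp_all
  qed
  have surj: "\<exists>s\<in>topspace S. y = \<Psi> s" if y: "y \<in> pts Pt" "Mt y = q" for y
  proof -
    have "y \<in> {y \<in> orb z. avg y = fst q}" using y fib by blast
    then obtain a where a: "a \<in> torus_pts X" "y = ta a z" "avg y = fst q" by auto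
    then have am: "cmod (a x) = exp (l \<bullet> x)" if "x \<in> X" "x \<in> D" for x using l[OF a(1)] that by blast
    define s where "s = restrict (\<lambda>j. a (b j) / of_real (exp (l \<bullet> b j))) {..<k}"
    have s: "s \<in> topspace S"
      unfolding S_def s_def using am bX bD kn by (auto simp: norm_divide)
    have "a x = A s x" if x: "x \<in> X" "x \<in> dir (cell (Zc z))" for x
    proof -
      have xD: "x \<in> D" using x(2) z(2) D_def by simp
      have "a (b j) powi \<lfloor>dd j \<bullet> x\<rfloor> = A s (b j) powi \<lfloor>dd j \<bullet> x\<rfloor>" if j: "j < n" for j
      proof (cases "j < k")
        case True
        then have "A s (b j) = a (b j)" using A_b[OF j, of s] by (simp add: s_def)
        then show ?thesis by simp
      next
        case False
        then have "dd j \<bullet> x = 0" using inD[OF x(1)] xD j by simp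
        then show ?thesis by simp
      qed
      then show ?thesis
        unfolding torus_pts_basis_expand[OF X ab a(1) x(1)] torus_pts_basis_expand[OF X ab A_torus[OF s] x(1)] by simp
    qed
    then have "y = \<Psi> s" unfolding a(2) \<Psi>_def by (rule annihilator_eq[OF z(1) a(1) A_torus[OF s]])
    then show ?thesis using s by blast
  qed
  \<comment> \<open>Injectivity holds even after projection to \<open>P\<close>: a deck
    transformation between two points over \<open>q\<close> fixes \<open>q\<close>, hence translates
    by 0.\<close>
  have inj: "s = s'" if s: "s \<in> topspace S" "s' \<in> topspace S" and eq: "\<pi> (\<Psi> s) = \<pi> (\<Psi> s')" for s s'
  proof -
    obtain x where x: "x \<in> X" "\<Psi> s' = dk x (\<Psi> s)" using \<pi>_quotient[OF \<Psi>(1)[OF s(1)] \<Psi>(1)[OF s(2)]] eq by auto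
    have "\<alpha> x q = q" using Mt_equivariant[OF x(1) \<Psi>(1)[OF s(1)]] x(2) \<Psi>(2)[OF s(1)] \<Psi>(2)[OF s(2)] by simp
    then have "fst q = fst q + x" using act_fst[OF x(1), of q] d q(1) by auto
    then have "x = 0" by simp
    then have e: "\<Psi> s' = \<Psi> s" using x(2) dk_zero[OF \<Psi>(1)[OF s(1)]] by simp
    note As = A_torus[OF s(1)] and As' = A_torus[OF s(2)]
    have t: "tinv (A s) \<odot> A s' \<in> torus_pts X" by (intro tmult_closed tinv_closed As As')
    have "ta (tinv (A s) \<odot> A s') z = z"
      using ta_mult[OF tinv_closed[OF As] As' z(1)] e ta_tinv[OF As z(1)] unfolding \<Psi>_def by simp
    note one = stabilizer_annihilates[OF z(1) t this]
    have "s j = s' j" if j: "j < k" for j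
    proof -
      have bj: "b j \<in> X" using bX j kn by simp
      have "(tinv (A s) \<odot> A s') (b j) = 1" by (rule one[OF bj]) (use bD[OF j] z(2) D_def in simp)
      then have "A s (b j) = A s' (b j)" using bj torus_pts_nz[OF As bj] by (simp add: field_simps)
      then show ?thesis using A_b[of j s] A_b[of j s'] j kn by simp
    qed
    moreover have "s \<in> extensional {..<k}" "s' \<in> extensional {..<k}" using s unfolding S_def by (auto simp: PiE_def)
    ultimately show ?thesis by (intro extensionalityI) auto
  qed
  define F where "F = {p \<in> pts P. Mom p = lattice_orbit X \<alpha> q}"
  have img: "(\<lambda>s. \<pi> (\<Psi> s)) ` topspace S = F"
  proof (intro Set.set_eqI iffI)
    fix p assume "p \<in> (\<lambda>s. \<pi> (\<Psi> s)) ` topspace S"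
    then obtain s where s: "s \<in> topspace S" "p = \<pi> (\<Psi> s)" by blast
    then show "p \<in> F" unfolding F_def using Mom[OF \<Psi>(1)[OF s(1)]] \<Psi>[OF s(1)] \<pi>_pts by simp
  next
    fix p assume "p \<in> F"
    then have p: "p \<in> pts P" "Mom p = lattice_orbit X \<alpha> q" unfolding F_def by auto
    obtain y where y: "y \<in> pts Pt" "\<pi> y = p" using \<pi>_surj[OF p(1)] by blast
    have "\<alpha> 0 q \<in> lattice_orbit X \<alpha> q" unfolding lattice_orbit_def using lattice_in_0[OF X] by blast
    moreover have "\<alpha> 0 q = q" by (rule act_zero) (use q(1) d in blast)
    ultimately have "q \<in> lattice_orbit X \<alpha> (Mt y)" using p(2) y(2) Mom[OF y(1)] by simp
    then obtain x where x: "x \<in> X" "q = \<alpha> x (Mt y)" unfolding lattice_orbit_def by blast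
    have "dk x y \<in> pts Pt" "Mt (dk x y) = q" using dk_pts[OF x(1) y(1)] Mt_equivariant[OF x(1) y(1)] x(2) by auto
    then obtain s where s: "s \<in> topspace S" "dk x y = \<Psi> s" using surj by blast
    then have "\<pi> (\<Psi> s) = p" using \<pi>_dk[OF x(1) y(1)] y(2) by simp
    then show "p \<in> (\<lambda>s. \<pi> (\<Psi> s)) ` topspace S" using s(1) by blast
  qed
  have "continuous_map S (spc Pt) \<Psi>"
    unfolding \<Psi>_def
    by (rule ta_continuous_pair) (use angle_char_continuous[OF ab] z(1) in \<open>simp_all add: S_def A_def\<close>)
  then have "continuous_map S Pan (\<pi> \<circ> \<Psi>)" using \<pi>_continuous by (rule continuous_map_compose)
  then have cont: "continuous_map S (subtopology Pan F) (\<lambda>s. \<pi> (\<Psi> s))"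
    using img by (simp add: o_def continuous_map_in_subtopology image_subset_iff_funcset[symmetric])
  have FP: "topspace (subtopology Pan F) = F" unfolding F_def topspace_subtopology pts_Pan by blast
  have "homeomorphic_map S (subtopology Pan F) (\<lambda>s. \<pi> (\<Psi> s))"
  proof (rule continuous_imp_homeomorphic_map[OF cont])
    show "compact_space S"
      unfolding S_def by (simp add: compact_space_product_topology compact_space_subtopology)
    show "Hausdorff_space (subtopology Pan F)" by (rule Hausdorff_space_subtopology[OF Hausdorff_P])
    show "(\<lambda>s. \<pi> (\<Psi> s)) ` topspace S = topspace (subtopology Pan F)" unfolding FP by (rule img)
    show "inj_on (\<lambda>s. \<pi> (\<Psi> s)) (topspace S)" using inj by (intro inj_onI) blast
  qed
  then have "S homeomorphic_space subtopology Pan F" by (rule homeomorphic_map_imp_homeomorphic_space)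
  then have "subtopology Pan F homeomorphic_space S" by (rule homeomorphic_space_sym[THEN iffD1])
  then show ?thesis unfolding S_def F_def .
qed

section \<open>Descent of the moment map\<close>

definition Mom :: "'p \<Rightarrow> ('e \<times> 'c \<times> 'i) set" where
  "Mom p = lattice_orbit X \<alpha> (Mt (SOME z. z \<in> pts Pt \<and> \<pi> z = p))"

lemma lattice_orbit_act:
  assumes x: "x \<in> X" and w: "w \<in> \<Union>cells"
  shows "lattice_orbit X \<alpha> (\<alpha> x w) = lattice_orbit X \<alpha> w"
  unfolding lattice_orbit_def
proof (intro subset_antisym image_subsetI)
  fix y assume y: "y \<in> X"
  have "\<alpha> y (\<alpha> x w) = \<alpha> (y + x) w" using act_add[OF y x w] by simp
  then show "\<alpha> y (\<alpha> x w) \<in> (\<lambda>y. \<alpha> y w) ` X" using lattice_in_add[OF X y x] by blast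
  have "\<alpha> y w = \<alpha> (y - x) (\<alpha> x w)" using act_add[OF lattice_in_diff[OF X y x] x w] by simp
  then show "\<alpha> y w \<in> (\<lambda>y. \<alpha> y (\<alpha> x w)) ` X" using lattice_in_diff[OF X y x] by blast
qed

lemma Mom_\<pi>:
  assumes z: "z \<in> pts Pt"
  shows "Mom (\<pi> z) = lattice_orbit X \<alpha> (Mt z)"
proof -
  define y where "y = (SOME y. y \<in> pts Pt \<and> \<pi> y = \<pi> z)"
  have y: "y \<in> pts Pt \<and> \<pi> y = \<pi> z" unfolding y_def by (rule someI[of _ z]) (simp add: z)
  then obtain x where x: "x \<in> X" "z = dk x y" using \<pi>_quotient[of y z] z by blast
  have "Mt y \<in> \<Union>cells" using Mt(1)[of y] cell_in[of y] y by blast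
  then have "lattice_orbit X \<alpha> (Mt z) = lattice_orbit X \<alpha> (Mt y)"
    unfolding x(2) using Mt_equivariant[OF x(1), of y] y lattice_orbit_act[OF x(1)] by simp
  then show ?thesis unfolding Mom_def y_def by simp
qed

end

theorem theorem1p2p10:
  fixes G :: "'g cspace" and \<G> :: "'g monoid"
    and X' :: "'f::euclidean_space set" and \<iota> :: "('f \<Rightarrow> complex) \<Rightarrow> 'g"
    and P :: "'p cspace" and act :: "'g \<Rightarrow> 'p \<Rightarrow> 'p" and \<Theta> :: "'p divisor"
    and \<rho>' :: "'c \<Rightarrow> 'f" and C' :: "'c set set" and \<alpha>' :: "'f \<Rightarrow> 'c \<Rightarrow> 'c"
    and X :: "'e::euclidean_space set" and r :: "'e \<Rightarrow> 'f" and I :: "'i set"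
    and \<alpha> :: "'e \<Rightarrow> 'e \<times> 'c \<times> 'i \<Rightarrow> 'e \<times> 'c \<times> 'i"
    and \<phi> :: "('e \<Rightarrow> complex) \<Rightarrow> 'g"
    and Pt :: "'b cspace" and \<pi> :: "'b \<Rightarrow> 'p" and dk :: "'e \<Rightarrow> 'b \<Rightarrow> 'b"
    and ta :: "('e \<Rightarrow> complex) \<Rightarrow> 'b \<Rightarrow> 'b"
    and lin :: "('e \<Rightarrow> complex) \<Rightarrow> 'b \<Rightarrow> 'p fibre_vec \<Rightarrow> 'p fibre_vec"
    and cell :: "'b set \<Rightarrow> ('e \<times> 'c \<times> 'i) set"
    and \<xi> :: "'e \<times> 'c \<times> 'i \<Rightarrow> 'b \<Rightarrow> 'p fibre_vec"
  assumes "theta_expansion G \<G> X' \<iota> P act \<Theta> \<rho>' C' \<alpha>' X r I \<alpha> \<phi> Pt \<pi> dk ta lin cell \<xi>"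
  shows "\<exists>Mt Mom.
    (\<forall>z\<in>pts Pt. Mt z \<in> cell (orbit_closure X Pt ta z) \<and>
       (\<forall>i\<in>\<Theta>. \<pi> z \<in> fst i \<longrightarrow>
          is_weighted_average (integral_points X (pullback_cells X r \<rho>' C' I))
            (\<lambda>w. (cmod (\<xi> w z i))\<^sup>2) fst (fst (Mt z)))) \<and>
    (\<forall>x\<in>X. \<forall>z\<in>pts Pt. Mt (dk x z) = \<alpha> x (Mt z)) \<and>
    Mom ` pts P \<subseteq> lattice_orbit X \<alpha> ` \<Union>(pullback_cells X r \<rho>' C' I) \<and>
    (\<forall>z\<in>pts Pt. Mom (\<pi> z) = lattice_orbit X \<alpha> (Mt z)) \<and>
    (\<forall>\<delta>\<in>pullback_cells X r \<rho>' C' I. \<forall>q\<in>\<delta>. \<forall>k::nat.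
       fst q \<in> rel_interior (fst ` \<delta>) \<and> aff_dim (fst ` \<delta>) = int k \<longrightarrow>
       subtopology (spc (analytification P)) {p \<in> pts P. Mom p = lattice_orbit X \<alpha> q}
         homeomorphic_space product_topology (\<lambda>_. top_of_set (sphere (0::complex) 1)) {..<k})"
proof -
  interpret theta_expansion G \<G> X' \<iota> P act \<Theta> \<rho>' C' \<alpha>' X r I \<alpha> \<phi> Pt \<pi> dk ta lin cell \<xi>
    by (rule assms)
  show ?thesis
  proof (intro exI[of _ Mt] exI[of _ Mom] conjI ballI allI impI)
    show "Mt z \<in> cell (Zc z)" if "z \<in> pts Pt" for z by (rule Mt(1)[OF that])
    show "is_weighted_average IP (\<lambda>w. (cmod (\<xi> w z i))\<^sup>2) fst (fst (Mt z))"
      if "z \<in> pts Pt" "i \<in> \<Theta>" "\<pi> z \<in> fst i" for z i unfolding Mt(2)[OF that(1)] by (rule avg_weighted[OF that])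
    show "Mt (dk x z) = \<alpha> x (Mt z)" if "x \<in> X" "z \<in> pts Pt" for x z by (rule Mt_equivariant[OF that])
    show "Mom ` pts P \<subseteq> lattice_orbit X \<alpha> ` \<Union>cells"
    proof (rule image_subsetI)
      fix p assume "p \<in> pts P"
      then obtain z where z: "z \<in> pts Pt" "\<pi> z = p" using \<pi>_surj by blast
      have "Mt z \<in> \<Union>cells" using Mt(1)[OF z(1)] cell_in[OF z(1)] by blast
      then show "Mom p \<in> lattice_orbit X \<alpha> ` \<Union>cells" using Mom_\<pi>[OF z(1)] z(2) by (metis imageI)
    qed
    show "Mom (\<pi> z) = lattice_orbit X \<alpha> (Mt z)" if "z \<in> pts Pt" for z by (rule Mom_\<pi>[OF that])
    show "subtopology Pan {p \<in> pts P. Mom p = lattice_orbit X \<alpha> q}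
        homeomorphic_space product_topology (\<lambda>_. top_of_set (sphere (0::complex) 1)) {..<k}"
      if "\<delta> \<in> cells" "q \<in> \<delta>" "fst q \<in> rel_interior (fst ` \<delta>) \<and> aff_dim (fst ` \<delta>) = int k" for \<delta> q k
      by (rule moment_fibre[OF that(1,2) _ _ Mom_\<pi>]) (use that(3) in auto)
  qed
qed

end
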